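(* (Zeroth law for vacuum gravity EFTs.) Let $N\ge1$ and consider the $d$-dimensional effective field theory of vacuum gravity with Lagrangian $\mathcal L=-2\Lambda+R+\sum_{n=1}^{N-1}l^n\mathcal L_{n+2}+O(l^N)$, where each $\mathcal L_{n+2}$ is a sum of arbitrary covariant $(n+2)$-derivative scalars built from the metric. Consider a family of stationary black hole solutions lying in the regime of validity of the EFT. Then the surface gravity $\kappa$ of the horizon satisfies, on the horizon cross-section $C$, $$\partial_A\kappa=O_\infty(l^N).$$
   Context: Equations of motion: $E_{\mu\nu}\equiv R_{\mu\nu}-\frac12Rg_{\mu\nu}+\Lambda g_{\mu\nu}+lH_{\mu\nu}[g]=O(l^N)$, where $lH_{\mu\nu}$ is the metric variation of $\sum_{n=1}^{N-1}l^n\mathcal L_{n+2}$ (a tensor that is a sum of contractions of $g$, $g^{-1}$ and their derivatives). Stationary black hole: the event horizon $\mathcal H$ is a smooth Killing horizon of a Killing field $\xi$; $C$ is a spacelike cross-section met exactly once by each horizon generator. Surface gravity: $\xi^b\nabla_b\xi^a=\kappa\xi^a$ on $\mathcal H$. Killing vector Gaussian null coordinates $(\tau,\rho,x^A)$ near $\mathcal H$: $\xi=\partial_\tau$, $\mathcal H=\{\rho=0\}$, $C=\{\rho=\tau=0\}$, and $$g=2d\tau d\rho-\rho X\,d\tau^2+2\rho\,\omega_A\,d\tau dx^A+h_{AB}\,dx^Adx^B$$ with $X,\omega_A,h_{AB}$ smooth functions of $(\rho,x^C)$ only. Then $\kappa=\frac12X|_{\rho=0}$. $\mathcal D_A$ is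 the Levi-Civita derivative of $h_{AB}$ on $C$. For a tensor $\psi$ on $C$, $|\psi|_h$ is its pointwise norm with respect to $h_{AB}$. We consider a family of solutions parametrized by $l$, in units where the smallest length/time scale $L$ of the solution is $L=1$, with $l$ small. $\psi=O_\infty(l^k)$ means: for every $m\ge0$ there is a constant $c_m$ independent of $l$ with $\sup_C|\mathcal D^m\psi|_h\le c_ml^k$. Regime of validity: $X,\omega_A,h_{AB},h^{AB}$ and all their $\rho$-derivatives are $O_\infty(1)$ on $C$, the equations of motion hold with $E_{\mu\nu}=O_\infty(l^N)$ on $C$ (components in the Killing vector Gaussian null coordinates $(\tau,\rho,x^A)$), $|\Lambda|\le1$, and $l$ is small. *)

theory Defs
  imports "HOL-Analysis.Analysis"
begin

section \<open>Smooth functions and local differential geometry\<close>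

definition pd :: "'i::finite \<Rightarrow> (real^'i \<Rightarrow> 'b::real_normed_vector) \<Rightarrow> real^'i \<Rightarrow> 'b" where
  "pd i f x = vector_derivative (\<lambda>t. f (x + t *\<^sub>R axis i 1)) (at 0)"

primrec ck_on :: "nat \<Rightarrow> (real^'i::finite) set \<Rightarrow> (real^'i \<Rightarrow> 'b::real_normed_vector) \<Rightarrow> bool" where
  "ck_on 0 S f \<longleftrightarrow> continuous_on S f"
| "ck_on (Suc k) S f \<longleftrightarrow> (\<forall>x\<in>S. f differentiable (at x)) \<and> (\<forall>i. ck_on k S (pd i f))"

text \<open>Only meant for open \<open>S\<close>.\<close>
definition smooth_on :: "(real^'i::finite) set \<Rightarrow> (real^'i \<Rightarrow> 'b::real_normed_vector) \<Rightarrow> bool" where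
  "smooth_on S f \<longleftrightarrow> (\<forall>k. ck_on k S f)"

text \<open>Component fields \<open>g\<^sub>a\<^sub>b\<close> of a metric in one coordinate system.\<close>
type_synonym 'i metric = "real^'i \<Rightarrow> real^'i^'i"

definition lorentzian :: "real^('i::finite)^'i \<Rightarrow> bool" where
  "lorentzian A \<longleftrightarrow> transpose A = A \<and>
     (\<exists>(P :: real^'i^'i) t. invertible P \<and>
        transpose P ** A ** P = (\<chi> a b. if a = b then (if a = t then - 1 else 1) else 0))"

definition riemannian :: "real^('i::finite)^'i \<Rightarrow> bool" where
  "riemannian A \<longleftrightarrow> transpose A = A \<and> (\<forall>v. v \<noteq> 0 \<longrightarrow> v \<bullet> (A *v v) > 0)"

text \<open>\<open>christoffel g x a b c\<close> is \<open>\<Gamma>\<^sup>a\<^sub>b\<^sub>c\<close>; \<open>riemann g x a b c d\<close> is \<open>R\<^sup>a\<^sub>b\<^sub>c\<^sub>d\<close>,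
  with the sign convention for which round spheres have positive scalar curvature.\<close>
definition christoffel :: "'i::finite metric \<Rightarrow> real^'i \<Rightarrow> 'i \<Rightarrow> 'i \<Rightarrow> 'i \<Rightarrow> real" where
  "christoffel g x a b c = (1/2) * (\<Sum>d\<in>UNIV. matrix_inv (g x) $ a $ d *
     (pd b (\<lambda>y. g y $ d $ c) x + pd c (\<lambda>y. g y $ d $ b) x - pd d (\<lambda>y. g y $ b $ c) x))"

definition riemann :: "'i::finite metric \<Rightarrow> real^'i \<Rightarrow> 'i \<Rightarrow> 'i \<Rightarrow> 'i \<Rightarrow> 'i \<Rightarrow> real" where
  "riemann g x a b c d =
     pd c (\<lambda>y. christoffel g y a d b) x - pd d (\<lambda>y. christoffel g y a c b) x +
     (\<Sum>e\<in>UNIV. christoffel g x a c e * christoffel g x e d b -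
                christoffel g x a d e * christoffel g x e c b)"

definition ricci :: "'i::finite metric \<Rightarrow> real^'i \<Rightarrow> 'i \<Rightarrow> 'i \<Rightarrow> real" where
  "ricci g x b d = (\<Sum>a\<in>UNIV. riemann g x a b a d)"

definition scalar_curv :: "'i::finite metric \<Rightarrow> real^'i \<Rightarrow> real" where
  "scalar_curv g x = (\<Sum>a\<in>UNIV. \<Sum>b\<in>UNIV. matrix_inv (g x) $ a $ b * ricci g x a b)"

definition pullback :: "(real^'i::finite \<Rightarrow> real^'i) \<Rightarrow> 'i metric \<Rightarrow> 'i metric" where
  "pullback F g x = (\<chi> a b. \<Sum>c\<in>UNIV. \<Sum>d\<in>UNIV. pd a F x $ c * pd b F x $ d * g (F x) $ c $ d)"

text \<open>Components of a tensor field in one coordinate system: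
  \<open>T x [a\<^sub>1,\<dots>,a\<^sub>p] [b\<^sub>1,\<dots>,b\<^sub>q]\<close> has the \<open>a\<^sub>i\<close> as upper and the \<open>b\<^sub>i\<close> as lower indices.\<close>
type_synonym 'i tensor_field = "real^'i \<Rightarrow> 'i list \<Rightarrow> 'i list \<Rightarrow> real"

text \<open>The index of the derivative becomes the first lower index.\<close>
definition covd :: "'i::finite metric \<Rightarrow> 'i tensor_field \<Rightarrow> 'i tensor_field" where
  "covd h T x us ls = (case ls of [] \<Rightarrow> 0 | c # ls' \<Rightarrow>
     pd c (\<lambda>y. T y us ls') x
     + (\<Sum>i<length us. \<Sum>e\<in>UNIV. christoffel h x (us ! i) c e * T x (us[i := e]) ls')
     - (\<Sum>i<length ls'. \<Sum>e\<in>UNIV. christoffel h x e c (ls' ! i) * T x us (ls'[i := e])))"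

text \<open>Pointwise norm with respect to \<open>A = h\<^sub>a\<^sub>b(x)\<close> of the components \<open>T\<close> of a tensor with
  \<open>p\<close> upper and \<open>q\<close> lower indices.\<close>
definition tensor_norm ::
  "real^('i::finite)^'i \<Rightarrow> nat \<Rightarrow> nat \<Rightarrow> ('i list \<Rightarrow> 'i list \<Rightarrow> real) \<Rightarrow> real" where
  "tensor_norm A p q T = sqrt
     (\<Sum>us\<in>{us. length us = p}. \<Sum>us'\<in>{us. length us = p}.
      \<Sum>ls\<in>{ls. length ls = q}. \<Sum>ls'\<in>{ls. length ls = q}.
        (\<Prod>i<p. A $ (us ! i) $ (us' ! i)) * (\<Prod>j<q. matrix_inv A $ (ls ! j) $ (ls' ! j)) *
        T us ls * T us' ls')"

section \<open>Higher-derivative Lagrangians\<close>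

text \<open>A scalar Lagrangian assigns to the components of a metric in some coordinates a function
  of these coordinates.\<close>
type_synonym 'i lagrangian = "'i metric \<Rightarrow> real^'i \<Rightarrow> real"

text \<open>Expressions built from \<open>g\<close>, \<open>g\<^sup>-\<^sup>1\<close> and their partial derivatives in which every
  term contains exactly \<open>k\<close> derivatives.\<close>
inductive metric_expr :: "nat \<Rightarrow> ('i::finite) lagrangian \<Rightarrow> bool" where
  const: "metric_expr 0 (\<lambda>g x. r)"
| lower: "metric_expr 0 (\<lambda>g x. g x $ a $ b)"
| upper: "metric_expr 0 (\<lambda>g x. matrix_inv (g x) $ a $ b)"
| deriv: "metric_expr k F \<Longrightarrow> metric_expr (Suc k) (\<lambda>g x. pd i (F g) x)"
| add: "metric_expr k F \<Longrightarrow> metric_expr k G \<Longrightarrow> metric_expr k (\<lambda>g x. F g x + G g x)"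
| mult: "metric_expr j F \<Longrightarrow> metric_expr k G \<Longrightarrow> metric_expr (j + k) (\<lambda>g x. F g x * G g x)"

definition diffeomorphic_map ::
  "(real^'i::finite) set \<Rightarrow> (real^'i) set \<Rightarrow> (real^'i \<Rightarrow> real^'i) \<Rightarrow> bool" where
  "diffeomorphic_map V W \<phi> \<longleftrightarrow> open V \<and> open W \<and> bij_betw \<phi> V W \<and>
     smooth_on V \<phi> \<and> smooth_on W (inv_into V \<phi>)"

definition covariant_scalar :: "nat \<Rightarrow> 'i::finite lagrangian \<Rightarrow> bool" where
  "covariant_scalar k F \<longleftrightarrow> metric_expr k F \<and>
     (\<forall>V W \<phi> g. diffeomorphic_map V W \<phi> \<and> smooth_on W g \<and> (\<forall>z\<in>W. lorentzian (g z)) \<longrightarrow>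
        (\<forall>x\<in>V. F (pullback \<phi> g) x = F g (\<phi> x)))"

text \<open>\<open>H\<^sub>a\<^sub>b = (-g)\<^sup>-\<^sup>1\<^sup>/\<^sup>2 \<delta>(\<integral>(-g)\<^sup>1\<^sup>/\<^sup>2 L) / \<delta>g\<^sup>a\<^sup>b\<close>, the normalisation for which \<open>R - 2\<Lambda>\<close> has variation
  \<open>R\<^sub>a\<^sub>b - R g\<^sub>a\<^sub>b/2 + \<Lambda> g\<^sub>a\<^sub>b\<close>. The minus sign comes from varying \<open>g\<^sub>a\<^sub>b\<close> by \<open>\<epsilon> k\<^sub>a\<^sub>b\<close>, i.e. \<open>g\<^sup>a\<^sup>b\<close> by
  \<open>- \<epsilon> k\<^sup>a\<^sup>b\<close>; subtracting the unperturbed integrand confines the integral to the support of \<open>k\<close>.\<close>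
definition metric_variation ::
  "(real^'i::finite) set \<Rightarrow> 'i metric \<Rightarrow> 'i lagrangian \<Rightarrow> (real^'i \<Rightarrow> real^'i^'i) \<Rightarrow> bool" where
  "metric_variation V g L H \<longleftrightarrow> smooth_on V H \<and> (\<forall>z\<in>V. transpose (H z) = H z) \<and>
     (\<forall>k :: real^'i \<Rightarrow> real^'i^'i.
        smooth_on UNIV k \<and> (\<forall>z. transpose (k z) = k z) \<and>
        compact (closure {z. k z \<noteq> 0}) \<and> closure {z. k z \<noteq> 0} \<subseteq> V \<longrightarrow>
        ((\<lambda>\<epsilon>. LINT z:V|lborel.
            sqrt \<bar>det (g z + \<epsilon> *\<^sub>R k z)\<bar> * L (\<lambda>z. g z + \<epsilon> *\<^sub>R k z) z - sqrt \<bar>det (g z)\<bar> * L g z)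
         has_real_derivative
           - (LINT z:V|lborel. sqrt \<bar>det (g z)\<bar> *
               (\<Sum>a\<in>UNIV. \<Sum>b\<in>UNIV. \<Sum>c\<in>UNIV. \<Sum>d\<in>UNIV.
                  H z $ a $ b * matrix_inv (g z) $ a $ c * matrix_inv (g z) $ b $ d * k z $ c $ d)))
        (at 0))"

section \<open>Stationary black holes\<close>

text \<open>A chart is a pair of its domain and its coordinate map; the coordinate map is only
  meaningful on the domain.\<close>
type_synonym ('p, 'i) chart = "'p set \<times> ('p \<Rightarrow> real^'i)"

abbreviation dom_of :: "('p, 'i) chart \<Rightarrow> 'p set" where
  "dom_of c \<equiv> fst c"

abbreviation coord :: "('p, 'i) chart \<Rightarrow> 'p \<Rightarrow> real^'i" where
  "coord c \<equiv> snd c"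

definition img :: "('p, 'i) chart \<Rightarrow> (real^'i) set" where
  "img c = coord c ` dom_of c"

definition param :: "('p, 'i) chart \<Rightarrow> real^'i \<Rightarrow> 'p" where
  "param c = inv_into (dom_of c) (coord c)"

definition transition :: "('p, 'i) chart \<Rightarrow> ('p, 'i) chart \<Rightarrow> real^'i \<Rightarrow> real^'i" where
  "transition c c' = coord c' \<circ> param c"

definition overlap :: "('p, 'i) chart \<Rightarrow> ('p, 'i) chart \<Rightarrow> (real^'i) set" where
  "overlap c c' = coord c ` (dom_of c \<inter> dom_of c')"

definition smooth_atlas ::
  "'p::{t2_space,second_countable_topology} set \<Rightarrow> ('p, 'i::finite) chart set \<Rightarrow> bool" where
  "smooth_atlas M \<A> \<longleftrightarrow>
     (\<forall>c\<in>\<A>. openin (top_of_set M) (dom_of c) \<and> open (img c) \<and>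
        homeomorphism (dom_of c) (img c) (coord c) (param c)) \<and>
     M = (\<Union>c\<in>\<A>. dom_of c) \<and>
     (\<forall>c\<in>\<A>. \<forall>c'\<in>\<A>. smooth_on (overlap c c') (transition c c'))"

datatype 'n gnc = Tau | Rho | Ang 'n

instance gnc :: (finite) finite
proof
  have "(UNIV :: 'a gnc set) = {Tau, Rho} \<union> range Ang"
    by (auto intro: gnc.exhaust)
  then show "finite (UNIV :: 'a gnc set)"
    by (metis finite finite_Un finite_imageI finite.emptyI finite.insertI)
qed

definition gnc_point :: "real \<Rightarrow> real \<Rightarrow> real^'n::finite \<Rightarrow> real^('n gnc)" where
  "gnc_point \<tau> \<rho> y = (\<chi> i. case i of Tau \<Rightarrow> \<tau> | Rho \<Rightarrow> \<rho> | Ang A \<Rightarrow> y $ A)"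

definition ang :: "real^('n gnc) \<Rightarrow> real^'n::finite" where
  "ang z = (\<chi> A. z $ Ang A)"

text \<open>A chart together with functions \<open>X\<close>, \<open>\<omega>\<^sub>A\<close>, \<open>h\<^sub>A\<^sub>B\<close> of \<open>(\<rho>, x\<^sup>A)\<close>.\<close>
record ('p, 'n) gnc_chart =
  chart_of :: "('p, 'n gnc) chart"
  X_of :: "real \<Rightarrow> real^'n \<Rightarrow> real"
  \<omega>_of :: "real \<Rightarrow> real^'n \<Rightarrow> real^'n"
  h_of :: "real \<Rightarrow> real^'n \<Rightarrow> real^'n^'n"

text \<open>The spacetime dimension is \<open>d = CARD('n) + 2\<close>. The fields \<open>metric\<close> and \<open>killing\<close> give
  components in each chart of the atlas; \<open>gncs\<close> are the Killing vector Gaussian null coordinate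
  systems under consideration.\<close>
record ('p, 'n) black_hole =
  spacetime :: "'p set"
  atlas :: "('p, 'n gnc) chart set"
  metric :: "('p, 'n gnc) chart \<Rightarrow> 'n gnc metric"
  killing :: "('p, 'n gnc) chart \<Rightarrow> real^('n gnc) \<Rightarrow> real^('n gnc)"
  horizon :: "'p set"
  cross_section :: "'p set"
  gncs :: "('p, 'n) gnc_chart set"

definition lorentzian_spacetime ::
  "('p::{t2_space,second_countable_topology}, 'n::finite) black_hole \<Rightarrow> bool" where
  "lorentzian_spacetime B \<longleftrightarrow> smooth_atlas (spacetime B) (atlas B) \<and>
     (\<forall>c\<in>atlas B. smooth_on (img c) (metric B c) \<and> (\<forall>z\<in>img c. lorentzian (metric B c z))) \<and>
     (\<forall>c\<in>atlas B. \<forall>c'\<in>atlas B. \<forall>z\<in>overlap c c'.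
        metric B c z = pullback (transition c c') (metric B c') z)"

definition killing_field ::
  "('p::{t2_space,second_countable_topology}, 'n::finite) black_hole \<Rightarrow> bool" where
  "killing_field B \<longleftrightarrow>
     (\<forall>c\<in>atlas B. smooth_on (img c) (killing B c)) \<and>
     (\<forall>c\<in>atlas B. \<forall>c'\<in>atlas B. \<forall>z\<in>overlap c c'.
        killing B c' (transition c c' z) =
          (\<Sum>a\<in>UNIV. killing B c z $ a *\<^sub>R pd a (transition c c') z)) \<and>
     (\<forall>c\<in>atlas B. \<forall>z\<in>img c. \<forall>a b.
        (\<Sum>e\<in>UNIV. killing B c z $ e * pd e (\<lambda>y. metric B c y $ a $ b) z
          + metric B c z $ e $ b * pd a (\<lambda>y. killing B c y $ e) z
          + metric B c z $ a $ e * pd b (\<lambda>y. killing B c y $ e) z) = 0)"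

text \<open>A smooth null hypersurface, locally \<open>f = 0\<close>, on which the Killing field is null, nonzero
  and normal.\<close>
definition killing_horizon ::
  "('p::{t2_space,second_countable_topology}, 'n::finite) black_hole \<Rightarrow> bool" where
  "killing_horizon B \<longleftrightarrow> horizon B \<subseteq> spacetime B \<and>
     (\<forall>p\<in>horizon B. \<exists>c\<in>atlas B. \<exists>U f. p \<in> dom_of c \<and> open U \<and> coord c p \<in> U \<and> U \<subseteq> img c \<and>
        smooth_on U (f :: _ \<Rightarrow> real) \<and>
        (\<forall>z\<in>U. param c z \<in> horizon B \<longleftrightarrow> f z = 0) \<and>
        (\<forall>z\<in>U. f z = 0 \<longrightarrow> killing B c z \<noteq> 0 \<and>
           killing B c z \<bullet> (metric B c z *v killing B c z) = 0 \<and>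
           (\<exists>\<mu>. \<mu> \<noteq> 0 \<and> (\<forall>a. pd a f z = \<mu> * (metric B c z *v killing B c z) $ a))))"

definition integral_curve ::
  "('p::{t2_space,second_countable_topology}, 'n::finite) black_hole \<Rightarrow> real set \<Rightarrow> (real \<Rightarrow> 'p) \<Rightarrow> bool" where
  "integral_curve B I \<gamma> \<longleftrightarrow> \<gamma> ` I \<subseteq> spacetime B \<and> continuous_on I \<gamma> \<and>
     (\<forall>t\<in>I. \<forall>c\<in>atlas B. \<gamma> t \<in> dom_of c \<longrightarrow>
        ((\<lambda>s. coord c (\<gamma> s)) has_vector_derivative killing B c (coord c (\<gamma> t))) (at t within I))"

text \<open>The generators of a Killing horizon are the integral curves of the Killing field in it.\<close>
definition same_generator ::
  "('p::{t2_space,second_countable_topology}, 'n::finite) black_hole \<Rightarrow> 'p \<Rightarrow> 'p \<Rightarrow> bool" where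
  "same_generator B p q \<longleftrightarrow> (\<exists>\<gamma> a b. integral_curve B {a..b} \<gamma> \<and> \<gamma> ` {a..b} \<subseteq> horizon B \<and>
     p \<in> \<gamma> ` {a..b} \<and> q \<in> \<gamma> ` {a..b})"

definition gnc_metric ::
  "(real \<Rightarrow> real^'n \<Rightarrow> real) \<Rightarrow> (real \<Rightarrow> real^'n \<Rightarrow> real^'n) \<Rightarrow> (real \<Rightarrow> real^'n \<Rightarrow> real^'n^'n) \<Rightarrow>
   'n::finite gnc metric" where
  "gnc_metric X \<omega> h z = (let \<rho> = z $ Rho; y = ang z in \<chi> i j. case (i, j) of
       (Tau, Tau) \<Rightarrow> - \<rho> * X \<rho> y
     | (Tau, Rho) \<Rightarrow> 1
     | (Rho, Tau) \<Rightarrow> 1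
     | (Tau, Ang A) \<Rightarrow> \<rho> * \<omega> \<rho> y $ A
     | (Ang A, Tau) \<Rightarrow> \<rho> * \<omega> \<rho> y $ A
     | (Ang A, Ang A') \<Rightarrow> h \<rho> y $ A $ A'
     | _ \<Rightarrow> 0)"

definition killing_gnc ::
  "('p::{t2_space,second_countable_topology}, 'n::finite) black_hole \<Rightarrow> ('p, 'n) gnc_chart \<Rightarrow> bool" where
  "killing_gnc B K \<longleftrightarrow> (let c = chart_of K; V = img c in
     c \<in> atlas B \<and>
     smooth_on V (\<lambda>z. X_of K (z $ Rho) (ang z)) \<and>
     smooth_on V (\<lambda>z. \<omega>_of K (z $ Rho) (ang z)) \<and>
     smooth_on V (\<lambda>z. h_of K (z $ Rho) (ang z)) \<and>
     (\<forall>z\<in>V. riemannian (h_of K (z $ Rho) (ang z))) \<and>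
     (\<forall>z\<in>V. metric B c z = gnc_metric (X_of K) (\<omega>_of K) (h_of K) z) \<and>
     (\<forall>z\<in>V. killing B c z = axis Tau 1) \<and>
     (\<forall>z\<in>V. param c z \<in> horizon B \<longleftrightarrow> z $ Rho = 0) \<and>
     (\<forall>z\<in>V. param c z \<in> cross_section B \<longleftrightarrow> z $ Rho = 0 \<and> z $ Tau = 0))"

definition stationary_black_hole ::
  "('p::{t2_space,second_countable_topology}, 'n::finite) black_hole \<Rightarrow> bool" where
  "stationary_black_hole B \<longleftrightarrow> lorentzian_spacetime B \<and> killing_field B \<and> killing_horizon B \<and>
     cross_section B \<subseteq> horizon B \<and>
     (\<forall>p\<in>horizon B. \<exists>!q. q \<in> cross_section B \<and> same_generator B p q) \<and>
     (\<forall>K\<in>gncs B. killing_gnc B K) \<and>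
     cross_section B \<subseteq> (\<Union>K\<in>gncs B. dom_of (chart_of K))"

text \<open>\<open>\<xi>\<^sup>b \<nabla>\<^sub>b \<xi>\<^sup>a = \<kappa> \<xi>\<^sup>a\<close> on the horizon.\<close>
definition surface_gravity ::
  "('p::{t2_space,second_countable_topology}, 'n::finite) black_hole \<Rightarrow> ('p \<Rightarrow> real) \<Rightarrow> bool" where
  "surface_gravity B \<kappa> \<longleftrightarrow>
     (\<forall>c\<in>atlas B. \<forall>p\<in>horizon B \<inter> dom_of c. \<forall>a. let z = coord c p; \<xi> = killing B c in
        (\<Sum>b\<in>UNIV. \<xi> z $ b * (pd b (\<lambda>y. \<xi> y $ a) z
           + (\<Sum>e\<in>UNIV. christoffel (metric B c) z a b e * \<xi> z $ e))) = \<kappa> p * \<xi> z $ a)"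

section \<open>The regime of validity of the effective field theory\<close>

definition section_img :: "('p, 'n::finite) gnc_chart \<Rightarrow> (real^'n) set" where
  "section_img K = {y. gnc_point 0 0 y \<in> img (chart_of K)}"

text \<open>\<open>\<psi> = O\<^sub>\<infinity>(l\<^sup>k)\<close> for a family \<open>\<psi> l\<close>, \<open>l \<in> S\<close>, of tensors with \<open>p\<close> upper and \<open>q\<close> lower indices on
  the cross-sections of \<open>B l\<close>, given by components in the coordinates \<open>x\<^sup>A\<close>. Being a scalar, the
  norm may be bounded in all coordinate systems instead of at all points of the cross-section.\<close>
definition O_inf ::
  "real set \<Rightarrow> (real \<Rightarrow> ('p, 'n::finite) black_hole) \<Rightarrow> nat \<Rightarrow> nat \<Rightarrow>
   (real \<Rightarrow> ('p, 'n) gnc_chart \<Rightarrow> 'n tensor_field) \<Rightarrow> nat \<Rightarrow> bool" where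
  "O_inf S B p q \<psi> k \<longleftrightarrow>
     (\<forall>m. \<exists>C. \<forall>l\<in>S. \<forall>K\<in>gncs (B l). \<forall>y\<in>section_img K.
        tensor_norm (h_of K 0 y) p (q + m) ((covd (h_of K 0) ^^ m) (\<psi> l K) y) \<le> C * l ^ k)"

definition eom ::
  "real \<Rightarrow> 'i::finite metric \<Rightarrow> (real^'i \<Rightarrow> real^'i^'i) \<Rightarrow> real^'i \<Rightarrow> 'i \<Rightarrow> 'i \<Rightarrow> real" where
  "eom \<Lambda> g lH z \<mu> \<nu> = ricci g z \<mu> \<nu> - (1/2) * scalar_curv g z * g z $ \<mu> $ \<nu>
     + \<Lambda> * g z $ \<mu> $ \<nu> + lH z $ \<mu> $ \<nu>"

text \<open>The metric variation of \<open>\<Sum>\<^sub>n l\<^sup>n \<L>\<^sub>n\<^sub>+\<^sub>2\<close>, where \<open>L n\<close> stands for \<open>\<L>\<^sub>n\<^sub>+\<^sub>2\<close>.\<close>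
definition eft_correction ::
  "nat \<Rightarrow> (nat \<Rightarrow> 'n::finite gnc lagrangian) \<Rightarrow> real \<Rightarrow> ('p, 'n) black_hole \<Rightarrow>
   (('p, 'n gnc) chart \<Rightarrow> real^('n gnc) \<Rightarrow> real^('n gnc)^('n gnc)) \<Rightarrow> bool" where
  "eft_correction N L l B lH \<longleftrightarrow>
     (\<forall>c\<in>atlas B. metric_variation (img c) (metric B c)
        (\<lambda>g z. \<Sum>n = 1..<N. l ^ n * L n g z) (lH c))"

text \<open>The bound on the Riemann tensor of the cross-section expresses that the smallest length
  scale of the solution is 1. It is not contained in the bound on \<open>h\<^sub>A\<^sub>B\<close>, whose covariant
  derivatives vanish identically.\<close>
definition regime_of_validity ::
  "nat \<Rightarrow> real set \<Rightarrow> (real \<Rightarrow> ('p, 'n::finite) black_hole) \<Rightarrow> (real \<Rightarrow> real) \<Rightarrow>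
   (real \<Rightarrow> ('p, 'n gnc) chart \<Rightarrow> real^('n gnc) \<Rightarrow> real^('n gnc)^('n gnc)) \<Rightarrow> bool" where
  "regime_of_validity N S B \<Lambda> lH \<longleftrightarrow>
     (let E = (\<lambda>l K y \<mu> \<nu>. eom (\<Lambda> l) (metric (B l) (chart_of K)) (lH l (chart_of K))
                  (gnc_point 0 0 y) \<mu> \<nu>) in
     (\<forall>l\<in>S. \<bar>\<Lambda> l\<bar> \<le> 1) \<and>
     (\<forall>j. O_inf S B 0 0 (\<lambda>l K y us ls. (deriv ^^ j) (\<lambda>\<rho>. X_of K \<rho> y) 0) 0) \<and>
     (\<forall>j. O_inf S B 0 1 (\<lambda>l K y us ls. (deriv ^^ j) (\<lambda>\<rho>. \<omega>_of K \<rho> y $ (ls ! 0)) 0) 0) \<and>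
     (\<forall>j. O_inf S B 0 2
        (\<lambda>l K y us ls. (deriv ^^ j) (\<lambda>\<rho>. h_of K \<rho> y $ (ls ! 0) $ (ls ! 1)) 0) 0) \<and>
     (\<forall>j. O_inf S B 2 0
        (\<lambda>l K y us ls. (deriv ^^ j) (\<lambda>\<rho>. matrix_inv (h_of K \<rho> y) $ (us ! 0) $ (us ! 1)) 0) 0) \<and>
     O_inf S B 1 3
        (\<lambda>l K y us ls. riemann (h_of K 0) y (us ! 0) (ls ! 0) (ls ! 1) (ls ! 2)) 0 \<and>
     O_inf S B 0 0 (\<lambda>l K y us ls. E l K y Tau Tau) N \<and>
     O_inf S B 0 0 (\<lambda>l K y us ls. E l K y Tau Rho) N \<and>
     O_inf S B 0 0 (\<lambda>l K y us ls. E l K y Rho Rho) N \<and>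
     O_inf S B 0 1 (\<lambda>l K y us ls. E l K y Tau (Ang (ls ! 0))) N \<and>
     O_inf S B 0 1 (\<lambda>l K y us ls. E l K y Rho (Ang (ls ! 0))) N \<and>
     O_inf S B 0 2 (\<lambda>l K y us ls. E l K y (Ang (ls ! 0)) (Ang (ls ! 1))) N)"

end

(*
 Since kappa = X/2 and R_{tau A} = - d_A X / 2 on the horizon, the equations of motion there express d_A kappa, up to
 E_{tau A}, as the sum of l^n times the (tau, A) components of the Euler-Lagrange tensors of the L_{n+2}. These tensors are
 covariant and polynomial in the jets of the metric and its inverse. If kappa is constant, the boosts
  (tau, rho, x) |-> ((log (s + kappa tau) - log s) / kappa, rho (s + kappa tau), x)
 keep the metric regular as s -> 0 but multiply the (tau, A) components on the horizon by 1/s, so these vanish. In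
 general, replacing X by a function that is constant on the horizon changes them by at most a constant times a jet norm of
 X - X(p), that is, of d kappa, because polynomials in the jet are Lipschitz. Hence d kappa = O(l^k) improves to O(l^(k+1))
 as long as k < N. The estimates are made in normal coordinates at each point p of the cross-section, where the covariant
 norms control partial derivatives.
*)
theory Submission
 imports Defs
begin

text \<open>The obstacle is uniformity in l. The angular coordinates of the charts in
  \<open>gncs\<close> are arbitrary and only tensor norms are bounded, so constants may depend on
  the dimension, the Lagrangians and the assumed bounds, but on no chart. Partial derivatives obey
  such bounds once the connection is bounded by the curvature and its covariant derivatives. Jet
  polynomials see finitely many derivatives, so coordinates that are normal to finite order suffice;
  finitely many corrections of an affine map produce them, without geodesics. Only the Lagrangians
  are assumed covariant, and only on Lorentzian metrics; covariance of the Euler-Lagrange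
  expressions is extracted from compactly supported variations that stay Lorentzian. For the
  comparison with constant \<kappa>, X is replaced by its Taylor polynomial in \<rho> with the
  zeroth coefficient frozen: then (X - 2 \<kappa>) / \<rho> is a polynomial in \<rho>, and the jets
  of the two metrics differ by at most a multiple of the jet of X(0, x) - X(0, 0). The inverse
  metric belongs to the jet, so its value at the point must be bounded too; in an orthonormal frame
  its entries there are 0 and 1.\<close>

abbreviation (input) sum_all :: "('i => 'b::comm_monoid_add) => 'b" (binder "\<Sigma>" 10) where
 "sum_all f \<equiv> sum f UNIV"

section \<open>Partial derivatives and smooth functions\<close>

lemma pd_eq_has_derivative:
 assumes "(f has_derivative D) (at x)"
 shows "pd i f x = D (axis i 1)"
proof -
 have "((\<lambda>t. x + t *\<^sub>R axis i 1) has_derivative (\<lambda>t. t *\<^sub>R axis i 1)) (at 0)"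
  by (auto intro!: derivative_eq_intros)
 moreover have "(f has_derivative D) (at (x + 0 *\<^sub>R axis i 1))"
  using assms by simp
 ultimately have "((\<lambda>t. f (x + t *\<^sub>R axis i 1)) has_derivative (\<lambda>t. D (t *\<^sub>R axis i 1))) (at 0)"
  by (rule has_derivative_compose)
 moreover have "linear D"
  using assms has_derivative_linear by blast
 ultimately have "((\<lambda>t. f (x + t *\<^sub>R axis i 1)) has_vector_derivative D (axis i 1)) (at 0)"
  by (simp add: has_vector_derivative_def linear_scale)
 then show ?thesis
  unfolding pd_def by (rule vector_derivative_at)
qed

lemma has_derivative_pd:
 fixes f :: "real^'i::finite => 'b::real_normed_vector"
 assumes "f differentiable (at x)"
 shows "(f has_derivative (\<lambda>v. \<Sigma> i. v $ i *\<^sub>R pd i f x)) (at x)"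
proof -
 obtain D where D: "(f has_derivative D) (at x)"
  using assms by (auto simp: differentiable_def)
 then have lin: "linear D" by (rule has_derivative_linear)
 have "D v = (\<Sigma> i. v $ i *\<^sub>R pd i f x)" for v
 proof -
  have "D v = D (\<Sigma> i. v $ i *\<^sub>R axis i 1)" by (simp add: basis_expansion flip: scalar_mult_eq_scaleR)
  also have "... = (\<Sigma> i. v $ i *\<^sub>R D (axis i 1))" by (simp add: linear_sum[OF lin] linear_scale[OF lin])
  finally show ?thesis by (simp add: pd_eq_has_derivative[OF D])
 qed
 then have "D = (\<lambda>v. \<Sigma> i. v $ i *\<^sub>R pd i f x)" by auto
 with D show ?thesis by simp
qed

lemma has_vector_derivative_line:
 assumes "f differentiable (at (x + t *\<^sub>R axis i 1))"
 shows "((\<lambda>t. f (x + t *\<^sub>R axis i 1)) has_vector_derivative pd i f (x + t *\<^sub>R axis i 1)) (at t)"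
proof -
 obtain D where D: "(f has_derivative D) (at (x + t *\<^sub>R axis i 1))"
  using assms by (auto simp: differentiable_def)
 have "((\<lambda>t. x + t *\<^sub>R axis i 1) has_derivative (\<lambda>t. t *\<^sub>R axis i 1)) (at t)"
  by (auto intro!: derivative_eq_intros)
 then have "((\<lambda>t. f (x + t *\<^sub>R axis i 1)) has_derivative (\<lambda>t. D (t *\<^sub>R axis i 1))) (at t)"
  using D by (rule has_derivative_compose)
 moreover have "linear D"
  using D has_derivative_linear by blast
 ultimately show ?thesis by (simp add: has_vector_derivative_def linear_scale pd_eq_has_derivative[OF D])
qed

lemma pd_cong_open:
 assumes "open S" "x \<in> S" "!!y. y \<in> S ==> f y = g y"
 shows "pd i f x = pd i g x"
proof -
 have "((\<lambda>t::real. x + t *\<^sub>R axis i 1) \<longlongrightarrow> x + 0 *\<^sub>R axis i 1) (nhds 0)"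
  by (intro tendsto_intros) (simp add: filterlim_ident)
 then have "\<forall>\<^sub>F t in nhds 0. x + t *\<^sub>R axis i 1 \<in> S"
  using assms(1,2) by (simp add: tendsto_def)
 then have ev: "\<forall>\<^sub>F t in nhds 0. f (x + t *\<^sub>R axis i 1) = g (x + t *\<^sub>R axis i 1)"
  by eventually_elim (use assms(3) in auto)
 have "((\<lambda>t. f (x + t *\<^sub>R axis i 1)) has_vector_derivative D) (at 0) \<longleftrightarrow>
  ((\<lambda>t. g (x + t *\<^sub>R axis i 1)) has_vector_derivative D) (at 0)" for D
  by (rule has_vector_derivative_cong_ev) (use ev assms in "auto elim: eventually_mono")
 then show ?thesis
  unfolding pd_def vector_derivative_def by simp
qed

lemma differentiable_cong_open:
 assumes "open S" "x \<in> S" "!!y. y \<in> S ==> f y = g y" "g differentiable (at x)"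
 shows "f differentiable (at x)"
proof -
 obtain D where "(g has_derivative D) (at x)"
  using assms(4) by (auto simp: differentiable_def)
 then have "(f has_derivative D) (at x)"
  using assms(1-3) by (metis has_derivative_transform_within_open)
 then show ?thesis by (auto simp: differentiable_def)
qed

lemma ck_on_cong:
 assumes "open S" "!!x. x \<in> S ==> f x = g x"
 shows "ck_on k S f \<longleftrightarrow> ck_on k S g"
 using assms(2)
proof (induction k arbitrary: f g)
 case 0
 then show ?case by (simp cong: continuous_on_cong)
next
 case (Suc k)
 have "f differentiable (at x) \<longleftrightarrow> g differentiable (at x)" if "x \<in> S" for x
  using differentiable_cong_open[OF assms(1) that] Suc.prems by metis
 moreover have "ck_on k S (pd i f) \<longleftrightarrow> ck_on k S (pd i g)" for i
  by (rule Suc.IH) (rule pd_cong_open[OF assms(1) _ Suc.prems])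
 ultimately show ?case by auto
qed

lemma smooth_on_cong:
 assumes "open S" "!!x. x \<in> S ==> f x = g x"
 shows "smooth_on S f \<longleftrightarrow> smooth_on S g"
 using ck_on_cong[OF assms] by (simp add: smooth_on_def)

lemma ck_on_subset: "ck_on k S f ==> T \<subseteq> S ==> ck_on k T f"
 by (induction k arbitrary: f) (auto intro: continuous_on_subset)

lemma smooth_on_subset: "smooth_on S f ==> T \<subseteq> S ==> smooth_on T f" by (auto simp: smooth_on_def intro: ck_on_subset)

lemma ck_on_SucD: "ck_on (Suc k) S f ==> ck_on k S f"
proof (induction k arbitrary: f)
 case 0
 then show ?case by (simp add: continuous_at_imp_continuous_on differentiable_imp_continuous_within)
qed auto

lemma smooth_on_D: "smooth_on S f ==> x \<in> S ==> f differentiable (at x)"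
 unfolding smooth_on_def by (metis ck_on.simps(2))

lemma smooth_on_pd: "smooth_on S f ==> smooth_on S (pd i f)"
 unfolding smooth_on_def by (metis ck_on.simps(2))

lemma smooth_on_cont: "smooth_on S f ==> continuous_on S f"
 unfolding smooth_on_def by (metis ck_on.simps(1))

text \<open>Differentiability is local; this glues the two open pieces on which an extension by zero
  is smooth.\<close>

lemma ck_on_bigunion:
 assumes "!!x. x \<in> S ==> \<exists>U. open U \<and> x \<in> U \<and> ck_on k U f"
 shows "ck_on k S f"
 using assms
proof (induction k arbitrary: f)
 case 0
 then show ?case
  unfolding ck_on.simps by (metis continuous_at_imp_continuous_on continuous_on_eq_continuous_at)
next
 case (Suc k)
 show ?case
  unfolding ck_on.simps
 proof safe
  fix x assume "x \<in> S"
  then show "f differentiable (at x)" using Suc.prems[of x] by auto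
 next
  fix i show "ck_on k S (pd i f)"
  proof (rule Suc.IH)
   fix x assume "x \<in> S"
   then show "\<exists>U. open U \<and> x \<in> U \<and> ck_on k U (pd i f)"
    using Suc.prems[of x] by auto
  qed
 qed
qed

section \<open>Rules for partial derivatives\<close>

lemma pd_const [simp]: "pd i (\<lambda>x. c) x = 0" by (rule pd_eq_has_derivative[OF has_derivative_const])

lemma pd_add:
 assumes "f differentiable (at x)" "g differentiable (at x)"
 shows "pd i (\<lambda>x. f x + g x) x = pd i f x + pd i g x"
 using pd_eq_has_derivative[OF has_derivative_add[OF has_derivative_pd[OF assms(1)] has_derivative_pd[OF assms(2)]], of i]
 by (simp add: axis_def if_distrib[of "\<lambda>c. c *\<^sub>R _"] cong: if_cong)

lemma pd_mult:
 fixes f g :: "real^'i::finite => real"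
 assumes "f differentiable (at x)" "g differentiable (at x)"
 shows "pd i (\<lambda>x. f x * g x) x = f x * pd i g x + pd i f x * g x"
 using pd_eq_has_derivative[OF has_derivative_mult[OF has_derivative_pd[OF assms(1)] has_derivative_pd[OF assms(2)]], of i]
 by (simp add: axis_def if_distrib[of "\<lambda>c. c * _"] cong: if_cong)

lemma pd_sum:
 assumes "finite A" "!!a. a \<in> A ==> f a differentiable (at x)"
 shows "pd i (\<lambda>x. \<Sum>a\<in>A. f a x) x = (\<Sum>a\<in>A. pd i (f a) x)"
 using assms
proof (induction A)
 case (insert a A)
 have "(\<lambda>x. \<Sum>a\<in>A. f a x) differentiable (at x)"
  using insert by (intro differentiable_sum) auto
 with insert show ?case by (simp add: pd_add)
qed simp

lemma pd_cmult:
 fixes f :: "real^'i::finite => real"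
 assumes "f differentiable (at x)"
 shows "pd i (\<lambda>x. c * f x) x = c * pd i f x"
 using pd_mult[of "\<lambda>_. c" x f i] assms by simp

lemma pd_minus:
 fixes f :: "real^'i::finite => real"
 assumes "f differentiable (at x)"
 shows "pd i (\<lambda>x. - f x) x = - pd i f x"
 using pd_cmult[OF assms, of i "-1"] by simp

lemma pd_diff:
 fixes f :: "real^'i::finite => real"
 assumes "f differentiable (at x)" "g differentiable (at x)"
 shows "pd i (\<lambda>x. f x - g x) x = pd i f x - pd i g x"
proof -
 have "(\<lambda>x. - g x) differentiable (at x)" using assms(2) by simp
 from pd_add[OF assms(1) this, of i] show ?thesis by (simp add: pd_minus[OF assms(2)])
qed

lemma pd_coord [simp]: "pd i (\<lambda>x. x $ j) x = (if i = j then 1 else 0)"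
proof -
 have "((\<lambda>x::real^'a. x $ j) has_derivative (\<lambda>x. x $ j)) (at x)"
  by (rule bounded_linear_imp_has_derivative) (rule bounded_linear_vec_nth)
 from pd_eq_has_derivative[OF this, of i] show ?thesis by (auto simp: axis_def)
qed

text \<open>The entries may lie in any normed space, so that the rows of a matrix are covered too; a
  vector is rebuilt from its entries by the bounded linear maps \<open>axis a\<close>.\<close>

lemma has_derivative_vec:
 fixes f :: "'a::real_normed_vector => 'b::real_normed_vector^'j::finite"
 shows "(f has_derivative D) F \<longleftrightarrow> (\<forall>a. ((\<lambda>x. f x $ a) has_derivative (\<lambda>v. D v $ a)) F)"
proof
 assume "(f has_derivative D) F"
 then show "\<forall>a. ((\<lambda>x. f x $ a) has_derivative (\<lambda>v. D v $ a)) F"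
  by (auto intro: bounded_linear.has_derivative[OF bounded_linear_vec_nth])
next
 assume D: "\<forall>a. ((\<lambda>x. f x $ a) has_derivative (\<lambda>v. D v $ a)) F"
 have bl: "bounded_linear (axis a :: 'b => 'b^'j)" for a
 proof (rule bounded_linear_intro[where K=1])
  fix v :: 'b
  have "norm (axis a v :: 'b^'j) <= (\<Sigma> b. norm ((axis a v :: 'b^'j) $ b))"
   unfolding norm_vec_def by (rule L2_set_le_sum) simp
  also have "... = norm v" by (simp add: axis_def if_distrib cong: if_cong)
  finally show "norm (axis a v :: 'b^'j) <= norm v * 1" by simp
 qed (simp_all add: vec_eq_iff axis_def)
 have eq: "u = (\<Sigma> a. axis a (u $ a))" for u :: "'b^'j" by (simp add: vec_eq_iff axis_def if_distrib cong: if_cong)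
 have "((\<lambda>x. \<Sigma> a. axis a (f x $ a)) has_derivative (\<lambda>v. \<Sigma> a. axis a (D v $ a))) F"
  using D by (intro has_derivative_sum bounded_linear.has_derivative[OF bl]) auto
 then show "(f has_derivative D) F"
  unfolding eq[symmetric] .
qed

lemma differentiable_vec:
 fixes f :: "'a::real_normed_vector => 'b::real_normed_vector^'j::finite"
 shows "f differentiable F \<longleftrightarrow> (\<forall>a. (\<lambda>x. f x $ a) differentiable F)"
proof
 assume "f differentiable F"
 then show "\<forall>a. (\<lambda>x. f x $ a) differentiable F"
  unfolding differentiable_def by (metis has_derivative_vec)
next
 assume "\<forall>a. (\<lambda>x. f x $ a) differentiable F"
 then obtain D where "!!a. ((\<lambda>x. f x $ a) has_derivative D a) F"
  unfolding differentiable_def by metis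
 then have "(f has_derivative (\<lambda>v. \<chi> a. D a v)) F" by (subst has_derivative_vec) simp
 then show "f differentiable F" by (auto simp: differentiable_def)
qed

lemma pd_component:
 fixes f :: "real^'i::finite => 'b::real_normed_vector^'j::finite"
 assumes "f differentiable (at x)"
 shows "pd i f x $ a = pd i (\<lambda>y. f y $ a) x"
proof -
 have "((\<lambda>y. f y $ a) has_derivative (\<lambda>v. (\<Sigma> i. v $ i *\<^sub>R pd i f x) $ a)) (at x)"
  using iffD1[OF has_derivative_vec has_derivative_pd[OF assms]] by simp
 from pd_eq_has_derivative[OF this, of i] show ?thesis
  by (simp add: axis_def if_distrib[of "\<lambda>c. c *\<^sub>R _"] cong: if_cong)
qed

lemma ck_on_vec:
 fixes f :: "real^'i::finite => 'b::real_normed_vector^'j::finite"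
 assumes "open S"
 shows "ck_on k S f \<longleftrightarrow> (\<forall>a. ck_on k S (\<lambda>x. f x $ a))"
proof (induction k arbitrary: f)
 case 0
 have "continuous_on S (\<lambda>x. \<chi> a. f x $ a)" if "\<forall>a. continuous_on S (\<lambda>x. f x $ a)"
  using that by (intro continuous_on_vec_lambda) auto
 then show ?case by (auto intro: continuous_on_component)
next
 case (Suc k)
 show ?case
 proof (cases "\<forall>x\<in>S. f differentiable (at x)")
  case True
  then have "ck_on k S (\<lambda>x. pd i f x $ a) \<longleftrightarrow> ck_on k S (pd i (\<lambda>x. f x $ a))" for i a
   by (intro ck_on_cong[OF assms]) (simp add: pd_component)
  with True Suc show ?thesis by (auto simp: differentiable_vec)
 next
  case False
  then show ?thesis by (auto simp: differentiable_vec)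
 qed
qed

lemma smooth_on_vec:
 fixes f :: "real^'i::finite => 'b::real_normed_vector^'j::finite"
 assumes "open S"
 shows "smooth_on S f \<longleftrightarrow> (\<forall>a. smooth_on S (\<lambda>x. f x $ a))"
 using ck_on_vec[OF assms] by (auto simp: smooth_on_def)

lemma smooth_on_mat:
 fixes f :: "real^'i::finite => real^'j::finite^'k::finite"
 assumes "open S"
 shows "smooth_on S f \<longleftrightarrow> (\<forall>a b. smooth_on S (\<lambda>x. f x $ a $ b))"
 using assms by (simp add: smooth_on_vec)

section \<open>Closure properties of smooth functions\<close>

lemma ck_on_const [simp]: "ck_on k S (\<lambda>x. c)"
proof (induction k arbitrary: c)
 case (Suc k)
 have "pd i (\<lambda>x. c) = (\<lambda>x. 0)" for i :: 'a by auto
 with Suc show ?case by simp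
qed simp

lemma smooth_on_const [simp]: "smooth_on S (\<lambda>x. c)" by (simp add: smooth_on_def)

lemma ck_on_coord: "ck_on k S (\<lambda>x. x $ j)"
proof (cases k)
 case 0
 then show ?thesis by (simp add: continuous_on_component)
next
 case (Suc m)
 have "pd i (\<lambda>x::real^'a. x $ j) = (\<lambda>x. if i = j then 1 else 0)" for i by auto
 moreover have "(\<lambda>x::real^'a. x $ j) differentiable (at x)" for x
  by (intro bounded_linear_imp_differentiable bounded_linear_vec_nth)
 ultimately show ?thesis using Suc by simp
qed

lemma smooth_on_coord: "smooth_on S (\<lambda>x. x $ j)" by (simp add: smooth_on_def ck_on_coord)

lemma ck_on_add:
 assumes "open S" "ck_on k S f" "ck_on k S g"
 shows "ck_on k S (\<lambda>x. f x + g x)"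
 using assms(2,3)
proof (induction k arbitrary: f g)
 case (Suc k)
 have "ck_on k S (pd i (\<lambda>x. f x + g x)) \<longleftrightarrow> ck_on k S (\<lambda>x. pd i f x + pd i g x)" for i
  using Suc.prems by (intro ck_on_cong[OF assms(1)] pd_add) auto
 with Suc show ?case by auto
qed (simp add: continuous_on_add)

lemma ck_on_mult:
 fixes f g :: "real^'i::finite => real"
 assumes "open S" "ck_on k S f" "ck_on k S g"
 shows "ck_on k S (\<lambda>x. f x * g x)"
 using assms(2,3)
proof (induction k arbitrary: f g)
 case (Suc k)
 have "ck_on k S (pd i (\<lambda>x. f x * g x)) \<longleftrightarrow> ck_on k S (\<lambda>x. f x * pd i g x + pd i f x * g x)" for i
  using Suc.prems by (intro ck_on_cong[OF assms(1)] pd_mult) auto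
 moreover have "ck_on k S f" "ck_on k S g"
  using Suc.prems by (auto intro: ck_on_SucD simp del: ck_on.simps)
 ultimately show ?case using Suc by (auto intro!: ck_on_add[OF assms(1)])
qed (simp add: continuous_on_mult)

lemma smooth_on_add: "open S ==> smooth_on S f ==> smooth_on S g ==> smooth_on S (\<lambda>x. f x + g x)"
 by (simp add: smooth_on_def ck_on_add)

lemma smooth_on_mult:
 fixes f g :: "real^'i::finite => real"
 shows "open S ==> smooth_on S f ==> smooth_on S g ==> smooth_on S (\<lambda>x. f x * g x)"
 by (simp add: smooth_on_def ck_on_mult)

lemma smooth_on_minus:
 fixes f :: "real^'i::finite => real"
 shows "open S ==> smooth_on S f ==> smooth_on S (\<lambda>x. - f x)"
 using smooth_on_mult[of S "\<lambda>_. -1" f] by simp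

lemma smooth_on_diff:
 fixes f g :: "real^'i::finite => real"
 shows "open S ==> smooth_on S f ==> smooth_on S g ==> smooth_on S (\<lambda>x. f x - g x)"
 using smooth_on_add[of S f "\<lambda>x. - g x"] smooth_on_minus[of S g] by simp

lemma ck_on_sum:
 assumes "open S" "!!a. a \<in> A ==> ck_on k S (f a)"
 shows "ck_on k S (\<lambda>x. \<Sum>a\<in>A. f a x)"
 using assms(2) by (induction A rule: infinite_finite_induct) (auto intro!: ck_on_add assms(1))

lemma ck_on_prod:
 fixes f :: "'a => real^'i::finite => real"
 assumes "open S" "!!a. a \<in> A ==> ck_on k S (f a)"
 shows "ck_on k S (\<lambda>x. \<Prod>a\<in>A. f a x)"
 using assms(2) by (induction A rule: infinite_finite_induct) (auto intro!: ck_on_mult assms(1))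

lemma smooth_on_sum:
 "open S ==> (!!a. a \<in> A ==> smooth_on S (f a)) ==> smooth_on S (\<lambda>x. \<Sum>a\<in>A. f a x)"
 by (simp add: smooth_on_def ck_on_sum)

lemma smooth_on_power:
 fixes f :: "real^'i::finite => real"
 shows "open S ==> smooth_on S f ==> smooth_on S (\<lambda>x. f x ^ n)" by (induction n) (auto intro: smooth_on_mult)

lemma pd_compose_real:
 fixes u :: "real^'i::finite => real"
 assumes "u differentiable (at x)" "(F has_real_derivative F') (at (u x))"
 shows "pd i (\<lambda>x. F (u x)) x = F' * pd i u x"
  and "(\<lambda>x. F (u x)) differentiable (at x)"
proof -
 have "(F has_derivative (\<lambda>t. F' * t)) (at (u x))"
  using assms(2) by (simp add: has_field_derivative_def)
 from has_derivative_compose[OF has_derivative_pd[OF assms(1)] this]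
 have *: "((\<lambda>x. F (u x)) has_derivative (\<lambda>v. F' * (\<Sigma> i. v $ i *\<^sub>R pd i u x))) (at x)" .
 from pd_eq_has_derivative[OF this, of i] show "pd i (\<lambda>x. F (u x)) x = F' * pd i u x"
  by (simp add: axis_def if_distrib[of "\<lambda>c. c * _"] cong: if_cong)
 from * show "(\<lambda>x. F (u x)) differentiable (at x)" by (auto simp: differentiable_def)
qed

text \<open>The outer function comes with the sequence of all its derivatives, and \<open>n\<close>
  is arbitrary in the induction because differentiating \<open>F n (u x)\<close> produces
  \<open>F (Suc n) (u x)\<close>.\<close>

lemma ck_on_compose_real:
 fixes u :: "real^'i::finite => real"
 assumes "open S" "ck_on k S u" "u ` S \<subseteq> T"
  and "!!n t. t \<in> T ==> (F n has_real_derivative F (Suc n) t) (at t)"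
 shows "ck_on k S (\<lambda>x. F n (u x))"
 using assms(2)
proof (induction k arbitrary: n)
 case 0
 have "isCont (F n) t" if "t \<in> T" for t
  using assms(4)[OF that] by (blast intro: DERIV_isCont)
 then have "continuous_on T (F n)" by (simp add: continuous_at_imp_continuous_on)
 with 0 assms(3) show ?case by (auto intro: continuous_on_compose2)
next
 case (Suc k)
 have "ck_on k S u" using Suc.prems ck_on_SucD by blast
 have *: "x \<in> S ==> pd i (\<lambda>x. F n (u x)) x = F (Suc n) (u x) * pd i u x"
  "x \<in> S ==> (\<lambda>x. F n (u x)) differentiable (at x)" for x i
  using pd_compose_real[of u x "F n" "F (Suc n) (u x)"] Suc.prems assms(3,4) by auto
 have "ck_on k S (pd i (\<lambda>x. F n (u x)))" for i
  using Suc.prems by (subst ck_on_cong[OF assms(1) *(1)])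
   (auto intro!: ck_on_mult[OF assms(1)] Suc.IH \<open>ck_on k S u\<close>)
 with * show ?case by auto
qed

lemma smooth_on_compose_real:
 fixes u :: "real^'i::finite => real"
 assumes "open S" "smooth_on S u" "u ` S \<subseteq> T"
  and "!!n t. t \<in> T ==> (F n has_real_derivative F (Suc n) t) (at t)"
 shows "smooth_on S (\<lambda>x. F n (u x))"
 using ck_on_compose_real[OF assms(1) _ assms(3), of _ F] assms(2,4) unfolding smooth_on_def by auto

lemma
 fixes f :: "real^'j::finite => 'b::real_normed_vector" and \<phi> :: "real^'i::finite => real^'j"
 assumes "\<phi> differentiable (at x)" "f differentiable (at (\<phi> x))"
 shows pd_compose: "pd i (\<lambda>x. f (\<phi> x)) x = (\<Sigma> j. pd i (\<lambda>x. \<phi> x $ j) x *\<^sub>R pd j f (\<phi> x))"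
  and differentiable_compose_pd: "(\<lambda>x. f (\<phi> x)) differentiable (at x)"
proof -
 note * = has_derivative_compose[OF has_derivative_pd[OF assms(1)] has_derivative_pd[OF assms(2)]]
 then show "(\<lambda>x. f (\<phi> x)) differentiable (at x)" by (auto simp: differentiable_def)
 from pd_eq_has_derivative[OF *, of i]
 show "pd i (\<lambda>x. f (\<phi> x)) x = (\<Sigma> j. pd i (\<lambda>x. \<phi> x $ j) x *\<^sub>R pd j f (\<phi> x))"
  by (simp add: axis_def if_distrib[of "\<lambda>c. c *\<^sub>R _"] pd_component[OF assms(1)] cong: if_cong)
qed

lemma ck_on_compose:
 fixes f :: "real^'j::finite => real" and \<phi> :: "real^'i::finite => real^'j"
 assumes "open S" "ck_on k S \<phi>" "\<phi> ` S \<subseteq> T" "ck_on k T f"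
 shows "ck_on k S (\<lambda>x. f (\<phi> x))"
 using assms(2,4)
proof (induction k arbitrary: f)
 case 0
 with assms(3) show ?case by (auto intro: continuous_on_compose2)
next
 case (Suc k)
 have *: "x \<in> S ==> pd i (\<lambda>x. f (\<phi> x)) x = (\<Sigma> j. pd i \<phi> x $ j * pd j f (\<phi> x))"
  "x \<in> S ==> (\<lambda>x. f (\<phi> x)) differentiable (at x)" for x i
  using pd_compose[of \<phi> x f] differentiable_compose_pd[of \<phi> x f] Suc.prems(1,2) assms(3)
  by (simp_all add: pd_component image_subset_iff)
 have "ck_on k S \<phi>" using Suc.prems ck_on_SucD by blast
 have "ck_on k S (pd i (\<lambda>x. f (\<phi> x)))" for i
 proof (subst ck_on_cong[OF assms(1) *(1)])
  have "ck_on k S (pd i \<phi>)" using Suc.prems by simp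
  then have "ck_on k S (\<lambda>x. pd i \<phi> x $ j)" for j by (simp add: ck_on_vec[OF assms(1)])
  then show "ck_on k S (\<lambda>x. \<Sigma> j. pd i \<phi> x $ j * pd j f (\<phi> x))"
   using Suc.prems \<open>ck_on k S \<phi>\<close> by (auto intro!: ck_on_sum[OF assms(1)] ck_on_mult[OF assms(1)] Suc.IH)
 qed auto
 with * show ?case by auto
qed

lemma smooth_on_compose:
 fixes f :: "real^'j::finite => real" and \<phi> :: "real^'i::finite => real^'j"
 assumes "open S" "smooth_on S \<phi>" "\<phi> ` S \<subseteq> T" "smooth_on T f"
 shows "smooth_on S (\<lambda>x. f (\<phi> x))"
 using ck_on_compose[OF assms(1) _ assms(3)] assms(2,4) by (auto simp: smooth_on_def)

lemma ck_on_inverse: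
 fixes f :: "real^'i::finite => real"
 assumes "open S" "ck_on k S f" "!!x. x \<in> S ==> f x ~= 0"
 shows "ck_on k S (\<lambda>x. inverse (f x))"
proof -
 \<comment> \<open>The n-th derivative of 1/t.\<close>
 define F where "F n t = (-1)^n * fact n * (inverse t)^(Suc n)" for n and t :: real
 have "(F n has_real_derivative F (Suc n) t) (at t)" if "t \<in> -{0}" for n t
 proof -
  from that have "t ~= 0" by simp
  have "((\<lambda>t. inverse t ^ Suc n) has_real_derivative real (Suc n) * (- (inverse t)\<^sup>2 * inverse t ^ n)) (at t)"
   using DERIV_power[OF DERIV_inverse[OF \<open>t ~= 0\<close>, of UNIV], of "Suc n"] by (simp add: numeral_2_eq_2)
  from DERIV_cmult[OF this, of "(-1)^n * fact n"]
  have "(F n has_real_derivative ((-1)^n * fact n) * (real (Suc n) * inverse t ^ n * (- (inverse t)\<^sup>2))) (at t)"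
   unfolding F_def by (simp add: mult.commute mult.left_commute)
  also have "((-1)^n * fact n) * (real (Suc n) * inverse t ^ n * (- (inverse t)\<^sup>2)) = F (Suc n) t"
   by (simp add: F_def power2_eq_square algebra_simps)
  finally show ?thesis .
 qed
 then have "ck_on k S (\<lambda>x. F 0 (f x))" by (intro ck_on_compose_real[OF assms(1,2), where T="-{0}"]) (use assms(3) in auto)
 then show ?thesis by (simp add: F_def)
qed

section \<open>Determinants and inverse matrices\<close>

lemma ck_on_det:
 fixes A :: "real^'i::finite => real^'j::finite^'j"
 assumes "open S" "!!a b. ck_on k S (\<lambda>x. A x $ a $ b)"
 shows "ck_on k S (\<lambda>x. det (A x))"
 unfolding det_def using assms by (intro ck_on_sum ck_on_mult ck_on_prod) auto

lemma
 fixes A :: "real^'j::finite^'j"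
 assumes "det A ~= 0"
 shows matrix_inv_right: "A ** matrix_inv A = mat 1" and matrix_inv_left: "matrix_inv A ** A = mat 1"
proof -
 have "\<exists>B. A ** B = mat 1 \<and> B ** A = mat 1"
  using assms by (simp add: invertible_det_nz[symmetric] invertible_def)
 then have "A ** matrix_inv A = mat 1 \<and> matrix_inv A ** A = mat 1"
  unfolding matrix_inv_def by (rule someI_ex)
 then show "A ** matrix_inv A = mat 1" "matrix_inv A ** A = mat 1" by auto
qed

lemma matrix_mult_distribs:
 fixes A B :: "real^'m::finite^'k::finite" and C D :: "real^'l::finite^'m"
 shows "(A + B) ** C = A ** C + B ** C" "(A - B) ** C = A ** C - B ** C" "A ** (C - D) = A ** C - A ** D"
 by (simp_all add: vec_eq_iff matrix_matrix_mult_def distrib_right left_diff_distrib right_diff_distrib sum.distrib sum_subtractf)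

text \<open>The resolvent identity. The derivative of the inverse, its Lipschitz estimate and the
  agreement of two inverses to finite order all rest on it.\<close>

lemma matrix_inv_diff:
 fixes A B :: "real^'j::finite^'j"
 assumes "det A ~= 0" "det B ~= 0"
 shows "matrix_inv A $ a $ b - matrix_inv B $ a $ b =
  - (\<Sigma> c d. matrix_inv A $ a $ c * (A $ c $ d - B $ c $ d) * matrix_inv B $ d $ b)"
proof -
 have "(\<Sigma> c d. matrix_inv A $ a $ c * (A $ c $ d - B $ c $ d) * matrix_inv B $ d $ b) =
  (matrix_inv A ** ((A - B) ** matrix_inv B)) $ a $ b" by (simp add: matrix_matrix_mult_def sum_distrib_left mult.assoc)
 also have "matrix_inv A ** ((A - B) ** matrix_inv B) = matrix_inv B - matrix_inv A"
  by (simp add: matrix_mult_distribs matrix_inv_right[OF assms(2)] matrix_mul_assoc matrix_inv_left[OF assms(1)])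
 finally show ?thesis by simp
qed

text \<open>Cramer's rule for column \<open>b\<close> of the inverse. The entries become polynomials
  divided by the determinant, so continuity and smoothness are inherited.\<close>

lemma matrix_inv_cofactor:
 fixes A :: "real^'j::finite^'j"
 assumes "det A ~= 0"
 shows "matrix_inv A $ a $ b = det (\<chi> i j. if j = a then (if i = b then 1 else 0) else A $ i $ j) * inverse (det A)"
proof -
 have "A ** matrix_inv A = mat 1"
  using assms by (rule matrix_inv_right)
 then have "A *v (matrix_inv A *v axis b 1) = axis b 1" by (metis matrix_vector_mul_assoc matrix_vector_mul_lid)
 then have "matrix_inv A *v axis b 1 = (\<chi> k. det (\<chi> i j. if j = k then axis b 1 $ i else A $ i $ j) / det A)"
  by (simp only: cramer[OF assms])
 then have "(matrix_inv A *v axis b 1) $ a = det (\<chi> i j. if j = a then axis b 1 $ i else A $ i $ j) / det A" by simp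
 moreover have "(matrix_inv A *v axis b 1) $ a = matrix_inv A $ a $ b"
  by (simp add: matrix_vector_mul_component inner_vec_def axis_def if_distrib[of "\<lambda>c. _ * c"] cong: if_cong)
 moreover have "axis b 1 $ i = (if i = b then 1 else (0::real))" for i by (simp add: axis_def)
 ultimately show ?thesis by (simp add: divide_inverse cong: if_cong)
qed

lemma ck_on_matrix_inv:
 fixes A :: "real^'i::finite => real^'j::finite^'j"
 assumes "open S" "!!a b. ck_on k S (\<lambda>x. A x $ a $ b)" "!!x. x \<in> S ==> det (A x) ~= 0"
 shows "ck_on k S (\<lambda>x. matrix_inv (A x) $ a $ b)"
proof (subst ck_on_cong[OF assms(1) matrix_inv_cofactor[OF assms(3)]])
 have "ck_on k S (\<lambda>x. (\<chi> i j. if j = a then if i = b then 1 else 0 else A x $ i $ j) $ c $ d)" for c d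
  by (cases "d = a") (auto simp: assms(2))
 then show "ck_on k S (\<lambda>x. det (\<chi> i j. if j = a then if i = b then 1 else 0 else A x $ i $ j) * inverse (det (A x)))"
  using assms by (intro ck_on_mult ck_on_inverse ck_on_det) auto
qed

lemma smooth_on_inverse:
 fixes f :: "real^'i::finite => real"
 shows "open S ==> smooth_on S f ==> (!!x. x \<in> S ==> f x ~= 0) ==> smooth_on S (\<lambda>x. inverse (f x))"
 by (simp add: smooth_on_def ck_on_inverse)

lemma smooth_on_det:
 fixes A :: "real^'i::finite => real^'j::finite^'j"
 shows "open S ==> smooth_on S A ==> smooth_on S (\<lambda>x. det (A x))"
 by (subst (asm) smooth_on_mat) (auto simp: smooth_on_def intro!: ck_on_det)

lemma smooth_on_matrix_inv:
 fixes A :: "real^'i::finite => real^'j::finite^'j"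
 shows "open S ==> smooth_on S A ==> (!!x. x \<in> S ==> det (A x) ~= 0) ==> smooth_on S (\<lambda>x. matrix_inv (A x))"
 by (subst (asm) smooth_on_mat, assumption, subst smooth_on_mat) (auto simp: smooth_on_def intro!: ck_on_matrix_inv)

lemma smooth_on_nth:
 fixes A :: "real^'i::finite => 'b::real_normed_vector^'j::finite"
 shows "open S ==> smooth_on S A ==> smooth_on S (\<lambda>x. A x $ a)" by (simp add: smooth_on_vec)

lemma smooth_on_compose_vec:
 fixes f :: "real^'j::finite => real^'k::finite" and \<phi> :: "real^'i::finite => real^'j"
 assumes "open S" "open T" "smooth_on S \<phi>" "\<phi> ` S \<subseteq> T" "smooth_on T f"
 shows "smooth_on S (\<lambda>x. f (\<phi> x))"
 using assms(5) smooth_on_compose[OF assms(1,3,4)]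
 unfolding smooth_on_vec[OF assms(1)] smooth_on_vec[OF assms(2)] by blast

lemma smooth_on_compose_mat:
 fixes f :: "real^'j::finite => real^'k::finite^'l::finite" and \<phi> :: "real^'i::finite => real^'j"
 assumes "open S" "open T" "smooth_on S \<phi>" "\<phi> ` S \<subseteq> T" "smooth_on T f"
 shows "smooth_on S (\<lambda>x. f (\<phi> x))"
 using assms(5) smooth_on_compose[OF assms(1,3,4)]
 unfolding smooth_on_mat[OF assms(1)] smooth_on_mat[OF assms(2)] by blast

subsection \<open>Symmetry of second derivatives\<close>

text \<open>Two mean value theorems, first along \<open>i\<close> and then along \<open>j\<close>,
  over a square of side \<open>h\<close>.\<close>

lemma second_difference:
 fixes f :: "real^'i::finite => real"
 assumes "0 < h" "cball x (2 * h) \<subseteq> S"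
  and f: "!!y. y \<in> S ==> f differentiable (at y)"
  and fi: "!!y. y \<in> S ==> pd i f differentiable (at y)"
 shows "\<exists>z\<in>cball x (2 * h).
  f (x + h *\<^sub>R axis j 1 + h *\<^sub>R axis i 1) - f (x + h *\<^sub>R axis i 1) - f (x + h *\<^sub>R axis j 1) + f x
  = h\<^sup>2 * pd j (pd i f) z"
proof -
 have in_cball: "x + s *\<^sub>R axis i 1 + t *\<^sub>R axis j 1 \<in> cball x (2 * h)"
  if "0 <= s" "s <= h" "0 <= t" "t <= h" for s t
 proof -
  have "norm (s *\<^sub>R axis i 1 + t *\<^sub>R axis j 1 :: real^'i) <= s + t"
   using that by (intro norm_triangle_le) (simp add: norm_axis_1)
  moreover have "x - (x + s *\<^sub>R axis i 1 + t *\<^sub>R axis j 1) = - (s *\<^sub>R axis i 1 + t *\<^sub>R axis j 1)" by simp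
  ultimately show ?thesis using that unfolding mem_cball dist_norm by (simp only: norm_minus_cancel)
 qed
 define g where "g s = f (x + h *\<^sub>R axis j 1 + s *\<^sub>R axis i 1) - f (x + s *\<^sub>R axis i 1)" for s
 have inS: "x + h *\<^sub>R axis j 1 + s *\<^sub>R axis i 1 \<in> S" "x + s *\<^sub>R axis i 1 \<in> S"
  if "0 <= s" "s <= h" for s
  using in_cball[OF that, of h] in_cball[OF that, of 0] assms(1,2) by (auto simp: algebra_simps)
 have "(g has_real_derivative
   pd i f (x + h *\<^sub>R axis j 1 + s *\<^sub>R axis i 1) - pd i f (x + s *\<^sub>R axis i 1)) (at s)"
  if "0 <= s" "s <= h" for s
  unfolding g_def has_real_derivative_iff_has_vector_derivative
  by (intro has_vector_derivative_diff has_vector_derivative_line f inS that)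
 from MVT2[OF \<open>0 < h\<close> this] obtain s where s: "0 < s" "s < h"
  "g h - g 0 = h * (pd i f (x + h *\<^sub>R axis j 1 + s *\<^sub>R axis i 1) - pd i f (x + s *\<^sub>R axis i 1))" by auto
 define k where "k t = pd i f (x + s *\<^sub>R axis i 1 + t *\<^sub>R axis j 1)" for t
 have "(k has_real_derivative pd j (pd i f) (x + s *\<^sub>R axis i 1 + t *\<^sub>R axis j 1)) (at t)"
  if "0 <= t" "t <= h" for t
  unfolding k_def has_real_derivative_iff_has_vector_derivative
  using in_cball[of s t] s that assms(2) by (intro has_vector_derivative_line fi) auto
 from MVT2[OF \<open>0 < h\<close> this] obtain t where t: "0 < t" "t < h"
  "k h - k 0 = h * pd j (pd i f) (x + s *\<^sub>R axis i 1 + t *\<^sub>R axis j 1)" by auto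
 show ?thesis
 proof
  show "x + s *\<^sub>R axis i 1 + t *\<^sub>R axis j 1 \<in> cball x (2 * h)"
   using s t by (intro in_cball) auto
  have "pd i f (x + h *\<^sub>R axis j 1 + s *\<^sub>R axis i 1) - pd i f (x + s *\<^sub>R axis i 1) = k h - k 0"
   by (simp add: k_def algebra_simps)
  with s t show "f (x + h *\<^sub>R axis j 1 + h *\<^sub>R axis i 1) - f (x + h *\<^sub>R axis i 1) - f (x + h *\<^sub>R axis j 1) + f x
   = h\<^sup>2 * pd j (pd i f) (x + s *\<^sub>R axis i 1 + t *\<^sub>R axis j 1)" by (simp add: g_def power2_eq_square)
 qed
qed

text \<open>The second difference does not depend on the order of the two directions, so the mixed
  derivatives take equal values at two points arbitrarily close to \<open>x\<close>; continuity does
  the rest.\<close>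

lemma pd_commute:
 fixes f :: "real^'i::finite => real"
 assumes "open S" "x \<in> S" "smooth_on S f"
 shows "pd i (pd j f) x = pd j (pd i f) x"
proof (rule ccontr)
 assume neq: "pd i (pd j f) x ~= pd j (pd i f) x"
 define e where "e = \<bar>pd i (pd j f) x - pd j (pd i f) x\<bar> / 2"
 have "0 < e" using neq by (simp add: e_def)
 have "isCont (pd k (pd l f)) x" for k l
  using assms smooth_on_cont[OF smooth_on_pd[OF smooth_on_pd]] continuous_on_eq_continuous_at by blast
 then have "\<exists>d>0. \<forall>y. dist y x < d --> dist (pd k (pd l f) y) (pd k (pd l f) x) < e" for k l
  using \<open>0 < e\<close> by (simp add: continuous_at_eps_delta)
 then obtain d1 d2 where d: "0 < d1" "0 < d2"
  "!!y. dist y x < d1 ==> dist (pd i (pd j f) y) (pd i (pd j f) x) < e"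
  "!!y. dist y x < d2 ==> dist (pd j (pd i f) y) (pd j (pd i f) x) < e" by metis
 obtain r where r: "0 < r" "cball x r \<subseteq> S"
  using assms(1,2) open_contains_cball by blast
 define h where "h = min r (min (d1/2) (d2/2)) / 2"
 have h: "0 < h" "2 * h <= r" "2 * h < d1" "2 * h < d2"
  using r d by (auto simp: h_def)
 then have sub: "cball x (2 * h) \<subseteq> S" using r by auto
 note df = smooth_on_D[OF assms(3)] smooth_on_D[OF smooth_on_pd[OF assms(3)]]
 obtain z where z: "z \<in> cball x (2*h)"
  "f (x + h *\<^sub>R axis j 1 + h *\<^sub>R axis i 1) - f (x + h *\<^sub>R axis i 1) - f (x + h *\<^sub>R axis j 1) + f x
  = h\<^sup>2 * pd j (pd i f) z"
  using second_difference[OF h(1) sub, of f i j] df by auto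
 obtain w where w: "w \<in> cball x (2*h)"
  "f (x + h *\<^sub>R axis i 1 + h *\<^sub>R axis j 1) - f (x + h *\<^sub>R axis j 1) - f (x + h *\<^sub>R axis i 1) + f x
  = h\<^sup>2 * pd i (pd j f) w"
  using second_difference[OF h(1) sub, of f j i] df by auto
 have "x + h *\<^sub>R axis j 1 + h *\<^sub>R axis i 1 = x + h *\<^sub>R axis i 1 + h *\<^sub>R axis j 1" by (simp only: ac_simps)
 then have "f (x + h *\<^sub>R axis j 1 + h *\<^sub>R axis i 1) = f (x + h *\<^sub>R axis i 1 + h *\<^sub>R axis j 1)"
  by (rule arg_cong)
 then have "h\<^sup>2 * pd j (pd i f) z = h\<^sup>2 * pd i (pd j f) w"
  using z(2) w(2) by linarith
 then have eq: "pd j (pd i f) z = pd i (pd j f) w" using h by simp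
 have "dist (pd i (pd j f) w) (pd i (pd j f) x) < e" "dist (pd j (pd i f) z) (pd j (pd i f) x) < e"
  using d(3)[of w] d(4)[of z] z(1) w(1) h by (simp_all add: dist_commute[of x])
 then show False using eq unfolding dist_real_def e_def by (smt (verit) field_sum_of_halves)
qed

subsection \<open>Diffeomorphisms\<close>

definition jac :: "(real^'i::finite => real^'j::finite) => real^'i => real^'i^'j" where
 "jac \<phi> x = (\<chi> a b. pd b (\<lambda>y. \<phi> y $ a) x)"

lemma has_derivative_jac:
 assumes "\<phi> differentiable (at x)"
 shows "(\<phi> has_derivative (\<lambda>v. jac \<phi> x *v v)) (at x)"
proof -
 have "(\<lambda>v. \<Sigma> i. v $ i *\<^sub>R pd i \<phi> x) = (\<lambda>v. jac \<phi> x *v v)"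
  by (auto simp: jac_def matrix_vector_mult_def vec_eq_iff pd_component[OF assms] mult.commute)
 with has_derivative_pd[OF assms] show ?thesis by simp
qed

lemma matrix_jac: "matrix (\<lambda>v. jac \<phi> x *v v) = jac \<phi> x" by (rule matrix_of_matrix_vector_mul)

lemma jac_eq_matrix:
 assumes "(\<phi> has_derivative D) (at x)"
 shows "jac \<phi> x = matrix D"
 using has_derivative_unique[OF assms has_derivative_jac] assms matrix_jac by (metis differentiable_def)

lemma smooth_on_jac:
 assumes "open S" "smooth_on S \<phi>"
 shows "smooth_on S (jac \<phi>)"
 unfolding smooth_on_mat[OF assms(1)] jac_def
 using assms by (simp add: smooth_on_vec smooth_on_pd)

text \<open>Bootstrapping: the derivative of the inverse map is the inverse Jacobian matrix
  evaluated along the inverse map itself, so each order of regularity yields the next.\<close>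

lemma smooth_on_inverse_map:
 fixes \<phi> :: "real^'i::finite => real^'i"
 assumes "open V" "open W" "smooth_on V \<phi>" "\<psi> ` W \<subseteq> V"
  and nz: "!!x. x \<in> V ==> det (jac \<phi> x) ~= 0"
  and der: "!!y. y \<in> W ==> (\<psi> has_derivative (\<lambda>v. matrix_inv (jac \<phi> (\<psi> y)) *v v)) (at y)"
 shows "smooth_on W \<psi>"
 unfolding smooth_on_def
proof
 fix k show "ck_on k W \<psi>"
 proof (induction k)
  case 0
  show ?case
   using der by (auto intro!: continuous_at_imp_continuous_on has_derivative_continuous)
 next
  case (Suc k)
  have "pd j \<psi> y $ a = matrix_inv (jac \<phi> (\<psi> y)) $ a $ j" if "y \<in> W" for j a y
   using pd_eq_has_derivative[OF der[OF that], of j]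
   by (simp add: matrix_vector_mult_def axis_def if_distrib[of "\<lambda>c. _ * c"] cong: if_cong)
  moreover have "ck_on k W (\<lambda>y. matrix_inv (jac \<phi> (\<psi> y)) $ a $ j)" for a j
  proof (rule ck_on_matrix_inv[OF assms(2)])
   have "ck_on k V (\<lambda>x. jac \<phi> x $ a $ b)" for a b
    using smooth_on_jac[OF assms(1,3)] unfolding smooth_on_mat[OF assms(1)] by (simp add: smooth_on_def)
   then show "ck_on k W (\<lambda>x. jac \<phi> (\<psi> x) $ a $ b)" for a b
    using ck_on_compose[OF assms(2) Suc assms(4)] by blast
   show "det (jac \<phi> (\<psi> x)) ~= 0" if "x \<in> W" for x
    using nz that assms(4) by auto
  qed
  ultimately have "ck_on k W (pd j \<psi>)" for j
   unfolding ck_on_vec[OF assms(2)] using ck_on_cong[OF assms(2)] by (metis (no_types, lifting))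
  then show ?case using der by (auto simp: differentiable_def)
 qed
qed

lemma local_diffeomorphism:
 fixes \<phi> :: "real^'i::finite => real^'i"
 assumes "open U" "smooth_on U \<phi>" "x0 \<in> U" "det (jac \<phi> x0) ~= 0"
 obtains V where "open V" "x0 \<in> V" "V \<subseteq> U" "diffeomorphic_map V (\<phi> ` V) \<phi>"
  "!!x. x \<in> V ==> det (jac \<phi> x) ~= 0"
proof -
 \<comment> \<open>Restricting to \<open>U0\<close> first keeps the Jacobian invertible on the whole
   neighbourhood that the inverse function theorem provides.\<close>
 define U0 where "U0 = {x\<in>U. det (jac \<phi> x) ~= 0}"
 have "continuous_on U (\<lambda>x. det (jac \<phi> x))" by (intro smooth_on_cont smooth_on_det smooth_on_jac assms)
 then have "open U0"
  using continuous_open_preimage[of U "\<lambda>x. det (jac \<phi> x)" "-{0}"] assms(1)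
  by (simp add: U0_def vimage_def Int_def open_Compl)
 define f' where "f' x = Blinfun (\<lambda>v. jac \<phi> x *v v)" for x
 have f': "blinfun_apply (f' x) = (\<lambda>v. jac \<phi> x *v v)" for x
  unfolding f'_def by (rule bounded_linear_Blinfun_apply) (simp add: matrix_vector_mul_bounded_linear)
 have cont: "continuous_on U0 f'"
 proof (rule continuous_on_blinfun_componentwise)
  fix v :: "real^'i"
  have "continuous_on U (\<lambda>x. jac \<phi> x $ a $ b)" for a b
   using smooth_on_jac[OF assms(1,2)] unfolding smooth_on_mat[OF assms(1)] by (intro smooth_on_cont) auto
  then have "continuous_on U0 (\<lambda>x. jac \<phi> x $ a $ b)" for a b by (rule continuous_on_subset) (auto simp: U0_def)
  then show "continuous_on U0 (\<lambda>x. blinfun_apply (f' x) v)"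
   unfolding f' matrix_vector_mult_def
   by (intro continuous_on_vec_lambda continuous_on_sum continuous_on_mult continuous_on_const)
 qed
 have inv: "Blinfun (\<lambda>v. matrix_inv (jac \<phi> x0) *v v) o\<^sub>L f' x0 = id_blinfun" by (rule blinfun_eqI)
   (simp add: f' bounded_linear_Blinfun_apply matrix_vector_mul_bounded_linear
    matrix_vector_mul_assoc matrix_inv_left[OF assms(4)])
 have der: "(\<phi> has_derivative blinfun_apply (f' x)) (at x)" if "x \<in> U0" for x
  unfolding f' using that assms(2) by (intro has_derivative_jac smooth_on_D) (auto simp: U0_def)
 have "x0 \<in> U0" using assms by (simp add: U0_def)
 obtain V W g g' where VW: "open V" "V \<subseteq> U0" "x0 \<in> V" "open W" "homeomorphism V W \<phi> g"
  "!!y. y \<in> W ==> (g has_derivative (g' y)) (at y)"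
  "!!y. y \<in> W ==> g' y = Hilbert_Choice.inv (blinfun_apply (f'(g y)))"
  "!!y. y \<in> W ==> bij (blinfun_apply (f'(g y)))"
  using inverse_function_theorem[OF \<open>open U0\<close> der cont \<open>x0 \<in> U0\<close> inv] by metis
 have gW: "g ` W = V" "\<phi> ` V = W" "!!x. x \<in> V ==> g (\<phi> x) = x" "!!y. y \<in> W ==> \<phi> (g y) = y"
  using VW(5) by (auto simp: homeomorphism_def)
 have nz: "det (jac \<phi> x) ~= 0" if "x \<in> V" for x using that VW(2) by (auto simp: U0_def)
 have sm: "smooth_on V \<phi>" using assms(2) by (rule smooth_on_subset) (use VW(2) in \<open>auto simp: U0_def\<close>)
 have gder: "(g has_derivative (\<lambda>v. matrix_inv (jac \<phi> (g y)) *v v)) (at y)" if "y \<in> W" for y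
 proof -
  have "det (jac \<phi> (g y)) ~= 0" using nz gW that by auto
  then have "g' y = (\<lambda>v. matrix_inv (jac \<phi> (g y)) *v v)"
   unfolding VW(7)[OF that] f'
   by (intro inv_unique_comp) (auto simp: fun_eq_iff matrix_vector_mul_assoc matrix_inv_left matrix_inv_right)
  with VW(6)[OF that] show ?thesis by simp
 qed
 have smg: "smooth_on W g" by (rule smooth_on_inverse_map[OF VW(1,4) sm _ nz gder]) (use gW in auto)
 have bij: "bij_betw \<phi> V W"
  unfolding bij_betw_def using gW by (metis inj_on_def)
 have "inv_into V \<phi> y = g y" if "y \<in> W" for y
  using that bij gW by (metis bij_betw_def image_eqI inv_into_f_f)
 with smg have "smooth_on W (inv_into V \<phi>)"
  using smooth_on_cong[OF VW(4)] by metis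
 then have "diffeomorphic_map V (\<phi> ` V) \<phi>"
  using VW sm bij gW by (simp add: diffeomorphic_map_def)
 moreover have "V \<subseteq> U" using VW(2) by (auto simp: U0_def)
 ultimately show ?thesis using that VW nz by blast
qed

subsection \<open>Functions with compact support in an open set\<close>

definition ext0 :: "'a set => ('a => 'b::zero) => 'a => 'b" where
 "ext0 V f z = (if z \<in> V then f z else 0)"

text \<open>Only values on \<open>V\<close> enter: component fields mean nothing off the image of
  their chart, so the support cannot be formed in the whole space.\<close>

definition csupp :: "'a::topological_space set => ('a => 'b::zero) => bool" where
 "csupp V f \<longleftrightarrow> (\<exists>K. compact K \<and> K \<subseteq> V \<and> (\<forall>z\<in>V - K. f z = 0))"

lemma csupp_mult_left: "csupp V f ==> csupp V (\<lambda>z. g z * f z :: 'b::mult_zero)" by (fastforce simp: csupp_def)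

lemma csupp_cong: "csupp V f ==> (!!z. z \<in> V ==> f z = 0 ==> g z = 0) ==> csupp V g" by (fastforce simp: csupp_def)

lemma csupp_add:
 fixes f g :: "'a::t2_space => 'b::monoid_add"
 assumes "csupp V f" "csupp V g"
 shows "csupp V (\<lambda>z. f z + g z)"
proof -
 obtain K K' where "compact K" "K \<subseteq> V" "\<forall>z\<in>V - K. f z = 0" "compact K'" "K' \<subseteq> V" "\<forall>z\<in>V - K'. g z = 0"
  using assms by (auto simp: csupp_def)
 then show ?thesis
  unfolding csupp_def by (intro exI[of _ "K \<union> K'"]) (auto simp: compact_Un)
qed

lemma csupp_sum:
 fixes f :: "'c => 'a::t2_space => 'b::comm_monoid_add"
 assumes "!!a. a \<in> A ==> csupp V (f a)"
 shows "csupp V (\<lambda>z. \<Sum>a\<in>A. f a z)"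
 using assms
proof (induction A rule: infinite_finite_induct)
 case (insert a A)
 then show ?case by (simp add: csupp_add)
qed (auto simp: csupp_def intro!: exI[of _ "{}"])

lemma csupp_pd:
 fixes f :: "real^'i::finite => 'b::real_normed_vector"
 assumes "open V" "csupp V f"
 shows "csupp V (pd i f)"
proof -
 obtain K where K: "compact K" "K \<subseteq> V" "\<forall>z\<in>V - K. f z = 0"
  using assms(2) by (auto simp: csupp_def)
 have "pd i f z = 0" if "z \<in> V - K" for z
 proof -
  have "open (V - K)" using assms(1) K by (simp add: compact_imp_closed open_Diff)
  then have "pd i f z = pd i (\<lambda>_. 0) z" by (rule pd_cong_open[OF _ that]) (use K in auto)
  then show ?thesis by simp
 qed
 with K show ?thesis by (auto simp: csupp_def)
qed

text \<open>\<open>V\<close> and the complement of the compact set are open and cover the space; on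
  the second one the extension is zero.\<close>

lemma ck_on_ext0:
 fixes f :: "real^'i::finite => 'b::real_normed_vector"
 assumes "open V" "ck_on k V f" "csupp V f"
 shows "ck_on k UNIV (ext0 V f)"
proof (rule ck_on_bigunion)
 fix x :: "real^'i"
 obtain K where K: "compact K" "K \<subseteq> V" "\<forall>z\<in>V - K. f z = 0"
  using assms(3) by (auto simp: csupp_def)
 show "\<exists>U. open U \<and> x \<in> U \<and> ck_on k U (ext0 V f)"
 proof (cases "x \<in> V")
  case True
  have "ck_on k V (ext0 V f)"
   using ck_on_cong[OF assms(1), of "ext0 V f" f k] assms(2) by (simp add: ext0_def)
  with True assms(1) show ?thesis by blast
 next
  case False
  have op: "open (- K)" using K(1) by (simp add: compact_imp_closed open_Compl)
  have "ck_on k (- K) (ext0 V f)"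
   using ck_on_cong[OF op, of "ext0 V f" "\<lambda>_. 0" k] K by (simp add: ext0_def)
  with False op K show ?thesis by blast
 qed
qed

lemma smooth_on_ext0:
 fixes f :: "real^'i::finite => 'b::real_normed_vector"
 shows "open V ==> smooth_on V f ==> csupp V f ==> smooth_on UNIV (ext0 V f)" by (simp add: smooth_on_def ck_on_ext0)

lemma continuous_on_ext0:
 fixes f :: "real^'i::finite => 'b::real_normed_vector"
 shows "open V ==> continuous_on V f ==> csupp V f ==> continuous_on UNIV (ext0 V f)"
 using ck_on_ext0[of V 0 f] by simp

lemma compact_subset_cbox:
 fixes K :: "(real^'i::finite) set"
 assumes "compact K"
 obtains a b where "K \<subseteq> cbox a b"
 using assms compact_imp_bounded bounded_subset_cbox_symmetric by metis

text \<open>\<open>metric_variation\<close> is stated with Lebesgue integrals over \<open>V\<close>,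
  change of variables and Leibniz' rule with gauge integrals; for compact support all of them agree
  with an integral over a box.\<close>

lemma csupp_integral:
 fixes f :: "real^'i::finite => real"
 assumes V: "open V" and f: "continuous_on V f" and K: "K \<subseteq> cbox a b" "!!z. z \<in> V - K ==> f z = 0" "compact K" "K \<subseteq> V"
 shows "(f has_integral integral (cbox a b) (ext0 V f)) V"
  and "f absolutely_integrable_on V"
  and "set_integrable lborel V f"
  and "(LINT z:V|lborel. f z) = integral V f"
  and "integral V f = integral (cbox a b) (ext0 V f)"
proof -
 have cs: "csupp V f" using K by (auto simp: csupp_def)
 note cont = continuous_on_ext0[OF V f cs]
 have "ext0 V f absolutely_integrable_on cbox a b"
  by (rule absolutely_integrable_continuous) (rule continuous_on_subset[OF cont], simp)
 moreover have eq: "(\<lambda>x. if x \<in> cbox a b then ext0 V f x else 0) = ext0 V f"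
  using K(1,2) by (fastforce simp: ext0_def fun_eq_iff)
 ultimately have ai: "ext0 V f absolutely_integrable_on UNIV"
  using absolutely_integrable_restrict_UNIV[of "cbox a b" "ext0 V f"] by simp
 have eq': "(\<lambda>x. if x \<in> V then f x else 0) = ext0 V f" by (auto simp: ext0_def)
 show "f absolutely_integrable_on V"
  using ai absolutely_integrable_restrict_UNIV[of V f] eq' by simp
 have "(ext0 V f has_integral integral (cbox a b) (ext0 V f)) (cbox a b)"
  by (intro integrable_integral integrable_continuous continuous_on_subset[OF cont]) simp
 then have "(ext0 V f has_integral integral (cbox a b) (ext0 V f)) UNIV"
  using has_integral_restrict_UNIV[of "cbox a b" "ext0 V f"] eq by simp
 then show *: "(f has_integral integral (cbox a b) (ext0 V f)) V"
  using has_integral_restrict_UNIV[of V f] eq' by simp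
 then show "integral V f = integral (cbox a b) (ext0 V f)" by (rule integral_unique)
 have ind: "(\<lambda>x. indicator V x *\<^sub>R f x) = ext0 V f" by (auto simp: ext0_def indicator_def)
 have meas: "ext0 V f \<in> borel_measurable borel"
  using cont by (rule borel_measurable_continuous_onI)
 have "integrable lebesgue (ext0 V f)"
  using ai by (simp add: set_integrable_def)
 then have li: "integrable lborel (ext0 V f)"
  using meas by (simp add: integrable_completion)
 then show si: "set_integrable lborel V f" unfolding set_integrable_def ind .
 have "(LINT z:V|lborel. f z) = integral\<^sup>L lborel (ext0 V f)"
  unfolding set_lebesgue_integral_def ind ..
 also have "... = integral UNIV (ext0 V f)"
  using li by (rule integral_lborel[symmetric])
 also have "... = integral V f"
  using eq' integral_restrict_UNIV[of V f] by simp
 finally show "(LINT z:V|lborel. f z) = integral V f" .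
qed

subsection \<open>Change of variables\<close>

text \<open>The change of variables theorem of the library needs a well-ordered index type.\<close>
typedef 'a wo = "UNIV :: 'a set" by simp

instance wo :: (finite) finite
proof
 have "(UNIV :: 'a wo set) = range Abs_wo" by (metis UNIV_eq_I Rep_wo_inverse rangeI)
 then show "finite (UNIV :: 'a wo set)" by (metis finite_imageI finite)
qed

definition wo_rank :: "'a::finite wo => nat" where
 "wo_rank = (SOME f. inj f)"

lemma inj_wo_rank: "inj (wo_rank :: 'a::finite wo => nat)"
proof -
 have "\<exists>f :: 'a wo => nat. inj f"
  using finite_imp_inj_to_nat_seg[OF finite, of "UNIV :: 'a wo set"] by auto
 then show ?thesis unfolding wo_rank_def by (rule someI_ex)
qed

instantiation wo :: (finite) wellorder
begin

definition "x <= y \<longleftrightarrow> wo_rank x <= wo_rank y"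
definition "x < y \<longleftrightarrow> wo_rank x < wo_rank y"

instance
proof
 fix x y :: "'a wo"
 show "x <= y ==> y <= x ==> x = y"
  unfolding less_eq_wo_def using inj_wo_rank by (metis injD order_antisym)
next
 fix P and a :: "'a wo"
 assume *: "!!x :: 'a wo. (!!y. y < x ==> P y) ==> P x"
 show "P a" by (induction a rule: measure_induct_rule[of wo_rank]) (rule *, simp add: less_wo_def)
qed (auto simp: less_eq_wo_def less_wo_def)

end

definition to_wo :: "real^'n::finite => real^'n wo" where
 "to_wo x = (\<chi> i. x $ Rep_wo i)"

definition of_wo :: "real^'n::finite wo => real^'n" where
 "of_wo y = (\<chi> i. y $ Abs_wo i)"

lemma of_wo_to_wo [simp]: "of_wo (to_wo x) = x" by (simp add: of_wo_def to_wo_def vec_eq_iff Abs_wo_inverse)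

lemma to_wo_of_wo [simp]: "to_wo (of_wo y) = y" by (simp add: of_wo_def to_wo_def vec_eq_iff Rep_wo_inverse)

lemma bij_Rep_wo: "bij Rep_wo" by (metis Abs_wo_inverse Rep_wo_inverse UNIV_I bijI')

lemma linear_to_wo: "linear to_wo" and linear_of_wo: "linear of_wo" by (auto intro!: linearI simp: to_wo_def of_wo_def vec_eq_iff)

lemma bounded_linear_to_wo: "bounded_linear to_wo" and bounded_linear_of_wo: "bounded_linear of_wo"
 using linear_to_wo linear_of_wo linear_linear by blast+

lemma to_wo_cbox: "to_wo ` cbox u v = cbox (to_wo u) (to_wo v)"
proof (intro set_eqI iffI)
 fix y assume "y \<in> cbox (to_wo u) (to_wo v)"
 then have "y $ i >= u $ Rep_wo i" "y $ i <= v $ Rep_wo i" for i by (simp_all add: mem_box_cart to_wo_def)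
 from this[of "Abs_wo _"] have "of_wo y \<in> cbox u v" by (simp add: mem_box_cart of_wo_def Abs_wo_inverse)
 then show "y \<in> to_wo ` cbox u v" by (metis imageI to_wo_of_wo)
qed (auto simp: mem_box_cart to_wo_def)

lemma of_wo_cbox: "of_wo ` cbox u v = cbox (of_wo u) (of_wo v)"
proof -
 have "of_wo ` cbox u v = of_wo ` (to_wo ` cbox (of_wo u) (of_wo v))" by (simp add: to_wo_cbox)
 then show ?thesis by (simp only: image_image of_wo_to_wo image_ident)
qed

lemma content_of_wo: "measure lborel (of_wo ` cbox u v) = measure lborel (cbox u v)"
proof -
 have "(\<Prod>i\<in>UNIV. v $ Abs_wo i - u $ Abs_wo i) = (\<Prod>i\<in>UNIV. v $ i - u $ i)"
  by (rule prod.reindex_bij_betw) (metis Abs_wo_inverse Rep_wo_inverse UNIV_I bijI')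
 moreover have "cbox (of_wo u) (of_wo v) = {} \<longleftrightarrow> cbox u v = {}" by (metis image_is_empty of_wo_cbox)
 ultimately show ?thesis
  unfolding of_wo_cbox content_cbox_if_cart by (simp add: of_wo_def)
qed

lemma integral_of_wo:
 fixes F :: "real^'n::finite => real"
 assumes "continuous_on UNIV F"
 shows "integral (cbox a b) F = integral (cbox (to_wo a) (to_wo b)) (\<lambda>y. F (of_wo y))"
proof -
 have "(F has_integral integral (cbox a b) F) (cbox a b)"
  by (intro integrable_integral integrable_continuous continuous_on_subset[OF assms]) simp
 from has_integral_twiddle[of 1 to_wo of_wo, OF _ _ _ _ _ _ _ this]
 have "((\<lambda>x. F (of_wo x)) has_integral integral (cbox a b) F) (to_wo ` cbox a b)"
  by (simp add: linear_continuous_at bounded_linear_of_wo to_wo_cbox of_wo_cbox[unfolded of_wo_cbox]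
    content_of_wo) (metis of_wo_cbox to_wo_cbox)
 then show ?thesis unfolding to_wo_cbox by (simp add: integral_unique)
qed

text \<open>The two permutations live on different types, so invariance of the sign under
  relabelling is proved by induction over transpositions.\<close>

lemma sign_wo:
 fixes p :: "'n::finite => 'n"
 assumes "p permutes UNIV"
 shows "sign (Abs_wo \<circ> p \<circ> Rep_wo) = sign p \<and> (Abs_wo \<circ> p \<circ> Rep_wo) permutes UNIV"
 using assms finite
proof (induction p rule: permutes_induct)
 case id
 have "Abs_wo \<circ> id \<circ> Rep_wo = (id :: 'n wo => 'n wo)" by (auto simp: Rep_wo_inverse)
 then show ?case by (metis permutes_id sign_id)
next
 case (swap a b p)
 let ?q = "Abs_wo \<circ> p \<circ> Rep_wo"
 have inj: "Abs_wo x = Abs_wo y \<longleftrightarrow> x = y" for x y :: 'n by (metis Abs_wo_inverse UNIV_I)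
 have eq: "Abs_wo \<circ> (Transposition.transpose a b \<circ> p) \<circ> Rep_wo = Transposition.transpose (Abs_wo a) (Abs_wo b) \<circ> ?q"
  by (auto simp: fun_eq_iff Transposition.transpose_def inj)
 have q: "?q permutes UNIV" "sign ?q = sign p" using swap by (simp_all only: simp_thms)
 have "permutation ?q" "permutation p"
  unfolding permutation_permutes using q(1) swap(4,5) finite by blast+
 then have "sign (Transposition.transpose (Abs_wo a) (Abs_wo b) \<circ> ?q) = sign (Transposition.transpose a b \<circ> p)"
  using q(2) by (simp add: sign_compose permutation_swap_id sign_swap_id inj)
 moreover have "Transposition.transpose (Abs_wo a) (Abs_wo b) \<circ> ?q permutes UNIV"
  using q(1) by (intro permutes_compose permutes_swap_id) auto
 ultimately show ?case unfolding eq by (rule conjI)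
qed

lemma sign_wo':
 fixes q :: "'n::finite wo => 'n wo"
 assumes "q permutes UNIV"
 shows "(Rep_wo \<circ> q \<circ> Abs_wo) permutes UNIV"
proof -
 have "bij q" "bij (Abs_wo :: 'n => _)" "bij (Rep_wo :: _ => 'n)"
  using assms permutes_bij bij_Rep_wo by (blast, metis Abs_wo_inverse Rep_wo_inverse UNIV_I bijI', blast)
 then show ?thesis by (intro bij_imp_permutes) (auto intro: bij_comp)
qed

lemma det_wo:
 fixes A :: "real^'n::finite^'n"
 shows "det (\<chi> i j. A $ Rep_wo i $ Rep_wo j) = det A"
proof -
 have "(\<Sum>q | q permutes UNIV. of_int (sign q) * (\<Prod>i\<in>UNIV. A $ Rep_wo i $ Rep_wo (q i))) =
  (\<Sum>p | p permutes UNIV. of_int (sign p) * (\<Prod>i\<in>UNIV. A $ i $ p i))"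
 proof (rule sum.reindex_bij_witness[where j="\<lambda>q. Rep_wo \<circ> q \<circ> Abs_wo" and i="\<lambda>p. Abs_wo \<circ> p \<circ> Rep_wo"])
  fix q :: "'n wo => 'n wo" assume "q \<in> {q. q permutes UNIV}"
  then have q: "q permutes UNIV" by simp
  show eq: "Abs_wo \<circ> (Rep_wo \<circ> q \<circ> Abs_wo) \<circ> Rep_wo = q" by (simp add: fun_eq_iff Rep_wo_inverse)
  show "Rep_wo \<circ> q \<circ> Abs_wo \<in> {p. p permutes UNIV}" using sign_wo'[OF q] by simp
  have "sign q = sign (Rep_wo \<circ> q \<circ> Abs_wo)"
   using sign_wo[OF sign_wo'[OF q]] unfolding eq by simp
  moreover have "(\<Prod>i\<in>UNIV. A $ Rep_wo i $ Rep_wo (q i)) = (\<Prod>i\<in>UNIV. A $ i $ (Rep_wo \<circ> q \<circ> Abs_wo) i)"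
   by (subst prod.reindex_bij_betw[OF bij_Rep_wo, symmetric]) (simp add: Rep_wo_inverse)
  ultimately show "of_int (sign (Rep_wo \<circ> q \<circ> Abs_wo)) * (\<Prod>i\<in>UNIV. A $ i $ (Rep_wo \<circ> q \<circ> Abs_wo) i) =
    of_int (sign q) * (\<Prod>i\<in>UNIV. A $ Rep_wo i $ Rep_wo (q i))" by simp
 next
  fix p :: "'n => 'n" assume "p \<in> {p. p permutes UNIV}"
  then show "Abs_wo \<circ> p \<circ> Rep_wo \<in> {q. q permutes UNIV}" using sign_wo[of p] by simp
  show "Rep_wo \<circ> (Abs_wo \<circ> p \<circ> Rep_wo) \<circ> Abs_wo = p" by (simp add: fun_eq_iff Abs_wo_inverse)
 qed
 then show ?thesis by (simp add: det_def)
qed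

lemma matrix_wo:
 fixes A :: "real^'n::finite^'n"
 shows "matrix (\<lambda>v. to_wo (A *v of_wo v)) = (\<chi> i j. A $ Rep_wo i $ Rep_wo j)"
proof -
 have "of_wo (axis j 1) = (axis (Rep_wo j) 1 :: real^'n)" for j
  by (auto simp: of_wo_def axis_def vec_eq_iff Rep_wo_inverse Abs_wo_inverse)
 then show ?thesis
  by (simp add: matrix_def to_wo_def vec_eq_iff matrix_vector_mult_def axis_def if_distrib[of "\<lambda>c. _ * c"] cong: if_cong)
qed

lemma integral_of_wo_open:
 fixes f :: "real^'n::finite => real"
 assumes V: "open V" and f: "continuous_on V f" "csupp V f"
 shows "(\<lambda>y. f (of_wo y)) absolutely_integrable_on to_wo ` V"
  and "integral (to_wo ` V) (\<lambda>y. f (of_wo y)) = integral V f"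
proof -
 obtain K where K: "compact K" "K \<subseteq> V" "!!z. z \<in> V - K ==> f z = 0"
  using f(2) by (auto simp: csupp_def)
 obtain a b where ab: "K \<subseteq> cbox a b" using compact_subset_cbox[OF K(1)] .
 have c: "continuous_on S of_wo" "continuous_on S' to_wo" for S S'
  by (intro linear_continuous_on bounded_linear_of_wo bounded_linear_to_wo)+
 have im: "to_wo ` S = of_wo -` S" for S by (auto, metis imageI to_wo_of_wo)
 then have V': "open (to_wo ` V)" using open_vimage[OF V c(1)] by (simp add: im)
 have f': "continuous_on (to_wo ` V) (\<lambda>y. f (of_wo y))" by (rule continuous_on_compose2[OF f(1) c(1)]) auto
 have K': "compact (to_wo ` K)" "to_wo ` K \<subseteq> to_wo ` V" "to_wo ` K \<subseteq> cbox (to_wo a) (to_wo b)"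
  using K(2) compact_continuous_image[OF c(2) K(1)] image_mono[OF ab, of to_wo]
  unfolding to_wo_cbox by auto
 have z: "f (of_wo y) = 0" if "y \<in> to_wo ` V - to_wo ` K" for y
  using that K(3) by (simp add: im)
 note 1 = csupp_integral[OF V f(1) ab K(3,1,2)]
 note 2 = csupp_integral[OF V' f' K'(3) z K'(1,2)]
 show "(\<lambda>y. f (of_wo y)) absolutely_integrable_on to_wo ` V" using 2(2) .
 have "ext0 (to_wo ` V) (\<lambda>y. f (of_wo y)) = (\<lambda>y. ext0 V f (of_wo y))" by (simp add: ext0_def fun_eq_iff im)
 with 1(5) 2(5) integral_of_wo[OF continuous_on_ext0[OF V f], of a b]
 show "integral (to_wo ` V) (\<lambda>y. f (of_wo y)) = integral V f" by simp
qed

text \<open>Differentiate the composition of the map with its inverse, which is the identity on an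
  open set.\<close>

lemma diffeomorphic_map_jac:
 fixes \<phi> :: "real^'n::finite => real^'n"
 assumes \<phi>: "diffeomorphic_map V W \<phi>" and x: "x \<in> V"
 shows "jac (inv_into V \<phi>) (\<phi> x) ** jac \<phi> x = mat 1" and "det (jac \<phi> x) ~= 0"
proof -
 let ?\<psi> = "inv_into V \<phi>"
 have o: "open V" "open W" and bij: "bij_betw \<phi> V W" and sm: "smooth_on V \<phi>" "smooth_on W ?\<psi>"
  using \<phi> by (auto simp: diffeomorphic_map_def)
 have fx: "\<phi> x \<in> W" using bij x by (auto simp: bij_betw_def)
 have "(\<phi> has_derivative (\<lambda>v. jac \<phi> x *v v)) (at x)"
  "(?\<psi> has_derivative (\<lambda>v. jac ?\<psi> (\<phi> x) *v v)) (at (\<phi> x))"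
  using has_derivative_jac smooth_on_D sm x fx by blast+
 then have "((\<lambda>x. ?\<psi> (\<phi> x)) has_derivative (\<lambda>v. jac ?\<psi> (\<phi> x) *v (jac \<phi> x *v v))) (at x)"
  by (rule has_derivative_compose)
 then have "((\<lambda>x. x) has_derivative (\<lambda>v. jac ?\<psi> (\<phi> x) *v (jac \<phi> x *v v))) (at x)"
  by (rule has_derivative_transform_within_open[OF _ o(1) x]) (use bij in "auto simp: bij_betw_def")
 then have "(\<lambda>v. jac ?\<psi> (\<phi> x) *v (jac \<phi> x *v v)) = (\<lambda>v. v)"
  using has_derivative_unique has_derivative_ident by blast
 then have "(jac ?\<psi> (\<phi> x) ** jac \<phi> x) *v v = mat 1 *v v" for v
  by (simp add: matrix_vector_mul_assoc[symmetric] fun_eq_iff)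
 then show "jac ?\<psi> (\<phi> x) ** jac \<phi> x = mat 1" using matrix_eq by blast
 then show "det (jac \<phi> x) ~= 0" by (metis det_I det_mul mult_zero_right zero_neq_one)
qed

text \<open>Everything is conjugated with \<open>to_wo\<close>, which changes neither integrals nor
  Jacobian determinants.\<close>

lemma integral_diffeomorphism:
 fixes \<phi> :: "real^'n::finite => real^'n" and f :: "real^'n => real"
 assumes \<phi>: "diffeomorphic_map V W \<phi>" and f: "continuous_on W f" "csupp W f"
 shows "integral W f = integral V (\<lambda>x. \<bar>det (jac \<phi> x)\<bar> * f (\<phi> x))"
proof -
 let ?\<psi> = "inv_into V \<phi>"
 have o: "open V" "open W" and bij: "bij_betw \<phi> V W" and sm: "smooth_on V \<phi>" "smooth_on W ?\<psi>"
  using \<phi> by (auto simp: diffeomorphic_map_def)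
 have VW: "!!x. x \<in> V ==> \<phi> x \<in> W" "!!y. y \<in> W ==> ?\<psi> y \<in> V"
  "!!x. x \<in> V ==> ?\<psi> (\<phi> x) = x" "!!y. y \<in> W ==> \<phi> (?\<psi> y) = y"
  using bij by (auto simp: bij_betw_def inv_into_into f_inv_into_f)
 define g where "g = (\<lambda>y. to_wo (\<phi> (of_wo y)))"
 define h where "h = (\<lambda>y. to_wo (?\<psi> (of_wo y)))"
 define g' where "g' = (\<lambda>y v. to_wo (jac \<phi> (of_wo y) *v of_wo v))"
 define h' where "h' = (\<lambda>y v. to_wo (jac ?\<psi> (of_wo y) *v of_wo v))"
 have der: "((\<lambda>y. to_wo (F (of_wo y))) has_derivative (\<lambda>v. to_wo (jac F (of_wo y) *v of_wo v))) (at y within S)"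
  if "F differentiable (at (of_wo y))" for F :: "real^'n => real^'n" and y S
 proof -
  have "(of_wo has_derivative of_wo) (at y)" by (rule bounded_linear_imp_has_derivative[OF bounded_linear_of_wo])
  from has_derivative_compose[OF this has_derivative_jac[OF that]]
  have "((\<lambda>y. F (of_wo y)) has_derivative (\<lambda>v. jac F (of_wo y) *v of_wo v)) (at y)" .
  from bounded_linear.has_derivative[OF bounded_linear_to_wo this] show ?thesis by (rule has_derivative_at_withinI)
 qed
 \<comment> \<open>The change of variables is an equivalence of two integrability statements with
   prescribed value; the right-hand one is known from \<open>integral_of_wo_open\<close>.\<close>
 have "(\<lambda>x. \<bar>det (matrix (g' x))\<bar> * f (of_wo (g x))) absolutely_integrable_on (to_wo ` V) \<and>
      integral (to_wo ` V) (\<lambda>x. \<bar>det (matrix (g' x))\<bar> * f (of_wo (g x))) = integral W f \<longleftrightarrow>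
     (\<lambda>y. f (of_wo y)) absolutely_integrable_on (to_wo ` W) \<and> integral (to_wo ` W) (\<lambda>y. f (of_wo y)) = integral W f"
 proof (rule cov_invertible_real)
  show "(g has_derivative g' x) (at x within to_wo ` V)" if "x \<in> to_wo ` V" for x
   unfolding g_def g'_def using that sm smooth_on_D by (intro der) auto
  show "(h has_derivative h' y) (at y within to_wo ` W)" if "y \<in> to_wo ` W" for y
   unfolding h_def h'_def using that sm smooth_on_D by (intro der) auto
  show "g x \<in> to_wo ` W \<and> h (g x) = x" if "x \<in> to_wo ` V" for x
   using that VW by (auto simp: g_def h_def)
  show "h y \<in> to_wo ` V \<and> g (h y) = y" if "y \<in> to_wo ` W" for y
   using that VW by (auto simp: g_def h_def)
  show "h' y \<circ> g' (h y) = id" if y: "y \<in> to_wo ` W" for y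
  proof -
   obtain w where w: "y = to_wo w" "w \<in> W" using y by auto
   have "jac ?\<psi> w ** jac \<phi> (?\<psi> w) = mat 1"
    using diffeomorphic_map_jac(1)[OF \<phi> VW(2)[OF w(2)]] VW(4)[OF w(2)] by simp
   then show ?thesis by (auto simp: h'_def g'_def h_def w(1) fun_eq_iff matrix_vector_mul_assoc)
  qed
 qed
 then have *: "integral (to_wo ` V) (\<lambda>x. \<bar>det (matrix (g' x))\<bar> * f (of_wo (g x))) = integral W f"
  using integral_of_wo_open[OF o(2) f] by simp
 obtain K where K: "compact K" "K \<subseteq> W" "!!z. z \<in> W - K ==> f z = 0"
  using f(2) by (auto simp: csupp_def)
 have "compact (?\<psi> ` K)"
  using K smooth_on_cont[OF sm(2)] by (meson compact_continuous_image continuous_on_subset)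
 then have cs: "csupp V (\<lambda>x. \<bar>det (jac \<phi> x)\<bar> * f (\<phi> x))"
  unfolding csupp_def by (rule_tac exI[of _ "?\<psi> ` K"]) (use K VW in "force simp: image_iff")
 have "continuous_on V (\<lambda>x. \<bar>det (jac \<phi> x)\<bar> * f (\<phi> x))"
  by (intro continuous_on_mult continuous_on_rabs continuous_on_compose2[OF f(1)] smooth_on_cont
    smooth_on_det smooth_on_jac o sm) (use VW in auto)
 from integral_of_wo_open(2)[OF o(1) this cs] * show ?thesis by (simp add: g_def g'_def matrix_wo det_wo)
qed

subsection \<open>Differentiation under the integral and integration by parts\<close>

text \<open>The set \<open>K\<close> supports the integrand for every small \<open>e\<close>, so all
  integrals can be taken over one box and Leibniz' rule applies.\<close>

lemma csupp_integral_derivative: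
 fixes f :: "real => real^'i::finite => real"
 assumes V: "open V" and K: "compact K" "K \<subseteq> V" and "0 < \<delta>"
  and z: "!!e z. \<bar>e\<bar> < \<delta> ==> z \<in> V - K ==> f e z = 0"
  and c: "!!e. \<bar>e\<bar> < \<delta> ==> continuous_on V (f e)"
  and d: "!!e z. \<bar>e\<bar> < \<delta> ==> z \<in> K ==> ((\<lambda>e. f e z) has_real_derivative f' e z) (at e)"
  and c': "continuous_on ({-\<delta><..<\<delta>} \<times> V) (\<lambda>(e, z). f' e z)"
  and z': "!!e z. \<bar>e\<bar> < \<delta> ==> z \<in> V - K ==> f' e z = 0"
 shows "((\<lambda>e. integral V (f e)) has_real_derivative integral V (f' 0)) (at 0)"
proof -
 obtain a b where ab: "K \<subseteq> cbox a b" using compact_subset_cbox[OF K(1)] .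
 let ?U = "{-\<delta><..<\<delta>}"
 have closedK: "closed K" using K(1) by (rule compact_imp_closed)
 have e1: "integral V (f e) = integral (cbox a b) (ext0 V (f e))" if "e \<in> ?U" for e
  using that by (intro csupp_integral(5)[OF V c ab _ K] z) auto
 have c'': "continuous_on V (f' e)" if "e \<in> ?U" for e
 proof -
  have "continuous_on V (\<lambda>z. case (e, z) of (e, z) => f' e z)"
   by (rule continuous_on_compose2[OF c']) (use that in "auto intro: continuous_on_Pair continuous_on_const continuous_on_id")
  then show ?thesis by simp
 qed
 have e2: "integral V (f' e) = integral (cbox a b) (ext0 V (f' e))" if "e \<in> ?U" for e
  using that by (intro csupp_integral(5)[OF V c'' ab _ K] z') auto
 have "((\<lambda>e. integral (cbox a b) (ext0 V (f e))) has_real_derivative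
   integral (cbox a b) (ext0 V (f' 0))) (at 0 within ?U)"
 proof (rule leibniz_rule_field_derivative)
  fix e z assume e: "e \<in> ?U"
  have "((\<lambda>e. ext0 V (f e) z) has_real_derivative ext0 V (f' e) z) (at e)"
  proof (cases "z \<in> K")
   case True
   then show ?thesis using d[of e z] e K by (auto simp: ext0_def)
  next
   case False
   have eq0: "ext0 V (f e) z = 0" "ext0 V (f' e) z = 0" if "e \<in> ?U" for e
    using False that z[of e z] z'[of e z] by (auto simp: ext0_def abs_less_iff)
   have "((\<lambda>e. 0) has_real_derivative 0) (at e)" by simp
   then have "((\<lambda>e. ext0 V (f e) z) has_real_derivative 0) (at e)"
    by (rule has_field_derivative_transform_within_open[of _ _ _ ?U]) (use e eq0 in auto)
   then show ?thesis by (simp add: eq0[OF e])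
  qed
  then show "((\<lambda>e. ext0 V (f e) z) has_real_derivative ext0 V (f' e) z) (at e within ?U)" by (rule DERIV_subset) simp
 next
  fix e assume "e \<in> ?U"
  then have "continuous_on UNIV (ext0 V (f e))" by (intro continuous_on_ext0[OF V c]) (use z K in "auto simp: csupp_def")
  then show "ext0 V (f e) integrable_on cbox a b" by (intro integrable_continuous) (rule continuous_on_subset, auto)
 next
  have o1: "open (?U \<times> V)" "open (?U \<times> (- K))"
   using V closedK by (auto intro!: open_Times)
  \<comment> \<open>The box may leave \<open>V\<close>; it is covered by the open sets
    \<open>V\<close> and \<open>- K\<close>, and on the second the extended derivative
    vanishes.\<close>
  have "continuous_on (?U \<times> V \<union> ?U \<times> (- K)) (\<lambda>(e, z). ext0 V (f' e) z)"
  proof (rule continuous_on_open_Un[OF o1])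
   show "continuous_on (?U \<times> V) (\<lambda>(e, z). ext0 V (f' e) z)" by (rule continuous_on_eq[OF c']) (auto simp: ext0_def)
   show "continuous_on (?U \<times> (- K)) (\<lambda>(e, z). ext0 V (f' e) z)"
    by (rule continuous_on_eq[OF continuous_on_const[of _ 0]]) (use z' in "auto simp: ext0_def")
  qed
  then show "continuous_on (?U \<times> cbox a b) (\<lambda>(e, z). ext0 V (f' e) z)"
   by (rule continuous_on_subset) (use K in auto)
 qed (use \<open>0 < \<delta>\<close> in auto)
 moreover have "at 0 within ?U = at 0"
  using \<open>0 < \<delta>\<close> by (intro at_within_open) auto
 moreover have "integral (cbox a b) (ext0 V (f' 0)) = integral V (f' 0)"
  using e2[of 0] \<open>0 < \<delta>\<close> by simp
 ultimately have "((\<lambda>e. integral (cbox a b) (ext0 V (f e))) has_real_derivative integral V (f' 0)) (at 0)" by (simp only:)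
 then show ?thesis by (rule has_field_derivative_transform_within_open[of _ _ _ ?U]) (use e1 \<open>0 < \<delta>\<close> in auto)
qed

lemma
 fixes f :: "real^'i::finite => real"
 assumes V: "open V" and f: "continuous_on V f" "csupp V f"
 shows csupp_integrable: "f integrable_on V"
  and csupp_set_integrable: "set_integrable lborel V f"
  and csupp_lborel_integral: "(LINT z:V|lborel. f z) = integral V f"
proof -
 obtain K where K: "compact K" "K \<subseteq> V" "!!z. z \<in> V - K ==> f z = 0"
  using f(2) by (auto simp: csupp_def)
 obtain a b where ab: "K \<subseteq> cbox a b" using compact_subset_cbox[OF K(1)] .
 note * = csupp_integral[OF V f(1) ab K(3,1,2)]
 show "f integrable_on V" using *(1) by blast
 show "set_integrable lborel V f" "(LINT z:V|lborel. f z) = integral V f" using *(3,4) by blast+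
qed

lemma integral_translation:
 fixes f :: "real^'i::finite => real"
 assumes f: "continuous_on UNIV f" "csupp UNIV f"
 shows "integral UNIV (\<lambda>z. f (z + c)) = integral UNIV f"
proof -
 obtain K where K: "compact K" "!!z. z \<in> UNIV - K ==> f z = 0"
  using f(2) by (auto simp: csupp_def)
 obtain a b where ab: "K \<subseteq> cbox a b" using compact_subset_cbox[OF K(1)] .
 have e: "ext0 UNIV g = g" for g :: "real^'i => real" by (auto simp: ext0_def)
 have 1: "(f has_integral integral UNIV f) (cbox a b)"
  using csupp_integral(5)[OF open_UNIV f(1) ab K(2,1)] continuous_on_subset[OF f(1)]
  by (simp add: e integrable_integral integrable_continuous)
 have g: "continuous_on UNIV (\<lambda>z. f (z + c))" by (rule continuous_on_compose2[OF f(1)]) (auto intro!: continuous_on_add)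
 have K': "compact ((\<lambda>z. z - c) ` K)"
  using K(1) compact_translation[of K "-c"] by simp
 have sub: "(\<lambda>z. z - c) ` K \<subseteq> cbox (a - c) (b - c)"
  using ab by (auto simp: mem_box_cart)
 have z: "f (z + c) = 0" if "z \<in> UNIV - (\<lambda>z. z - c) ` K" for z
 proof -
  have "z + c \<notin> K" using that by (metis DiffD2 add_diff_cancel_right' imageI)
  then show ?thesis using K(2) by simp
 qed
 have "integral UNIV (\<lambda>z. f (z + c)) = integral (cbox (a - c) (b - c)) (\<lambda>z. f (z + c))"
  using csupp_integral(5)[OF open_UNIV g sub z K'] by (simp add: e)
 moreover have "((f \<circ> (+) c) has_integral integral UNIV f) (cbox (a - c) (b - c))"
  using 1 by (simp add: has_integral_shift_cbox_iff)
 ultimately show ?thesis by (simp add: integral_unique o_def add.commute)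
qed

text \<open>The integral of a translate of \<open>f\<close> along axis \<open>i\<close> does not
  depend on the shift; differentiating under the integral at shift 0 gives the claim without
  iterated integrals.\<close>

lemma integral_pd_eq_0:
 fixes f :: "real^'i::finite => real"
 assumes V: "open V" and f: "smooth_on V f" "csupp V f"
 shows "integral V (pd i f) = 0"
proof -
 define F where "F = ext0 V f"
 have F: "smooth_on UNIV F" unfolding F_def by (rule smooth_on_ext0[OF V f])
 obtain K where K: "compact K" "K \<subseteq> V" "!!z. z \<in> V - K ==> f z = 0"
  using f(2) by (auto simp: csupp_def)
 have F0: "F z = 0" if "z \<notin> K" for z using K that by (auto simp: F_def ext0_def)
 then have csF: "csupp UNIV F" using K(1) by (auto simp: csupp_def)
 have pF0: "pd i F z = 0" if "z \<notin> K" for z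
 proof -
  have "open (- K)" using K(1) by (simp add: compact_imp_closed open_Compl)
  then have "pd i F z = pd i (\<lambda>_. 0) z" by (rule pd_cong_open) (use that F0 in auto)
  then show ?thesis by simp
 qed
 \<comment> \<open>All translates of \<open>K\<close> by at most 1, a common support for the whole
   family.\<close>
 define K' where "K' = (\<lambda>(s, z). z - s *\<^sub>R axis i 1) ` ({-1..1} \<times> K)"
 have "compact K'"
  unfolding K'_def by (rule compact_continuous_image)
   (auto intro!: compact_Times K continuous_intros simp: case_prod_unfold)
 have out: "z + s *\<^sub>R axis i 1 \<notin> K" if "\<bar>s\<bar> < 1" "z \<notin> K'" for s z
 proof
  assume "z + s *\<^sub>R axis i 1 \<in> K"
  then have "(\<lambda>(s, z). z - s *\<^sub>R axis i 1) (s, z + s *\<^sub>R axis i 1) \<in> K'"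
   unfolding K'_def using that(1) by (intro imageI) auto
  then show False using that by simp
 qed
 have cont: "continuous_on UNIV F" "continuous_on UNIV (pd i F)"
  using F smooth_on_pd smooth_on_cont by blast+
 have "((\<lambda>s. integral UNIV (\<lambda>z. F (z + s *\<^sub>R axis i 1))) has_real_derivative
   integral UNIV (\<lambda>z. pd i F (z + 0 *\<^sub>R axis i 1))) (at 0)"
 proof (rule csupp_integral_derivative[OF open_UNIV \<open>compact K'\<close>, of 1])
  fix s z assume "\<bar>s\<bar> < (1::real)" "z \<in> UNIV - K'"
  then show "F (z + s *\<^sub>R axis i 1) = 0" "pd i F (z + s *\<^sub>R axis i 1) = 0"
   using out F0 pF0 by auto
 next
  fix s :: real
  show "continuous_on UNIV (\<lambda>z. F (z + s *\<^sub>R axis i 1))"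
   by (rule continuous_on_compose2[OF cont(1)]) (auto intro!: continuous_on_add)
  fix z
  show "((\<lambda>s. F (z + s *\<^sub>R axis i 1)) has_real_derivative pd i F (z + s *\<^sub>R axis i 1)) (at s)"
   unfolding has_real_derivative_iff_has_vector_derivative by (rule has_vector_derivative_line) (use F smooth_on_D in blast)
 next
  show "continuous_on ({- 1<..<1} \<times> UNIV) (\<lambda>(s, z). pd i F (z + s *\<^sub>R axis i 1))"
   unfolding case_prod_unfold by (rule continuous_on_compose2[OF cont(2)]) (auto intro!: continuous_intros)
 qed auto
 moreover have "integral UNIV (\<lambda>z. F (z + s *\<^sub>R axis i 1)) = integral UNIV F" for s
  by (rule integral_translation[OF cont(1) csF])
 ultimately have "((\<lambda>s. integral UNIV F) has_real_derivative integral UNIV (pd i F)) (at 0)" by simp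
 then have "integral UNIV (pd i F) = 0"
  using DERIV_const DERIV_unique by blast
 moreover have "pd i F = ext0 V (pd i f)"
 proof
  fix z show "pd i F z = ext0 V (pd i f) z"
  proof (cases "z \<in> V")
   case True
   then show ?thesis using pd_cong_open[OF V, of z F f i] by (simp add: F_def ext0_def)
  next
   case False
   then show ?thesis using pF0 K by (auto simp: ext0_def)
  qed
 qed
 ultimately show ?thesis
  using integral_restrict_UNIV[of V "pd i f"] by (simp add: ext0_def[abs_def])
qed

lemma csupp_mult_right: "csupp V f ==> csupp V (\<lambda>z. f z * g z :: 'b::mult_zero)" by (fastforce simp: csupp_def)

lemma integral_by_parts:
 fixes f g :: "real^'i::finite => real"
 assumes V: "open V" and f: "smooth_on V f" and g: "smooth_on V g" "csupp V g"
 shows "integral V (\<lambda>z. f z * pd i g z) = - integral V (\<lambda>z. pd i f z * g z)"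
proof -
 have "integral V (pd i (\<lambda>z. f z * g z)) = 0"
  by (rule integral_pd_eq_0[OF V smooth_on_mult[OF V f g(1)] csupp_mult_left[OF g(2)]])
 also have "integral V (pd i (\<lambda>z. f z * g z)) = integral V (\<lambda>z. f z * pd i g z + pd i f z * g z)"
  by (rule integral_cong) (simp add: pd_mult smooth_on_D[OF f] smooth_on_D[OF g(1)])
 also have "... = integral V (\<lambda>z. f z * pd i g z) + integral V (\<lambda>z. pd i f z * g z)"
 proof (rule integral_add)
  show "(\<lambda>z. f z * pd i g z) integrable_on V"
   by (rule csupp_integrable[OF V smooth_on_cont[OF smooth_on_mult[OF V f smooth_on_pd[OF g(1)]]]])
    (rule csupp_mult_left[OF csupp_pd[OF V g(2)]])
  show "(\<lambda>z. pd i f z * g z) integrable_on V"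
   by (rule csupp_integrable[OF V smooth_on_cont[OF smooth_on_mult[OF V smooth_on_pd[OF f] g(1)]]])
    (rule csupp_mult_left[OF g(2)])
 qed
 finally show ?thesis by simp
qed

subsection \<open>The fundamental lemma of the calculus of variations\<close>

text \<open>With u = 1/t one has du/dt = - u^2, so differentiating p(u) exp(-u) in t multiplies by
  u^2 and replaces p by p - p'.\<close>

fun bump_poly :: "nat => real poly" where
 "bump_poly 0 = 1"
| "bump_poly (Suc n) = [:0, 0, 1:] * (bump_poly n - pderiv (bump_poly n))"

text \<open>The derivatives of \<open>exp (-1/t)\<close>, extended by zero to \<open>t <= 0\<close>.\<close>
definition bump1 :: "nat => real => real" where
 "bump1 n t = (if t > 0 then poly (bump_poly n) (inverse t) * exp (- inverse t) else 0)"

text \<open>The extra power is what the induction over coefficients needs: peeling one off the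
  polynomial raises \<open>k\<close> by one.\<close>

lemma poly_exp_tendsto_0: "((\<lambda>u. u ^ k * poly p u * exp (- u)) \<longlongrightarrow> (0::real)) at_top"
proof (induction p arbitrary: k)
 case (pCons a p)
 have "((\<lambda>u. a * (u ^ k / exp u) + u ^ Suc k * poly p u * exp (- u)) \<longlongrightarrow> a * 0 + 0) at_top"
  by (intro tendsto_intros tendsto_power_div_exp_0 pCons)
 then show ?case by (simp add: algebra_simps exp_minus divide_inverse)
qed simp

lemma bump1_deriv: "(bump1 n has_real_derivative bump1 (Suc n) t) (at t)"
proof -
 consider "t > 0" | "t < 0" | "t = 0" by linarith
 then show ?thesis
 proof cases
  case 1
  have "((\<lambda>t. poly (bump_poly n) (inverse t) * exp (- inverse t)) has_real_derivative
   poly (bump_poly n) (inverse t) * (exp (- inverse t) * (inverse t)\<^sup>2) +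
   poly (pderiv (bump_poly n)) (inverse t) * (- (inverse t)\<^sup>2) * exp (- inverse t)) (at t)"
   using 1 by (auto intro!: derivative_eq_intros simp: power2_eq_square)
  also have "poly (bump_poly n) (inverse t) * (exp (- inverse t) * (inverse t)\<^sup>2) +
   poly (pderiv (bump_poly n)) (inverse t) * (- (inverse t)\<^sup>2) * exp (- inverse t) = bump1 (Suc n) t"
   using 1 by (simp add: bump1_def algebra_simps power2_eq_square)
  finally show ?thesis by (rule has_field_derivative_transform_within_open[of _ _ _ "{0<..}"]) (use 1 in "auto simp: bump1_def")
 next
  case 2
  have "((\<lambda>t. 0) has_real_derivative bump1 (Suc n) t) (at t)"
   using 2 by (simp add: bump1_def)
  then show ?thesis by (rule has_field_derivative_transform_within_open[of _ _ _ "{..<0}"]) (use 2 in "auto simp: bump1_def")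
 next
  case 3
  have "((\<lambda>h. (bump1 n h - bump1 n 0) / h) \<longlongrightarrow> 0) (at 0)"
  proof (rule filterlim_split_at)
   have "\<forall>\<^sub>F h in at_left 0. h < (0::real)" by (simp add: eventually_at_filter)
   then have "\<forall>\<^sub>F h in at_left (0::real). (bump1 n h - bump1 n 0) / h = 0" by eventually_elim (simp add: bump1_def)
   then show "((\<lambda>h. (bump1 n h - bump1 n 0) / h) \<longlongrightarrow> 0) (at_left 0)" by (rule tendsto_eventually)
   \<comment> \<open>The difference quotient at 0 contributes exactly one factor 1/h.\<close>
   have "((\<lambda>h. inverse h ^ 1 * poly (bump_poly n) (inverse h) * exp (- inverse h)) \<longlongrightarrow> 0) (at_right (0::real))"
    by (rule filterlim_compose[OF poly_exp_tendsto_0 filterlim_inverse_at_top_right])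
   moreover have "\<forall>\<^sub>F h in at_right 0. h > (0::real)" by (simp add: eventually_at_filter)
   then have "\<forall>\<^sub>F h in at_right (0::real). inverse h ^ 1 * poly (bump_poly n) (inverse h) * exp (- inverse h) = (bump1 n h - bump1 n 0) / h"
    by eventually_elim (simp add: bump1_def divide_inverse)
   ultimately show "((\<lambda>h. (bump1 n h - bump1 n 0) / h) \<longlongrightarrow> 0) (at_right 0)"
    by (rule Lim_transform_eventually)
  qed
  then show ?thesis
   using 3 by (simp add: DERIV_def bump1_def[of "Suc n"])
 qed
qed

definition bump :: "real^'i::finite => real => real^'i => real" where
 "bump p r z = bump1 0 (r\<^sup>2 - (\<Sigma> i. (z $ i - p $ i)\<^sup>2))"

lemma smooth_on_bump: "smooth_on UNIV (bump p r)"
 unfolding bump_def by (rule smooth_on_compose_real[where T=UNIV])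
  (auto intro!: bump1_deriv smooth_on_diff smooth_on_sum smooth_on_power smooth_on_coord)

lemma bump_nonneg: "bump p r z >= 0" by (simp add: bump_def bump1_def)

lemma bump_pos_iff:
 assumes "r > 0"
 shows "bump p r z ~= 0 \<longleftrightarrow> z \<in> ball p r"
proof -
 have "(\<Sigma> i. (z $ i - p $ i)\<^sup>2) = (dist z p)\<^sup>2" by (simp add: dist_vec_def L2_set_def sum_nonneg dist_real_def)
 moreover have "(dist z p)\<^sup>2 < r\<^sup>2 \<longleftrightarrow> dist z p < r"
  using assms by (metis power2_less_imp_less zero_le_dist less_imp_le power_strict_mono pos2)
 ultimately show ?thesis by (simp add: bump_def bump1_def dist_commute)
qed

text \<open>Near \<open>p\<close> the function keeps the sign of \<open>f p\<close>, so testing with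
  a bump in a small ball would give a nonzero integral. The test functions are those of
  \<open>metric_variation\<close>: smooth on the whole space, with closed support compact and inside
  \<open>V\<close>.\<close>

lemma fundamental_lemma:
 fixes f :: "real^'i::finite => real"
 assumes V: "open V" and f: "continuous_on V f"
  and test: "!!k. smooth_on UNIV k ==> compact (closure {z. k z ~= 0}) ==> closure {z. k z ~= 0} \<subseteq> V ==>
   integral V (\<lambda>z. f z * k z) = 0"
  and p: "p \<in> V"
 shows "f p = 0"
proof (rule ccontr)
 assume fp: "f p ~= 0"
 have "isCont f p" using f V p continuous_on_eq_continuous_at by blast
 then have "\<exists>d>0. \<forall>y. dist y p < d --> dist (f y) (f p) < \<bar>f p\<bar>"
  using fp by (simp add: continuous_at_eps_delta)
 then obtain d where d: "0 < d" "!!y. dist y p < d ==> \<bar>f y - f p\<bar> < \<bar>f p\<bar>" by (auto simp: dist_real_def)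
 obtain e where e: "0 < e" "cball p e \<subseteq> V" using V p open_contains_cball by blast
 define r where "r = min (d / 2) e"
 have r: "0 < r" "r < d" "cball p r \<subseteq> V" using d e by (auto simp: r_def)
 have sub: "{z. bump p r z ~= 0} \<subseteq> cball p r" using bump_pos_iff[OF r(1), of p] by auto
 then have cl: "closure {z. bump p r z ~= 0} \<subseteq> cball p r" by (simp add: closure_minimal)
 then have "compact (closure {z. bump p r z ~= 0})"
  by (meson bounded_cball bounded_subset compact_closure closure_subset order_trans sub)
 then have int0: "integral V (\<lambda>z. f z * bump p r z) = 0"
  using smooth_on_bump cl r(3) by (intro test) auto
 obtain a b where ab: "cball p r \<subseteq> cbox a b" by (rule compact_subset_cbox[OF compact_cball])
 \<comment> \<open>The sign factor makes the integrand nonnegative; a continuous nonnegative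
   function with integral 0 over a box vanishes there.\<close>
 let ?g = "\<lambda>z. sgn (f p) * (f z * bump p r z)"
 have cont: "continuous_on V ?g"
  using smooth_on_cont[OF smooth_on_bump, of p r] f
  by (intro continuous_on_mult continuous_on_const) (auto intro: continuous_on_subset)
 have 0: "?g z = 0" if "z \<in> V - cball p r" for z
  using that sub by auto
 have "integral V ?g = integral (cbox a b) (ext0 V ?g)" by (rule csupp_integral(5)[OF V cont ab _ compact_cball r(3)]) (rule 0)
 moreover have "integral V ?g = 0" using int0 by simp
 ultimately have int: "integral (cbox a b) (ext0 V ?g) = 0" by (rule trans[OF sym])
 have nn: "ext0 V ?g z >= 0" for z
 proof (cases "z \<in> ball p r")
  case True
  then have "\<bar>f z - f p\<bar> < \<bar>f p\<bar>" using d(2)[of z] r(2) by (simp add: dist_commute)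
  then have "sgn (f p) * f z >= 0" by (auto simp: sgn_if abs_if split: if_splits)
  then show ?thesis using bump_nonneg[of p r z] by (simp add: ext0_def mult.assoc[symmetric])
 next
  case False
  then show ?thesis using bump_pos_iff[OF r(1), of p z] by (simp add: ext0_def)
 qed
 have "csupp V ?g" unfolding csupp_def using compact_cball r(3) 0 by blast
 then have c: "continuous_on UNIV (ext0 V ?g)" by (rule continuous_on_ext0[OF V cont])
 have pin: "p \<in> cbox a b" using ab r(1) by auto
 have "box a b ~= {}"
 proof -
  have "interior (cball p r) \<subseteq> interior (cbox a b)" by (rule interior_mono[OF ab])
  then show ?thesis using r(1) by (auto simp: interior_cbox)
 qed
 moreover have "(ext0 V ?g has_integral 0) (cbox a b)"
  using int integrable_integral[OF integrable_continuous[OF continuous_on_subset[OF c]]] by (metis subset_UNIV)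
 ultimately have "ext0 V ?g p = 0"
  using has_integral_0_cbox_imp_0[OF continuous_on_subset[OF c] nn _ _ pin] by blast
 moreover have "bump p r p ~= 0" using bump_pos_iff[OF r(1), of p p] r(1) by simp
 ultimately show False using fp p by (simp add: ext0_def sgn_if split: if_splits)
qed

section \<open>Polynomials in the jet of a metric\<close>

primrec pdl :: "'i::finite list => (real^'i => 'b::real_normed_vector) => real^'i => 'b" where
 "pdl [] f = f"
| "pdl (i # I) f = pdl I (pd i f)"

lemma pdl_append: "pdl (I @ J) f = pdl J (pdl I f)" by (induction I arbitrary: f) auto

lemma smooth_on_pdl: "smooth_on S f ==> smooth_on S (pdl I f)" by (induction I arbitrary: f) (auto intro: smooth_on_pd)

lemma pdl_cong_open:
 assumes "open S" "x \<in> S" "!!y. y \<in> S ==> f y = g y"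
 shows "pdl I f x = pdl I g x"
 using assms(3)
proof (induction I arbitrary: f g)
 case (Cons i I)
 show ?case unfolding pdl.simps by (rule Cons.IH) (rule pd_cong_open[OF assms(1) _ Cons.prems])
qed (use assms in auto)

lemma csupp_pdl: "open V ==> csupp V f ==> csupp V (pdl I f)" by (induction I arbitrary: f) (auto intro: csupp_pd)

lemma pdl_add_cmult:
 fixes f k :: "real^'i::finite => real"
 assumes "open S" "x \<in> S" "smooth_on S f" "smooth_on S k"
 shows "pdl I (\<lambda>y. f y + c * k y) x = pdl I f x + c * pdl I k x"
 using assms(3,4)
proof (induction I arbitrary: f k)
 case (Cons i I)
 have *: "pd i (\<lambda>y. f y + c * k y) y = pd i f y + c * pd i k y" if "y \<in> S" for y
 proof -
  have "f differentiable (at y)" "k differentiable (at y)" "(\<lambda>y. c * k y) differentiable (at y)"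
   using Cons.prems that smooth_on_D smooth_on_mult[OF assms(1) smooth_on_const] by blast+
  then show ?thesis by (simp add: pd_add pd_cmult)
 qed
 have "pdl I (pd i (\<lambda>y. f y + c * k y)) x = pdl I (\<lambda>y. pd i f y + c * pd i k y) x"
  by (rule pdl_cong_open[OF assms(1,2) *])
 also have "... = pdl I (pd i f) x + c * pdl I (pd i k) x" by (rule Cons.IH) (use Cons.prems smooth_on_pd in auto)
 finally show ?case by simp
qed simp

text \<open>A normal form of \<open>metric_expr\<close>: derivatives sit on the metric components
  alone. Variations and Lipschitz estimates can then be proved by inductions that have no case for
  differentiating a compound expression.\<close>

inductive jet_poly :: "'i::finite lagrangian => bool" where
 const: "jet_poly (\<lambda>g x. r)"
| jet: "jet_poly (\<lambda>g x. pdl I (\<lambda>y. g y $ a $ b) x)"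
| upper: "jet_poly (\<lambda>g x. matrix_inv (g x) $ a $ b)"
| add: "jet_poly F ==> jet_poly G ==> jet_poly (\<lambda>g x. F g x + G g x)"
| mult: "jet_poly F ==> jet_poly G ==> jet_poly (\<lambda>g x. F g x * G g x)"

lemma jet_poly_lower: "jet_poly (\<lambda>g x. g x $ a $ b)"
 using jet_poly.jet[of "[]" a b] by simp

lemma jet_poly_cmult: "jet_poly F ==> jet_poly (\<lambda>g x. c * F g x)" by (rule jet_poly.mult[OF jet_poly.const])

lemma jet_poly_minus: "jet_poly F ==> jet_poly (\<lambda>g x. - F g x)"
 using jet_poly_cmult[of F "-1"] by simp

lemma jet_poly_sum: "(!!a. a \<in> A ==> jet_poly (F a)) ==> jet_poly (\<lambda>g x. \<Sum>a\<in>A. F a g x)"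
 by (induction A rule: infinite_finite_induct) (auto intro: jet_poly.intros)

lemma jet_poly_prod: "(!!a. a \<in> A ==> jet_poly (F a)) ==> jet_poly (\<lambda>g x. \<Prod>a\<in>A. F a g x)"
 by (induction A rule: infinite_finite_induct) (auto intro: jet_poly.intros)

lemma jet_poly_det: "jet_poly (\<lambda>g x. det (g x))"
 unfolding det_def by (intro jet_poly_sum jet_poly_cmult jet_poly_prod jet_poly_lower)

lemma jet_poly_det_inv: "jet_poly (\<lambda>g x. det (matrix_inv (g x)))"
 unfolding det_def by (intro jet_poly_sum jet_poly_cmult jet_poly_prod jet_poly.upper)

definition regular_on :: "(real^'i::finite) set => 'i metric => bool" where
 "regular_on S g \<longleftrightarrow> open S \<and> smooth_on S g \<and> (\<forall>x\<in>S. det (g x) ~= 0)"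

text \<open>Equality on regular metrics is the most that can be asked: where the metric is
  degenerate or not differentiable, \<open>matrix_inv\<close> and \<open>pd\<close> have arbitrary
  values.\<close>

abbreviation jet_eq :: "'i::finite lagrangian => 'i lagrangian => bool" where
 "jet_eq F G \<equiv> \<forall>S g. regular_on S g --> (\<forall>x\<in>S. F g x = G g x)"

lemma regular_on_component: "regular_on S g ==> smooth_on S (\<lambda>x. g x $ a $ b)"
 unfolding regular_on_def using smooth_on_mat by blast

lemma jet_poly_smooth:
 assumes "jet_poly F" "regular_on S g"
 shows "smooth_on S (F g)"
proof -
 have o: "open S" and sm: "smooth_on S g" "!!x. x \<in> S ==> det (g x) ~= 0"
  using assms(2) by (auto simp: regular_on_def)
 from assms(1) show ?thesis
 proof induction
  case (jet I a b)
  show ?case using smooth_on_pdl[OF regular_on_component[OF assms(2)]] by simp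
 next
  case (upper a b)
  show ?case using smooth_on_matrix_inv[OF o sm] by (simp add: smooth_on_mat[OF o])
 qed (auto intro: smooth_on_add smooth_on_mult o)
qed

lemma jet_poly_cong_open:
 assumes "jet_poly F" "open S" "x \<in> S" "!!y. y \<in> S ==> g y = g' y"
 shows "F g x = F g' x"
 using assms(1)
proof induction
 case (jet I a b)
 show ?case by (rule pdl_cong_open[OF assms(2,3)]) (simp add: assms(4))
qed (use assms in auto)

subsection \<open>Derivative of the inverse matrix\<close>

lemma isCont_det:
 fixes M :: "'a::t2_space => real^'i::finite^'i"
 assumes "!!a b. isCont (\<lambda>t. M t $ a $ b) t0"
 shows "isCont (\<lambda>t. det (M t)) t0"
 unfolding det_def isCont_def by (intro tendsto_intros assms[unfolded isCont_def])

lemma isCont_matrix_inv: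
 fixes M :: "'a::t2_space => real^'i::finite^'i"
 assumes c: "!!a b. isCont (\<lambda>t. M t $ a $ b) t0" and nz: "det (M t0) ~= 0"
 shows "isCont (\<lambda>t. matrix_inv (M t) $ a $ b) t0"
proof -
 have cd: "isCont (\<lambda>t. det (M t)) t0" by (rule isCont_det[OF c])
 then have "\<forall>\<^sub>F t in at t0. det (M t) ~= 0"
  using nz unfolding isCont_def by (rule tendsto_imp_eventually_ne)
 then have "\<forall>\<^sub>F t in nhds t0. det (M t) ~= 0"
  using nz by (auto simp: eventually_at_filter elim: eventually_mono)
 then have "\<forall>\<^sub>F t in nhds t0. det (\<chi> i j. if j = a then (if i = b then 1 else 0) else M t $ i $ j) * inverse (det (M t)) = matrix_inv (M t) $ a $ b"
  by eventually_elim (simp add: matrix_inv_cofactor)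
 moreover have "isCont (\<lambda>t. (\<chi> i j. if j = a then (if i = b then 1 else 0) else M t $ i $ j) $ k $ l) t0" for k l
  using c by (cases "l = a") auto
 then have "isCont (\<lambda>t. det (\<chi> i j. if j = a then (if i = b then 1 else 0) else M t $ i $ j)) t0"
  by (rule isCont_det)
 then have "isCont (\<lambda>t. det (\<chi> i j. if j = a then (if i = b then 1 else 0) else M t $ i $ j) * inverse (det (M t))) t0"
  by (rule isCont_mult[OF _ continuous_at_within_inverse[OF cd nz]])
 ultimately show ?thesis by (rule iffD1[OF isCont_cong])
qed

text \<open>By the resolvent identity the difference quotient of the inverse is a product of the two
  inverses with the difference quotient of \<open>M\<close>; continuity of the inverse gives the
  limit.\<close>

lemma has_real_derivative_matrix_inv:
 fixes M :: "real => real^'i::finite^'i"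
 assumes d: "!!a b. ((\<lambda>t. M t $ a $ b) has_real_derivative M' a b) (at t0)" and nz: "det (M t0) ~= 0"
 shows "((\<lambda>t. matrix_inv (M t) $ a $ b) has_real_derivative
  - (\<Sigma> c d. matrix_inv (M t0) $ a $ c * M' c d * matrix_inv (M t0) $ d $ b)) (at t0)"
proof -
 have c: "isCont (\<lambda>t. M t $ a $ b) t0" for a b using d DERIV_isCont by blast
 have ci: "((\<lambda>t. matrix_inv (M t) $ a $ b) \<longlongrightarrow> matrix_inv (M t0) $ a $ b) (at t0)" for a b
  using isCont_matrix_inv[OF c nz] by (simp add: isCont_def)
 have "\<forall>\<^sub>F t in at t0. det (M t) ~= 0"
  using isCont_det[OF c] nz unfolding isCont_def by (rule tendsto_imp_eventually_ne)
 then have ev: "\<forall>\<^sub>F t in at t0. - (\<Sigma> c d. matrix_inv (M t) $ a $ c * ((M t $ c $ d - M t0 $ c $ d) / (t - t0)) * matrix_inv (M t0) $ d $ b)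
  = (matrix_inv (M t) $ a $ b - matrix_inv (M t0) $ a $ b) / (t - t0)"
 proof eventually_elim
  case (elim t)
  show ?case by (simp add: matrix_inv_diff[OF elim nz] sum_divide_distrib)
 qed
 have "((\<lambda>t. - (\<Sigma> c d. matrix_inv (M t) $ a $ c * ((M t $ c $ d - M t0 $ c $ d) / (t - t0)) * matrix_inv (M t0) $ d $ b))
  \<longlongrightarrow> - (\<Sigma> c d. matrix_inv (M t0) $ a $ c * M' c d * matrix_inv (M t0) $ d $ b)) (at t0)"
  using d unfolding has_field_derivative_iff by (intro tendsto_minus tendsto_sum tendsto_mult ci tendsto_const)
 then show ?thesis
  unfolding has_field_derivative_iff by (rule Lim_transform_eventually[OF _ ev])
qed

lemma pd_eq_DERIV: "((\<lambda>t. f (x + t *\<^sub>R axis i 1)) has_real_derivative D) (at 0) ==> pd i f x = D"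
 unfolding pd_def has_real_derivative_iff_has_vector_derivative by (rule vector_derivative_at)

lemma DERIV_pd:
 fixes f :: "real^'i::finite => real"
 assumes "f differentiable (at x)"
 shows "((\<lambda>t. f (x + t *\<^sub>R axis i 1)) has_real_derivative pd i f x) (at 0)"
 using has_vector_derivative_line[of f x 0 i] assms by (simp add: has_real_derivative_iff_has_vector_derivative)

lemma pd_matrix_inv:
 fixes g :: "real^'j::finite => real^'i::finite^'i"
 assumes "!!a b. (\<lambda>y. g y $ a $ b) differentiable (at x)" "det (g x) ~= 0"
 shows "pd i (\<lambda>y. matrix_inv (g y) $ a $ b) x =
  - (\<Sigma> c d. matrix_inv (g x) $ a $ c * pd i (\<lambda>y. g y $ c $ d) x * matrix_inv (g x) $ d $ b)"
proof -
 have "((\<lambda>t. g (x + t *\<^sub>R axis i 1) $ a $ b) has_real_derivative pd i (\<lambda>y. g y $ a $ b) x) (at 0)" for a b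
  by (rule DERIV_pd[OF assms(1)])
 from has_real_derivative_matrix_inv[OF this, of a b] assms(2)
 show ?thesis by (intro pd_eq_DERIV) simp
qed

text \<open>The one case with content is the inverse metric, where \<open>\<partial>
  g\<^sup>-\<^sup>1 = - g\<^sup>-\<^sup>1 (\<partial> g) g\<^sup>-\<^sup>1\<close> is again
  polynomial in the jet.\<close>

lemma jet_poly_pd:
 assumes "jet_poly F"
 shows "\<exists>G. jet_poly G \<and> jet_eq (\<lambda>g. pd i (F g)) G"
 using assms
proof induction
 case (const r)
 show ?case by (rule exI[of _ "\<lambda>g x. 0"]) (simp add: jet_poly.const)
next
 case (jet I a b)
 have "pd i (\<lambda>x. pdl I (\<lambda>y. g y $ a $ b) x) x = pdl (I @ [i]) (\<lambda>y. g y $ a $ b) x" for g :: "'a metric" and x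
  by (simp add: pdl_append)
 then show ?case using jet_poly.jet by blast
next
 case (upper a b)
 let ?G = "\<lambda>g x. -1 * (\<Sigma> c d. matrix_inv (g x) $ a $ c * pdl [i] (\<lambda>y. g y $ c $ d) x * matrix_inv (g x) $ d $ b)"
 have "jet_poly ?G" by (intro jet_poly_cmult jet_poly_sum jet_poly.mult jet_poly.upper jet_poly.jet)
 moreover have "pd i (\<lambda>x. matrix_inv (g x) $ a $ b) x = ?G g x" if "regular_on S g" "x \<in> S" for S g x
  using pd_matrix_inv[of g x i a b] smooth_on_D[OF regular_on_component[OF that(1)] that(2)] that by (simp add: regular_on_def)
 ultimately show ?case by blast
next
 case (add F F')
 then obtain G G' where G: "jet_poly G" "jet_poly G'"
  "jet_eq (\<lambda>g. pd i (F g)) G" "jet_eq (\<lambda>g. pd i (F' g)) G'" by auto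
 have "pd i (\<lambda>x. F g x + F' g x) x = G g x + G' g x" if "regular_on S g" "x \<in> S" for S g x
  using G(3,4) that pd_add[OF smooth_on_D[OF jet_poly_smooth[OF add(1)] that(2)]
    smooth_on_D[OF jet_poly_smooth[OF add(2)] that(2)]] by auto
 then show ?case using jet_poly.add[OF G(1,2)] by blast
next
 case (mult F F')
 then obtain G G' where G: "jet_poly G" "jet_poly G'"
  "jet_eq (\<lambda>g. pd i (F g)) G" "jet_eq (\<lambda>g. pd i (F' g)) G'" by auto
 have "pd i (\<lambda>x. F g x * F' g x) x = F g x * G' g x + G g x * F' g x" if "regular_on S g" "x \<in> S" for S g x
  using G(3,4) that pd_mult[OF smooth_on_D[OF jet_poly_smooth[OF mult(1)] that(2)]
    smooth_on_D[OF jet_poly_smooth[OF mult(2)] that(2)]] by auto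
 moreover have "jet_poly (\<lambda>g x. F g x * G' g x + G g x * F' g x)"
  using mult G by (intro jet_poly.add jet_poly.mult)
 ultimately show ?case by blast
qed

lemma metric_expr_jet_poly:
 assumes "metric_expr k F"
 shows "\<exists>G. jet_poly G \<and> jet_eq F G"
 using assms
proof induction
 case (deriv k F i)
 then obtain G where G: "jet_poly G" "jet_eq F G" by blast
 obtain G' where G': "jet_poly G'" "jet_eq (\<lambda>g. pd i (G g)) G'"
  using jet_poly_pd[OF G(1)] by blast
 have "pd i (F g) x = G' g x" if "regular_on S g" "x \<in> S" for S g x
 proof -
  \<comment> \<open>The induction hypothesis gives equality on all of the open set \<open>S\<close>,
    hence also of the derivatives.\<close>
  have "pd i (F g) x = pd i (G g) x"
   using that G(2) by (intro pd_cong_open[of S]) (auto simp: regular_on_def)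
  then show ?thesis using G'(2) that by auto
 qed
 with G'(1) show ?case by (intro exI[of _ G']) auto
next
 case (add k F F')
 then obtain G G' where G: "jet_poly G" "jet_poly G'"
  "jet_eq F G" "jet_eq F' G'" by auto
 have "F g x + F' g x = G g x + G' g x" if "regular_on S g" "x \<in> S" for S g x
  using G(3,4) that by auto
 then show ?case using jet_poly.add[OF G(1,2)] by blast
next
 case (mult j F k F')
 then obtain G G' where G: "jet_poly G" "jet_poly G'"
  "jet_eq F G" "jet_eq F' G'" by auto
 have "F g x * F' g x = G g x * G' g x" if "regular_on S g" "x \<in> S" for S g x
  using G(3,4) that by auto
 then show ?case using jet_poly.mult[OF G(1,2)] by blast
qed (blast intro: jet_poly.const jet_poly_lower jet_poly.upper)+

section \<open>Euler-Lagrange expressions\<close>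

text \<open>A list of tuples \<open>(c, I, a, b)\<close> stands for the differential operator
 \<open>k \<mapsto> \<Sum> c \<partial>\<^sub>I k\<^sub>a\<^sub>b\<close>.\<close>
definition diffop ::
 "('i::finite lagrangian \<times> 'i list \<times> 'i \<times> 'i) list => 'i metric => (real^'i => real^'i^'i) => real^'i => real"
 where "diffop T g k x = (\<Sum>(c, I, a, b)\<leftarrow>T. c g x * pdl I (\<lambda>y. k y $ a $ b) x)"

definition jet_op :: "('i::finite lagrangian \<times> 'i list \<times> 'i \<times> 'i) list => bool" where
 "jet_op T \<longleftrightarrow> (\<forall>(c, I, a, b)\<in>set T. jet_poly c)"

definition scale_op where
 "scale_op F T = map (\<lambda>(c, I, a, b). (\<lambda>g x. F g x * c g x, I, a, b)) T"

lemma diffop_append: "diffop (T @ T') g k x = diffop T g k x + diffop T' g k x" by (simp add: diffop_def)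

lemma diffop_scale: "diffop (scale_op F T) g k x = F g x * diffop T g k x"
 unfolding diffop_def scale_op_def by (induction T) (auto simp: algebra_simps)

lemma jet_op_append: "jet_op T ==> jet_op T' ==> jet_op (T @ T')" by (auto simp: jet_op_def)

lemma jet_op_scale: "jet_poly F ==> jet_op T ==> jet_op (scale_op F T)"
 by (fastforce simp: jet_op_def scale_op_def intro: jet_poly.mult)

abbreviation perturb :: "'i::finite metric => (real^'i => real^'i^'i) => real => 'i metric" where
 "perturb g k e \<equiv> \<lambda>z. g z + e *\<^sub>R k z"

text \<open>The derivative is described at every \<open>e\<close> where the perturbed metric is
  nondegenerate, not just at 0, because differentiation under the integral uses a whole interval of
  \<open>e\<close>.\<close>

definition variation_of ::
 "('i::finite lagrangian \<times> 'i list \<times> 'i \<times> 'i) list => 'i lagrangian => bool" where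
 "variation_of T F \<longleftrightarrow> (\<forall>S g k x e. open S \<and> smooth_on S g \<and> smooth_on S k \<and> x \<in> S \<and> det (perturb g k e x) ~= 0 -->
   ((\<lambda>e. F (perturb g k e) x) has_real_derivative diffop T (perturb g k e) k x) (at e))"

lemma jet_poly_variation:
 fixes F :: "'a::finite lagrangian"
 assumes "jet_poly F"
 shows "\<exists>T. jet_op T \<and> variation_of T F"
 using assms
proof induction
 case (const r)
 show ?case by (rule exI[of _ "[]"]) (simp add: jet_op_def variation_of_def diffop_def)
next
 case (jet I a b)
 have "((\<lambda>e. pdl I (\<lambda>y. perturb g k e y $ a $ b) x) has_real_derivative pdl I (\<lambda>y. k y $ a $ b) x) (at e)"
  if "open S" "smooth_on S g" "smooth_on S k" "x \<in> S" for S g k x e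
 proof -
  have "pdl I (\<lambda>y. perturb g k e y $ a $ b) x = pdl I (\<lambda>y. g y $ a $ b) x + e * pdl I (\<lambda>y. k y $ a $ b) x" for e
   using pdl_add_cmult[OF that(1,4), of "\<lambda>y. g y $ a $ b" "\<lambda>y. k y $ a $ b" I e] that smooth_on_mat[OF that(1)]
   by auto
  then show ?thesis by (auto intro!: derivative_eq_intros)
 qed
 then show ?case
  by (intro exI[of _ "[(\<lambda>g x. 1, I, a, b)]"]) (auto simp: jet_op_def variation_of_def diffop_def jet_poly.const)
next
 case (upper a b)
 obtain l :: "('a \<times> 'a) list" where l: "distinct l" "set l = UNIV"
  using finite_distinct_list[OF finite, of "UNIV :: ('a \<times> 'a) set"] by auto
 \<comment> \<open>\<open>diffop\<close> sums over a list, so the double contraction with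
   \<open>k\<close> is spread over a list of all index pairs.\<close>
 define T :: "('a lagrangian \<times> 'a list \<times> 'a \<times> 'a) list" where
  "T = map (\<lambda>(c, d). (\<lambda>g x. - (matrix_inv (g x) $ a $ c * matrix_inv (g x) $ d $ b), [], c, d)) l"
 have "jet_op T" by (auto simp: jet_op_def T_def intro!: jet_poly_minus jet_poly.mult jet_poly.upper)
 moreover have "diffop T g k x = - (\<Sigma> c d. matrix_inv (g x) $ a $ c * k x $ c $ d * matrix_inv (g x) $ d $ b)" for g k x
 proof -
  have "diffop T g k x = (\<Sum>(c, d)\<in>UNIV. - (matrix_inv (g x) $ a $ c * k x $ c $ d * matrix_inv (g x) $ d $ b))"
   unfolding diffop_def T_def by (simp add: o_def case_prod_unfold sum_list_distinct_conv_sum_set l algebra_simps)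
  then show ?thesis by (simp add: sum_negf sum.cartesian_product case_prod_unfold)
 qed
 moreover have "((\<lambda>e. matrix_inv (perturb g k e x) $ a $ b) has_real_derivative
   - (\<Sigma> c d. matrix_inv (perturb g k e x) $ a $ c * k x $ c $ d * matrix_inv (perturb g k e x) $ d $ b)) (at e)"
  if "det (perturb g k e x) ~= 0" for g k x e
  by (rule has_real_derivative_matrix_inv) (use that in "auto intro!: derivative_eq_intros")
 ultimately show ?case by (auto simp: variation_of_def intro!: exI[of _ T])
next
 case (add F G)
 then obtain T T' where T: "jet_op T" "jet_op T'" "variation_of T F" "variation_of T' G" by auto
 have "variation_of (T @ T') (\<lambda>g x. F g x + G g x)"
  unfolding variation_of_def diffop_append
  by (intro allI impI DERIV_add) (use T(3,4) in \<open>auto simp: variation_of_def\<close>)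
 then show ?case using jet_op_append T(1,2) by blast
next
 case (mult F G)
 then obtain T T' where T: "jet_op T" "jet_op T'" "variation_of T F" "variation_of T' G" by auto
 have "variation_of (scale_op G T @ scale_op F T') (\<lambda>g x. F g x * G g x)"
  unfolding variation_of_def diffop_append diffop_scale
 proof (intro allI impI)
  fix S and g :: "'a metric" and k x and e :: real
  assume "open S \<and> smooth_on S g \<and> smooth_on S k \<and> x \<in> S \<and> det (perturb g k e x) ~= 0"
  then have "((\<lambda>e. F (perturb g k e) x) has_real_derivative diffop T (perturb g k e) k x) (at e)"
   "((\<lambda>e. G (perturb g k e) x) has_real_derivative diffop T' (perturb g k e) k x) (at e)"
   using T(3,4) unfolding variation_of_def by blast+
  from DERIV_mult[OF this]
  show "((\<lambda>e. F (perturb g k e) x * G (perturb g k e) x) has_real_derivative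
   G (perturb g k e) x * diffop T (perturb g k e) k x + F (perturb g k e) x * diffop T' (perturb g k e) k x) (at e)"
   by (simp add: algebra_simps)
 qed
 then show ?case using jet_op_append jet_op_scale T(1,2) mult by blast
qed

subsection \<open>The volume density\<close>

abbreviation vol :: "'i::finite metric => real^'i => real" where
 "vol g x \<equiv> sqrt \<bar>det (g x)\<bar>"

abbreviation contract :: "('i => 'i => 'i lagrangian) => 'i::finite metric => (real^'i => real^'i^'i) => real^'i => real" where
 "contract E g k z \<equiv> \<Sigma> a b. E a b g z * k z $ a $ b"

abbreviation pairing :: "(real^'i) set => ('i => 'i => 'i lagrangian) => 'i::finite metric => (real^'i => real^'i^'i) => real" where
 "pairing V E g k \<equiv> integral V (\<lambda>z. vol g z * contract E g k z)"

abbreviation change :: "'i::finite lagrangian => 'i metric => (real^'i => real^'i^'i) => real => real^'i => real" where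
 "change F g k e z \<equiv> vol (perturb g k e) z * F (perturb g k e) z - vol g z * F g z"

text \<open>The determinant may have either sign; this form shows the density as a smooth function
  of the positive number \<open>u\<^sup>2\<close>.\<close>

lemma sqrt_abs_eq_powr: "sqrt \<bar>u\<bar> = (u\<^sup>2) powr (1/4)" if "u ~= 0"
proof -
 have "(u\<^sup>2) powr (1/4) = (\<bar>u\<bar> powr 2) powr (1/4)" using that by simp
 also have "... = \<bar>u\<bar> powr (1/2)" by (simp only: powr_powr) simp
 also have "... = sqrt \<bar>u\<bar>" by (simp add: powr_half_sqrt)
 finally show ?thesis ..
qed

lemma DERIV_sqrt_abs:
 assumes "(f has_real_derivative f') (at t)" "f t ~= 0"
 shows "((\<lambda>t. sqrt \<bar>f t\<bar>) has_real_derivative 1/2 * sqrt \<bar>f t\<bar> * inverse (f t) * f') (at t)"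
proof -
 have "((\<lambda>t. sqrt \<bar>t\<bar>) has_real_derivative 1/2 * sqrt \<bar>u\<bar> * inverse u) (at u)" if "u ~= 0" for u :: real
 proof -
  have "((\<lambda>t. (t\<^sup>2) powr (1/4)) has_real_derivative (1/4) * (u\<^sup>2) powr (1/4 - 1) * (2 * u)) (at u)"
   using that by (auto intro!: derivative_eq_intros)
  also have "(1/4) * (u\<^sup>2) powr (1/4 - 1) * (2 * u) = 1/2 * sqrt \<bar>u\<bar> * inverse u"
  proof -
   have "(u\<^sup>2) powr (1/4 - 1) = sqrt \<bar>u\<bar> / u\<^sup>2"
    using that by (simp only: powr_diff sqrt_abs_eq_powr[OF that]) simp
   then show ?thesis using that by (simp add: power2_eq_square field_simps)
  qed
  finally show ?thesis
   by (rule has_field_derivative_transform_within_open[of _ _ _ "-{0}"]) (use that in "auto simp: sqrt_abs_eq_powr")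
 qed
 from DERIV_chain2[OF this[OF assms(2)] assms(1)] show ?thesis .
qed

lemma det_matrix_inv: "det (A :: real^'i::finite^'i) ~= 0 ==> det (matrix_inv A) = inverse (det A)"
 by (metis det_I det_mul inverse_unique matrix_inv_right)

lemma smooth_on_vol:
 assumes "regular_on S g"
 shows "smooth_on S (vol g)"
proof -
 have o: "open S" and nz: "!!x. x \<in> S ==> det (g x) ~= 0" and sm: "smooth_on S g"
  using assms by (auto simp: regular_on_def)
 \<comment> \<open>The n-th derivative of the fourth root.\<close>
 define F where "F n t = (\<Prod>j<n. 1/4 - real j) * t powr (1/4 - real n)" for n and t :: real
 have F: "(F n has_real_derivative F (Suc n) t) (at t)" if "t \<in> {0<..}" for n t
  unfolding F_def using that by (auto intro!: derivative_eq_intros simp: algebra_simps)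
 have "smooth_on S (\<lambda>x. F 0 ((det (g x))\<^sup>2))" by (rule smooth_on_compose_real[where T="{0<..}"])
   (use nz F in "auto intro!: o smooth_on_power smooth_on_det sm")
 then show ?thesis by (subst smooth_on_cong[OF o]) (auto simp: F_def sqrt_abs_eq_powr nz)
qed

text \<open>The density is no jet polynomial, but its logarithmic derivative is one, because the
  reciprocal of the determinant is the determinant of the inverse. So every derivative reproduces
  the factor \<open>vol\<close>.\<close>

lemma jet_poly_pd_vol:
 assumes "jet_poly F"
 shows "\<exists>G. jet_poly G \<and> jet_eq (\<lambda>g. pd i (\<lambda>x. vol g x * F g x)) (\<lambda>g x. vol g x * G g x)"
proof -
 from jet_poly_pd[OF jet_poly_det, where i=i] obtain D where
  D: "jet_poly D" "jet_eq (\<lambda>g. pd i (\<lambda>x. det (g x))) D" by (elim exE conjE)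
 from jet_poly_pd[OF assms, where i=i] obtain F' where
  F': "jet_poly F'" "jet_eq (\<lambda>g. pd i (F g)) F'" by (elim exE conjE)
 let ?G = "\<lambda>g x. F' g x + 1/2 * (det (matrix_inv (g x)) * D g x * F g x)"
 have "pd i (\<lambda>x. vol g x * F g x) x = vol g x * ?G g x" if "regular_on S g" "x \<in> S" for S g x
 proof -
  have nz: "det (g x) ~= 0" and o: "open S" using that by (auto simp: regular_on_def)
  have d: "(\<lambda>x. det (g x)) differentiable (at x)" "F g differentiable (at x)" "vol g differentiable (at x)"
   using smooth_on_D[OF jet_poly_smooth[OF jet_poly_det that(1)] that(2)]
    smooth_on_D[OF jet_poly_smooth[OF assms that(1)] that(2)]
    smooth_on_D[OF smooth_on_vol[OF that(1)] that(2)] by simp_all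
  have "pd i (vol g) x = 1/2 * vol g x * inverse (det (g x)) * pd i (\<lambda>x. det (g x)) x"
   using DERIV_sqrt_abs[OF DERIV_pd[OF d(1), of i]] nz by (intro pd_eq_DERIV) simp
  then show ?thesis
   using pd_mult[OF d(3,2), of i] D(2) F'(2) that by (simp add: det_matrix_inv[OF nz] algebra_simps)
 qed
 moreover have "jet_poly ?G"
  using D F' assms by (intro jet_poly.add jet_poly_cmult jet_poly.mult jet_poly_det_inv) auto
 ultimately show ?thesis by blast
qed

lemma jet_poly_variation_vol:
 fixes F :: "'a::finite lagrangian"
 assumes "jet_poly F"
 shows "\<exists>T. jet_op T \<and> (\<forall>S g k x e. open S \<and> smooth_on S g \<and> smooth_on S k \<and> x \<in> S \<and> det (perturb g k e x) ~= 0 -->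
   ((\<lambda>e. vol (perturb g k e) x * F (perturb g k e) x) has_real_derivative
    vol (perturb g k e) x * diffop T (perturb g k e) k x) (at e))"
proof -
 obtain T where T: "jet_op T" "variation_of T F" using jet_poly_variation[OF assms] by blast
 obtain D :: "('a lagrangian \<times> 'a list \<times> 'a \<times> 'a) list" where D: "jet_op D" "variation_of D (\<lambda>g x. det (g x))" using jet_poly_variation[OF jet_poly_det] by blast
 \<comment> \<open>The second summand is half the variation of the logarithm of the determinant,
   times \<open>F\<close>.\<close>
 let ?T = "T @ scale_op (\<lambda>g x. 1/2 * (det (matrix_inv (g x)) * F g x)) D"
 have "((\<lambda>e. vol (perturb g k e) x * F (perturb g k e) x) has_real_derivative
    vol (perturb g k e) x * diffop ?T (perturb g k e) k x) (at e)"
  if *: "open S \<and> smooth_on S g \<and> smooth_on S k \<and> x \<in> S \<and> det (perturb g k e x) ~= 0" for S g k x e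
 proof -
  have "((\<lambda>e. F (perturb g k e) x) has_real_derivative diffop T (perturb g k e) k x) (at e)"
   using * T(2) unfolding variation_of_def by blast
  moreover have "((\<lambda>e. det (perturb g k e x)) has_real_derivative diffop D (perturb g k e) k x) (at e)"
   using * D(2) unfolding variation_of_def by blast
  moreover have nz: "det (perturb g k e x) ~= 0" using * by blast
  ultimately have "((\<lambda>e. vol (perturb g k e) x * F (perturb g k e) x) has_real_derivative
   1/2 * vol (perturb g k e) x * inverse (det (perturb g k e x)) * diffop D (perturb g k e) k x * F (perturb g k e) x +
   diffop T (perturb g k e) k x * vol (perturb g k e) x) (at e)" by (intro DERIV_mult DERIV_sqrt_abs)
  then show ?thesis by (simp add: diffop_append diffop_scale det_matrix_inv[OF nz] algebra_simps)
 qed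
 moreover have "jet_op ?T" by (intro jet_op_append jet_op_scale T D jet_poly_cmult jet_poly.mult jet_poly_det_inv assms)
 ultimately show ?thesis by blast
qed

subsection \<open>Integration by parts\<close>

lemma csupp_component:
 fixes k :: "'a::topological_space => real^'i::finite^'j::finite"
 shows "csupp V k ==> csupp V (\<lambda>z. k z $ a $ b)" by (erule csupp_cong) simp

abbreviation test_pair :: "(real^'i::finite) set => 'i metric => (real^'i => 'b::real_normed_vector) => bool" where
 "test_pair V g k \<equiv> regular_on V g \<and> smooth_on V k \<and> csupp V k"

text \<open>Each integration by parts turns the coefficient into another jet polynomial in front of
  the same density. The result is universal: it depends on neither \<open>V\<close>,
  \<open>g\<close> nor \<open>k\<close>.\<close>

lemma integral_parts_pdl:
 fixes c :: "'i::finite lagrangian"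
 assumes "jet_poly c"
 shows "\<exists>G. jet_poly G \<and> (\<forall>V g k. test_pair V g k -->
  integral V (\<lambda>z. vol g z * c g z * pdl I k z) = integral V (\<lambda>z. vol g z * G g z * k z))"
proof (induction I)
 case Nil
 show ?case by (rule exI[of _ c]) (use assms in auto)
next
 case (Cons i I)
 then obtain G where G: "jet_poly G" "\<forall>V g k. test_pair V g k -->
  integral V (\<lambda>z. vol g z * c g z * pdl I k z) = integral V (\<lambda>z. vol g z * G g z * k z)" by (elim exE conjE)
 from jet_poly_pd_vol[OF G(1), where i=i] obtain G' where G': "jet_poly G'"
  "jet_eq (\<lambda>g. pd i (\<lambda>x. vol g x * G g x)) (\<lambda>g x. vol g x * G' g x)" by (elim exE conjE)
 have "integral V (\<lambda>z. vol g z * c g z * pdl (i # I) k z) = integral V (\<lambda>z. vol g z * - G' g z * k z)"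
  if r: "regular_on V g" "smooth_on V k" "csupp V k" for V k and g :: "'i metric"
 proof -
  have o: "open V" using r by (simp add: regular_on_def)
  have sm: "smooth_on V (\<lambda>z. vol g z * G g z)"
   by (rule smooth_on_mult[OF o smooth_on_vol[OF r(1)] jet_poly_smooth[OF G(1) r(1)]])
  have "integral V (\<lambda>z. vol g z * c g z * pdl (i # I) k z) = integral V (\<lambda>z. vol g z * G g z * pd i k z)"
   using G(2) r(1) smooth_on_pd[OF r(2)] csupp_pd[OF o r(3)] by simp
  also have "... = - integral V (\<lambda>z. pd i (\<lambda>z. vol g z * G g z) z * k z)"
   by (rule integral_by_parts[OF o sm r(2,3)])
  also have "... = - integral V (\<lambda>z. vol g z * G' g z * k z)"
  proof -
   have "integral V (\<lambda>z. pd i (\<lambda>z. vol g z * G g z) z * k z) = integral V (\<lambda>z. vol g z * G' g z * k z)"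
    by (rule integral_cong) (use G'(2) r(1) in simp)
   then show ?thesis by simp
  qed
  finally show ?thesis by (simp add: integral_neg)
 qed
 then show ?case by (intro exI[of _ "\<lambda>g x. - G' g x"] conjI jet_poly_minus G'(1)) blast
qed

lemma smooth_diffop:
 assumes "jet_op T" "regular_on V g" "smooth_on V k"
 shows "smooth_on V (diffop T g k)"
proof -
 have o: "open V" using assms by (simp add: regular_on_def)
 have k: "smooth_on V (\<lambda>y. k y $ a $ b)" for a b using assms(3) smooth_on_mat[OF o] by blast
 from assms(1) show ?thesis
  unfolding diffop_def
 proof (induction T)
  case (Cons t T)
  obtain c I a b where t: "t = (c, I, a, b)" by (cases t)
  have c: "jet_poly c" and T: "jet_op T" using Cons.prems t by (auto simp: jet_op_def)
  show ?case
   unfolding t by simp (intro smooth_on_add smooth_on_mult o jet_poly_smooth[OF c assms(2)] smooth_on_pdl[OF k] Cons.IH[OF T])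
 qed simp
qed

lemma pdl_zero [simp]: "pdl I (\<lambda>y. 0 :: 'b::real_normed_vector) = (\<lambda>y. 0)"
proof (induction I)
 case (Cons i I)
 have "pd i (\<lambda>y. 0 :: 'b) = (\<lambda>y. 0)" by (rule ext) simp
 with Cons show ?case by simp
qed simp

lemma diffop_eq_0:
 assumes "open S" "x \<in> S" "!!y. y \<in> S ==> k y = 0"
 shows "diffop T g k x = 0"
proof -
 have "pdl I (\<lambda>y. k y $ a $ b) x = pdl I (\<lambda>y. 0) x" for I a b
  by (rule pdl_cong_open[OF assms(1,2)]) (simp add: assms(3))
 then show ?thesis by (induction T) (auto simp: diffop_def)
qed

lemma csupp_diffop:
 assumes "open V" "csupp V k"
 shows "csupp V (diffop T g k)"
proof -
 obtain K where K: "compact K" "K \<subseteq> V" "\<forall>z\<in>V - K. k z = 0" using assms(2) by (auto simp: csupp_def)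
 have "open (V - K)" using K assms(1) by (simp add: compact_imp_closed open_Diff)
 then have "\<forall>z\<in>V - K. diffop T g k z = 0" using diffop_eq_0 K by metis
 with K show ?thesis by (auto simp: csupp_def)
qed

text \<open>The formal adjoint, term by term; \<open>E\<close> collects the coefficients of the
  undifferentiated entries of \<open>k\<close>.\<close>

lemma diffop_adjoint:
 fixes T :: "('i::finite lagrangian \<times> 'i list \<times> 'i \<times> 'i) list"
 assumes "jet_op T"
 shows "\<exists>E. (\<forall>a b. jet_poly (E a b)) \<and> (\<forall>V g k. test_pair V g k -->
  integral V (\<lambda>z. vol g z * diffop T g k z) = pairing V E g k)"
 using assms
proof (induction T)
 case Nil
 show ?case by (rule exI[of _ "\<lambda>a b g z. 0"]) (simp add: jet_poly.const diffop_def)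
next
 case (Cons t T)
 obtain c I p q where t: "t = (c, I, p, q)" by (cases t)
 have c: "jet_poly c" and T: "jet_op T" using Cons.prems t by (auto simp: jet_op_def)
 from Cons.IH[OF T] obtain E where E: "\<forall>a b. jet_poly (E a b)" "\<forall>V g k. test_pair V g k -->
  integral V (\<lambda>z. vol g z * diffop T g k z) = pairing V E g k" by (elim exE conjE)
 from integral_parts_pdl[OF c, where I=I] obtain G where G: "jet_poly G" "\<forall>V g k. test_pair V g k -->
  integral V (\<lambda>z. vol g z * c g z * pdl I k z) = integral V (\<lambda>z. vol g z * G g z * k z)" by (elim exE conjE)
 let ?E = "\<lambda>a b. if a = p \<and> b = q then (\<lambda>g z. E a b g z + G g z) else E a b"
 have "integral V (\<lambda>z. vol g z * diffop (t # T) g k z) = pairing V ?E g k"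
  if r: "regular_on V g" "smooth_on V k" "csupp V k" for V k and g :: "'i metric"
 proof -
  have o: "open V" using r by (simp add: regular_on_def)
  have k: "smooth_on V (\<lambda>y. k y $ a $ b)" for a b using r(2) smooth_on_mat[OF o] by blast
  note int = csupp_integrable[OF o smooth_on_cont]
  have i1: "(\<lambda>z. vol g z * c g z * pdl I (\<lambda>y. k y $ p $ q) z) integrable_on V"
   by (intro int smooth_on_mult o smooth_on_vol r jet_poly_smooth[OF c] smooth_on_pdl k csupp_mult_left csupp_pdl csupp_component)
  have i2: "(\<lambda>z. vol g z * diffop T g k z) integrable_on V"
   by (intro int smooth_on_mult o smooth_on_vol r smooth_diffop T csupp_mult_left csupp_diffop)
  have i3: "(\<lambda>z. vol g z * G g z * k z $ p $ q) integrable_on V"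
   by (intro int smooth_on_mult o smooth_on_vol r jet_poly_smooth[OF G(1)] k csupp_mult_left csupp_component)
  have i4: "(\<lambda>z. vol g z * contract E g k z) integrable_on V"
   using E(1) by (intro int smooth_on_mult o smooth_on_vol r smooth_on_sum jet_poly_smooth[OF _ r(1)] k csupp_mult_left csupp_component csupp_sum) auto
  have "integral V (\<lambda>z. vol g z * diffop (t # T) g k z) =
   integral V (\<lambda>z. vol g z * c g z * pdl I (\<lambda>y. k y $ p $ q) z + vol g z * diffop T g k z)"
   by (simp add: t diffop_def algebra_simps)
  also have "... = integral V (\<lambda>z. vol g z * G g z * k z $ p $ q) + pairing V E g k"
   using G(2) E(2) r k csupp_component[OF r(3), of p q] by (subst integral_add[OF i1 i2]) auto
  also have "... = integral V (\<lambda>z. vol g z * G g z * k z $ p $ q + vol g z * contract E g k z)"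
   by (rule integral_add[OF i3 i4, symmetric])
  also have "(\<lambda>z. vol g z * G g z * k z $ p $ q + vol g z * contract E g k z)
   = (\<lambda>z. vol g z * contract ?E g k z)"
  proof
   fix z
   have "contract ?E g k z =
    (\<Sigma> a b. E a b g z * k z $ a $ b + (if a = p then if b = q then G g z * k z $ a $ b else 0 else 0))"
    by (intro sum.cong refl) (auto simp: algebra_simps)
   also have "... = contract E g k z + G g z * k z $ p $ q"
   proof -
    have "(\<Sigma> b. if a = p then if b = q then G g z * k z $ a $ b else 0 else 0) = (if a = p then G g z * k z $ p $ q else 0)" for a
     by (cases "a = p") auto
    then show ?thesis by (simp add: sum.distrib)
   qed
   finally show "vol g z * G g z * k z $ p $ q + vol g z * contract E g k z
    = vol g z * contract ?E g k z" by (simp add: algebra_simps)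
  qed
  finally show ?thesis .
 qed
 moreover have "\<forall>a b. jet_poly (?E a b)"
  using E(1) G(1) by (auto intro: jet_poly.add)
 ultimately show ?case by (intro exI[of _ ?E]) blast
qed

subsection \<open>Perturbations on a compact set\<close>

text \<open>A sequence of violations with parameters tending to 0 would accumulate at a point of
  \<open>K\<close>, where \<open>P\<close> holds on a whole ball. Applied to nondegeneracy and to
  Lorentzian signature.\<close>

lemma compact_perturb:
 fixes g k :: "'a::metric_space => 'b::real_normed_vector"
 assumes K: "compact K" and c: "continuous_on K g" "continuous_on K k"
  and P: "!!z. z \<in> K ==> \<exists>s>0. \<forall>B. dist B (g z) < s --> P B"
 shows "\<exists>\<delta>>0. \<forall>e z. \<bar>e\<bar> < \<delta> \<and> z \<in> K --> P (g z + e *\<^sub>R k z)"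
proof (rule ccontr)
 assume *: "\<not> ?thesis"
 have "\<exists>e z. \<bar>e\<bar> < 1 / real (Suc n) \<and> z \<in> K \<and> \<not> P (g z + e *\<^sub>R k z)" for n
  using * by (meson of_nat_0_less_iff zero_less_Suc zero_less_divide_1_iff)
 then obtain s z where ez: "!!n. \<bar>s n\<bar> < 1 / real (Suc n)" "!!n. z n \<in> K" "!!n. \<not> P (g (z n) + s n *\<^sub>R k (z n))"
  by metis
 obtain l r where lr: "l \<in> K" "strict_mono r" "(z \<circ> r) \<longlonglongrightarrow> l"
  using K ez(2) unfolding compact_def by metis
 have "s \<longlonglongrightarrow> 0" by (rule LIMSEQ_norm_0) (use ez(1) in simp)
 then have "(s \<circ> r) \<longlonglongrightarrow> 0" using lr(2) LIMSEQ_subseq_LIMSEQ by blast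
 moreover have "(\<lambda>n. g ((z \<circ> r) n)) \<longlonglongrightarrow> g l" "(\<lambda>n. k ((z \<circ> r) n)) \<longlonglongrightarrow> k l"
  using c lr(1,3) ez(2) unfolding continuous_on_sequentially o_def by auto
 ultimately have "(\<lambda>n. g ((z \<circ> r) n) + (s \<circ> r) n *\<^sub>R k ((z \<circ> r) n)) \<longlonglongrightarrow> g l + 0 *\<^sub>R k l"
  by (intro tendsto_intros)
 moreover obtain d where "d > 0" "\<forall>B. dist B (g l) < d --> P B" using P[OF lr(1)] by blast
 ultimately obtain n where "P (g ((z \<circ> r) n) + (s \<circ> r) n *\<^sub>R k ((z \<circ> r) n))"
  unfolding lim_sequentially by (metis add.right_neutral le_refl scale_zero_left)
 with ez(3) show False by simp
qed

lemma det_open: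
 fixes A :: "real^'i::finite^'i"
 assumes "det A ~= 0"
 shows "\<exists>e>0. \<forall>B. dist B A < e --> det B ~= 0"
proof -
 have "isCont (\<lambda>B. det B) A" by (rule isCont_det) (auto intro!: continuous_intros)
 then have "\<forall>\<^sub>F B in at A. det B ~= 0"
  using assms unfolding isCont_def by (rule tendsto_imp_eventually_ne)
 then have "\<forall>\<^sub>F B in nhds A. det B ~= 0"
  using assms by (auto simp: eventually_at_filter elim: eventually_mono)
 then show ?thesis by (simp add: eventually_nhds_metric)
qed

lemma continuous_on_det:
 fixes M :: "'a::topological_space => real^'i::finite^'i"
 assumes "!!a b. continuous_on S (\<lambda>t. M t $ a $ b)"
 shows "continuous_on S (\<lambda>t. det (M t))"
 unfolding det_def by (intro continuous_on_sum continuous_on_mult continuous_on_prod continuous_on_const assms)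

lemma continuous_on_matrix_inv:
 fixes M :: "'a::topological_space => real^'i::finite^'i"
 assumes c: "!!a b. continuous_on S (\<lambda>t. M t $ a $ b)" and nz: "!!t. t \<in> S ==> det (M t) ~= 0"
 shows "continuous_on S (\<lambda>t. matrix_inv (M t) $ a $ b)"
proof -
 have "continuous_on S (\<lambda>t. (\<chi> i j. if j = a then (if i = b then 1 else 0) else M t $ i $ j) $ k $ l)" for k l
  using c by (cases "l = a") auto
 then have "continuous_on S (\<lambda>t. det (\<chi> i j. if j = a then (if i = b then 1 else 0) else M t $ i $ j))"
  by (rule continuous_on_det)
 then have "continuous_on S (\<lambda>t. det (\<chi> i j. if j = a then (if i = b then 1 else 0) else M t $ i $ j) * inverse (det (M t)))"
  using nz by (intro continuous_on_mult continuous_on_inverse[OF continuous_on_det[OF c]]) auto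
 then show ?thesis by (rule continuous_on_eq) (simp add: matrix_inv_cofactor nz)
qed

text \<open>Joint continuity in the parameter and the point is what Leibniz' rule requires of the
  derivative.\<close>

lemma jet_poly_continuous:
 assumes F: "jet_poly F" and V: "open V" "smooth_on V g" "smooth_on V k"
  and S: "!!e z. (e, z) \<in> S ==> z \<in> V \<and> det (perturb g k e z) ~= 0"
 shows "continuous_on S (\<lambda>(e, z). F (perturb g k e) z)"
 using F
proof induction
 case (const r)
 then show ?case by (simp add: case_prod_unfold)
next
 case (jet I a b)
 have gk: "smooth_on V (\<lambda>y. g y $ a $ b)" "smooth_on V (\<lambda>y. k y $ a $ b)"
  using V smooth_on_mat[OF V(1)] by blast+
 have c: "continuous_on S (\<lambda>p. pdl I f (snd p))" if "smooth_on V f" for f :: "_ => real"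
  by (rule continuous_on_compose2[OF smooth_on_cont[OF smooth_on_pdl[OF that]] continuous_on_snd[OF continuous_on_id]])
   (use S in auto)
 have "continuous_on S (\<lambda>p. pdl I (\<lambda>y. g y $ a $ b) (snd p) + fst p * pdl I (\<lambda>y. k y $ a $ b) (snd p))"
  by (intro continuous_on_add continuous_on_mult c gk continuous_on_fst continuous_on_id)
 then show ?case by (rule continuous_on_eq) (use S pdl_add_cmult[OF V(1) _ gk] in auto)
next
 case (upper a b)
 have c: "continuous_on S (\<lambda>p. f (snd p) $ a $ b)" if f: "smooth_on V f" for f :: "_ => real^'a^'a" and a b
 proof -
  have "continuous_on V (\<lambda>z. f z $ a $ b)"
   using f smooth_on_mat[OF V(1)] smooth_on_cont by blast
  then show ?thesis by (rule continuous_on_compose2[OF _ continuous_on_snd[OF continuous_on_id]]) (use S in auto)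
 qed
 have "continuous_on S (\<lambda>p. matrix_inv (perturb g k (fst p) (snd p)) $ a $ b)"
 proof (rule continuous_on_matrix_inv)
  show "continuous_on S (\<lambda>p. perturb g k (fst p) (snd p) $ a $ b)" for a b
   by simp (intro continuous_on_add continuous_on_mult c V continuous_on_fst continuous_on_id)
 qed (use S in auto)
 then show ?case by (simp add: case_prod_unfold)
next
 case (add F G)
 then show ?case by (simp add: case_prod_unfold continuous_on_add)
next
 case (mult F G)
 then show ?case by (simp add: case_prod_unfold continuous_on_mult)
qed

lemma regular_on_perturb:
 assumes "regular_on V g" "smooth_on V k" "csupp V k"
 shows "\<exists>\<delta>>0. \<forall>e. \<bar>e\<bar> < \<delta> --> regular_on V (perturb g k e)"
proof -
 have o: "open V" and g: "smooth_on V g" using assms(1) by (auto simp: regular_on_def)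
 obtain K where K: "compact K" "K \<subseteq> V" "\<forall>z\<in>V - K. k z = 0" using assms(3) by (auto simp: csupp_def)
 have c: "continuous_on K g" "continuous_on K k"
  using smooth_on_cont[OF g] smooth_on_cont[OF assms(2)] K(2) continuous_on_subset by blast+
 have "\<exists>\<delta>>0. \<forall>e z. \<bar>e\<bar> < \<delta> \<and> z \<in> K --> det (g z + e *\<^sub>R k z) ~= 0"
  by (rule compact_perturb[OF K(1) c det_open]) (use assms(1) K in \<open>auto simp: regular_on_def\<close>)
 then obtain \<delta> where \<delta>: "\<delta> > 0" "!!e z. \<bar>e\<bar> < \<delta> ==> z \<in> K ==> det (perturb g k e z) ~= 0" by blast
 show ?thesis
 proof (intro exI[of _ \<delta>] conjI \<delta>(1) allI impI)
  fix e :: real assume e: "\<bar>e\<bar> < \<delta>"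
  have "det (perturb g k e z) ~= 0" if "z \<in> V" for z
  proof (cases "z \<in> K")
   case False
   then have "k z = 0" using K that by auto
   then show ?thesis using assms(1) that by (simp add: regular_on_def)
  qed (rule \<delta>(2)[OF e])
  moreover have "smooth_on V (perturb g k e)"
   unfolding smooth_on_mat[OF o]
   by simp (use g assms(2) smooth_on_mat[OF o] in \<open>intro allI smooth_on_add smooth_on_mult o smooth_on_const; blast\<close>)
  ultimately show "regular_on V (perturb g k e)" using o by (simp add: regular_on_def)
 qed
qed

text \<open>\<open>E\<close> is the Euler-Lagrange expression, with upper indices because
  \<open>g\<close> with lower indices is varied. It is tested by symmetric fields \<open>k\<close>;
  its own symmetry is demanded so that these determine it. \<open>change\<close> subtracts the
  unperturbed integrand, as \<open>metric_variation\<close> does.\<close>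

definition first_variation :: "'i::finite lagrangian => ('i => 'i => 'i lagrangian) => bool" where
 "first_variation F E \<longleftrightarrow> (\<forall>a b. jet_poly (E a b)) \<and> (\<forall>a b. E a b = E b a) \<and>
  (\<forall>V g k. test_pair V g k \<and> (\<forall>z\<in>V. transpose (k z) = k z) -->
   ((\<lambda>e. integral V (\<lambda>z. change F g k e z)) has_real_derivative pairing V E g k) (at 0))"

lemma euler_lagrange:
 fixes F :: "'i::finite lagrangian"
 assumes "jet_poly F"
 shows "\<exists>E. first_variation F E"
proof -
 from jet_poly_variation_vol[OF assms] obtain T where T: "jet_op T"
  "\<forall>S g k x e. open S \<and> smooth_on S g \<and> smooth_on S k \<and> x \<in> S \<and> det (perturb g k e x) ~= 0 -->
   ((\<lambda>e. vol (perturb g k e) x * F (perturb g k e) x) has_real_derivative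
    vol (perturb g k e) x * diffop T (perturb g k e) k x) (at e)" by (elim exE conjE)
 from diffop_adjoint[OF T(1)] obtain E where E: "\<forall>a b. jet_poly (E a b)" "\<forall>V g k. test_pair V g k -->
  integral V (\<lambda>z. vol g z * diffop T g k z) = pairing V E g k" by (elim exE conjE)
 \<comment> \<open>Symmetrising does not alter the contraction with a symmetric
   \<open>k\<close>.\<close>
 let ?E = "\<lambda>a b g z. 1/2 * (E a b g z + E b a g z)"
 have "((\<lambda>e. integral V (\<lambda>z. change F g k e z)) has_real_derivative pairing V ?E g k) (at 0)"
  if r: "regular_on V g" "smooth_on V k" "csupp V k" "\<forall>z\<in>V. transpose (k z) = k z" for V g k
 proof -
  have o: "open V" and g: "smooth_on V g" using r by (auto simp: regular_on_def)
  obtain K where K: "compact K" "K \<subseteq> V" "\<forall>z\<in>V - K. k z = 0" using r(3) by (auto simp: csupp_def)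
  have oK: "open (V - K)" using K o by (simp add: compact_imp_closed open_Diff)
  obtain \<delta> where \<delta>: "\<delta> > 0" "!!e. \<bar>e\<bar> < \<delta> ==> regular_on V (perturb g k e)"
   using regular_on_perturb[OF r(1-3)] by auto
  have "((\<lambda>e. integral V (\<lambda>z. change F g k e z))
    has_real_derivative integral V (\<lambda>z. vol (perturb g k 0) z * diffop T (perturb g k 0) k z)) (at 0)"
  proof (rule csupp_integral_derivative[OF o K(1,2) \<delta>(1)])
   fix e z assume e: "\<bar>e\<bar> < \<delta>" "z \<in> V - K"
   have "F (perturb g k e) z = F g z" by (rule jet_poly_cong_open[OF assms oK e(2)]) (use K in auto)
   then show "change F g k e z = 0"
    using K e by simp
   show "vol (perturb g k e) z * diffop T (perturb g k e) k z = 0"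
    using diffop_eq_0[OF oK e(2)] K(3) by simp
  next
   fix e assume e: "\<bar>e\<bar> < \<delta>"
   show "continuous_on V (\<lambda>z. change F g k e z)"
    by (intro smooth_on_cont smooth_on_diff smooth_on_mult o smooth_on_vol jet_poly_smooth assms \<delta>(2) e r)
   fix z assume z: "z \<in> K"
   have "det (perturb g k e z) ~= 0" using \<delta>(2)[OF e] z K(2) by (auto simp: regular_on_def)
   then have "((\<lambda>e. vol (perturb g k e) z * F (perturb g k e) z) has_real_derivative
    vol (perturb g k e) z * diffop T (perturb g k e) k z) (at e)"
    using T(2) o g r(2) z K(2) by blast
   from DERIV_diff[OF this DERIV_const]
   show "((\<lambda>e. change F g k e z) has_real_derivative
    vol (perturb g k e) z * diffop T (perturb g k e) k z) (at e)" by simp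
  next
   let ?S = "{-\<delta><..<\<delta>} \<times> V"
   have S: "z \<in> V \<and> det (perturb g k e z) ~= 0" if "(e, z) \<in> ?S" for e z
    using that \<delta>(2)[of e] by (auto simp: regular_on_def)
   have jc: "continuous_on ?S (\<lambda>p. c (perturb g k (fst p)) (snd p))" if "jet_poly c" for c
   proof -
    have "continuous_on ?S (\<lambda>(e, z). c (perturb g k e) z)" by (rule jet_poly_continuous[OF that o g r(2)]) (rule S)
    then show ?thesis by (simp add: case_prod_unfold)
   qed
   have k: "smooth_on V (\<lambda>y. k y $ a $ b)" for a b using r(2) smooth_on_mat[OF o] by blast
   have ck: "continuous_on ?S (\<lambda>p. pdl I (\<lambda>y. k y $ a $ b) (snd p))" for I a b
    by (rule continuous_on_compose2[OF smooth_on_cont[OF smooth_on_pdl[OF k]] continuous_on_snd[OF continuous_on_id]]) auto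
   have "continuous_on ?S (\<lambda>p. diffop T (perturb g k (fst p)) k (snd p))"
    using T(1)
   proof (induction T)
    case (Cons t T)
    obtain c I a b where t: "t = (c, I, a, b)" by (cases t)
    have c: "jet_poly c" and T: "jet_op T" using Cons.prems t by (auto simp: jet_op_def)
    have "continuous_on ?S (\<lambda>p. c (perturb g k (fst p)) (snd p) * pdl I (\<lambda>y. k y $ a $ b) (snd p) + diffop T (perturb g k (fst p)) k (snd p))"
     by (intro continuous_on_add continuous_on_mult ck jc[OF c] Cons.IH[OF T])
    then show ?case by (simp add: t diffop_def)
   qed (simp add: diffop_def)
   moreover have "continuous_on ?S (\<lambda>p. vol (perturb g k (fst p)) (snd p))"
    by (intro continuous_on_real_sqrt continuous_on_rabs jc[OF jet_poly_det])
   ultimately show "continuous_on ?S (\<lambda>(e, z). vol (perturb g k e) z * diffop T (perturb g k e) k z)"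
    unfolding case_prod_unfold by (intro continuous_on_mult)
  qed
  moreover have "integral V (\<lambda>z. vol (perturb g k 0) z * diffop T (perturb g k 0) k z) = pairing V E g k"
   using E(2) r by simp
  moreover have "... = pairing V ?E g k"
  proof (rule integral_cong)
   fix z assume "z \<in> V"
   then have "transpose (k z) = k z" using r(4) by blast
   then have sym: "k z $ a $ b = k z $ b $ a" for a b by (auto simp: transpose_def vec_eq_iff)
   have "contract ?E g k z =
    1/2 * contract E g k z + 1/2 * (\<Sigma> a b. E b a g z * k z $ a $ b)"
    by (simp add: sum_distrib_left sum.distrib algebra_simps)
   also have "(\<Sigma> a b. E b a g z * k z $ a $ b) = contract E g k z" by (subst sum.swap) (simp add: sym)
   finally show "vol g z * contract E g k z =
    vol g z * contract ?E g k z" by simp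
  qed
  ultimately show ?thesis by (simp only:)
 qed
 moreover have "\<forall>a b. jet_poly (?E a b)"
  using E(1) by (intro allI jet_poly_cmult jet_poly.add) auto
 moreover have "\<forall>a b. ?E a b = ?E b a" by (simp add: add.commute)
 ultimately have "first_variation F ?E" unfolding first_variation_def by blast
 then show ?thesis by blast
qed

section \<open>Lorentzian matrices\<close>

lemma symmetric_matrix_entry: "transpose A = A ==> A $ i $ j = A $ j $ i" by (auto simp: transpose_def vec_eq_iff)

lemma congruence_entry:
 fixes A P :: "real^'i::finite^'i"
 shows "(transpose P ** A ** P) $ i $ j = column i P \<bullet> (A *v column j P)"
 by (simp add: matrix_matrix_mult_def transpose_def column_def inner_vec_def matrix_vector_mult_def
   sum_distrib_left sum_distrib_right mult.assoc) (rule sum.swap)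

lemma inner_congruence:
 fixes A P :: "real^'i::finite^'i"
 shows "v \<bullet> ((transpose P ** A ** P) *v w) = (P *v v) \<bullet> (A *v (P *v w))"
 by (metis dot_lmul_matrix matrix_vector_mul_assoc vector_transpose_matrix)

lemma symmetric_congruence:
 fixes A P :: "real^'i::finite^'i"
 assumes "transpose A = A"
 shows "transpose (transpose P ** A ** P) = transpose P ** A ** P" by (simp add: matrix_transpose_mul matrix_mul_assoc assms)

lemma axis_matrix_axis:
 fixes A :: "real^'i::finite^'i"
 shows "axis i x \<bullet> (A *v axis j y) = x * A $ i $ j * y"
proof -
 have "(A *v axis j y) $ i = A $ i $ j * y"
  by (simp add: matrix_vector_mult_def axis_def if_distrib[of "\<lambda>c. _ * c"] cong: if_cong)
 then show ?thesis by (simp add: inner_axis')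
qed

lemma invertible_injI:
 fixes P :: "real^'i::finite^'i"
 assumes "!!v. P *v v = 0 ==> v = 0"
 shows "invertible P"
 using assms by (metis invertible_left_inverse matrix_left_invertible_ker)

lemma invertible_ker:
 fixes P :: "real^'i::finite^'i"
 assumes "invertible P" "P *v v = 0"
 shows "v = 0"
 using assms by (metis invertible_left_inverse matrix_left_invertible_ker)

lemma riemannian_congruence:
 fixes A P :: "real^'i::finite^'i"
 assumes "riemannian A" "invertible P"
 shows "riemannian (transpose P ** A ** P)"
 unfolding riemannian_def
proof (intro conjI allI impI)
 show "transpose (transpose P ** A ** P) = transpose P ** A ** P"
  using assms(1) by (intro symmetric_congruence) (simp add: riemannian_def)
 fix v :: "real^'i" assume "v ~= 0"
 then have "P *v v ~= 0" using invertible_ker[OF assms(2)] by blast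
 then show "v \<bullet> ((transpose P ** A ** P) *v v) > 0"
  unfolding inner_congruence using assms(1) by (simp add: riemannian_def)
qed

lemma riemannian_diag_pos:
 assumes "riemannian A"
 shows "A $ t $ t > 0"
proof -
 have "axis t 1 \<bullet> (A *v axis t 1) > 0"
  using assms by (simp add: riemannian_def axis_eq_0_iff)
 then show ?thesis by (simp add: axis_matrix_axis)
qed

text \<open>One step of Gram-Schmidt: basis vector \<open>t\<close> is normalised and its component
  is removed from the others, which leaves the Schur complement in the remaining entries.\<close>

lemma riemannian_pivot:
 fixes A :: "real^'i::finite^'i"
 assumes "riemannian A"
 shows "\<exists>Q :: real^'i^'i. invertible Q \<and> (\<forall>i j. (transpose Q ** A ** Q) $ i $ j =
  (if i = t then (if j = t then 1 else 0) else if j = t then 0 else A $ i $ j - A $ i $ t * A $ j $ t / A $ t $ t))"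
proof -
 have a: "A $ t $ t > 0" by (rule riemannian_diag_pos[OF assms])
 have sym: "A $ i $ j = A $ j $ i" for i j
  using assms by (intro symmetric_matrix_entry) (simp add: riemannian_def)
 define q where "q c = (if c = t then axis t (1 / sqrt (A $ t $ t)) else axis c 1 - axis t (A $ c $ t / A $ t $ t))" for c
 define Q :: "real^'i^'i" where "Q = (\<chi> r c. q c $ r)"
 have col: "column c Q = q c" for c by (simp add: Q_def column_def vec_eq_iff)
 have "invertible Q"
 proof (rule invertible_injI)
  fix v assume v: "Q *v v = 0"
  have Qv: "(Q *v v) $ r = (\<Sigma> c. q c $ r * v $ c)" for r by (simp add: Q_def matrix_vector_mult_def)
  have r: "v $ r = 0" if "r ~= t" for r
  proof -
   have "(\<Sigma> c. q c $ r * v $ c) = (\<Sigma> c. if c = r then v $ c else 0)"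
    by (rule sum.cong) (use that in "auto simp: q_def axis_def")
   then show ?thesis using Qv[of r] v by simp
  qed
  have "(\<Sigma> c. q c $ t * v $ c) = (\<Sigma> c. if c = t then v $ c / sqrt (A $ t $ t) else 0)"
   by (rule sum.cong) (use r in "auto simp: q_def axis_def")
  then have "v $ t = 0" using Qv[of t] v a by simp
  with r show "v = 0" by (metis vec_eq_iff zero_index)
 qed
 moreover have "(transpose Q ** A ** Q) $ i $ j =
  (if i = t then (if j = t then 1 else 0) else if j = t then 0 else A $ i $ j - A $ i $ t * A $ j $ t / A $ t $ t)" for i j
  unfolding congruence_entry col q_def using a
  by (auto simp: axis_matrix_axis inner_diff_left inner_diff_right matrix_vector_mult_diff_distrib sym field_simps)
 ultimately show ?thesis by blast
qed

lemma riemannian_normal_form: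
 fixes A :: "real^'i::finite^'i"
 assumes "riemannian A"
 shows "\<exists>P :: real^'i^'i. invertible P \<and> transpose P ** A ** P = mat 1"
proof -
 have "\<exists>P :: real^'i^'i. invertible P \<and> (\<forall>i\<in>I. \<forall>j. (transpose P ** A ** P) $ i $ j = (if i = j then 1 else 0))" if "finite I" for I
  using that
 proof (induction I)
  case empty
  have "invertible (mat 1 :: real^'i^'i)" by (simp add: invertible_det_nz)
  then show ?case by blast
 next
  case (insert t I)
  then obtain P :: "real^'i^'i" where P: "invertible P" "\<forall>i\<in>I. \<forall>j. (transpose P ** A ** P) $ i $ j = (if i = j then 1 else 0)" by blast
  let ?B = "transpose P ** A ** P"
  have rB: "riemannian ?B" by (rule riemannian_congruence[OF assms P(1)])
  obtain Q :: "real^'i^'i" where Q: "invertible Q" "\<forall>i j. (transpose Q ** ?B ** Q) $ i $ j =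
   (if i = t then (if j = t then 1 else 0) else if j = t then 0 else ?B $ i $ j - ?B $ i $ t * ?B $ j $ t / ?B $ t $ t)"
   using riemannian_pivot[OF rB] by blast
  have eq: "transpose (P ** Q) ** A ** (P ** Q) = transpose Q ** ?B ** Q" by (simp add: matrix_transpose_mul matrix_mul_assoc)
  \<comment> \<open>Rows already treated have entry 0 in column \<open>t\<close>, so the pivot does
    not disturb them.\<close>
  have "\<forall>i\<in>insert t I. \<forall>j. (transpose (P ** Q) ** A ** (P ** Q)) $ i $ j = (if i = j then 1 else 0)"
   unfolding eq Q(2)[rule_format] using P(2) insert.hyps by auto
  moreover have "invertible (P ** Q)" using P(1) Q(1) by (rule invertible_mult)
  ultimately show ?case by blast
 qed
 from this[OF finite, of UNIV] show ?thesis by (auto simp: mat_def vec_eq_iff)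
qed

lemma riemannian_det: "riemannian (A :: real^'i::finite^'i) ==> det A ~= 0"
 using riemannian_normal_form[of A] by (metis det_I det_mul mult_zero_left mult_zero_right zero_neq_one)

abbreviation minkowski :: "'i::finite => real^'i^'i" where
 "minkowski t \<equiv> (\<chi> a b. if a = b then (if a = t then - 1 else 1) else 0)"

lemma lorentzianE:
 fixes A :: "real^'i::finite^'i"
 assumes "lorentzian A"
 obtains P :: "real^'i^'i" and t where "transpose A = A" "invertible P" "transpose P ** A ** P = minkowski t"
 using assms unfolding lorentzian_def by blast

lemma lorentzian_congruence:
 fixes A P :: "real^'i::finite^'i"
 assumes "lorentzian A" "invertible P"
 shows "lorentzian (transpose P ** A ** P)"
proof -
 obtain Q :: "real^'i^'i" and t where A: "transpose A = A" and Q: "invertible Q" "transpose Q ** A ** Q = minkowski t"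
  using assms(1) by (rule lorentzianE)
 obtain P' :: "real^'i^'i" where P': "P ** P' = mat 1" "P' ** P = mat 1" using assms(2) by (auto simp: invertible_def)
 have "transpose (P' ** Q) ** (transpose P ** A ** P) ** (P' ** Q) = transpose Q ** transpose (P ** P') ** A ** (P ** P') ** Q"
  by (simp add: matrix_transpose_mul matrix_mul_assoc)
 also have "... = transpose Q ** A ** Q" by (simp add: P' transpose_mat)
 moreover have "invertible P'" using P' by (auto simp: invertible_def)
 ultimately show ?thesis
  unfolding lorentzian_def using Q(2) invertible_mult[OF _ Q(1)] symmetric_congruence[OF A]
  by (intro conjI exI[of _ "P' ** Q"] exI[of _ t]) auto
qed

lemma lorentzian_congruence_iff:
 fixes A P :: "real^'i::finite^'i"
 assumes "invertible P"
 shows "lorentzian (transpose P ** A ** P) \<longleftrightarrow> lorentzian A"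
proof
 obtain P' :: "real^'i^'i" where P': "P ** P' = mat 1" "P' ** P = mat 1" using assms by (auto simp: invertible_def)
 assume "lorentzian (transpose P ** A ** P)"
 moreover have "invertible P'" using P' by (auto simp: invertible_def)
 ultimately have "lorentzian (transpose P' ** (transpose P ** A ** P) ** P')" by (rule lorentzian_congruence)
 also have "transpose P' ** (transpose P ** A ** P) ** P' = transpose (P ** P') ** A ** (P ** P')"
  by (simp add: matrix_transpose_mul matrix_mul_assoc)
 finally show "lorentzian A" by (simp add: P' transpose_mat)
qed (rule lorentzian_congruence[OF _ assms])

lemma lorentzian_det:
 fixes A :: "real^'i::finite^'i"
 assumes "lorentzian A"
 shows "det A ~= 0"
proof -
 obtain P :: "real^'i^'i" and t where "transpose A = A" and P: "invertible P" "transpose P ** A ** P = minkowski t"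
  using assms by (rule lorentzianE)
 have "det (minkowski t :: real^'i^'i) = (\<Prod>a\<in>UNIV. if a = t then -1 else 1)" by (subst det_diagonal) auto
 then have "det (transpose P ** A ** P) ~= 0" unfolding P(2) by simp
 then show ?thesis by (simp add: det_mul)
qed

text \<open>Flipping the sign of \<open>A\<close> on the line spanned by a timelike vector gives a
 positive definite form exactly for Lorentzian \<open>A\<close>; positivity is an open condition.\<close>
lemma lorentzian_of_riemannian:
 fixes M :: "real^'i::finite^'i"
 assumes sym: "transpose M = M" and neg: "M $ t $ t < 0"
  and r: "riemannian (\<chi> i j. M $ i $ j - 2 * M $ i $ t * M $ j $ t / M $ t $ t)"
 shows "lorentzian M"
proof -
 let ?R = "(\<chi> i j. M $ i $ j - 2 * M $ i $ t * M $ j $ t / M $ t $ t) :: real^'i^'i"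
 obtain Q :: "real^'i^'i" where Q: "invertible Q" "transpose Q ** ?R ** Q = mat 1" using riemannian_normal_form[OF r] by blast
 obtain Q' :: "real^'i^'i" where Q': "Q ** Q' = mat 1" "Q' ** Q = mat 1" using Q(1) by (auto simp: invertible_def)
 let ?e = "axis t 1 :: real^'i"
 \<comment> \<open>In the frame \<open>Q\<close> the flipped form is the Euclidean product and the
   timelike line is spanned by \<open>u\<close>; a rotation taking the axis \<open>t\<close> to the
   direction of \<open>u\<close> then diagonalises \<open>M\<close>.\<close>
 define u where "u = Q' *v ?e"
 have Qu: "Q *v u = ?e" by (simp add: u_def matrix_vector_mul_assoc Q')
 have RM: "v \<bullet> (?R *v w) = v \<bullet> (M *v w) - 2 * (v \<bullet> (M *v ?e)) * (w \<bullet> (M *v ?e)) / M $ t $ t" for v w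
 proof -
  define m where "m = M *v ?e"
  have m: "m $ i = M $ i $ t" for i
   by (simp add: m_def matrix_vector_mult_def axis_def if_distrib[of "\<lambda>c. _ * c"] cong: if_cong)
  have "v \<bullet> (?R *v w) = (\<Sigma> i j. v $ i * (M $ i $ j * w $ j) - 2 / M $ t $ t * ((v $ i * m $ i) * (w $ j * m $ j)))"
   by (simp add: inner_vec_def matrix_vector_mult_def sum_distrib_left algebra_simps diff_divide_distrib m)
  also have "... = v \<bullet> (M *v w) - 2 / M $ t $ t * ((\<Sigma> i. v $ i * m $ i) * (\<Sigma> j. w $ j * m $ j))"
   by (simp only: sum_subtractf sum_distrib_left[symmetric] sum_product inner_vec_def matrix_vector_mult_def
    vec_lambda_beta inner_real_def)
  finally show ?thesis by (simp add: inner_vec_def m_def[symmetric])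
 qed
 have id: "v \<bullet> w = (Q *v v) \<bullet> (?R *v (Q *v w))" for v w
  using inner_congruence[of v Q ?R w] by (simp add: Q(2))
 have eMe: "?e \<bullet> (M *v ?e) = M $ t $ t" by (simp add: axis_matrix_axis)
 have uu: "u \<bullet> u = - M $ t $ t"
  using neg unfolding id[of u u] Qu RM eMe by (simp add: field_simps)
 have vu: "v \<bullet> u = - ((Q *v v) \<bullet> (M *v ?e))" for v
  using neg unfolding id[of v u] Qu RM eMe by (simp add: field_simps)
 have nu: "norm u = sqrt (- M $ t $ t)" using uu by (simp add: norm_eq_sqrt_inner)
 then have nu0: "norm u > 0" using neg by simp
 obtain R :: "real^'i^'i" where R: "orthogonal_matrix R" "R *v ?e = (1 / norm u) *\<^sub>R u"
  using orthogonal_matrix_exists_basis[of "(1 / norm u) *\<^sub>R u" t] nu0 by auto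
 have invR: "invertible R" using R(1) by (metis invertible_def orthogonal_matrix_def)
 have "transpose (Q ** R) ** M ** (Q ** R) = minkowski t"
 proof -
  have "(transpose (Q ** R) ** M ** (Q ** R)) $ a $ b = (if a = b then (if a = t then - 1 else 1) else 0)" for a b
  proof -
   let ?a = "axis a 1 :: real^'i" and ?b = "axis b 1 :: real^'i"
   have orth: "(R *v v) \<bullet> (R *v w) = v \<bullet> w" for v w
    using inner_congruence[of v R "mat 1" w] R(1) by (simp add: orthogonal_matrix_def)
   have "(transpose (Q ** R) ** M ** (Q ** R)) $ a $ b = ?a \<bullet> ((transpose (Q ** R) ** M ** (Q ** R)) *v ?b)"
    by (simp add: axis_matrix_axis)
   also have "... = (Q *v (R *v ?a)) \<bullet> (M *v (Q *v (R *v ?b)))" by (simp add: inner_congruence matrix_vector_mul_assoc)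
   also have "... = (Q *v (R *v ?a)) \<bullet> (?R *v (Q *v (R *v ?b))) + 2 * ((R *v ?a) \<bullet> u) * ((R *v ?b) \<bullet> u) / M $ t $ t"
    unfolding RM vu by simp
   also have "... = ?a \<bullet> ?b + 2 * ((R *v ?a) \<bullet> u) * ((R *v ?b) \<bullet> u) / M $ t $ t"
    by (simp add: id[symmetric] orth)
   also have "(R *v v) \<bullet> u = norm u * (v \<bullet> ?e)" for v
   proof -
    have "u = norm u *\<^sub>R (R *v ?e)" using R(2) nu0 by simp
    then have "(R *v v) \<bullet> u = norm u * ((R *v v) \<bullet> (R *v ?e))" by (metis inner_scaleR_right)
    then show ?thesis by (simp add: orth)
   qed
   moreover have "2 * (norm u * x) * (norm u * y) / M $ t $ t = - 2 * (x * y)" for x y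
   proof -
    have "norm u * norm u = - M $ t $ t" using nu neg by simp
    then have *: "2 * (norm u * x) * (norm u * y) = (- 2 * (x * y)) * M $ t $ t" by algebra
    have "M $ t $ t ~= 0" using neg by simp
    then show ?thesis unfolding * by (rule nonzero_mult_div_cancel_right)
   qed
   ultimately show ?thesis by (auto simp: inner_axis_axis)
  qed
  then show ?thesis by (simp add: vec_eq_iff)
 qed
 then show ?thesis
  unfolding lorentzian_def using sym invertible_mult[OF Q(1) invR] by blast
qed

text \<open>The quadratic form of the deviation has as many terms as there are index pairs, each
  product of two components is at most the squared norm; hence the square of the dimension in the
  bound.\<close>

lemma riemannian_near_mat_1:
 fixes C :: "real^'i::finite^'i"
 assumes sym: "transpose C = C"
  and near: "!!i j. \<bar>C $ i $ j - (if i = j then 1 else 0)\<bar> < 1 / (real CARD('i))\<^sup>2"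
 shows "riemannian C"
 unfolding riemannian_def
proof (intro conjI sym allI impI)
 fix v :: "real^'i" assume v: "v ~= 0"
 let ?n = "real CARD('i)"
 define D where "D i j = C $ i $ j - (if i = j then 1 else 0)" for i j
 have "v \<bullet> (C *v v) = (\<Sigma> i j. v $ i * D i j * v $ j + (if i = j then v $ i * v $ j else 0))"
  unfolding inner_vec_def matrix_vector_mult_def
  by (simp add: sum_distrib_left) (intro sum.cong refl, simp add: D_def algebra_simps)
 also have "... = (\<Sigma> i j. v $ i * D i j * v $ j) + v \<bullet> v" by (simp add: sum.distrib inner_vec_def)
 finally have *: "v \<bullet> (C *v v) = (\<Sigma> i j. v $ i * D i j * v $ j) + v \<bullet> v" .
 have "\<bar>\<Sigma> i j. v $ i * D i j * v $ j\<bar> <= (\<Sigma> i. \<bar>\<Sigma> j. v $ i * D i j * v $ j\<bar>)"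
  by (rule sum_abs)
 also have "... <= (\<Sum>i\<in>(UNIV::'i set). \<Sum>j\<in>(UNIV::'i set). \<bar>v $ i * D i j * v $ j\<bar>)"
  by (intro sum_mono sum_abs)
 also have "... < (\<Sum>i\<in>(UNIV::'i set). \<Sum>j\<in>(UNIV::'i set). (norm v)\<^sup>2 / ?n\<^sup>2)"
 proof (intro sum_strict_mono)
  fix i j
  have "\<bar>v $ i\<bar> * \<bar>v $ j\<bar> <= norm v * norm v" by (intro mult_mono component_le_norm_cart) auto
  then have "\<bar>v $ i * D i j * v $ j\<bar> <= (norm v * norm v) * \<bar>D i j\<bar>"
   by (simp add: abs_mult) (metis abs_ge_zero mult.assoc mult.commute mult_right_mono)
  also have "... < (norm v * norm v) * (1 / ?n\<^sup>2)"
   using near[of i j] v unfolding D_def by (intro mult_strict_left_mono) auto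
  finally show "\<bar>v $ i * D i j * v $ j\<bar> < (norm v)\<^sup>2 / ?n\<^sup>2" by (simp add: power2_eq_square)
 qed auto
 also have "... = (norm v)\<^sup>2" by (simp add: power2_eq_square)
 finally have "\<bar>\<Sigma> i j. v $ i * D i j * v $ j\<bar> < v \<bullet> v" by (simp add: power2_norm_eq_inner)
 then show "v \<bullet> (C *v v) > 0" unfolding * by linarith
qed

lemma lorentzian_open:
 fixes A :: "real^'i::finite^'i"
 assumes "lorentzian A"
 shows "\<exists>e>0. \<forall>B. dist B A < e --> transpose B = B --> lorentzian B"
proof -
 obtain P :: "real^'i^'i" and t where "transpose A = A" and P: "invertible P" "transpose P ** A ** P = minkowski t"
  using assms by (rule lorentzianE)
 define M where "M B = transpose P ** B ** P" for B
 \<comment> \<open>\<open>C B\<close> is the flipped form of \<open>B\<close> in a frame where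
   \<open>A\<close> is \<open>minkowski t\<close>. It depends continuously on \<open>B\<close> near
   \<open>A\<close> and is the identity at \<open>A\<close>.\<close>
 define C where "C B i j = M B $ i $ j - 2 * M B $ i $ t * M B $ j $ t / M B $ t $ t" for B i j
 have cM: "isCont (\<lambda>B. M B $ i $ j) A" for i j
  unfolding M_def matrix_matrix_mult_def isCont_def vec_lambda_beta by (intro tendsto_intros tendsto_vec_nth)
 have MA: "M A $ i $ j = (if i = j then (if i = t then - 1 else 1) else 0)" for i j
  unfolding M_def P(2) by simp
 have "isCont (\<lambda>B. C B i j) A" for i j
  unfolding C_def by (intro continuous_intros cM) (simp add: MA)
 note cC = this
 have CA: "C A i j = (if i = j then 1 else 0)" for i j by (simp add: C_def MA)
 have "((\<lambda>B. C B i j) \<longlongrightarrow> (if i = j then 1 else 0)) (nhds A)" for i j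
  using cC unfolding CA[symmetric] isCont_def by (rule iffD1[OF tendsto_at_iff_tendsto_nhds])
 then have "\<forall>\<^sub>F B in nhds A. \<forall>i j. \<bar>C B i j - (if i = j then 1 else 0)\<bar> < 1 / (real CARD('i))\<^sup>2"
  by (auto simp: eventually_all_finite tendsto_iff dist_real_def)
 moreover have "\<forall>\<^sub>F B in nhds A. M B $ t $ t < 0"
 proof -
  have "((\<lambda>B. M B $ t $ t) \<longlongrightarrow> M A $ t $ t) (nhds A)"
   using cM unfolding isCont_def by (rule iffD1[OF tendsto_at_iff_tendsto_nhds])
  then show ?thesis by (rule order_tendstoD) (simp add: MA)
 qed
 ultimately have "\<forall>\<^sub>F B in nhds A. transpose B = B --> lorentzian B"
 proof eventually_elim
  case (elim B)
  show ?case
  proof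
   assume B: "transpose B = B"
   then have s: "transpose (M B) = M B" unfolding M_def by (rule symmetric_congruence)
   have "riemannian (\<chi> i j. C B i j)"
   proof (rule riemannian_near_mat_1)
    have "M B $ i $ j = M B $ j $ i" for i j by (rule symmetric_matrix_entry[OF s])
    then show "transpose (\<chi> i j. C B i j) = (\<chi> i j. C B i j)"
     by (simp add: transpose_def vec_eq_iff C_def mult.commute mult.left_commute)
   qed (use elim in simp)
   then have "lorentzian (M B)"
    unfolding C_def by (rule lorentzian_of_riemannian[OF s elim(2)])
   then show "lorentzian B"
    unfolding M_def lorentzian_congruence_iff[OF P(1)] .
  qed
 qed
 then show ?thesis by (simp add: eventually_nhds_metric)
qed

section \<open>Covariance of Euler-Lagrange expressions\<close>

lemma pullback_nth:
 assumes "\<phi> differentiable (at x)"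
 shows "pullback \<phi> g x $ a $ b = (\<Sigma> c d. jac \<phi> x $ c $ a * jac \<phi> x $ d $ b * g (\<phi> x) $ c $ d)"
 by (simp add: pullback_def jac_def pd_component[OF assms])

lemma pullback_eq:
 assumes "\<phi> differentiable (at x)"
 shows "pullback \<phi> g x = transpose (jac \<phi> x) ** g (\<phi> x) ** jac \<phi> x"
 unfolding vec_eq_iff congruence_entry pullback_nth[OF assms]
 by (simp add: column_def inner_vec_def matrix_vector_mult_def sum_distrib_left mult.assoc mult.commute[of "g _ $ _ $ _"])

lemma pullback_perturb: "pullback \<phi> (perturb g k e) = perturb (pullback \<phi> g) (pullback \<phi> k) e"
proof (intro ext, unfold vec_eq_iff, intro allI)
 fix x a b
 show "pullback \<phi> (perturb g k e) x $ a $ b = perturb (pullback \<phi> g) (pullback \<phi> k) e x $ a $ b"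
  unfolding pullback_def by (simp add: distrib_left sum.distrib sum_distrib_left mult.left_commute[of _ e])
qed

lemma smooth_on_entry:
 fixes A :: "real^'i::finite => real^'j::finite^'k::finite"
 shows "open S ==> smooth_on S A ==> smooth_on S (\<lambda>x. A x $ a $ b)" by (simp add: smooth_on_mat)

lemma smooth_on_pullback:
 assumes "open V" "open W" "smooth_on V \<phi>" "\<phi> ` V \<subseteq> W" "smooth_on W g"
 shows "smooth_on V (pullback \<phi> g)"
proof -
 have j: "smooth_on V (\<lambda>x. jac \<phi> x $ a $ b)" for a b
  using smooth_on_jac[OF assms(1,3)] smooth_on_mat[OF assms(1)] by blast
 have "smooth_on V (\<lambda>x. g (\<phi> x) $ c $ d)" for c d
  by (rule smooth_on_entry[OF assms(1) smooth_on_compose_mat[OF assms]])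
 then have "smooth_on V (\<lambda>x. \<Sigma> c d. jac \<phi> x $ c $ a * jac \<phi> x $ d $ b * g (\<phi> x) $ c $ d)" for a b
  by (intro smooth_on_sum smooth_on_mult assms(1) j)
 then have "smooth_on V (\<lambda>x. pullback \<phi> g x $ a $ b)" for a b
  by (subst smooth_on_cong[OF assms(1)]) (auto simp: pullback_nth smooth_on_D[OF assms(3)])
 then show ?thesis by (simp add: smooth_on_mat[OF assms(1)])
qed

lemma symmetric_pullback:
 assumes "\<phi> differentiable (at x)" "transpose (g (\<phi> x)) = g (\<phi> x)"
 shows "transpose (pullback \<phi> g x) = pullback \<phi> g x"
 unfolding pullback_eq[OF assms(1)] by (rule symmetric_congruence[OF assms(2)])

lemma csupp_pullback:
 assumes "diffeomorphic_map V W \<phi>" "csupp W f" "!!x. x \<in> V ==> f (\<phi> x) = 0 ==> h x = 0"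
 shows "csupp V h"
proof -
 have o: "open V" "open W" and bij: "bij_betw \<phi> V W" and sm: "smooth_on W (inv_into V \<phi>)"
  using assms(1) by (auto simp: diffeomorphic_map_def)
 obtain K where K: "compact K" "K \<subseteq> W" "!!z. z \<in> W - K ==> f z = 0"
  using assms(2) by (auto simp: csupp_def)
 have "compact (inv_into V \<phi> ` K)"
  using K smooth_on_cont[OF sm] by (meson compact_continuous_image continuous_on_subset)
 moreover have "inv_into V \<phi> ` K \<subseteq> V"
  using bij K(2) by (auto simp: bij_betw_def intro: inv_into_into)
 moreover have "h x = 0" if x: "x \<in> V - inv_into V \<phi> ` K" for x
 proof -
  have "inv_into V \<phi> (\<phi> x) = x" using x bij by (auto simp: bij_betw_def)
  then have "\<phi> x \<notin> K" using x by force
  then have "f (\<phi> x) = 0" using x bij K(3) by (auto simp: bij_betw_def)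
  then show ?thesis using assms(3) x by blast
 qed
 ultimately show ?thesis unfolding csupp_def by blast
qed

text \<open>Lagrangians are assumed covariant on Lorentzian metrics only, so perturbed metrics must
  stay Lorentzian before covariance may be used.\<close>

lemma lorentzian_perturb:
 assumes o: "open W" and g: "smooth_on W g" and l: "\<forall>z\<in>W. lorentzian (g z)"
  and k: "smooth_on W k" "csupp W k" "\<forall>z\<in>W. transpose (k z) = k z"
 shows "\<exists>\<delta>>0. \<forall>e. \<bar>e\<bar> < \<delta> --> (\<forall>z\<in>W. lorentzian (perturb g k e z))"
proof -
 obtain K where K: "compact K" "K \<subseteq> W" "\<forall>z\<in>W - K. k z = 0" using k(2) by (auto simp: csupp_def)
 have c: "continuous_on K g" "continuous_on K k"
  using smooth_on_cont[OF g] smooth_on_cont[OF k(1)] K(2) continuous_on_subset by blast+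
 have "\<exists>\<delta>>0. \<forall>e z. \<bar>e\<bar> < \<delta> \<and> z \<in> K --> (transpose (g z + e *\<^sub>R k z) = g z + e *\<^sub>R k z --> lorentzian (g z + e *\<^sub>R k z))"
  by (rule compact_perturb[OF K(1) c lorentzian_open]) (use l K in auto)
 then obtain \<delta> where \<delta>: "\<delta> > 0" "!!e z. \<bar>e\<bar> < \<delta> ==> z \<in> K ==> transpose (g z + e *\<^sub>R k z) = g z + e *\<^sub>R k z ==> lorentzian (g z + e *\<^sub>R k z)"
  by blast
 have "lorentzian (perturb g k e z)" if "\<bar>e\<bar> < \<delta>" "z \<in> W" for e z
 proof (cases "z \<in> K")
  case True
  have "transpose (g z) = g z" using l that(2) by (auto simp: lorentzian_def)
  then have "transpose (g z + e *\<^sub>R k z) = g z + e *\<^sub>R k z"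
   using k(3) that(2) by (auto simp: transpose_def vec_eq_iff)
  then show ?thesis using \<delta>(2) that(1) True by blast
 next
  case False
  then show ?thesis using K(3) l that(2) by simp
 qed
 with \<delta>(1) show ?thesis by blast
qed

lemma first_variation_jet_poly: "first_variation F E ==> jet_poly (E a b)" by (simp add: first_variation_def)

lemma first_variation_symmetric: "first_variation F E ==> E a b = E b a"
 unfolding first_variation_def by blast

lemma regular_on_lorentzian:
 "open W ==> smooth_on W g ==> \<forall>z\<in>W. lorentzian (g z) ==> regular_on W g" by (simp add: regular_on_def lorentzian_det)

lemma vol_pullback:
 assumes "\<phi> differentiable (at x)"
 shows "vol (pullback \<phi> g) x = \<bar>det (jac \<phi> x)\<bar> * vol g (\<phi> x)"
proof -
 have "\<bar>det (pullback \<phi> g x)\<bar> = \<bar>det (jac \<phi> x)\<bar>\<^sup>2 * \<bar>det (g (\<phi> x))\<bar>"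
  by (simp add: pullback_eq[OF assms] det_mul det_transpose abs_mult power2_eq_square)
 then show ?thesis by (simp add: real_sqrt_mult)
qed

lemma csupp_variation_integrand:
 assumes F: "jet_poly F" and o: "open W" and k: "csupp W k"
 shows "csupp W (\<lambda>z. change F g k e z)"
proof -
 obtain K where K: "compact K" "K \<subseteq> W" "\<forall>z\<in>W - K. k z = 0" using k by (auto simp: csupp_def)
 have oK: "open (W - K)" using K o by (simp add: compact_imp_closed open_Diff)
 have "F (perturb g k e) z = F g z" if "z \<in> W - K" for z by (rule jet_poly_cong_open[OF F oK that]) (use K in auto)
 then have "\<forall>z\<in>W - K. change F g k e z = 0"
  using K(3) by simp
 with K show ?thesis unfolding csupp_def by blast
qed

text \<open>For small \<open>e\<close> the change of the action on \<open>W\<close> equals that of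
  the pulled back metrics on \<open>V\<close>, by change of variables and covariance of
  \<open>L\<close>. Both pairings are derivatives at 0 of this one function of
  \<open>e\<close>.\<close>

lemma first_variation_integral_pullback:
 fixes L :: "'i::finite lagrangian"
 assumes L: "covariant_scalar n L" and F: "jet_poly F"
  and FL: "!!S g x. regular_on S g ==> x \<in> S ==> L g x = F g x"
  and E: "first_variation F E" and \<phi>: "diffeomorphic_map V W \<phi>"
  and g: "smooth_on W g" "\<forall>z\<in>W. lorentzian (g z)"
  and k: "smooth_on W k" "csupp W k" "\<forall>z\<in>W. transpose (k z) = k z"
 shows "pairing W E g k = pairing V E (pullback \<phi> g) (pullback \<phi> k)"
proof -
 have o: "open V" "open W" and bij: "bij_betw \<phi> V W" and sm: "smooth_on V \<phi>"
  using \<phi> by (auto simp: diffeomorphic_map_def)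
 have im: "\<phi> ` V \<subseteq> W" "!!x. x \<in> V ==> \<phi> x \<in> W" using bij by (auto simp: bij_betw_def)
 have d: "\<phi> differentiable (at x)" if "x \<in> V" for x using smooth_on_D[OF sm that] .
 have invJ: "invertible (jac \<phi> x)" if "x \<in> V" for x
  using diffeomorphic_map_jac(2)[OF \<phi> that] by (simp add: invertible_det_nz)
 let ?g = "pullback \<phi> g" and ?k = "pullback \<phi> k"
 have sg: "smooth_on V (pullback \<phi> h)" if "smooth_on W h" for h by (rule smooth_on_pullback[OF o sm im(1) that])
 have lor: "\<forall>x\<in>V. lorentzian (pullback \<phi> h x)" if "\<forall>z\<in>W. lorentzian (h z)" for h
  using that im invJ by (simp add: pullback_eq[OF d] lorentzian_congruence_iff)
 have k': "smooth_on V ?k" "csupp V ?k" "\<forall>x\<in>V. transpose (?k x) = ?k x"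
  using sg[OF k(1)] csupp_pullback[OF \<phi> k(2), of ?k] symmetric_pullback[OF d] k(3) im
  by (auto simp: vec_eq_iff pullback_nth[OF d])
 have rW: "regular_on W g" by (rule regular_on_lorentzian[OF o(2) g])
 have rV: "regular_on V ?g" by (rule regular_on_lorentzian[OF o(1) sg[OF g(1)] lor[OF g(2)]])
 let ?fW = "\<lambda>e z. change F g k e z"
 let ?fV = "\<lambda>e z. change F ?g ?k e z"
 have 1: "((\<lambda>e. integral W (?fW e)) has_real_derivative pairing W E g k) (at 0)"
  using E rW k unfolding first_variation_def by blast
 have 2: "((\<lambda>e. integral V (?fV e)) has_real_derivative pairing V E ?g ?k) (at 0)"
  using E rV k' unfolding first_variation_def by blast
 obtain \<delta> where \<delta>: "\<delta> > 0" "\<forall>e. \<bar>e\<bar> < \<delta> --> (\<forall>z\<in>W. lorentzian (perturb g k e z))"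
  using lorentzian_perturb[OF o(2) g k] by blast
 have sp: "smooth_on W (perturb g k e)" for e
  unfolding smooth_on_mat[OF o(2)]
  by simp (use g(1) k(1) smooth_on_mat[OF o(2)] in \<open>intro allI smooth_on_add smooth_on_mult o smooth_on_const; blast\<close>)
 have Fcov: "F (pullback \<phi> h) x = F h (\<phi> x)" if h: "smooth_on W h" "\<forall>z\<in>W. lorentzian (h z)" and x: "x \<in> V" for h x
 proof -
  have "L (pullback \<phi> h) x = L h (\<phi> x)"
   using L \<phi> h x unfolding covariant_scalar_def by blast
  moreover have "L (pullback \<phi> h) x = F (pullback \<phi> h) x"
   by (rule FL[OF regular_on_lorentzian[OF o(1) sg[OF h(1)] lor[OF h(2)]] x])
  moreover have "L h (\<phi> x) = F h (\<phi> x)" by (rule FL[OF regular_on_lorentzian[OF o(2) h] im(2)[OF x]])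
  ultimately show ?thesis by simp
 qed
 have eq: "integral W (?fW e) = integral V (?fV e)" if e: "e \<in> {-\<delta><..<\<delta>}" for e
 proof -
  have l: "\<forall>z\<in>W. lorentzian (perturb g k e z)" using \<delta>(2) e by (simp add: abs_less_iff)
  have "continuous_on W (?fW e)" by (intro smooth_on_cont smooth_on_diff smooth_on_mult o smooth_on_vol jet_poly_smooth F rW
     regular_on_lorentzian[OF o(2) sp l])
  then have "integral W (?fW e) = integral V (\<lambda>x. \<bar>det (jac \<phi> x)\<bar> * ?fW e (\<phi> x))"
   by (rule integral_diffeomorphism[OF \<phi> _ csupp_variation_integrand[OF F o(2) k(2)]])
  also have "... = integral V (?fV e)"
  proof (rule integral_cong)
   fix x assume x: "x \<in> V"
   have "vol (perturb ?g ?k e) x = \<bar>det (jac \<phi> x)\<bar> * vol (perturb g k e) (\<phi> x)"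
    using vol_pullback[OF d[OF x], of "perturb g k e"] by (simp add: pullback_perturb)
   moreover have "F (perturb ?g ?k e) x = F (perturb g k e) (\<phi> x)"
    unfolding pullback_perturb[symmetric] by (rule Fcov[OF sp l x])
   ultimately show "\<bar>det (jac \<phi> x)\<bar> * ?fW e (\<phi> x) = ?fV e x"
    by (simp add: vol_pullback[OF d[OF x]] Fcov[OF g x] algebra_simps)
  qed
  finally show ?thesis .
 qed
 have "((\<lambda>e. integral V (?fV e)) has_real_derivative pairing W E g k) (at 0)"
  by (rule has_field_derivative_transform_within_open[OF 1, of "{-\<delta><..<\<delta>}"]) (use \<delta>(1) eq in auto)
 then show ?thesis using 2 DERIV_unique by blast
qed

text \<open>For \<open>c = d\<close> the entry is twice \<open>f\<close>; thereby
  \<open>sum_sym_test\<close> holds without a case distinction.\<close>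

definition sym_test :: "'i => 'i => (real^'i::finite => real) => real^'i => real^'i^'i" where
 "sym_test c d f z = (\<chi> a b. f z * ((if a = c \<and> b = d then 1 else 0) + (if a = d \<and> b = c then 1 else 0)))"

lemma smooth_on_sym_test: "open W ==> smooth_on W f ==> smooth_on W (sym_test c d f)"
 unfolding smooth_on_mat sym_test_def by (simp add: smooth_on_mult)

lemma csupp_sym_test: "csupp W f ==> csupp W (sym_test c d f)" by (erule csupp_cong) (simp add: sym_test_def vec_eq_iff)

lemma symmetric_sym_test: "transpose (sym_test c d f z) = sym_test c d f z"
proof -
 have "sym_test c d f z $ a $ b = sym_test c d f z $ b $ a" for a b
  by (cases "a = c"; cases "b = d"; cases "a = d"; cases "b = c") (simp_all add: sym_test_def)
 then show ?thesis unfolding transpose_def vec_eq_iff vec_lambda_beta by blast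
qed

lemma sum_sym_test: "(\<Sigma> a b. Q a b * sym_test c d f z $ a $ b) = f z * (Q c d + Q d c)"
proof -
 have "(\<Sigma> a b. Q a b * sym_test c d f z $ a $ b) =
  (\<Sigma> a b. (if a = c then if b = d then f z * Q a b else 0 else 0) + (if a = d then if b = c then f z * Q a b else 0 else 0))"
  by (intro sum.cong refl) (simp add: sym_test_def)
 also have "... = (\<Sigma> a. (if a = c then f z * Q a d else 0) + (if a = d then f z * Q a c else 0))"
  by (rule sum.cong) (auto simp: sum.distrib)
 also have "... = f z * (Q c d + Q d c)" by (simp add: sum.distrib algebra_simps)
 finally show ?thesis .
qed

text \<open>Invariance of the pairing under diffeomorphisms is tested with fields concentrated in a
  single pair of entries; the fundamental lemma turns the integral identity into the pointwise law
  for upper indices.\<close>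

theorem first_variation_covariant:
 fixes L :: "'i::finite lagrangian"
 assumes L: "covariant_scalar n L" and F: "jet_poly F"
  and FL: "!!S g x. regular_on S g ==> x \<in> S ==> L g x = F g x"
  and E: "first_variation F E" and \<phi>: "diffeomorphic_map V W \<phi>"
  and g: "smooth_on W g" "\<forall>z\<in>W. lorentzian (g z)" and x: "x \<in> V"
 shows "E c d g (\<phi> x) = (\<Sigma> a b. jac \<phi> x $ c $ a * jac \<phi> x $ d $ b * E a b (pullback \<phi> g) x)"
proof -
 have o: "open V" "open W" and bij: "bij_betw \<phi> V W" and sm: "smooth_on V \<phi>" "smooth_on W (inv_into V \<phi>)"
  using \<phi> by (auto simp: diffeomorphic_map_def)
 have im: "\<phi> ` V \<subseteq> W" "!!x. x \<in> V ==> \<phi> x \<in> W" "inv_into V \<phi> ` W \<subseteq> V" "!!x. x \<in> V ==> inv_into V \<phi> (\<phi> x) = x"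
  using bij by (auto simp: bij_betw_def inv_into_into)
 have df: "\<phi> differentiable (at x)" if "x \<in> V" for x using smooth_on_D[OF sm(1) that] .
 let ?g = "pullback \<phi> g"
 have rW: "regular_on W g" by (rule regular_on_lorentzian[OF o(2) g])
 have rV: "regular_on V ?g"
 proof (rule regular_on_lorentzian[OF o(1) smooth_on_pullback[OF o sm(1) im(1) g(1)]])
  show "\<forall>x\<in>V. lorentzian (?g x)"
   using g(2) im diffeomorphic_map_jac(2)[OF \<phi>] by (simp add: pullback_eq[OF df] lorentzian_congruence_iff invertible_det_nz)
 qed
 define T where "T x = (\<Sigma> a b. jac \<phi> x $ c $ a * jac \<phi> x $ d $ b * E a b ?g x)" for x
 have Tsm: "smooth_on V T"
 proof -
  have j: "smooth_on V (\<lambda>x. jac \<phi> x $ a $ b)" for a b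
   using smooth_on_jac[OF o(1) sm(1)] smooth_on_mat[OF o(1)] by blast
  show ?thesis unfolding T_def
   by (intro smooth_on_sum smooth_on_mult o(1) j jet_poly_smooth[OF first_variation_jet_poly[OF E] rV])
 qed
 \<comment> \<open>The defect of the transformation law, moved to \<open>W\<close> and weighted with
   the density so that its integrals against test functions are differences of pairings.\<close>
 define D where "D w = vol g w * (E c d g w - T (inv_into V \<phi> w))" for w
 have Tc: "smooth_on W (\<lambda>w. T (inv_into V \<phi> w))" by (rule smooth_on_compose[OF o(2) sm(2) im(3) Tsm])
 have Esm: "smooth_on W (\<lambda>w. E c d g w)" by (rule jet_poly_smooth[OF first_variation_jet_poly[OF E] rW])
 note vsm = smooth_on_vol[OF rW]
 have "D (\<phi> x) = 0"
 proof (rule fundamental_lemma[OF o(2)])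
  show "continuous_on W D"
   unfolding D_def by (intro smooth_on_cont smooth_on_mult smooth_on_diff o(2) vsm Esm Tc)
  show "\<phi> x \<in> W" using im(2) x .
  fix f :: "real^'i => real" assume f: "smooth_on UNIV f" "compact (closure {z. f z ~= 0})" "closure {z. f z ~= 0} \<subseteq> W"
  have fW: "smooth_on W f" using f(1) smooth_on_subset by blast
  have csf: "csupp W f"
   unfolding csupp_def using f(2,3) closure_subset[of "{z. f z ~= 0}"] by blast
  let ?k = "sym_test c d f"
  have k: "smooth_on W ?k" "csupp W ?k" "\<forall>z\<in>W. transpose (?k z) = ?k z"
   using smooth_on_sym_test[OF o(2) fW] csupp_sym_test[OF csf] symmetric_sym_test by blast+
  note pair = sum_sym_test
  have Es: "E a b h z = E b a h z" for a b h z by (rule fun_cong[OF fun_cong[OF first_variation_symmetric[OF E]]])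
  have 1: "pairing W E g ?k =
   2 * integral W (\<lambda>z. vol g z * E c d g z * f z)"
   unfolding pair Es[of d c] integral_mult_right[symmetric] by (rule integral_cong) simp
  have "pairing V E ?g (pullback \<phi> ?k) =
   integral V (\<lambda>x. \<bar>det (jac \<phi> x)\<bar> * (vol g (\<phi> x) * (2 * (T (inv_into V \<phi> (\<phi> x)) * f (\<phi> x)))))"
  proof (rule integral_cong)
   fix x assume x: "x \<in> V"
   have "pullback \<phi> ?k x $ a $ b = f (\<phi> x) * (jac \<phi> x $ c $ a * jac \<phi> x $ d $ b + jac \<phi> x $ d $ a * jac \<phi> x $ c $ b)" for a b
    unfolding pullback_nth[OF df[OF x]] pair ..
   then have "contract E ?g (pullback \<phi> ?k) x =
    f (\<phi> x) * (T x + (\<Sigma> a b. jac \<phi> x $ c $ b * jac \<phi> x $ d $ a * E b a ?g x))"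
    unfolding T_def sum.distrib[symmetric] sum_distrib_left by (intro sum.cong refl) (simp add: Es[of _ _ ?g x] algebra_simps)
   also have "(\<Sigma> a b. jac \<phi> x $ c $ b * jac \<phi> x $ d $ a * E b a ?g x) = T x"
    unfolding T_def by (rule sum.swap)
   finally show "vol ?g x * contract E ?g (pullback \<phi> ?k) x =
    \<bar>det (jac \<phi> x)\<bar> * (vol g (\<phi> x) * (2 * (T (inv_into V \<phi> (\<phi> x)) * f (\<phi> x))))"
    by (simp add: vol_pullback[OF df[OF x]] im(4)[OF x])
  qed
  also have "... = integral W (\<lambda>w. vol g w * (2 * (T (inv_into V \<phi> w) * f w)))"
  proof (rule integral_diffeomorphism[OF \<phi>, symmetric])
   show "continuous_on W (\<lambda>w. vol g w * (2 * (T (inv_into V \<phi> w) * f w)))"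
    by (intro smooth_on_cont smooth_on_mult o(2) vsm Tc fW smooth_on_const)
   show "csupp W (\<lambda>w. vol g w * (2 * (T (inv_into V \<phi> w) * f w)))" by (intro csupp_mult_left csf)
  qed
  also have "... = 2 * integral W (\<lambda>w. vol g w * T (inv_into V \<phi> w) * f w)"
   unfolding integral_mult_right[symmetric] by (rule integral_cong) simp
  finally have eq: "integral W (\<lambda>z. vol g z * E c d g z * f z) = integral W (\<lambda>w. vol g w * T (inv_into V \<phi> w) * f w)"
   using first_variation_integral_pullback[OF L F FL E \<phi> g k] 1 by simp
  have "integral W (\<lambda>z. D z * f z) = integral W (\<lambda>z. vol g z * E c d g z * f z - vol g z * T (inv_into V \<phi> z) * f z)"
   by (simp add: D_def algebra_simps)
  also have "... = integral W (\<lambda>z. vol g z * E c d g z * f z) - integral W (\<lambda>z. vol g z * T (inv_into V \<phi> z) * f z)"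
   by (intro integral_diff csupp_integrable[OF o(2)] smooth_on_cont smooth_on_mult o(2) vsm Esm Tc fW csupp_mult_left csf)
  finally show "integral W (\<lambda>z. D z * f z) = 0" using eq by simp
 qed
 moreover have "vol g (\<phi> x) ~= 0"
  using rW im(2)[OF x] by (simp add: regular_on_def)
 ultimately show ?thesis by (simp add: D_def T_def im(4)[OF x])
qed

text \<open>The fundamental lemma identifies the given \<open>H\<close> with the Euler-Lagrange
  expressions. They have upper indices, hence the two factors \<open>g\<close>; the sign is that of
  varying the inverse metric.\<close>

lemma metric_variation_eq:
 fixes L :: "'m => 'i::finite lagrangian"
 assumes mv: "metric_variation V g (\<lambda>g z. \<Sum>n\<in>A. c n * L n g z) H"
  and V: "open V" and g: "smooth_on V g" "\<forall>z\<in>V. lorentzian (g z)"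
  and F: "!!n. n \<in> A ==> jet_poly (F n)"
  and FL: "!!n S g x. n \<in> A ==> regular_on S g ==> x \<in> S ==> L n g x = F n g x"
  and E: "!!n. n \<in> A ==> first_variation (F n) (E n)"
  and z: "z \<in> V"
 shows "H z $ a $ b = - (\<Sigma> p q. g z $ a $ p * g z $ b $ q * (\<Sum>n\<in>A. c n * E n p q g z))"
proof -
 have H: "smooth_on V H" "\<forall>z\<in>V. transpose (H z) = H z" using mv by (auto simp: metric_variation_def)
 have rV: "regular_on V g" by (rule regular_on_lorentzian[OF V g])
 \<comment> \<open>\<open>H\<close> with both indices raised, the form in which it meets the test
   field.\<close>
 define U where "U p q z = (\<Sigma> a b. H z $ a $ b * matrix_inv (g z) $ a $ p * matrix_inv (g z) $ b $ q)" for p q z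
 define T where "T p q z = (\<Sum>n\<in>A. c n * E n p q g z)" for p q z
 have Usym: "U q p z = U p q z" if "z \<in> V" for p q z
  unfolding U_def by (subst sum.swap) (simp add: symmetric_matrix_entry[OF H(2)[rule_format, OF that]] mult.commute mult.left_commute)
 have Usm: "smooth_on V (U p q)" for p q
 proof -
  have "smooth_on V (\<lambda>z. matrix_inv (g z) $ a $ b)" for a b
   using jet_poly_smooth[OF jet_poly.upper rV] .
  then show ?thesis
   unfolding U_def by (intro smooth_on_sum smooth_on_mult V smooth_on_entry[OF V H(1)])
 qed
 have Tsm: "smooth_on V (T p q)" for p q
  unfolding T_def by (intro smooth_on_sum smooth_on_mult V smooth_on_const jet_poly_smooth[OF first_variation_jet_poly[OF E] rV])
 note vsm = smooth_on_vol[OF rV]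
 have Tsym: "T q p z = T p q z" for p q z
  unfolding T_def using first_variation_symmetric[OF E] by (metis (no_types, lifting) sum.cong)
 have UT: "U p q z = - T p q z" for p q
 proof -
  have "vol g z * (U p q z + T p q z) = 0"
  proof (rule fundamental_lemma[OF V _ _ z])
   show "continuous_on V (\<lambda>z. vol g z * (U p q z + T p q z))"
    by (intro smooth_on_cont smooth_on_mult smooth_on_add V vsm Usm Tsm)
   fix f :: "real^'i => real" assume f: "smooth_on UNIV f" "compact (closure {z. f z ~= 0})" "closure {z. f z ~= 0} \<subseteq> V"
   let ?k = "sym_test p q f"
   let ?h = "\<lambda>e z. vol (perturb g ?k e) z * (\<Sum>n\<in>A. c n * L n (perturb g ?k e) z) - vol g z * (\<Sum>n\<in>A. c n * L n g z)"
   let ?H = "\<lambda>z. (\<Sigma> a b. \<Sigma> c d. H z $ a $ b * matrix_inv (g z) $ a $ c * matrix_inv (g z) $ b $ d * ?k z $ c $ d)"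
   let ?E = "\<lambda>n z. contract (E n) g ?k z"
   have fV: "smooth_on V f" using f(1) smooth_on_subset by blast
   have csf: "csupp V f"
    unfolding csupp_def using f(2,3) closure_subset[of "{z. f z ~= 0}"] by blast
   have k: "smooth_on V ?k" "csupp V ?k" "\<forall>z\<in>V. transpose (?k z) = ?k z"
    using smooth_on_sym_test[OF V fV] csupp_sym_test[OF csf] symmetric_sym_test by blast+
   have "?k z = 0" if "f z = 0" for z using that by (simp add: sym_test_def vec_eq_iff)
   then have "{z. ?k z ~= 0} \<subseteq> {z. f z ~= 0}" by blast
   then have cl: "closure {z. ?k z ~= 0} \<subseteq> closure {z. f z ~= 0}" by (rule closure_mono)
   then have "closure {z. f z ~= 0} \<inter> closure {z. ?k z ~= 0} = closure {z. ?k z ~= 0}" by (rule inf_absorb2)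
   then have "compact (closure {z. ?k z ~= 0})"
    using compact_Int_closed[OF f(2) closed_closure, of "{z. ?k z ~= 0}"] by simp
   then have D1: "((\<lambda>e. LINT z:V|lborel. ?h e z)
     has_real_derivative - (LINT z:V|lborel. vol g z * ?H z)) (at 0)"
    using mv smooth_on_sym_test[OF open_UNIV f(1)] symmetric_sym_test cl f(3)
    unfolding metric_variation_def by blast
   \<comment> \<open>\<open>L n\<close> and \<open>F n\<close> are known to agree on regular
     metrics, so \<open>e\<close> must be small enough for the perturbed metric to be
     regular.\<close>
   obtain \<delta> where \<delta>: "\<delta> > 0" "\<forall>e. \<bar>e\<bar> < \<delta> --> regular_on V (perturb g ?k e)"
    using regular_on_perturb[OF rV k(1,2)] by blast
   let ?f = "\<lambda>n e z. change (F n) g ?k e z"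
   have eqint: "(LINT z:V|lborel. ?h e z)
    = (\<Sum>n\<in>A. c n * integral V (?f n e))" if e: "e \<in> {-\<delta><..<\<delta>}" for e
   proof -
    have r: "regular_on V (perturb g ?k e)" using \<delta>(2) e by (simp add: abs_less_iff)
    have co: "continuous_on V (?f n e)" if "n \<in> A" for n
     by (intro smooth_on_cont smooth_on_diff smooth_on_mult V smooth_on_vol jet_poly_smooth F that rV r)
    have cs: "csupp V (?f n e)" if "n \<in> A" for n by (rule csupp_variation_integrand[OF F[OF that] V k(2)])
    have "(LINT z:V|lborel. ?h e z)
     = (LINT z:V|lborel. (\<Sum>n\<in>A. c n * ?f n e z))"
    proof (rule set_lebesgue_integral_cong)
     show "V \<in> sets lborel" using V by simp
     have "?h e z
      = (\<Sum>n\<in>A. c n * ?f n e z)" if "z \<in> V" for z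
     proof -
      have "L n (perturb g ?k e) z = F n (perturb g ?k e) z" "L n g z = F n g z" if "n \<in> A" for n
       using FL[OF that r \<open>z \<in> V\<close>] FL[OF that rV \<open>z \<in> V\<close>] by simp_all
      then have "(\<Sum>n\<in>A. c n * L n (perturb g ?k e) z) = (\<Sum>n\<in>A. c n * F n (perturb g ?k e) z)"
       "(\<Sum>n\<in>A. c n * L n g z) = (\<Sum>n\<in>A. c n * F n g z)" by simp_all
      then show ?thesis by (simp add: sum_distrib_left right_diff_distrib sum_subtractf mult.left_commute)
     qed
     then show "\<forall>z. z \<in> V --> ?h e z
      = (\<Sum>n\<in>A. c n * ?f n e z)" by blast
    qed
    also have "... = integral V (\<lambda>z. \<Sum>n\<in>A. c n * ?f n e z)" by (rule csupp_lborel_integral[OF V])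
      (auto intro!: continuous_on_sum continuous_on_mult continuous_on_const co csupp_sum csupp_mult_left cs simp del: right_diff_distrib_numeral)
    also have "... = (\<Sum>n\<in>A. integral V (\<lambda>z. c n * ?f n e z))"
    proof (cases "finite A")
     case True
     show ?thesis by (rule integral_sum[OF True])
       (intro csupp_integrable[OF V] continuous_on_mult continuous_on_const co csupp_mult_left cs)
    qed simp
    finally show ?thesis by simp
   qed
   have "((\<lambda>e. \<Sum>n\<in>A. c n * integral V (?f n e)) has_real_derivative
    (\<Sum>n\<in>A. c n * integral V (\<lambda>z. vol g z * ?E n z))) (at 0)"
   proof (intro DERIV_sum DERIV_cmult)
    fix n assume "n \<in> A"
    from E[OF this] show "((\<lambda>e. integral V (?f n e)) has_real_derivative
     integral V (\<lambda>z. vol g z * ?E n z)) (at 0)"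
     using rV k unfolding first_variation_def by blast
   qed
   then have "((\<lambda>e. LINT z:V|lborel. ?h e z)
     has_real_derivative (\<Sum>n\<in>A. c n * integral V (\<lambda>z. vol g z * ?E n z))) (at 0)"
    by (rule has_field_derivative_transform_within_open[of _ _ _ "{-\<delta><..<\<delta>}"]) (use \<delta>(1) eqint in auto)
   from DERIV_unique[OF D1 this]
   have main: "- (LINT z:V|lborel. vol g z * ?H z)
    = (\<Sum>n\<in>A. c n * integral V (\<lambda>z. vol g z * ?E n z))" .
   have I1: "(LINT z:V|lborel. vol g z * ?H z)
    = integral V (\<lambda>z. 2 * (vol g z * U p q z * f z))"
   proof -
    have "(LINT z:V|lborel. vol g z * ?H z)
     = (LINT z:V|lborel. 2 * (vol g z * U p q z * f z))"
    proof (rule set_lebesgue_integral_cong)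
     show "V \<in> sets lborel" using V by simp
     have "?H z
      = f z * (U p q z + U q p z)" for z
      unfolding sum_sym_test U_def by (simp add: sum_distrib_left[symmetric] sum.distrib)
     then show "\<forall>z. z \<in> V --> vol g z * ?H z
      = 2 * (vol g z * U p q z * f z)"
      using Usym by simp
    qed
    also have "... = integral V (\<lambda>z. 2 * (vol g z * U p q z * f z))"
     by (intro csupp_lborel_integral[OF V] smooth_on_cont smooth_on_mult V smooth_on_const vsm Usm fV csupp_mult_left csf)
    finally show ?thesis .
   qed
   have I2: "(\<Sum>n\<in>A. c n * integral V (\<lambda>z. vol g z * ?E n z))
    = integral V (\<lambda>z. 2 * (vol g z * T p q z * f z))"
   proof -
    have int: "(\<lambda>z. c n * (vol g z * ?E n z)) integrable_on V" if "n \<in> A" for n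
     unfolding sum_sym_test by (intro csupp_integrable[OF V] smooth_on_cont smooth_on_mult smooth_on_add V smooth_on_const vsm fV
       jet_poly_smooth[OF first_variation_jet_poly[OF E[OF that]] rV] csupp_mult_left csupp_mult_right csf)
    have "(\<Sum>n\<in>A. c n * integral V (\<lambda>z. vol g z * ?E n z))
     = (\<Sum>n\<in>A. integral V (\<lambda>z. c n * (vol g z * ?E n z)))" by simp
    also have "... = integral V (\<lambda>z. \<Sum>n\<in>A. c n * (vol g z * ?E n z))"
    proof (cases "finite A")
     case True
     show ?thesis by (rule integral_sum[OF True int, symmetric])
    qed simp
    also have "... = integral V (\<lambda>z. 2 * (vol g z * T p q z * f z))"
    proof (rule integral_cong)
     fix z
     have "(\<Sum>n\<in>A. c n * (vol g z * ?E n z))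
      = vol g z * f z * (T p q z + T q p z)"
      unfolding sum_sym_test T_def sum.distrib[symmetric] sum_distrib_left by (rule sum.cong) (simp_all add: algebra_simps)
     then show "(\<Sum>n\<in>A. c n * (vol g z * ?E n z)) = 2 * (vol g z * T p q z * f z)"
      using Tsym[of q p z] by simp
    qed
    finally show ?thesis .
   qed
   have "integral V (\<lambda>z. vol g z * (U p q z + T p q z) * f z) = integral V (\<lambda>z. vol g z * U p q z * f z + vol g z * T p q z * f z)"
    by (simp add: algebra_simps)
   also have "... = integral V (\<lambda>z. vol g z * U p q z * f z) + integral V (\<lambda>z. vol g z * T p q z * f z)"
    by (intro integral_add csupp_integrable[OF V] smooth_on_cont smooth_on_mult V vsm Usm Tsm fV csupp_mult_left csf)
   also have "... = 0" using main I1 I2 by simp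
   finally show "integral V (\<lambda>z. vol g z * (U p q z + T p q z) * f z) = 0" .
  qed
  moreover have "vol g z ~= 0" using rV z by (simp add: regular_on_def)
  ultimately show ?thesis by simp
 qed
 have nz: "det (g z) ~= 0" using rV z by (simp add: regular_on_def)
 have gs: "transpose (g z) = g z" using g(2) z by (simp add: lorentzian_def)
 let ?I = "matrix_inv (g z)" and ?Um = "(\<chi> p q. U p q z) :: real^'i^'i"
 have "?Um = transpose ?I ** H z ** ?I"
  unfolding vec_eq_iff congruence_entry
  by (simp add: U_def column_def inner_vec_def matrix_vector_mult_def sum_distrib_left mult.assoc mult.left_commute)
 then have "transpose (g z) ** ?Um ** g z = transpose (?I ** g z) ** H z ** (?I ** g z)"
  by (simp add: matrix_transpose_mul matrix_mul_assoc)
 then have "H z = transpose (g z) ** ?Um ** g z" by (simp add: matrix_inv_left[OF nz] transpose_mat)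
 then have "H z $ a $ b = column a (g z) \<bullet> (?Um *v column b (g z))" by (metis congruence_entry)
 also have "... = (\<Sigma> p q. g z $ a $ p * g z $ b $ q * U p q z)"
 proof -
  have col: "column a (g z) $ p = g z $ a $ p" for a p
   unfolding column_def by simp (rule symmetric_matrix_entry[OF gs])
  have *: "g z $ a $ p * (U p q z * g z $ b $ q) = g z $ a $ p * g z $ b $ q * U p q z" for p q by simp
  show ?thesis by (simp add: inner_vec_def matrix_vector_mult_def col sum_distrib_left) (simp only: *)
 qed
 finally show ?thesis by (simp add: UT T_def sum_negf)
qed

section \<open>Norms of jets\<close>

text \<open>The jet norm at a point, summed over words of indices rather than multi-indices, so that
  every estimate is a plain recursion on the order.\<close>

primrec jn :: "nat => (real^'i::finite => real) => real^'i => real" where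
 "jn 0 f x = \<bar>f x\<bar>"
| "jn (Suc r) f x = \<bar>f x\<bar> + (\<Sigma> i. jn r (pd i f) x)"

lemma jn_nonneg: "jn r f x >= 0" by (induction r arbitrary: f) (auto intro!: add_nonneg_nonneg sum_nonneg)

lemma jn_cong:
 assumes "open S" "x \<in> S" "!!y. y \<in> S ==> f y = g y"
 shows "jn r f x = jn r g x"
 using assms(3)
proof (induction r arbitrary: f g)
 case (Suc r)
 have "jn r (pd i f) x = jn r (pd i g) x" for i by (rule Suc.IH) (rule pd_cong_open[OF assms(1) _ Suc.prems])
 then show ?case using Suc.prems[OF assms(2)] by simp
qed (use assms in simp)

lemma abs_le_jn: "\<bar>f x\<bar> <= jn r f x" by (cases r) (auto intro!: sum_nonneg jn_nonneg)

lemma jn_mono_Suc: "jn r f x <= jn (Suc r) f x"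
proof (induction r arbitrary: f)
 case 0
 show ?case by (simp add: sum_nonneg)
next
 case (Suc r)
 show ?case unfolding jn.simps(2)[of _ f] by (intro add_left_mono sum_mono Suc.IH)
qed

lemma jn_mono: "r <= r' ==> jn r f x <= jn r' f x" by (rule lift_Suc_mono_le[of "\<lambda>r. jn r f x"]) (rule jn_mono_Suc)

lemma jn_pd: "jn r (pd i f) x <= jn (Suc r) f x"
proof -
 have "jn r (pd i f) x <= (\<Sigma> i. jn r (pd i f) x)" by (rule member_le_sum) (auto intro: jn_nonneg)
 then show ?thesis by simp
qed

lemma jn_const [simp]: "jn r (\<lambda>y. c) x = \<bar>c\<bar>"
proof (induction r arbitrary: c)
 case (Suc r)
 have "pd i (\<lambda>y. c) = (\<lambda>y. 0)" for i :: 'a by (rule ext) simp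
 with Suc[of 0] show ?case by simp
qed simp

locale smooth_at_point =
 fixes S :: "(real^'i::finite) set" and x0 :: "real^'i"
 assumes S: "open S" "x0 \<in> S"
begin

lemma jn_cong_S: "(!!y. y \<in> S ==> f y = g y) ==> jn r f x0 = jn r g x0" by (rule jn_cong[OF S])

lemma jn_add:
 assumes "smooth_on S f" "smooth_on S g"
 shows "jn r (\<lambda>y. f y + g y) x0 <= jn r f x0 + jn r g x0"
 using assms
proof (induction r arbitrary: f g)
 case (Suc r)
 have "jn r (pd i (\<lambda>y. f y + g y)) x0 = jn r (\<lambda>y. pd i f y + pd i g y) x0" for i
  by (rule jn_cong_S) (rule pd_add[OF smooth_on_D[OF Suc.prems(1)] smooth_on_D[OF Suc.prems(2)]])
 also have "... i <= jn r (pd i f) x0 + jn r (pd i g) x0" for i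
  by (rule Suc.IH[OF smooth_on_pd[OF Suc.prems(1)] smooth_on_pd[OF Suc.prems(2)]])
 finally have "(\<Sigma> i. jn r (pd i (\<lambda>y. f y + g y)) x0) <= (\<Sigma> i. jn r (pd i f) x0) + (\<Sigma> i. jn r (pd i g) x0)"
  unfolding sum.distrib[symmetric] by (rule sum_mono)
 then show ?case using abs_triangle_ineq[of "f x0" "g x0"] by simp
qed (simp add: abs_triangle_ineq)

text \<open>One more order costs the value of the product and the two halves of the product rule,
  each at most \<open>4 ^ r\<close> times the product of the norms; three such terms fit into a
  further factor 4.\<close>

lemma jn_mult:
 assumes "smooth_on S f" "smooth_on S g"
 shows "jn r (\<lambda>y. f y * g y) x0 <= 4 ^ r * jn r f x0 * jn r g x0"
 using assms
proof (induction r arbitrary: f g)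
 case 0
 then show ?case by (simp add: abs_mult)
next
 case (Suc r)
 let ?A = "\<Sigma> i. jn r (pd i f) x0" and ?B = "\<Sigma> i. jn r (pd i g) x0"
 note pf = smooth_on_pd[OF Suc.prems(1)] and pg = smooth_on_pd[OF Suc.prems(2)]
 have AB: "?A >= 0" "?B >= 0" by (simp_all add: sum_nonneg jn_nonneg)
 have FG: "jn r f x0 <= \<bar>f x0\<bar> + ?A" "jn r g x0 <= \<bar>g x0\<bar> + ?B"
  using jn_mono_Suc[of r f x0] jn_mono_Suc[of r g x0] by simp_all
 have "jn r (pd i (\<lambda>y. f y * g y)) x0 <= 4 ^ r * (jn r f x0 * jn r (pd i g) x0 + jn r (pd i f) x0 * jn r g x0)" for i
 proof -
  have "jn r (pd i (\<lambda>y. f y * g y)) x0 = jn r (\<lambda>y. f y * pd i g y + pd i f y * g y) x0"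
   by (rule jn_cong_S) (rule pd_mult[OF smooth_on_D[OF Suc.prems(1)] smooth_on_D[OF Suc.prems(2)]])
  also have "... <= jn r (\<lambda>y. f y * pd i g y) x0 + jn r (\<lambda>y. pd i f y * g y) x0"
   by (intro jn_add smooth_on_mult S(1) Suc.prems pf pg)
  also have "... <= 4 ^ r * jn r f x0 * jn r (pd i g) x0 + 4 ^ r * jn r (pd i f) x0 * jn r g x0"
   by (intro add_mono Suc.IH Suc.prems pf pg)
  finally show ?thesis by (simp add: algebra_simps)
 qed
 then have "(\<Sigma> i. jn r (pd i (\<lambda>y. f y * g y)) x0) <= 4 ^ r * (jn r f x0 * ?B + ?A * jn r g x0)"
  unfolding sum_distrib_left sum_distrib_right sum.distrib[symmetric] by (rule sum_mono)
 also have "... <= 4 ^ r * ((\<bar>f x0\<bar> + ?A) * (\<bar>g x0\<bar> + ?B) + (\<bar>f x0\<bar> + ?A) * (\<bar>g x0\<bar> + ?B))"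
  using AB FG jn_nonneg by (intro mult_left_mono add_mono mult_mono) auto
 finally have 1: "(\<Sigma> i. jn r (pd i (\<lambda>y. f y * g y)) x0) <= 2 * 4 ^ r * ((\<bar>f x0\<bar> + ?A) * (\<bar>g x0\<bar> + ?B))"
  by simp
 have "\<bar>f x0 * g x0\<bar> <= 1 * ((\<bar>f x0\<bar> + ?A) * (\<bar>g x0\<bar> + ?B))"
  using AB by (simp add: abs_mult) (intro mult_mono; simp)
 also have "... <= 4 ^ r * ((\<bar>f x0\<bar> + ?A) * (\<bar>g x0\<bar> + ?B))"
  using AB by (intro mult_right_mono mult_nonneg_nonneg add_nonneg_nonneg) auto
 finally have 2: "\<bar>f x0 * g x0\<bar> <= 4 ^ r * ((\<bar>f x0\<bar> + ?A) * (\<bar>g x0\<bar> + ?B))" .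
 have 3: "0 <= 4 ^ r * ((\<bar>f x0\<bar> + ?A) * (\<bar>g x0\<bar> + ?B))"
  using AB by (intro mult_nonneg_nonneg add_nonneg_nonneg) auto
 show ?case using 1 2 3 unfolding jn.simps power_Suc by linarith
qed

lemma jn_cmult:
 assumes "smooth_on S f"
 shows "jn r (\<lambda>y. c * f y) x0 = \<bar>c\<bar> * jn r f x0"
 using assms
proof (induction r arbitrary: f)
 case (Suc r)
 have "jn r (pd i (\<lambda>y. c * f y)) x0 = jn r (\<lambda>y. c * pd i f y) x0" for i
  by (rule jn_cong_S) (rule pd_cmult[OF smooth_on_D[OF Suc.prems]])
 then show ?case
  using Suc.IH[OF smooth_on_pd[OF Suc.prems]] by (simp add: abs_mult sum_distrib_left algebra_simps)
qed (simp add: abs_mult)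

lemma jn_minus:
 assumes "smooth_on S f"
 shows "jn r (\<lambda>y. - f y) x0 = jn r f x0"
 using jn_cmult[OF assms, of r "-1"] by simp

lemma jn_diff:
 assumes "smooth_on S f" "smooth_on S g"
 shows "jn r (\<lambda>y. f y - g y) x0 <= jn r f x0 + jn r g x0"
 using jn_add[OF assms(1) smooth_on_minus[OF S(1) assms(2)]] jn_minus[OF assms(2)] by simp

lemma jn_sum:
 assumes "!!a. a \<in> A ==> smooth_on S (f a)"
 shows "jn r (\<lambda>y. \<Sum>a\<in>A. f a y) x0 <= (\<Sum>a\<in>A. jn r (f a) x0)"
 using assms
proof (induction A rule: infinite_finite_induct)
 case (insert a A)
 have "jn r (\<lambda>y. f a y + (\<Sum>a\<in>A. f a y)) x0 <= jn r (f a) x0 + jn r (\<lambda>y. \<Sum>a\<in>A. f a y) x0"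
  using insert by (intro jn_add smooth_on_sum S(1)) auto
 with insert show ?case by simp
qed auto

lemma jn_mult_bound:
 assumes "smooth_on S f" "smooth_on S g" "jn r f x0 <= A" "jn r g x0 <= B"
 shows "jn r (\<lambda>y. f y * g y) x0 <= 4 ^ r * A * B"
proof -
 have "4 ^ r * jn r f x0 * jn r g x0 <= 4 ^ r * A * B"
  using assms(3,4) jn_nonneg[of r f x0] jn_nonneg[of r g x0] by (intro mult_mono mult_nonneg_nonneg) auto
 then show ?thesis using jn_mult[OF assms(1,2), of r] by linarith
qed

text \<open>Vanishing at \<open>x0\<close> together with all derivatives up to order
  \<open>r\<close>, so that a Taylor expansion starts in degree r + 1.\<close>

definition flat :: "nat => (real^'i => real) => bool" where
 "flat r f \<longleftrightarrow> jn r f x0 = 0"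

lemma flat_Suc: "flat (Suc r) f \<longleftrightarrow> f x0 = 0 \<and> (\<forall>i. flat r (pd i f))"
proof -
 have "jn (Suc r) f x0 = 0 \<longleftrightarrow> \<bar>f x0\<bar> = 0 \<and> (\<Sigma> i. jn r (pd i f) x0) = 0"
  unfolding jn.simps by (intro add_nonneg_eq_0_iff) (auto intro: sum_nonneg jn_nonneg)
 also have "(\<Sigma> i. jn r (pd i f) x0) = 0 \<longleftrightarrow> (\<forall>i. jn r (pd i f) x0 = 0)"
  by (subst sum_nonneg_eq_0_iff) (auto intro: jn_nonneg)
 finally show ?thesis by (simp add: flat_def)
qed

lemma flat_0: "flat 0 f \<longleftrightarrow> f x0 = 0" by (simp add: flat_def)

lemma flat_value: "flat r f ==> f x0 = 0" by (cases r) (auto simp: flat_Suc flat_0)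

lemma flat_cong: "flat r f ==> (!!y. y \<in> S ==> f y = g y) ==> flat r g"
 using jn_cong_S[of f g r] by (simp add: flat_def)

lemma flat_mono: "flat r f ==> r' <= r ==> flat r' f"
 using jn_mono[of r' r f x0] jn_nonneg[of r' f x0] by (simp add: flat_def)

lemma flat_add: "smooth_on S f ==> smooth_on S g ==> flat r f ==> flat r g ==> flat r (\<lambda>y. f y + g y)"
 using jn_add[of f g r] jn_nonneg[of r "\<lambda>y. f y + g y" x0] by (simp add: flat_def)

lemma flat_diff: "smooth_on S f ==> smooth_on S g ==> flat r f ==> flat r g ==> flat r (\<lambda>y. f y - g y)"
 using jn_diff[of f g r] jn_nonneg[of r "\<lambda>y. f y - g y" x0] by (simp add: flat_def)

lemma flat_mult_left: "smooth_on S f ==> smooth_on S g ==> flat r g ==> flat r (\<lambda>y. f y * g y)"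
 using jn_mult[of f g r] jn_nonneg[of r "\<lambda>y. f y * g y" x0] by (simp add: flat_def)

lemma flat_mult_right: "smooth_on S f ==> smooth_on S g ==> flat r f ==> flat r (\<lambda>y. f y * g y)"
 using jn_mult[of f g r] jn_nonneg[of r "\<lambda>y. f y * g y" x0] by (simp add: flat_def)

lemma flat_sum: "(!!a. a \<in> A ==> smooth_on S (f a)) ==> (!!a. a \<in> A ==> flat r (f a)) ==> flat r (\<lambda>y. \<Sum>a\<in>A. f a y)"
 using jn_sum[of A f r] jn_nonneg[of r "\<lambda>y. \<Sum>a\<in>A. f a y" x0] by (simp add: flat_def)

lemma flat_cmult: "smooth_on S f ==> flat r f ==> flat r (\<lambda>y. c * f y)" by (simp add: flat_def jn_cmult)

text \<open>A factor that vanishes at the point raises the order by one: a derivative either falls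
  on \<open>u\<close> and the order of \<open>f\<close> suffices, or falls on \<open>f\<close> and
  the induction hypothesis applies.\<close>

lemma flat_mult_vanishing:
 assumes "smooth_on S u" "smooth_on S f" "u x0 = 0" "flat r f"
 shows "flat (Suc r) (\<lambda>y. u y * f y)"
 using assms(2,4)
proof (induction r arbitrary: f)
 case 0
 have "pd i (\<lambda>y. u y * f y) x0 = 0" for i
  using pd_mult[OF smooth_on_D[OF assms(1) S(2)] smooth_on_D[OF 0(1) S(2)]] assms(3) 0(2) by (simp add: flat_0)
 then show ?case by (simp add: flat_Suc flat_0 assms(3))
next
 case (Suc r)
 have "flat (Suc r) (pd i (\<lambda>y. u y * f y))" for i
 proof (rule flat_cong)
  show "flat (Suc r) (\<lambda>y. u y * pd i f y + pd i u y * f y)"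
  proof (rule flat_add)
   show "flat (Suc r) (\<lambda>y. u y * pd i f y)"
    using Suc.IH[OF smooth_on_pd[OF Suc.prems(1)]] Suc.prems(2) by (simp add: flat_Suc[of r f])
   show "flat (Suc r) (\<lambda>y. pd i u y * f y)" by (rule flat_mult_left[OF smooth_on_pd[OF assms(1)] Suc.prems])
  qed (intro smooth_on_mult S(1) smooth_on_pd Suc.prems assms(1))+
  show "u y * pd i f y + pd i u y * f y = pd i (\<lambda>y. u y * f y) y" if "y \<in> S" for y
   using pd_mult[OF smooth_on_D[OF assms(1) that] smooth_on_D[OF Suc.prems(1) that]] by simp
 qed
 then show ?case unfolding flat_Suc[of "Suc r"] using assms(3) by simp
qed

text \<open>The radial derivative centred at \<open>x0\<close>. On a polynomial in y - x0 that is
  homogeneous of degree k it is multiplication by k.\<close>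

definition euler :: "(real^'i => real) => real^'i => real" where
 "euler f y = (\<Sigma> c. (y $ c - x0 $ c) * pd c f y)"

lemma smooth_on_shift: "smooth_on S (\<lambda>y. y $ c - x0 $ c)" by (intro smooth_on_diff S(1) smooth_on_coord smooth_on_const)

lemma smooth_on_euler: "smooth_on S f ==> smooth_on S (euler f)"
 unfolding euler_def by (intro smooth_on_sum smooth_on_mult S(1) smooth_on_shift smooth_on_pd)

lemma euler_point: "euler f x0 = 0" by (simp add: euler_def)

lemma pd_shift: "pd i (\<lambda>y. y $ c - x0 $ c) y = (if i = c then 1 else 0)"
proof -
 have "pd i (\<lambda>y. y $ c - x0 $ c) y = pd i (\<lambda>y. y $ c) y - pd i (\<lambda>y. x0 $ c) y"
  by (rule pd_diff) (auto intro: bounded_linear_imp_differentiable bounded_linear_vec_nth)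
 then show ?thesis by simp
qed

lemma pd_shift_mult:
 assumes "smooth_on S f" "y \<in> S"
 shows "pd i (\<lambda>y. (y $ c - x0 $ c) * f y) y = (y $ c - x0 $ c) * pd i f y + (if i = c then f y else 0)"
 using pd_mult[OF smooth_on_D[OF smooth_on_shift assms(2)] smooth_on_D[OF assms], of i c] by (simp add: pd_shift)

lemma pd_euler:
 assumes f: "smooth_on S f" and y: "y \<in> S"
 shows "pd i (euler f) y = euler (pd i f) y + pd i f y"
proof -
 have "pd i (euler f) y = (\<Sigma> c. pd i (\<lambda>y. (y $ c - x0 $ c) * pd c f y) y)"
  unfolding euler_def by (rule pd_sum) (auto intro!: smooth_on_D[OF _ y] smooth_on_mult S(1) smooth_on_shift smooth_on_pd f)
 also have "... = (\<Sigma> c. (y $ c - x0 $ c) * pd c (pd i f) y + (if i = c then pd c f y else 0))"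
  by (intro sum.cong refl) (simp add: pd_shift_mult[OF smooth_on_pd[OF f] y] pd_commute[OF S(1) y f, of i])
 finally show ?thesis by (simp add: euler_def sum.distrib)
qed

lemma flat_euler: "smooth_on S f ==> flat r f ==> flat r (euler f)"
proof (cases r)
 case (Suc m)
 assume f: "smooth_on S f" "flat r f"
 then show ?thesis unfolding euler_def[abs_def] Suc
  by (intro flat_sum flat_mult_vanishing smooth_on_mult S(1) smooth_on_shift smooth_on_pd) (auto simp: Suc flat_Suc)
qed (simp add: flat_0 euler_point)

text \<open>The leading Taylor polynomial has degree r + 1 and is homogeneous, so it is an
  eigenvector of the radial derivative and cancels.\<close>

lemma flat_euler_homogeneous:
 assumes "smooth_on S f" "flat r f"
 shows "flat (Suc r) (\<lambda>y. euler f y - real (Suc r) * f y)"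
 using assms
proof (induction r arbitrary: f)
 case 0
 have "pd i (\<lambda>y. euler f y - real (Suc 0) * f y) x0 = 0" for i
 proof -
  have "pd i (\<lambda>y. euler f y - real (Suc 0) * f y) x0 = pd i (euler f) x0 - pd i f x0"
   using pd_diff[OF smooth_on_D[OF smooth_on_euler[OF 0(1)] S(2)] smooth_on_D[OF 0(1) S(2)]] by simp
  then show ?thesis by (simp add: pd_euler[OF 0(1) S(2)] euler_point)
 qed
 then show ?case using 0 by (simp add: flat_Suc flat_0 euler_point)
next
 case (Suc r)
 have "flat (Suc r) (pd i (\<lambda>y. euler f y - real (Suc (Suc r)) * f y))" for i
 proof (rule flat_cong[OF Suc.IH[OF smooth_on_pd[OF Suc.prems(1)]]])
  show "flat r (pd i f)" using Suc.prems(2) by (simp add: flat_Suc)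
  fix y assume y: "y \<in> S"
  note d = smooth_on_D[OF Suc.prems(1) y]
  have "pd i (\<lambda>y. euler f y - real (Suc (Suc r)) * f y) y = pd i (euler f) y - real (Suc (Suc r)) * pd i f y"
   using pd_diff[OF smooth_on_D[OF smooth_on_euler[OF Suc.prems(1)] y]
     smooth_on_D[OF smooth_on_mult[OF S(1) smooth_on_const Suc.prems(1)] y], of i] by (simp only: pd_cmult[OF d])
  then show "euler (pd i f) y - real (Suc r) * pd i f y = pd i (\<lambda>y. euler f y - real (Suc (Suc r)) * f y) y"
   by (simp add: pd_euler[OF Suc.prems(1) y] algebra_simps)
 qed
 then show ?case using flat_value[OF Suc.prems(2)] by (simp add: flat_Suc[of "Suc r"] euler_point)
qed

text \<open>At \<open>x0\<close> a derivative of order j of the right-hand function is j + m + 1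
  times that of \<open>f\<close>, and this factor is at least 1: the radial equation can be inverted
  without loss. Commuting with one derivative raises \<open>m\<close> by one, hence the general
  \<open>m\<close>.\<close>

lemma jn_le_euler:
 assumes "smooth_on S f"
 shows "jn r f x0 <= jn r (\<lambda>y. euler f y + real (Suc m) * f y) x0"
 using assms
proof (induction r arbitrary: f m)
 case 0
 show ?case by (simp add: euler_point abs_mult mult_le_cancel_right1)
next
 case (Suc r)
 have "jn r (pd i f) x0 <= jn r (pd i (\<lambda>y. euler f y + real (Suc m) * f y)) x0" for i
 proof -
  have "jn r (pd i f) x0 <= jn r (\<lambda>y. euler (pd i f) y + real (Suc (Suc m)) * pd i f y) x0"
   by (rule Suc.IH[OF smooth_on_pd[OF Suc.prems]])
  also have "... = jn r (pd i (\<lambda>y. euler f y + real (Suc m) * f y)) x0"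
  proof (rule jn_cong_S)
   fix y assume y: "y \<in> S"
   note d = smooth_on_D[OF Suc.prems y]
   have "pd i (\<lambda>y. euler f y + real (Suc m) * f y) y = pd i (euler f) y + real (Suc m) * pd i f y"
    using pd_add[OF smooth_on_D[OF smooth_on_euler[OF Suc.prems] y]
      smooth_on_D[OF smooth_on_mult[OF S(1) smooth_on_const Suc.prems] y], of i] by (simp only: pd_cmult[OF d])
   then show "euler (pd i f) y + real (Suc (Suc m)) * pd i f y = pd i (\<lambda>y. euler f y + real (Suc m) * f y) y"
    by (simp add: pd_euler[OF Suc.prems y] algebra_simps)
  qed
  finally show ?thesis .
 qed
 then show ?case by (auto intro!: add_mono sum_mono simp: euler_point abs_mult mult_le_cancel_right1)
qed

text \<open>At \<open>x0\<close> a term survives only if exactly one derivative hits the coordinate,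
  so one order less of \<open>f\<close> is seen; there are at most r + 1 places for that
  derivative.\<close>

lemma jn_shift_mult:
 assumes "smooth_on S f"
 shows "jn (Suc r) (\<lambda>y. (y $ c - x0 $ c) * f y) x0 <= real (Suc r) * jn r f x0"
 using assms
proof (induction r arbitrary: f)
 case 0
 have "(\<Sigma> i. \<bar>pd i (\<lambda>y. (y $ c - x0 $ c) * f y) x0\<bar>) = (\<Sigma> i. if i = c then \<bar>f x0\<bar> else 0)"
  by (intro sum.cong refl) (simp add: pd_shift_mult[OF 0 S(2)])
 then show ?case by simp
next
 case (Suc r)
 have "jn (Suc r) (pd i (\<lambda>y. (y $ c - x0 $ c) * f y)) x0 <= (if i = c then jn (Suc r) f x0 else 0) + real (Suc r) * jn r (pd i f) x0" for i
 proof -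
  have "jn (Suc r) (pd i (\<lambda>y. (y $ c - x0 $ c) * f y)) x0 = jn (Suc r) (\<lambda>y. (if i = c then f y else 0) + (y $ c - x0 $ c) * pd i f y) x0"
   by (rule jn_cong_S) (simp add: pd_shift_mult[OF Suc.prems])
  also have "... <= jn (Suc r) (\<lambda>y. if i = c then f y else 0) x0 + jn (Suc r) (\<lambda>y. (y $ c - x0 $ c) * pd i f y) x0"
   using Suc.prems by (intro jn_add smooth_on_mult S(1) smooth_on_shift smooth_on_pd) (cases "i = c"; simp)
  also have "jn (Suc r) (\<lambda>y. if i = c then f y else 0) x0 = (if i = c then jn (Suc r) f x0 else 0)"
   by (simp del: jn.simps)
  finally show ?thesis using Suc.IH[OF smooth_on_pd[OF Suc.prems], of i] by linarith
 qed
 then have "(\<Sigma> i. jn (Suc r) (pd i (\<lambda>y. (y $ c - x0 $ c) * f y)) x0) \<le>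
  (\<Sigma> i. (if i = c then jn (Suc r) f x0 else 0) + real (Suc r) * jn r (pd i f) x0)" by (rule sum_mono)
 also have "... = jn (Suc r) f x0 + real (Suc r) * (\<Sigma> i. jn r (pd i f) x0)"
  by (simp add: sum.distrib sum_distrib_left del: jn.simps)
 also have "... <= jn (Suc r) f x0 + real (Suc r) * jn (Suc r) f x0" by (intro add_left_mono mult_left_mono) auto
 finally show ?case unfolding jn.simps(2)[of "Suc r"] by (simp add: algebra_simps del: jn.simps)
qed

end

section \<open>Normal coordinates to finite order\<close>

context smooth_at_point
begin

lemma flat_diff_mult:
 assumes "smooth_on S f" "smooth_on S f'" "smooth_on S g" "smooth_on S g'"
  and "flat r (\<lambda>x. f' x - f x)" "flat r (\<lambda>x. g' x - g x)"
 shows "flat r (\<lambda>x. f' x * g' x - f x * g x)"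
proof (rule flat_cong)
 show "flat r (\<lambda>x. (f' x - f x) * g' x + f x * (g' x - g x))"
  by (intro flat_add flat_mult_left flat_mult_right smooth_on_mult smooth_on_diff S(1) assms)
qed (simp add: algebra_simps)

lemma flat_diff_sum:
 assumes "!!a. a \<in> A ==> smooth_on S (f a)" "!!a. a \<in> A ==> smooth_on S (f' a)"
  and "!!a. a \<in> A ==> flat r (\<lambda>x. f' a x - f a x)"
 shows "flat r (\<lambda>x. (\<Sum>a\<in>A. f' a x) - (\<Sum>a\<in>A. f a x))"
 unfolding sum_subtractf[symmetric] by (intro flat_sum smooth_on_diff S(1) assms)

text \<open>The chain rule yields \<open>pd j F\<close> along the two maps, covered by the induction
  hypothesis, times first derivatives of maps that agree to one order less.\<close>

lemma flat_diff_compose: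
 fixes F :: "real^'j::finite => real"
 assumes T: "open T" "smooth_on T F"
  and \<phi>: "smooth_on S \<phi>" "smooth_on S \<phi>'" "\<phi> ` S \<subseteq> T" "\<phi>' ` S \<subseteq> T"
  and fl: "!!j. flat r (\<lambda>x. \<phi>' x $ j - \<phi> x $ j)"
 shows "flat r (\<lambda>x. F (\<phi>' x) - F (\<phi> x))"
 using T(2) fl
proof (induction r arbitrary: F)
 case 0
 then have "\<phi>' x0 = \<phi> x0" by (simp add: flat_0 vec_eq_iff)
 then show ?case by (simp add: flat_0)
next
 case (Suc r)
 have eq: "\<phi>' x0 = \<phi> x0" using flat_value[OF Suc.prems(2)] by (simp add: vec_eq_iff)
 have c: "smooth_on S (\<lambda>x. \<phi> x $ j)" "smooth_on S (\<lambda>x. \<phi>' x $ j)" for j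
  using \<phi> smooth_on_nth[OF S(1)] by blast+
 have j: "smooth_on T (pd j F)" for j by (rule smooth_on_pd[OF Suc.prems(1)])
 have s1: "smooth_on S (\<lambda>x. pd j F (\<phi> x))" "smooth_on S (\<lambda>x. pd j F (\<phi>' x))" for j
  by (rule smooth_on_compose[OF S(1) \<phi>(1,3) j], rule smooth_on_compose[OF S(1) \<phi>(2,4) j])
 have f1: "flat r (\<lambda>x. pd j F (\<phi>' x) - pd j F (\<phi> x))" for j
  by (rule Suc.IH[OF j]) (rule flat_mono[OF Suc.prems(2)], simp)
 have f2: "flat r (\<lambda>x. pd i (\<lambda>x. \<phi>' x $ j) x - pd i (\<lambda>x. \<phi> x $ j) x)" for i j
 proof (rule flat_cong)
  show "flat r (pd i (\<lambda>x. \<phi>' x $ j - \<phi> x $ j))" using Suc.prems(2)[of j] unfolding flat_Suc by blast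
 qed (rule pd_diff[OF smooth_on_D[OF c(2)] smooth_on_D[OF c(1)]])
 have "flat r (pd i (\<lambda>x. F (\<phi>' x) - F (\<phi> x)))" for i
 proof (rule flat_cong)
  show "flat r (\<lambda>x. (\<Sigma> j. pd i (\<lambda>x. \<phi>' x $ j) x * pd j F (\<phi>' x)) - (\<Sigma> j. pd i (\<lambda>x. \<phi> x $ j) x * pd j F (\<phi> x)))"
   by (intro flat_diff_sum flat_diff_mult smooth_on_mult S(1) smooth_on_pd c s1 f1 f2)
  fix x assume x: "x \<in> S"
  have d: "\<phi> differentiable (at x)" "\<phi>' differentiable (at x)" "F differentiable (at (\<phi> x))" "F differentiable (at (\<phi>' x))"
   using x \<phi> Suc.prems(1) by (auto intro!: smooth_on_D)
  have "pd i (\<lambda>x. F (\<phi>' x) - F (\<phi> x)) x = pd i (\<lambda>x. F (\<phi>' x)) x - pd i (\<lambda>x. F (\<phi> x)) x"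
   by (rule pd_diff[OF differentiable_compose_pd[OF d(2,4)] differentiable_compose_pd[OF d(1,3)]])
  then show "(\<Sigma> j. pd i (\<lambda>x. \<phi>' x $ j) x * pd j F (\<phi>' x)) - (\<Sigma> j. pd i (\<lambda>x. \<phi> x $ j) x * pd j F (\<phi> x))
   = pd i (\<lambda>x. F (\<phi>' x) - F (\<phi> x)) x"
   using pd_compose[OF d(1,3), of i] pd_compose[OF d(2,4), of i] by simp
 qed
 then show ?case by (simp add: flat_Suc eq)
qed

lemma flat_diff_matrix_inv:
 fixes A B :: "real^'i => real^'j::finite^'j"
 assumes sm: "smooth_on S A" "smooth_on S B"
  and nz: "!!x. x \<in> S ==> det (A x) ~= 0" "!!x. x \<in> S ==> det (B x) ~= 0"
  and fl: "!!a b. flat r (\<lambda>x. B x $ a $ b - A x $ a $ b)"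
 shows "flat r (\<lambda>x. matrix_inv (B x) $ a $ b - matrix_inv (A x) $ a $ b)"
proof (rule flat_cong)
 have s: "smooth_on S (\<lambda>x. matrix_inv (A x) $ a $ b)" "smooth_on S (\<lambda>x. matrix_inv (B x) $ a $ b)"
  "smooth_on S (\<lambda>x. A x $ a $ b)" "smooth_on S (\<lambda>x. B x $ a $ b)" for a b
  by (intro smooth_on_entry S(1) smooth_on_matrix_inv sm nz; assumption)+
 show "flat r (\<lambda>x. - 1 * (\<Sigma> c d. matrix_inv (B x) $ a $ c * (B x $ c $ d - A x $ c $ d) * matrix_inv (A x) $ d $ b))"
  by (intro flat_cmult flat_sum smooth_on_sum smooth_on_mult flat_mult_right flat_mult_left smooth_on_diff S(1) s fl)
qed (simp add: matrix_inv_diff[OF nz(2,1)])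

end

text \<open>The coefficients of a connection \<open>\<Gamma>\<close> in the coordinates \<open>x\<close> with \<open>y = \<phi>(x)\<close>.\<close>
definition fconn :: "(real^'n::finite => 'n => 'n => 'n => real) => (real^'n => real^'n) => 'n => 'n => 'n => real^'n => real" where
 "fconn \<Gamma> \<phi> a b c x = (\<Sigma> i. matrix_inv (jac \<phi> x) $ a $ i * (pd b (pd c (\<lambda>y. \<phi> y $ i)) x +
   (\<Sigma> j k. \<Gamma> (\<phi> x) i j k * jac \<phi> x $ j $ b * jac \<phi> x $ k $ c)))"

text \<open>It vanishes identically exactly when straight lines through 0 are affinely parametrised
  geodesics, i.e. in normal coordinates; here it will vanish to finite order.\<close>

definition radial_conn :: "(real^'n::finite => 'n => 'n => 'n => real) => (real^'n => real^'n) => 'n => real^'n => real" where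
 "radial_conn \<Gamma> \<phi> a x = (\<Sigma> b c. x $ b * (x $ c * fconn \<Gamma> \<phi> a b c x))"

definition coords_at :: "(real^'n::finite) set => real^'n => real^'n^'n => (real^'n) set => (real^'n => real^'n) => bool" where
 "coords_at S p E0 U \<phi> \<longleftrightarrow> open U \<and> 0 \<in> U \<and> smooth_on U \<phi> \<and> \<phi> ` U \<subseteq> S \<and> (\<forall>x\<in>U. det (jac \<phi> x) ~= 0) \<and>
   \<phi> 0 = p \<and> jac \<phi> 0 = E0"

lemma coords_at_smooth:
 assumes \<Gamma>: "!!i j k. smooth_on S (\<lambda>x. \<Gamma> x i j k)" and c: "coords_at S p E0 U \<phi>"
 shows "smooth_on U (\<lambda>x. jac \<phi> x $ a $ b)" "smooth_on U (\<lambda>x. matrix_inv (jac \<phi> x) $ a $ b)"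
  "smooth_on U (\<lambda>x. \<phi> x $ a)" "smooth_on U (\<lambda>x. \<Gamma> (\<phi> x) a b c)" "smooth_on U (fconn \<Gamma> \<phi> a b c)"
  "smooth_on U (radial_conn \<Gamma> \<phi> a)"
proof -
 have o: "open U" and sm: "smooth_on U \<phi>" and im: "\<phi> ` U \<subseteq> S" and nz: "!!x. x \<in> U ==> det (jac \<phi> x) ~= 0"
  using c by (auto simp: coords_at_def)
 show 1: "smooth_on U (\<lambda>x. jac \<phi> x $ a $ b)" for a b by (rule smooth_on_entry[OF o smooth_on_jac[OF o sm]])
 show 2: "smooth_on U (\<lambda>x. matrix_inv (jac \<phi> x) $ a $ b)" for a b
  by (rule smooth_on_entry[OF o smooth_on_matrix_inv[OF o smooth_on_jac[OF o sm] nz]])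
 show 3: "smooth_on U (\<lambda>x. \<phi> x $ a)" for a by (rule smooth_on_nth[OF o sm])
 show 4: "smooth_on U (\<lambda>x. \<Gamma> (\<phi> x) a b c)" for a b c by (rule smooth_on_compose[OF o sm im \<Gamma>])
 show 5: "smooth_on U (fconn \<Gamma> \<phi> a b c)" for a b c
  unfolding fconn_def[abs_def] by (intro smooth_on_sum smooth_on_mult smooth_on_add o smooth_on_pd 1 2 3 4)
 show "smooth_on U (radial_conn \<Gamma> \<phi> a)"
  unfolding radial_conn_def[abs_def] by (intro smooth_on_sum smooth_on_mult o smooth_on_coord 5)
qed

text \<open>Adding a small \<open>q\<close> to the map changes \<open>radial_conn\<close> to leading
  order by \<open>matrix_inv E0\<close> applied to the second radial derivative of \<open>q\<close>.
  On the leading homogeneous part the latter is multiplication by a number, so a multiple of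
  \<open>E0\<close> times \<open>radial_conn\<close> cancels the leading part.\<close>

lemma normal_coordinates_step:
 fixes \<Gamma> :: "real^'n::finite => 'n => 'n => 'n => real"
 assumes S: "open S" and \<Gamma>: "!!i j k. smooth_on S (\<lambda>x. \<Gamma> x i j k)" and E0: "det E0 ~= 0"
  and c: "coords_at S p E0 U \<phi>" and fl: "!!a. smooth_at_point.flat 0 (Suc r) (radial_conn \<Gamma> \<phi> a)"
 shows "\<exists>U' \<phi>'. coords_at S p E0 U' \<phi>' \<and> (\<forall>a. smooth_at_point.flat 0 (Suc (Suc r)) (radial_conn \<Gamma> \<phi>' a))"
proof -
 have U: "open U" "0 \<in> U" and sm: "smooth_on U \<phi>" and im: "\<phi> ` U \<subseteq> S" and nz: "!!x. x \<in> U ==> det (jac \<phi> x) ~= 0"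
  and p: "\<phi> 0 = p" "jac \<phi> 0 = E0"
  using c by (auto simp: coords_at_def)
 interpret V: smooth_at_point U "0 :: real^'n" by unfold_locales (fact U)+
 let ?N = "radial_conn \<Gamma> \<phi>"
 note sU = coords_at_smooth[OF \<Gamma> c]
 \<comment> \<open>On degree k the second radial derivative is k (k - 1), and the first degree still
   present is k = r + 2.\<close>
 define m where "m = (real (Suc r) + 1) * real (Suc r)"
 have m: "m ~= 0" unfolding m_def by (metis add_pos_pos mult_eq_0_iff of_nat_0_less_iff less_irrefl zero_less_Suc zero_less_one)
 define q where "q i x = - (1 / m) * (\<Sigma> a. E0 $ i $ a * ?N a x)" for i x
 define \<phi>' where "\<phi>' x = \<phi> x + (\<chi> i. q i x)" for x
 have qsm: "smooth_on U (q i)" for i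
  unfolding q_def by (intro smooth_on_mult smooth_on_sum U smooth_on_const sU)
 have qfl: "V.flat (Suc r) (q i)" for i
  unfolding q_def by (intro V.flat_cmult V.flat_sum smooth_on_mult smooth_on_sum U smooth_on_const sU fl)
 have sm': "smooth_on U \<phi>'"
  unfolding smooth_on_vec[OF U(1)] \<phi>'_def by (auto intro!: smooth_on_add U(1) qsm sU)
 have q0: "q i 0 = 0" "pd b (q i) 0 = 0" for i b
  using V.flat_value[OF qfl] V.flat_value[of r "pd b (q i)"] qfl[of i] by (auto simp: V.flat_Suc)
 have jac': "jac \<phi>' x $ i $ b = jac \<phi> x $ i $ b + pd b (q i) x" if "x \<in> U" for x i b
  unfolding jac_def \<phi>'_def by (simp add: pd_add smooth_on_D[OF sU(3) that] smooth_on_D[OF qsm that])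
 \<comment> \<open>The corrected map may leave \<open>S\<close> or degenerate away from 0, so the
   domain shrinks.\<close>
 define U' where "U' = {x\<in>U. \<phi>' x \<in> S \<and> det (jac \<phi>' x) ~= 0}"
 have oU': "open U'"
 proof -
  have "open (U \<inter> \<phi>' -` S)" by (rule continuous_open_preimage[OF smooth_on_cont[OF sm'] U(1) S])
  moreover have "open (U \<inter> (\<lambda>x. det (jac \<phi>' x)) -` (- {0}))"
   by (rule continuous_open_preimage[OF smooth_on_cont[OF smooth_on_det[OF U(1) smooth_on_jac[OF U(1) sm']]] U(1)])
    (simp add: open_Compl)
  moreover have "U' = (U \<inter> \<phi>' -` S) \<inter> (U \<inter> (\<lambda>x. det (jac \<phi>' x)) -` (- {0}))" by (auto simp: U'_def)
  ultimately show ?thesis by auto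
 qed
 have phi0: "\<phi>' 0 = p" using p(1) by (simp add: \<phi>'_def q0 vec_eq_iff)
 have jac0: "jac \<phi>' 0 = E0" by (simp add: vec_eq_iff jac'[OF U(2)] q0 p(2))
 have pS: "p \<in> S" using im U(2) p(1) by auto
 have c': "coords_at S p E0 U' \<phi>'"
  unfolding coords_at_def using oU' U(2) phi0 jac0 E0 pS smooth_on_subset[OF sm', of U'] by (auto simp: U'_def)
 have sub: "U' \<subseteq> U" by (auto simp: U'_def)
 have cU: "coords_at S p E0 U' \<phi>"
  using c oU' c' sub smooth_on_subset[OF sm sub] by (auto simp: coords_at_def)
 note s = coords_at_smooth[OF \<Gamma> cU]
 note s' = coords_at_smooth[OF \<Gamma> c']
 interpret W: smooth_at_point U' "0 :: real^'n" by unfold_locales (use c' in "auto simp: coords_at_def")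
 have q: "smooth_on U' (q i)" for i using smooth_on_subset[OF qsm sub] .
 have flE: "W.flat r (\<lambda>x. jac \<phi>' x $ i $ b - jac \<phi> x $ i $ b)" for i b
  by (rule W.flat_cong[of r "pd b (q i)"]) (use qfl sub in "auto simp: W.flat_Suc jac'")
 have flT: "W.flat r (\<lambda>x. matrix_inv (jac \<phi>' x) $ a $ i - matrix_inv (jac \<phi> x) $ a $ i)" for a i
  by (rule W.flat_diff_matrix_inv[OF smooth_on_jac smooth_on_jac _ _ flE])
   (use cU c' in "auto simp: coords_at_def")
 have flG: "W.flat r (\<lambda>x. \<Gamma> (\<phi>' x) i j k - \<Gamma> (\<phi> x) i j k)" for i j k
 proof (rule W.flat_diff_compose[OF S \<Gamma>])
  show "W.flat r (\<lambda>x. \<phi>' x $ j - \<phi> x $ j)" for j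
   using W.flat_mono[OF qfl, of r j] by (simp add: \<phi>'_def)
 qed (use cU c' in "auto simp: coords_at_def")
 let ?G = "\<lambda>\<phi> i b c x. (\<Sigma> j k. \<Gamma> (\<phi> x) i j k * jac \<phi> x $ j $ b * jac \<phi> x $ k $ c)"
 have Gsm: "smooth_on U' (?G \<phi> i b c)" "smooth_on U' (?G \<phi>' i b c)" for i b c
  by (intro smooth_on_sum smooth_on_mult oU' s s')+
 have flGG: "W.flat r (\<lambda>x. ?G \<phi>' i b c x - ?G \<phi> i b c x)" for i b c
  by (intro W.flat_diff_sum W.flat_diff_mult smooth_on_sum smooth_on_mult oU' s s' flE flG)
 \<comment> \<open>The part of the change that comes from the altered frame and the displaced
   \<open>\<Gamma>\<close>. It vanishes to order \<open>r\<close>; the two factors x in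
   \<open>radial_conn\<close> lift it to order r + 2.\<close>
 define R where "R a b c x = (\<Sigma> i. (matrix_inv (jac \<phi>' x) $ a $ i - matrix_inv (jac \<phi> x) $ a $ i) *
   (pd b (pd c (\<lambda>y. \<phi>' y $ i)) x + ?G \<phi>' i b c x) + matrix_inv (jac \<phi> x) $ a $ i * (?G \<phi>' i b c x - ?G \<phi> i b c x))" for a b c x
 have Rsm: "smooth_on U' (R a b c)" for a b c
  unfolding R_def by (intro smooth_on_sum smooth_on_mult smooth_on_add smooth_on_diff smooth_on_pd oU' s s')
 have Rfl: "W.flat r (R a b c)" for a b c
  unfolding R_def by (intro W.flat_sum W.flat_add W.flat_mult_right[OF _ _ flT] W.flat_mult_left[OF _ _ flGG]
    smooth_on_mult smooth_on_add smooth_on_diff smooth_on_pd Gsm oU' s s')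
 have pdphi': "pd b (pd c (\<lambda>y. \<phi>' y $ i)) x = pd b (pd c (\<lambda>y. \<phi> y $ i)) x + pd b (pd c (q i)) x" if x: "x \<in> U'" for b c i x
 proof -
  have "pd b (pd c (\<lambda>y. \<phi>' y $ i)) x = pd b (\<lambda>y. pd c (\<lambda>y. \<phi> y $ i) y + pd c (q i) y) x"
   by (rule pd_cong_open[OF oU' x]) (simp add: \<phi>'_def pd_add smooth_on_D[OF s(3)] smooth_on_D[OF q])
  then show ?thesis by (simp add: pd_add smooth_on_D[OF smooth_on_pd[OF s(3)] x] smooth_on_D[OF smooth_on_pd[OF q] x])
 qed
 have fc: "fconn \<Gamma> \<phi>' a b c x = R a b c x + fconn \<Gamma> \<phi> a b c x + (\<Sigma> i. matrix_inv (jac \<phi> x) $ a $ i * pd b (pd c (q i)) x)"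
  if x: "x \<in> U'" for a b c x
  unfolding fconn_def R_def pdphi'[OF x] sum.distrib[symmetric] by (rule sum.cong) (simp_all add: algebra_simps)
 \<comment> \<open>The second radial derivative of \<open>q\<close>; by the commutator of
   \<open>euler\<close> with partial derivatives it is \<open>euler\<close> applied twice minus
   \<open>euler\<close>.\<close>
 define w where "w i x = (\<Sigma> b c. x $ b * (x $ c * pd b (pd c (q i)) x))" for i x
 have wsm: "smooth_on U' (w i)" for i
  unfolding w_def by (intro smooth_on_sum smooth_on_mult smooth_on_pd smooth_on_coord oU' q)
 have w_euler: "w i x = W.euler (W.euler (q i)) x - W.euler (q i) x" if x: "x \<in> U'" for i x
 proof -
  have "W.euler (W.euler (q i)) x = (\<Sigma> b. x $ b * (W.euler (pd b (q i)) x + pd b (q i) x))"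
   unfolding W.euler_def[of "W.euler (q i)"] by (simp add: W.pd_euler[OF q x])
  also have "... = (\<Sigma> b c. x $ b * (x $ c * pd c (pd b (q i)) x)) + W.euler (q i) x"
   by (simp add: W.euler_def sum_distrib_left distrib_left sum.distrib)
  also have "(\<Sigma> b c. x $ b * (x $ c * pd c (pd b (q i)) x)) = w i x"
   unfolding w_def by (intro sum.cong refl) (simp add: pd_commute[OF oU' x q])
  finally show ?thesis by simp
 qed
 have qfl': "W.flat (Suc r) (q i)" for i by (rule qfl)
 have e1: "W.flat (Suc r) (W.euler (q i))" "W.flat (Suc r) (W.euler (W.euler (q i)))" for i
  by (intro W.flat_euler W.smooth_on_euler q qfl')+
 have wfl: "W.flat (Suc r) (w i)" for i
  by (rule W.flat_cong[OF W.flat_diff[OF W.smooth_on_euler[OF W.smooth_on_euler[OF q]] W.smooth_on_euler[OF q] e1(2,1)]])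
   (simp add: w_euler)
 let ?k = "real (Suc (Suc r))"
 have e2: "W.flat (Suc (Suc r)) (\<lambda>y. W.euler f y - ?k * f y)" if "smooth_on U' f" "W.flat (Suc r) f" for f
  by (rule W.flat_euler_homogeneous[OF that])
 \<comment> \<open>With D for \<open>euler\<close> and k = r + 2, D D - D - k (k - 1) = (D - k) D +
   (k - 1) (D - k), and D - k raises the order of vanishing of functions that start in degree
   k.\<close>
 have wqfl: "W.flat (Suc (Suc r)) (\<lambda>x. w i x - m * q i x)" for i
 proof (rule W.flat_cong)
  show "W.flat (Suc (Suc r)) (\<lambda>x. (W.euler (W.euler (q i)) x - ?k * W.euler (q i) x) + (?k - 1) * (W.euler (q i) x - ?k * q i x))"
   by (intro W.flat_add W.flat_cmult e2 smooth_on_diff smooth_on_mult smooth_on_const oU' W.smooth_on_euler q qfl' e1)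
  fix x assume x: "x \<in> U'"
  show "(W.euler (W.euler (q i)) x - ?k * W.euler (q i) x) + (?k - 1) * (W.euler (q i) x - ?k * q i x) = w i x - m * q i x"
   unfolding w_euler[OF x] m_def by (simp add: algebra_simps)
 qed
 let ?T0 = "matrix_inv E0"
 have T0: "matrix_inv (jac \<phi> 0) = ?T0" by (simp add: p)
 have "W.flat (Suc (Suc r)) (radial_conn \<Gamma> \<phi>' a)" for a
 proof (rule W.flat_cong)
  have xx: "W.flat (Suc (Suc r)) (\<lambda>x. x $ b * (x $ c * R a b c x))" for b c
   using W.flat_mult_vanishing[OF smooth_on_coord smooth_on_mult[OF oU' smooth_on_coord Rsm] _
     W.flat_mult_vanishing[OF smooth_on_coord Rsm _ Rfl]] by simp
  have tw: "W.flat (Suc (Suc r)) (\<lambda>x. (matrix_inv (jac \<phi> x) $ a $ i - ?T0 $ a $ i) * w i x)" for i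
   by (rule W.flat_mult_vanishing[OF _ wsm _ wfl]) (simp_all add: T0 smooth_on_diff oU' s)
  show "W.flat (Suc (Suc r)) (\<lambda>x. (\<Sigma> b c. x $ b * (x $ c * R a b c x)) +
   ((\<Sigma> i. (matrix_inv (jac \<phi> x) $ a $ i - ?T0 $ a $ i) * w i x) + (\<Sigma> i. ?T0 $ a $ i * (w i x - m * q i x))))"
   by (intro W.flat_add W.flat_sum W.flat_cmult xx tw wqfl smooth_on_add smooth_on_sum smooth_on_mult smooth_on_diff
     smooth_on_coord smooth_on_const oU' Rsm s wsm q)
  fix x assume x: "x \<in> U'"
  have N: "radial_conn \<Gamma> \<phi> a x = - (\<Sigma> i. ?T0 $ a $ i * (m * q i x))"
  proof -
   have "(\<Sigma> i. ?T0 $ a $ i * (m * q i x)) = - (\<Sigma> i. \<Sum>a'\<in>UNIV. ?T0 $ a $ i * E0 $ i $ a' * ?N a' x)"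
    using m by (simp add: q_def sum_distrib_left sum_negf mult.assoc)
   also have "... = - (\<Sum>a'\<in>UNIV. (?T0 ** E0) $ a $ a' * ?N a' x)"
    by (subst sum.swap) (simp add: matrix_matrix_mult_def sum_distrib_right)
   also have "... = - ?N a x" by (simp add: matrix_inv_left[OF E0] mat_def if_distrib[of "\<lambda>c. c * _"] cong: if_cong)
   finally show ?thesis by simp
  qed
  have "radial_conn \<Gamma> \<phi>' a x = (\<Sigma> b c. x $ b * (x $ c * R a b c x)) + radial_conn \<Gamma> \<phi> a x +
   (\<Sigma> b c i. matrix_inv (jac \<phi> x) $ a $ i * (x $ b * (x $ c * pd b (pd c (q i)) x)))"
   unfolding radial_conn_def fc[OF x] sum.distrib[symmetric] by (intro sum.cong refl) (simp add: algebra_simps sum_distrib_left)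
  also have "(\<Sigma> b c i. matrix_inv (jac \<phi> x) $ a $ i * (x $ b * (x $ c * pd b (pd c (q i)) x)))
   = (\<Sigma> i. matrix_inv (jac \<phi> x) $ a $ i * w i x)"
   unfolding w_def sum_distrib_left
   by (subst sum.swap[of _ "UNIV :: 'n set" "UNIV :: 'n set"], rule trans[OF sum.cong[OF refl sum.swap]], rule trans[OF sum.swap])
    (rule sum.cong[OF refl sum.swap])
  finally show "(\<Sigma> b c. x $ b * (x $ c * R a b c x)) +
   ((\<Sigma> i. (matrix_inv (jac \<phi> x) $ a $ i - ?T0 $ a $ i) * w i x) + (\<Sigma> i. ?T0 $ a $ i * (w i x - m * q i x)))
   = radial_conn \<Gamma> \<phi>' a x" by (simp add: N algebra_simps sum.distrib sum_subtractf)
 qed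
 with c' show ?thesis by blast
qed

text \<open>The induction starts from the affine map with Jacobian \<open>E0\<close>, for which the
  two factors x alone make \<open>radial_conn\<close> vanish to first order.\<close>

lemma normal_coordinates:
 fixes \<Gamma> :: "real^'n::finite => 'n => 'n => 'n => real"
 assumes S: "open S" "p \<in> S" and \<Gamma>: "!!i j k. smooth_on S (\<lambda>x. \<Gamma> x i j k)" and E0: "det E0 ~= 0"
 shows "\<exists>U \<phi>. coords_at S p E0 U \<phi> \<and> (\<forall>a. smooth_at_point.flat 0 (Suc r) (radial_conn \<Gamma> \<phi> a))"
proof (induction r)
 case 0
 define \<phi> where "\<phi> x = p + E0 *v x" for x
 have sm: "smooth_on UNIV \<phi>"
  unfolding smooth_on_vec[OF open_UNIV] \<phi>_def matrix_vector_mult_def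
  by (auto intro!: smooth_on_add smooth_on_sum smooth_on_mult smooth_on_coord)
 have "(\<phi> has_derivative (\<lambda>v. E0 *v v)) (at x)" for x
  unfolding \<phi>_def by (auto intro!: derivative_eq_intros bounded_linear_imp_has_derivative matrix_vector_mul_bounded_linear)
 then have j: "jac \<phi> x = E0" for x using jac_eq_matrix matrix_of_matrix_vector_mul by metis
 define U where "U = \<phi> -` S"
 have "open U" unfolding U_def by (rule open_vimage[OF S(1) smooth_on_cont[OF sm]])
 then have c: "coords_at S p E0 U \<phi>"
  using S sm E0 j smooth_on_subset[OF sm, of U] by (auto simp: coords_at_def U_def) (auto simp: \<phi>_def)
 note s = coords_at_smooth[OF \<Gamma> c]
 interpret W: smooth_at_point U "0 :: real^'n" by unfold_locales (use c in "auto simp: coords_at_def")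
 have "W.flat (Suc 0) (radial_conn \<Gamma> \<phi> a)" for a
  unfolding radial_conn_def[abs_def]
  by (intro W.flat_sum W.flat_mult_vanishing smooth_on_sum smooth_on_mult smooth_on_coord \<open>open U\<close> s) (auto simp: W.flat_0)
 with c show ?case by blast
next
 case (Suc r)
 then obtain U \<phi> where "coords_at S p E0 U \<phi>" "!!a. smooth_at_point.flat 0 (Suc r) (radial_conn \<Gamma> \<phi> a)" by blast
 from normal_coordinates_step[OF S(1) \<Gamma> E0 this] show ?case .
qed

section \<open>Components of tensors in a frame\<close>

text \<open>Contraction of every index of \<open>f\<close> with the matrix \<open>A\<close>: the
  components of a tensor in another frame.\<close>

primrec act :: "('n::finite => 'n => real) => ('n list => real) => 'n list => real" where
 "act A f [] = f []"
| "act A f (l # ls) = (\<Sigma> i. A i l * act A (\<lambda>ls'. f (i # ls')) ls)"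

text \<open>\<open>M\<close> applied to one index at a time, summed over the indices: the connection
  terms of a covariant derivative.\<close>

definition slot :: "('n::finite => 'n => real) => ('n list => real) => 'n list => real" where
 "slot M f ls = (\<Sum>i<length ls. \<Sigma> e. M e (ls ! i) * f (ls[i := e]))"

lemma slot_Nil [simp]: "slot M f [] = 0" by (simp add: slot_def)

lemma slot_Cons: "slot M f (l # ls) = (\<Sigma> e. M e l * f (e # ls)) + slot M (\<lambda>ls. f (l # ls)) ls"
 by (simp add: slot_def sum.lessThan_Suc_shift del: sum.lessThan_Suc)

lemma act_add: "act A (\<lambda>ls. f ls + g ls) ls = act A f ls + act A g ls"
 by (induction ls arbitrary: f g) (auto simp: distrib_left sum.distrib)

lemma act_cmult: "act A (\<lambda>ls. c * f ls) ls = c * act A f ls"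
 by (induction ls arbitrary: f) (auto simp: sum_distrib_left mult.left_commute)

lemma act_diff: "act A (\<lambda>ls. f ls - g ls) ls = act A f ls - act A g ls"
 using act_add[of A f "\<lambda>ls. -1 * g ls" ls] act_cmult[of A "-1" g ls] by simp

lemma act_zero: "act A (\<lambda>ls. 0) ls = 0"
 using act_cmult[of A 0 "\<lambda>_. 0" ls] by simp

lemma act_sum: "act A (\<lambda>ls. \<Sum>i\<in>I. f i ls) ls = (\<Sum>i\<in>I. act A (f i) ls)"
 by (induction I rule: infinite_finite_induct) (auto simp: act_zero act_add)

lemma slot_sum: "slot M (\<lambda>ls. \<Sum>i\<in>I. c i * f i ls) ls = (\<Sum>i\<in>I. c i * slot M (f i) ls)"
proof -
 have "slot M (\<lambda>ls. \<Sum>i\<in>I. c i * f i ls) ls = (\<Sum>j<length ls. \<Sigma> e. \<Sum>i\<in>I. c i * (M e (ls ! j) * f i (ls[j := e])))"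
  by (simp add: slot_def sum_distrib_left mult.left_commute)
 also have "... = (\<Sum>j<length ls. \<Sum>i\<in>I. \<Sigma> e. c i * (M e (ls ! j) * f i (ls[j := e])))"
  by (rule sum.cong[OF refl]) (rule sum.swap)
 also have "... = (\<Sum>i\<in>I. \<Sum>j<length ls. \<Sigma> e. c i * (M e (ls ! j) * f i (ls[j := e])))" by (rule sum.swap)
 finally show ?thesis by (simp add: slot_def sum_distrib_left)
qed

lemma slot_sum_left:
 "slot (\<lambda>e l. \<Sum>j\<in>I. M j e l * c j) f ls = (\<Sum>j\<in>I. c j * slot (M j) f ls)"
proof -
 have "slot (\<lambda>e l. \<Sum>j\<in>I. M j e l * c j) f ls = (\<Sum>k<length ls. \<Sigma> e. \<Sum>j\<in>I. c j * (M j e (ls ! k) * f (ls[k := e])))"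
  by (simp add: slot_def sum_distrib_right sum_distrib_left mult_ac)
 also have "... = (\<Sum>k<length ls. \<Sum>j\<in>I. \<Sigma> e. c j * (M j e (ls ! k) * f (ls[k := e])))"
  by (rule sum.cong[OF refl]) (rule sum.swap)
 also have "... = (\<Sum>j\<in>I. \<Sum>k<length ls. \<Sigma> e. c j * (M j e (ls ! k) * f (ls[k := e])))" by (rule sum.swap)
 finally show ?thesis by (simp add: slot_def sum_distrib_left)
qed

lemma act_slot: "act A (\<lambda>us. slot M (f us) ls) us = slot M (\<lambda>ls. act A (\<lambda>us. f us ls) us) ls"
 by (simp add: slot_def act_sum act_cmult)

lemma slot_act: "slot M (\<lambda>us. act A (f us) ls) us = act A (\<lambda>ls. slot M (\<lambda>us. f us ls) us) ls"
 by (simp add: act_slot)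

lemma smooth_on_act:
 assumes "open S" "!!i l. smooth_on S (\<lambda>x. A x i l)" "!!ls. smooth_on S (\<lambda>x. f x ls)"
 shows "smooth_on S (\<lambda>x. act (A x) (f x) ls)"
 using assms(3) by (induction ls arbitrary: f) (auto intro!: smooth_on_sum smooth_on_mult assms(1,2))

text \<open>The assumption on the derivative of \<open>A\<close> is the relation between connection
  coefficients \<open>G\<close> in the old and \<open>\<gamma>\<close> in the new frame. The product
  rule distributes it over the indices: the \<open>G\<close> terms complete a covariant derivative
  inside, the \<open>\<gamma>\<close> terms remain outside.\<close>

lemma pd_act:
 fixes A :: "real^'i::finite => 'n::finite => 'n => real"
 assumes S: "open S" "x \<in> S" and A: "!!i l. smooth_on S (\<lambda>x. A x i l)" and f: "!!ls. smooth_on S (\<lambda>x. f x ls)"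
  and A': "!!i l. pd c (\<lambda>x. A x i l) x = (\<Sigma> e. A x i e * \<gamma> e l) - (\<Sigma> k. G i k * A x k l)"
 shows "pd c (\<lambda>x. act (A x) (f x) ls) x =
  act (A x) (\<lambda>ls. pd c (\<lambda>x. f x ls) x - slot G (f x) ls) ls + slot \<gamma> (act (A x) (f x)) ls"
 using f
proof (induction ls arbitrary: f)
 case Nil
 show ?case by simp
next
 case (Cons l ls)
 let ?f = "\<lambda>i x ls. f x (i # ls)"
 note dA = smooth_on_D[OF A S(2)]
 have sf: "smooth_on S (\<lambda>x. act (A x) (?f i x) ls)" for i by (rule smooth_on_act[OF S(1) A Cons.prems])
 have "pd c (\<lambda>x. act (A x) (f x) (l # ls)) x = (\<Sigma> i. pd c (\<lambda>x. A x i l * act (A x) (?f i x) ls) x)"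
  unfolding act.simps by (rule pd_sum) (auto intro!: smooth_on_D[OF _ S(2)] smooth_on_mult S(1) A sf)
 also have "... = (\<Sigma> i. A x i l * (act (A x) (\<lambda>ls. pd c (\<lambda>x. ?f i x ls) x - slot G (?f i x) ls) ls + slot \<gamma> (act (A x) (?f i x)) ls)
   + ((\<Sigma> e. A x i e * \<gamma> e l) - (\<Sigma> k. G i k * A x k l)) * act (A x) (?f i x) ls)" by (rule sum.cong[OF refl])
   (simp add: pd_mult[OF dA smooth_on_D[OF sf S(2)]] A' Cons.IH[OF Cons.prems])
 also have "... = (\<Sigma> i. A x i l * act (A x) (\<lambda>ls. pd c (\<lambda>x. ?f i x ls) x - slot G (?f i x) ls) ls)
   + (\<Sigma> i. A x i l * slot \<gamma> (act (A x) (?f i x)) ls)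
   + (\<Sigma> i e. A x i e * \<gamma> e l * act (A x) (?f i x) ls)
   - (\<Sigma> i k. G i k * A x k l * act (A x) (?f i x) ls)"
  by (simp add: sum.distrib sum_subtractf distrib_left left_diff_distrib sum_distrib_right)
 also have "(\<Sigma> i e. A x i e * \<gamma> e l * act (A x) (?f i x) ls) = (\<Sigma> e. \<gamma> e l * act (A x) (f x) (e # ls))"
  by (subst sum.swap) (simp add: sum_distrib_left mult_ac)
 also have "(\<Sigma> i. A x i l * slot \<gamma> (act (A x) (?f i x)) ls) = slot \<gamma> (\<lambda>ls. act (A x) (f x) (l # ls)) ls"
  by (simp add: slot_sum)
 also have "(\<Sigma> i k. G i k * A x k l * act (A x) (?f i x) ls) =
  (\<Sigma> k. A x k l * act (A x) (\<lambda>ls. \<Sigma> e. G e k * f x (e # ls)) ls)"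
  by (subst sum.swap) (simp add: act_sum act_cmult sum_distrib_left mult_ac)
 finally have eq: "pd c (\<lambda>x. act (A x) (f x) (l # ls)) x =
  (\<Sigma> i. A x i l * act (A x) (\<lambda>ls. pd c (\<lambda>x. ?f i x ls) x - slot G (?f i x) ls) ls)
  - (\<Sigma> k. A x k l * act (A x) (\<lambda>ls. \<Sigma> e. G e k * f x (e # ls)) ls)
  + ((\<Sigma> e. \<gamma> e l * act (A x) (f x) (e # ls)) + slot \<gamma> (\<lambda>ls. act (A x) (f x) (l # ls)) ls)"
  by (simp only: algebra_simps)
 have "act (A x) (\<lambda>ls. pd c (\<lambda>x. f x ls) x - slot G (f x) ls) (l # ls) =
  (\<Sigma> i. A x i l * act (A x) (\<lambda>ls. (pd c (\<lambda>x. ?f i x ls) x - slot G (?f i x) ls) - (\<Sigma> e. G e i * f x (e # ls))) ls)"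
  by (simp add: slot_Cons algebra_simps)
 also have "... = (\<Sigma> i. A x i l * act (A x) (\<lambda>ls. pd c (\<lambda>x. ?f i x ls) x - slot G (?f i x) ls) ls)
  - (\<Sigma> k. A x k l * act (A x) (\<lambda>ls. \<Sigma> e. G e k * f x (e # ls)) ls)"
  unfolding act_diff[of _ _ "\<lambda>ls. \<Sigma> e. G e _ * f x (e # ls)"] right_diff_distrib sum_subtractf ..
 finally show ?case unfolding eq slot_Cons by simp
qed

lemma sum_lists_Suc:
 fixes F :: "'n::finite list => real"
 shows "(\<Sum>ls\<in>{ls. length ls = Suc q}. F ls) = (\<Sigma> i. \<Sum>ls\<in>{ls. length ls = q}. F (i # ls))"
proof -
 have "{ls :: 'n list. length ls = Suc q} = (\<lambda>(i, ls). i # ls) ` (UNIV \<times> {ls. length ls = q})"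
  by (auto simp: image_iff length_Suc_conv)
 then have "(\<Sum>ls\<in>{ls. length ls = Suc q}. F ls) = (\<Sum>(i, ls)\<in>UNIV \<times> {ls. length ls = q}. F (i # ls))"
  by (simp add: sum.reindex inj_on_def case_prod_unfold)
 then show ?thesis by (simp add: sum.cartesian_product)
qed

lemma finite_lists_length_eq': "finite {ls :: 'n::finite list. length ls = q}"
 using finite_lists_length_eq[of "UNIV :: 'n set" q] by simp

text \<open>If the form on one index is a sum of squares of the columns of \<open>A\<close>, the
  induced form on tensors is the sum of products of the components in that frame.\<close>

lemma sum_lists_act:
 fixes A B :: "'n::finite => 'n => real"
 assumes B: "!!i j. B i j = (\<Sigma> a. A i a * A j a)"
 shows "(\<Sum>ls\<in>{ls. length ls = q}. \<Sum>ls'\<in>{ls. length ls = q}. (\<Prod>j<q. B (ls ! j) (ls' ! j)) * f ls * g ls')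
  = (\<Sum>ls\<in>{ls. length ls = q}. act A f ls * act A g ls)"
proof (induction q arbitrary: f g)
 case (Suc q)
 let ?L = "{ls :: 'n list. length ls = q}"
 let ?X = "\<lambda>i j. \<Sum>ls\<in>?L. act A (\<lambda>ls. f (i # ls)) ls * act A (\<lambda>ls. g (j # ls)) ls"
 have "(\<Sum>ls\<in>{ls. length ls = Suc q}. \<Sum>ls'\<in>{ls. length ls = Suc q}. (\<Prod>j<Suc q. B (ls ! j) (ls' ! j)) * f ls * g ls')
  = (\<Sigma> i. \<Sum>ls\<in>?L. \<Sigma> j. \<Sum>ls'\<in>?L. B i j * ((\<Prod>j<q. B (ls ! j) (ls' ! j)) * f (i # ls) * g (j # ls')))"
  by (simp add: sum_lists_Suc prod.lessThan_Suc_shift mult.assoc del: prod.lessThan_Suc)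
 also have "... = (\<Sigma> i j. B i j * (\<Sum>ls\<in>?L. \<Sum>ls'\<in>?L. (\<Prod>j<q. B (ls ! j) (ls' ! j)) * f (i # ls) * g (j # ls')))"
  unfolding sum_distrib_left by (rule sum.cong[OF refl]) (rule sum.swap)
 also have "... = (\<Sigma> i j a. A i a * A j a * ?X i j)"
  unfolding Suc.IH by (simp only: B sum_distrib_right)
 also have "... = (\<Sigma> a i j. A i a * A j a * ?X i j)" by (rule trans[OF sum.cong[OF refl sum.swap] sum.swap])
 also have "... = (\<Sigma> a. \<Sum>ls\<in>?L. act A f (a # ls) * act A g (a # ls))"
 proof (rule sum.cong[OF refl])
  fix a
  have "(\<Sigma> i j. A i a * A j a * ?X i j) =
   (\<Sigma> i j. \<Sum>ls\<in>?L. (A i a * act A (\<lambda>ls. f (i # ls)) ls) * (A j a * act A (\<lambda>ls. g (j # ls)) ls))"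
   by (simp add: sum_distrib_left mult_ac)
  also have "... = (\<Sum>ls\<in>?L. \<Sigma> i j. (A i a * act A (\<lambda>ls. f (i # ls)) ls) * (A j a * act A (\<lambda>ls. g (j # ls)) ls))"
   by (rule trans[OF sum.cong[OF refl sum.swap] sum.swap])
  finally show "(\<Sigma> i j. A i a * A j a * ?X i j) = (\<Sum>ls\<in>?L. act A f (a # ls) * act A g (a # ls))"
   by (simp add: sum_product)
 qed
 finally show ?case by (simp add: sum_lists_Suc)
qed simp

text \<open>For an orthonormal frame \<open>E\<close> with dual \<open>\<theta>\<close> one has h =
  \<open>\<theta>\<^sup>T \<theta>\<close> and \<open>h\<^sup>-\<^sup>1 = E E\<^sup>T\<close>; so
  the invariant norm is the Euclidean norm of frame components.\<close>

lemma tensor_norm_eq_act: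
 fixes h E :: "real^'n::finite^'n"
 assumes E: "det E ~= 0" and h: "transpose E ** h ** E = mat 1"
 shows "tensor_norm h p q T = sqrt (\<Sum>us\<in>{us. length us = p}. \<Sum>ls\<in>{ls. length ls = q}.
  (act (\<lambda>i a. matrix_inv E $ a $ i) (\<lambda>us. act (\<lambda>i l. E $ i $ l) (T us) ls) us)\<^sup>2)"
proof -
 let ?\<theta> = "matrix_inv E"
 have E\<theta>: "E ** ?\<theta> = mat 1" "?\<theta> ** E = mat 1" using matrix_inv_right[OF E] matrix_inv_left[OF E] .
 have "transpose ?\<theta> ** (transpose E ** h ** E) ** ?\<theta> = transpose (E ** ?\<theta>) ** h ** (E ** ?\<theta>)"
  by (simp add: matrix_transpose_mul matrix_mul_assoc)
 then have h\<theta>: "h = transpose ?\<theta> ** ?\<theta>" by (simp add: h E\<theta> transpose_mat)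
 have "h ** (E ** transpose E) = transpose ?\<theta> ** (?\<theta> ** E) ** transpose E"
  by (simp only: h\<theta> matrix_mul_assoc)
 also have "... = transpose (E ** ?\<theta>)" by (simp add: E\<theta>(2) matrix_transpose_mul)
 finally have hE: "h ** (E ** transpose E) = mat 1" by (simp add: E\<theta> transpose_mat)
 then have "det h ~= 0" by (metis det_I det_mul mult_zero_left zero_neq_one)
 then have "matrix_inv h = matrix_inv h ** (h ** (E ** transpose E))" using hE by simp
 also have "... = E ** transpose E"
  using matrix_inv_left[OF \<open>det h ~= 0\<close>] by (simp add: matrix_mul_assoc)
 finally have hi: "matrix_inv h = E ** transpose E" .
 have 1: "h $ i $ j = (\<Sigma> a. ?\<theta> $ a $ i * ?\<theta> $ a $ j)" for i j
  by (subst h\<theta>) (simp add: matrix_matrix_mult_def transpose_def)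
 have 2: "matrix_inv h $ i $ j = (\<Sigma> a. E $ i $ a * E $ j $ a)" for i j
  by (simp add: hi matrix_matrix_mult_def transpose_def)
 let ?U = "{us :: 'n list. length us = p}" and ?L = "{ls :: 'n list. length ls = q}"
 let ?e = "\<lambda>us ls. act (\<lambda>i l. E $ i $ l) (T us) ls"
 have "(\<Sum>us\<in>?U. \<Sum>us'\<in>?U. \<Sum>ls\<in>?L. \<Sum>ls'\<in>?L.
    (\<Prod>i<p. h $ (us ! i) $ (us' ! i)) * (\<Prod>j<q. matrix_inv h $ (ls ! j) $ (ls' ! j)) * T us ls * T us' ls')
  = (\<Sum>us\<in>?U. \<Sum>us'\<in>?U. (\<Prod>i<p. h $ (us ! i) $ (us' ! i)) * (\<Sum>ls\<in>?L. ?e us ls * ?e us' ls))"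
  unfolding sum_lists_act[where B="\<lambda>i j. matrix_inv h $ i $ j" and A="\<lambda>i l. E $ i $ l", OF 2, symmetric]
  by (simp add: sum_distrib_left mult.assoc)
 also have "... = (\<Sum>us\<in>?U. \<Sum>us'\<in>?U. \<Sum>ls\<in>?L. (\<Prod>i<p. h $ (us ! i) $ (us' ! i)) * ?e us ls * ?e us' ls)"
  by (simp add: sum_distrib_left mult.assoc)
 also have "... = (\<Sum>ls\<in>?L. \<Sum>us\<in>?U. \<Sum>us'\<in>?U. (\<Prod>i<p. h $ (us ! i) $ (us' ! i)) * ?e us ls * ?e us' ls)"
  by (rule trans[OF sum.cong[OF refl sum.swap] sum.swap])
 also have "... = (\<Sum>ls\<in>?L. \<Sum>us\<in>?U. (act (\<lambda>i a. ?\<theta> $ a $ i) (\<lambda>us. ?e us ls) us)\<^sup>2)"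
  unfolding sum_lists_act[where B="\<lambda>i j. h $ i $ j" and A="\<lambda>i a. ?\<theta> $ a $ i", OF 1]
  by (simp add: power2_eq_square)
 also have "... = (\<Sum>us\<in>?U. \<Sum>ls\<in>?L. (act (\<lambda>i a. ?\<theta> $ a $ i) (\<lambda>us. ?e us ls) us)\<^sup>2)"
  by (rule sum.swap)
 finally show ?thesis by (simp add: tensor_norm_def)
qed

definition tensor_smooth_on :: "(real^'n::finite) set => 'n tensor_field => bool" where
 "tensor_smooth_on S T \<longleftrightarrow> (\<forall>us ls. smooth_on S (\<lambda>x. T x us ls))"

lemma christoffel_smooth_on:
 assumes S: "open S" and h: "smooth_on S h" "!!x. x \<in> S ==> riemannian (h x)"
 shows "smooth_on S (\<lambda>x. christoffel h x a b c)"
 unfolding christoffel_def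
 by (intro smooth_on_mult smooth_on_sum smooth_on_add smooth_on_diff smooth_on_pd smooth_on_const S smooth_on_entry[OF S h(1)]
  smooth_on_entry[OF S smooth_on_matrix_inv[OF S h(1) riemannian_det[OF h(2)]]])

section \<open>Tensor components and their derivatives in new coordinates around a point\<close>

locale frame_coords =
 fixes h :: "'n::finite metric" and S :: "(real^'n) set" and p :: "real^'n" and E0 :: "real^'n^'n"
  and U :: "(real^'n) set" and \<phi> :: "real^'n => real^'n"
 assumes oS: "open S" and hs: "smooth_on S h" and hr: "!!x. x \<in> S ==> riemannian (h x)"
  and coords: "coords_at S p E0 U \<phi>"
begin

lemma U: "open U" "0 \<in> U" "smooth_on U \<phi>" "!!x. x \<in> U ==> \<phi> x \<in> S" "!!x. x \<in> U ==> det (jac \<phi> x) ~= 0"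
 "\<phi> 0 = p" "jac \<phi> 0 = E0" "\<phi> ` U \<subseteq> S"
 using coords by (auto simp: coords_at_def)

sublocale smooth_at_point U 0 by unfold_locales (rule U)+

lemma smooth_on_christoffel: "smooth_on S (\<lambda>x. christoffel h x a b c)" by (rule christoffel_smooth_on[OF oS hs hr])

lemma christoffel_sym: "x \<in> S ==> christoffel h x a b c = christoffel h x a c b"
proof -
 assume x: "x \<in> S"
 have "pd d (\<lambda>y. h y $ b $ c) x = pd d (\<lambda>y. h y $ c $ b) x" for d
  by (rule pd_cong_open[OF oS x], rule symmetric_matrix_entry) (use hr in "auto simp: riemannian_def")
 then show ?thesis unfolding christoffel_def by (simp add: algebra_simps)
qed

lemma smooth_on_covd:
 assumes "tensor_smooth_on S T"
 shows "tensor_smooth_on S (covd h T)"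
 unfolding tensor_smooth_on_def
proof (intro allI)
 fix us ls
 have T: "smooth_on S (\<lambda>x. T x us ls)" for us ls using assms by (simp add: tensor_smooth_on_def)
 show "smooth_on S (\<lambda>x. covd h T x us ls)"
  unfolding covd_def by (cases ls)
   (auto intro!: smooth_on_add smooth_on_diff smooth_on_sum smooth_on_mult oS smooth_on_pd T smooth_on_christoffel)
qed

lemma smooth_on_covd_iter: "tensor_smooth_on S T ==> tensor_smooth_on S ((covd h ^^ m) T)"
 by (induction m) (auto intro: smooth_on_covd)

abbreviation \<gamma> :: "'n => 'n => 'n => real^'n => real" where
 "\<gamma> \<equiv> fconn (christoffel h) \<phi>"

abbreviation E :: "real^'n => real^'n^'n" where "E \<equiv> jac \<phi>"
abbreviation \<theta> :: "real^'n => real^'n^'n" where "\<theta> x \<equiv> matrix_inv (E x)"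

definition fr :: "'n tensor_field => real^'n => 'n list => 'n list => real" where
 "fr T x us ls = act (\<lambda>i a. \<theta> x $ a $ i) (\<lambda>us. act (\<lambda>i l. E x $ i $ l) (T (\<phi> x) us) ls) us"

lemma smooth_E: "smooth_on U (\<lambda>x. E x $ a $ b)" and smooth_\<theta>: "smooth_on U (\<lambda>x. \<theta> x $ a $ b)"
 and smooth_\<gamma>: "smooth_on U (\<gamma> a b c)" and smooth_\<Gamma>: "smooth_on U (\<lambda>x. christoffel h (\<phi> x) a b c)"
 by (rule coords_at_smooth[where \<Gamma>="christoffel h", OF smooth_on_christoffel coords])+

lemma smooth_fr: "tensor_smooth_on S T ==> smooth_on U (\<lambda>x. fr T x us ls)"
 unfolding fr_def tensor_smooth_on_def
 by (intro smooth_on_act U(1) smooth_E smooth_\<theta> smooth_on_compose[OF U(1,3) U(8)]) auto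

lemma pd_phi: "x \<in> U ==> smooth_on S f ==> pd c (\<lambda>x. f (\<phi> x)) x = (\<Sigma> i. E x $ i $ c * pd i f (\<phi> x))"
 using pd_compose[OF smooth_on_D[OF U(3)] smooth_on_D[OF _ U(4)], of x f c] by (simp add: jac_def)

abbreviation G :: "real^'n => 'n => 'n => 'n => real" where
 "G x c i k \<equiv> \<Sigma> j. christoffel h (\<phi> x) i j k * E x $ j $ c"

text \<open>The definition of the new connection coefficients, solved for the second derivatives of
  \<open>\<phi>\<close>.\<close>

lemma E_\<gamma>: "x \<in> U ==> (\<Sigma> e. E x $ i $ e * \<gamma> e b c x) = pd b (\<lambda>y. E y $ i $ c) x + (\<Sigma> k. G x b i k * E x $ k $ c)"
proof -
 assume x: "x \<in> U"
 define s where "s i = pd b (pd c (\<lambda>y. \<phi> y $ i)) x +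
   (\<Sigma> j k. christoffel h (\<phi> x) i j k * E x $ j $ b * E x $ k $ c)" for i
 have "(\<Sigma> e. E x $ i $ e * \<gamma> e b c x) = (\<Sigma> e. \<Sum>i'\<in>UNIV. E x $ i $ e * \<theta> x $ e $ i' * s i')"
  unfolding fconn_def s_def by (simp add: sum_distrib_left mult.assoc)
 also have "... = (\<Sum>i'\<in>UNIV. (E x ** \<theta> x) $ i $ i' * s i')"
  by (subst sum.swap) (simp add: matrix_matrix_mult_def sum_distrib_right)
 also have "... = s i" by (simp add: matrix_inv_right[OF U(5)[OF x]] mat_def if_distrib[of "\<lambda>c. c * _"] cong: if_cong)
 also have "s i = pd b (\<lambda>y. E y $ i $ c) x + (\<Sigma> k. G x b i k * E x $ k $ c)"
 proof -
  have "(\<lambda>y. E y $ i $ c) = pd c (\<lambda>y. \<phi> y $ i)" by (rule ext) (simp add: jac_def)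
  moreover have "(\<Sigma> j k. christoffel h (\<phi> x) i j k * E x $ j $ b * E x $ k $ c) = (\<Sigma> k. G x b i k * E x $ k $ c)"
   by (subst sum.swap) (simp add: sum_distrib_right)
  ultimately show ?thesis by (simp add: s_def)
 qed
 finally show ?thesis .
qed

lemma pd_E: "x \<in> U ==> pd c (\<lambda>y. E y $ i $ l) x = (\<Sigma> e. E x $ i $ e * \<gamma> e c l x) - (\<Sigma> k. G x c i k * E x $ k $ l)"
 by (simp add: E_\<gamma>)

text \<open>Brought to the shape demanded by \<open>pd_act\<close>: for the dual frame both
  connections enter with a minus sign and exchanged indices.\<close>

lemma pd_\<theta>:
 assumes x: "x \<in> U"
 shows "pd c (\<lambda>y. \<theta> y $ a $ i) x = (\<Sigma> e. \<theta> x $ e $ i * (- \<gamma> a c e x)) - (\<Sigma> k. - G x c k i * \<theta> x $ a $ k)"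
proof -
 have "pd c (\<lambda>y. \<theta> y $ a $ i) x = - (\<Sigma> r l. \<theta> x $ a $ r * pd c (\<lambda>y. E y $ r $ l) x * \<theta> x $ l $ i)"
  by (rule pd_matrix_inv[OF smooth_on_D[OF smooth_E x] U(5)[OF x]])
 also have "... = - (\<Sigma> r l e. \<theta> x $ a $ r * E x $ r $ e * (\<gamma> e c l x * \<theta> x $ l $ i))
  + (\<Sigma> r l k. \<theta> x $ a $ r * G x c r k * (E x $ k $ l * \<theta> x $ l $ i))"
  unfolding pd_E[OF x] by (simp add: left_diff_distrib right_diff_distrib sum_subtractf sum_distrib_left sum_distrib_right mult.assoc)
 also have "(\<Sigma> r l e. \<theta> x $ a $ r * E x $ r $ e * (\<gamma> e c l x * \<theta> x $ l $ i))
  = (\<Sigma> e l. (\<theta> x ** E x) $ a $ e * (\<gamma> e c l x * \<theta> x $ l $ i))"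
 proof -
  have "(\<Sigma> r l e. \<theta> x $ a $ r * E x $ r $ e * (\<gamma> e c l x * \<theta> x $ l $ i))
   = (\<Sigma> l e r. \<theta> x $ a $ r * E x $ r $ e * (\<gamma> e c l x * \<theta> x $ l $ i))"
   by (rule trans[OF sum.swap]) (rule sum.cong[OF refl sum.swap])
  then show ?thesis by (subst sum.swap) (simp add: matrix_matrix_mult_def sum_distrib_right)
 qed
 also have "... = (\<Sigma> l. \<gamma> a c l x * \<theta> x $ l $ i)" by (subst sum.swap)
   (simp add: matrix_inv_left[OF U(5)[OF x]] mat_def if_distrib[of "\<lambda>c. c * _"] cong: if_cong)
 also have "(\<Sigma> r l k. \<theta> x $ a $ r * G x c r k * (E x $ k $ l * \<theta> x $ l $ i))
  = (\<Sigma> r k. \<theta> x $ a $ r * G x c r k * (E x ** \<theta> x) $ k $ i)"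
 proof (rule sum.cong[OF refl])
  fix r
  show "(\<Sigma> l k. \<theta> x $ a $ r * G x c r k * (E x $ k $ l * \<theta> x $ l $ i)) = (\<Sigma> k. \<theta> x $ a $ r * G x c r k * (E x ** \<theta> x) $ k $ i)"
   by (rule trans[OF sum.swap]) (simp only: matrix_matrix_mult_def vec_lambda_beta sum_distrib_left)
 qed
 also have "... = (\<Sigma> r. \<theta> x $ a $ r * G x c r i)"
  by (simp add: matrix_inv_right[OF U(5)[OF x]] mat_def if_distrib[of "\<lambda>c. _ * c"] cong: if_cong)
 finally show ?thesis by (simp add: sum_negf mult.commute)
qed

text \<open>Covariance of \<open>covd\<close>, which is defined in the old coordinates: its
  components in the new ones are again partial derivatives plus connection terms, now with
  \<open>\<gamma>\<close>.\<close>

theorem pd_fr: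
 assumes T: "tensor_smooth_on S T" and x: "x \<in> U"
 shows "pd c (\<lambda>x. fr T x us ls) x = fr (covd h T) x us (c # ls)
  + slot (\<lambda>e l. \<gamma> e c l x) (fr T x us) ls + slot (\<lambda>e u. - \<gamma> u c e x) (\<lambda>us. fr T x us ls) us"
proof -
 have sT: "smooth_on S (\<lambda>x. T x us ls)" for us ls using T by (simp add: tensor_smooth_on_def)
 have sTp: "smooth_on U (\<lambda>x. T (\<phi> x) us ls)" for us ls by (rule smooth_on_compose[OF U(1,3,8) sT])
 let ?e = "\<lambda>x us ls. act (\<lambda>i l. E x $ i $ l) (T (\<phi> x) us) ls"
 have se: "smooth_on U (\<lambda>x. ?e x us ls)" for us ls by (rule smooth_on_act[OF U(1) smooth_E sTp])
 have 1: "pd c (\<lambda>x. ?e x us ls) x =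
  act (\<lambda>i l. E x $ i $ l) (\<lambda>ls. pd c (\<lambda>x. T (\<phi> x) us ls) x - slot (G x c) (T (\<phi> x) us) ls) ls
   + slot (\<lambda>e l. \<gamma> e c l x) (?e x us) ls" for us ls by (rule pd_act[OF U(1) x smooth_E sTp]) (rule pd_E[OF x])
 have "pd c (\<lambda>x. fr T x us ls) x =
  act (\<lambda>i a. \<theta> x $ a $ i) (\<lambda>us. pd c (\<lambda>x. ?e x us ls) x - slot (\<lambda>i k. - G x c k i) (\<lambda>us. ?e x us ls) us) us
   + slot (\<lambda>e a. - \<gamma> a c e x) (\<lambda>us. fr T x us ls) us"
  unfolding fr_def by (rule pd_act[OF U(1) x smooth_\<theta> se]) (rule pd_\<theta>[OF x])
 also have "act (\<lambda>i a. \<theta> x $ a $ i) (\<lambda>us. pd c (\<lambda>x. ?e x us ls) x - slot (\<lambda>i k. - G x c k i) (\<lambda>us. ?e x us ls) us) us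
  = act (\<lambda>i a. \<theta> x $ a $ i) (\<lambda>us. act (\<lambda>i l. E x $ i $ l) (\<lambda>ls. pd c (\<lambda>x. T (\<phi> x) us ls) x - slot (G x c) (T (\<phi> x) us) ls
    - slot (\<lambda>i k. - G x c k i) (\<lambda>us. T (\<phi> x) us ls) us) ls) us
   + slot (\<lambda>e l. \<gamma> e c l x) (fr T x us) ls"
  unfolding 1 slot_act fr_def act_slot[symmetric] act_add[symmetric] act_diff by (simp add: act_add act_diff)
 also have "act (\<lambda>i a. \<theta> x $ a $ i) (\<lambda>us. act (\<lambda>i l. E x $ i $ l) (\<lambda>ls. pd c (\<lambda>x. T (\<phi> x) us ls) x - slot (G x c) (T (\<phi> x) us) ls
    - slot (\<lambda>i k. - G x c k i) (\<lambda>us. T (\<phi> x) us ls) us) ls) us = fr (covd h T) x us (c # ls)"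
 proof -
  have "pd c (\<lambda>x. T (\<phi> x) us ls) x - slot (G x c) (T (\<phi> x) us) ls - slot (\<lambda>i k. - G x c k i) (\<lambda>us. T (\<phi> x) us ls) us
   = (\<Sum>c'\<in>UNIV. E x $ c' $ c * covd h T (\<phi> x) us (c' # ls))" for us ls
  proof -
   have a: "slot (G x c) f ls = (\<Sum>c'\<in>UNIV. E x $ c' $ c * slot (\<lambda>i k. christoffel h (\<phi> x) i c' k) f ls)" for f ls
    by (rule slot_sum_left)
   have b: "slot (\<lambda>i k. - G x c k i) f ls = (\<Sum>c'\<in>UNIV. E x $ c' $ c * slot (\<lambda>i k. - christoffel h (\<phi> x) k c' i) f ls)" for f ls
    using slot_sum_left[of "\<lambda>c' i k. - christoffel h (\<phi> x) k c' i" "\<lambda>c'. E x $ c' $ c" UNIV f ls] by (simp add: sum_negf)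
   have "covd h T (\<phi> x) us (c' # ls) = pd c' (\<lambda>y. T y us ls) (\<phi> x) - slot (\<lambda>i k. christoffel h (\<phi> x) i c' k) (T (\<phi> x) us) ls
    - slot (\<lambda>i k. - christoffel h (\<phi> x) k c' i) (\<lambda>us. T (\<phi> x) us ls) us" for c'
    by (simp add: covd_def slot_def sum_negf)
   then show ?thesis by (simp add: a b pd_phi[OF x sT] right_diff_distrib sum_subtractf)
  qed
  then show ?thesis by (simp add: fr_def act_sum act_cmult)
 qed
 finally show ?thesis by simp
qed

lemma tensor_norm_fr:
 assumes "transpose E0 ** h p ** E0 = mat 1"
 shows "tensor_norm (h p) r q (T p) = sqrt (\<Sum>us\<in>{us. length us = r}. \<Sum>ls\<in>{ls. length ls = q}. (fr T 0 us ls)\<^sup>2)"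
 unfolding fr_def U(6,7) by (rule tensor_norm_eq_act[OF _ assms]) (use U(5)[OF U(2)] U(7) in simp)

end

section \<open>Curvature bounds the connection in normal coordinates\<close>

context frame_coords
begin

text \<open>The new and the old connection as matrices attached to a direction \<open>c\<close> of
  the new coordinates, and below their derivatives in direction \<open>d\<close>; the structure
  equations become matrix identities.\<close>

definition gm :: "'n => real^'n => real^'n^'n" where "gm c x = (\<chi> a b. \<gamma> a c b x)"
definition Gm :: "'n => real^'n => real^'n^'n" where "Gm c x = (\<chi> i k. G x c i k)"
definition dgm :: "'n => 'n => real^'n => real^'n^'n" where "dgm d c x = (\<chi> a b. pd d (\<gamma> a c b) x)"
definition dGm :: "'n => 'n => real^'n => real^'n^'n" where "dGm d c x = (\<chi> i k. pd d (\<lambda>x. G x c i k) x)"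

lemma smooth_G: "smooth_on U (\<lambda>x. G x c i k)" by (intro smooth_on_sum smooth_on_mult U(1) smooth_\<Gamma> smooth_E)

lemma pd_E_matrix: "x \<in> U ==> pd c (\<lambda>y. E y $ i $ l) x = (E x ** gm c x - Gm c x ** E x) $ i $ l"
 by (simp add: pd_E matrix_matrix_mult_def gm_def Gm_def)

lemma pd_pd_E:
 assumes x: "x \<in> U"
 shows "pd d (pd c (\<lambda>y. E y $ i $ b)) x = ((E x ** gm d x - Gm d x ** E x) ** gm c x + E x ** dgm d c x
   - dGm d c x ** E x - Gm c x ** (E x ** gm d x - Gm d x ** E x)) $ i $ b"
proof -
 note sd = smooth_on_D[OF _ x]
 have mm: "(P ** Q) $ i $ j = (\<Sigma> k. P $ i $ k * Q $ k $ j)" for P Q :: "real^'n^'n" and i j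
  by (simp add: matrix_matrix_mult_def)
 have "pd d (pd c (\<lambda>y. E y $ i $ b)) x =
   pd d (\<lambda>y. (\<Sigma> e. E y $ i $ e * \<gamma> e c b y) - (\<Sigma> k. G y c i k * E y $ k $ b)) x"
  by (rule pd_cong_open[OF U(1) x]) (rule pd_E)
 also have "... = pd d (\<lambda>y. \<Sigma> e. E y $ i $ e * \<gamma> e c b y) x - pd d (\<lambda>y. \<Sigma> k. G y c i k * E y $ k $ b) x"
  by (rule pd_diff; rule sd) (intro smooth_on_sum smooth_on_mult U(1) smooth_\<gamma> smooth_\<Gamma> smooth_E)+
 also have "pd d (\<lambda>y. \<Sigma> e. E y $ i $ e * \<gamma> e c b y) x =
   (\<Sigma> e. E x $ i $ e * pd d (\<gamma> e c b) x + pd d (\<lambda>y. E y $ i $ e) x * \<gamma> e c b x)"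
  by (subst pd_sum) (auto intro!: sum.cong pd_mult sd smooth_on_mult U(1) smooth_\<gamma> smooth_E)
 also have "... = ((E x ** gm d x - Gm d x ** E x) ** gm c x + E x ** dgm d c x) $ i $ b"
  unfolding pd_E_matrix[OF x] vector_add_component mm[of "E x ** gm d x - Gm d x ** E x"] mm[of "E x" "dgm d c x"]
  by (simp add: dgm_def gm_def[of c] sum.distrib)
 also have "pd d (\<lambda>y. \<Sigma> k. G y c i k * E y $ k $ b) x =
   (\<Sigma> k. G x c i k * pd d (\<lambda>y. E y $ k $ b) x + pd d (\<lambda>y. G y c i k) x * E x $ k $ b)"
  by (subst pd_sum) (auto intro!: sum.cong pd_mult sd smooth_on_mult U(1) smooth_G smooth_E)
 also have "... = (Gm c x ** (E x ** gm d x - Gm d x ** E x) + dGm d c x ** E x) $ i $ b"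
  unfolding pd_E_matrix[OF x] vector_add_component mm[of "Gm c x" "E x ** gm d x - Gm d x ** E x"] mm[of "dGm d c x"]
  by (simp add: dGm_def Gm_def[of c] sum.distrib)
 finally show ?thesis by simp
qed

text \<open>The curvature as a matrix-valued two-form: form indices in the new coordinates, matrix
  indices in the old ones.\<close>

definition Rm :: "'n => 'n => real^'n => real^'n^'n" where
 "Rm d c x = (\<chi> i k. \<Sigma> m j. E x $ m $ d * E x $ j $ c * riemann h (\<phi> x) i k m j)"

lemma pd_E_sym: "pd c (\<lambda>y. E y $ i $ d) x = pd d (\<lambda>y. E y $ i $ c) x" if "x \<in> U"
proof -
 have "(\<lambda>y. E y $ i $ e) = pd e (\<lambda>y. \<phi> y $ i)" for e by (rule ext) (simp add: jac_def)
 then show ?thesis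
  using pd_commute[OF U(1) that smooth_on_nth[OF U(1,3)], of c d i] by simp
qed

text \<open>The structure equation dG + G G = R for the old connection pulled back by
  \<open>\<phi>\<close>. Second derivatives of \<open>\<phi>\<close> drop out because they are
  symmetric in \<open>c\<close> and \<open>d\<close>.\<close>

lemma Rm_eq:
 assumes x: "x \<in> U"
 shows "dGm d c x - dGm c d x + Gm d x ** Gm c x - Gm c x ** Gm d x = Rm d c x"
 unfolding vec_eq_iff
proof (intro allI)
 fix i k
 note sd = smooth_on_D[OF _ x]
 let ?C = "\<lambda>i j k. christoffel h (\<phi> x) i j k"
 have dG: "dGm d c x $ i $ k = (\<Sigma> m j. E x $ m $ d * E x $ j $ c * pd m (\<lambda>y. christoffel h y i j k) (\<phi> x))
   + (\<Sigma> j. ?C i j k * pd d (\<lambda>y. E y $ j $ c) x)" for d c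
 proof -
  have "dGm d c x $ i $ k = (\<Sigma> j. ?C i j k * pd d (\<lambda>y. E y $ j $ c) x +
    pd d (\<lambda>y. christoffel h (\<phi> y) i j k) x * E x $ j $ c)"
   unfolding dGm_def vec_lambda_beta
   by (subst pd_sum) (auto intro!: sum.cong pd_mult sd smooth_on_mult U(1) smooth_\<Gamma> smooth_E)
  also have "... = (\<Sigma> j m. E x $ m $ d * E x $ j $ c * pd m (\<lambda>y. christoffel h y i j k) (\<phi> x))
    + (\<Sigma> j. ?C i j k * pd d (\<lambda>y. E y $ j $ c) x)"
   by (simp add: pd_phi[OF x smooth_on_christoffel] sum.distrib sum_distrib_right sum_distrib_left mult_ac)
  finally show ?thesis by (subst sum.swap)
 qed
 have GG: "(Gm d x ** Gm c x) $ i $ k = (\<Sigma> m j. E x $ m $ d * E x $ j $ c * (\<Sigma> e. ?C i m e * ?C e j k))" for d c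
 proof -
  have "(Gm d x ** Gm c x) $ i $ k = (\<Sigma> e m j. E x $ m $ d * E x $ j $ c * (?C i m e * ?C e j k))"
   unfolding matrix_matrix_mult_def Gm_def vec_lambda_beta sum_product by (simp add: mult_ac)
  also have "... = (\<Sigma> m j e. E x $ m $ d * E x $ j $ c * (?C i m e * ?C e j k))"
   by (rule trans[OF sum.swap]) (rule sum.cong[OF refl sum.swap])
  finally show ?thesis by (simp add: sum_distrib_left)
 qed
 have sw: "(\<Sigma> m j. E x $ m $ c * E x $ j $ d * f m j) = (\<Sigma> m j. E x $ m $ d * E x $ j $ c * f j m)" for f
  by (subst sum.swap) (simp add: mult_ac)
 have "(dGm d c x - dGm c d x + Gm d x ** Gm c x - Gm c x ** Gm d x) $ i $ k =
   (\<Sigma> m j. E x $ m $ d * E x $ j $ c * pd m (\<lambda>y. christoffel h y i j k) (\<phi> x))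
  - (\<Sigma> m j. E x $ m $ d * E x $ j $ c * pd j (\<lambda>y. christoffel h y i m k) (\<phi> x))
  + (\<Sigma> m j. E x $ m $ d * E x $ j $ c * (\<Sigma> e. ?C i m e * ?C e j k))
  - (\<Sigma> m j. E x $ m $ d * E x $ j $ c * (\<Sigma> e. ?C i j e * ?C e m k))"
  unfolding vector_minus_component vector_add_component GG dG sw[of "\<lambda>m j. pd m (\<lambda>y. christoffel h y i j k) (\<phi> x)"]
   sw[of "\<lambda>m j. \<Sigma> e. ?C i m e * ?C e j k"] pd_E_sym[OF x, of c _ d] by simp
 also have "... = (\<Sigma> m j. E x $ m $ d * E x $ j $ c * riemann h (\<phi> x) i k m j)"
  by (simp add: riemann_def sum_subtractf sum.distrib distrib_left right_diff_distrib)
 also have "... = Rm d c x $ i $ k" by (simp add: Rm_def)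
 finally show "(dGm d c x - dGm c d x + Gm d x ** Gm c x - Gm c x ** Gm d x) $ i $ k = Rm d c x $ i $ k" .
qed

abbreviation riem :: "'n tensor_field" where
 "riem \<equiv> \<lambda>y us ls. riemann h y (us ! 0) (ls ! 0) (ls ! 1) (ls ! 2)"

lemma smooth_riem: "tensor_smooth_on S riem"
 unfolding tensor_smooth_on_def riemann_def
 by (intro allI smooth_on_sum smooth_on_add smooth_on_diff smooth_on_mult smooth_on_pd oS smooth_on_christoffel)

text \<open>Second derivatives of \<open>E\<close> commute. Written out with both connections this
  says that \<open>E\<close> intertwines their curvatures, so the curvature of
  \<open>\<gamma>\<close> is the transformed Riemann tensor.\<close>

lemma fr_riem:
 assumes x: "x \<in> U"
 shows "fr riem x [a] [b, d, c] = pd d (\<gamma> a c b) x - pd c (\<gamma> a d b) x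
  + (\<Sigma> e. \<gamma> a d e x * \<gamma> e c b x - \<gamma> a c e x * \<gamma> e d b x)"
proof -
 let ?K = "gm d x ** gm c x - gm c x ** gm d x + dgm d c x - dgm c d x"
 have "fr riem x [a] [b, d, c] = (\<Sigma> i. \<theta> x $ a $ i * (\<Sigma> k. E x $ k $ b * (\<Sigma> m j. E x $ m $ d * E x $ j $ c * riemann h (\<phi> x) i k m j)))"
  by (simp add: fr_def sum_distrib_left mult.assoc)
 also have "... = (\<theta> x ** (Rm d c x ** E x)) $ a $ b" by (simp add: matrix_matrix_mult_def Rm_def mult.commute)
 finally have R: "fr riem x [a] [b, d, c] = (\<theta> x ** (Rm d c x ** E x)) $ a $ b" .
 have "(E x ** ?K) = (dGm d c x - dGm c d x + Gm d x ** Gm c x - Gm c x ** Gm d x) ** E x"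
  unfolding vec_eq_iff
 proof (intro allI)
  fix i b
  have sm: "smooth_on U (\<lambda>y. E y $ i $ b)" by (rule smooth_E)
  have "pd d (pd c (\<lambda>y. E y $ i $ b)) x = pd c (pd d (\<lambda>y. E y $ i $ b)) x" by (rule pd_commute[OF U(1) x sm])
  then show "(E x ** ?K) $ i $ b = ((dGm d c x - dGm c d x + Gm d x ** Gm c x - Gm c x ** Gm d x) ** E x) $ i $ b"
   unfolding pd_pd_E[OF x] by (simp add: matrix_add_ldistrib matrix_mult_distribs matrix_mul_assoc)
 qed
 then have "\<theta> x ** (Rm d c x ** E x) = \<theta> x ** (E x ** ?K)" by (simp add: Rm_eq[OF x])
 also have "... = ?K" by (simp add: matrix_mul_assoc matrix_inv_left[OF U(5)[OF x]])
 finally show ?thesis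
  unfolding R by (simp add: gm_def dgm_def matrix_matrix_mult_def sum_subtractf)
qed

lemma \<gamma>_sym:
 assumes x: "x \<in> U"
 shows "\<gamma> a b c x = \<gamma> a c b x"
proof -
 have "pd b (pd c (\<lambda>y. \<phi> y $ i)) x = pd c (pd b (\<lambda>y. \<phi> y $ i)) x" for i
  by (rule pd_commute[OF U(1) x smooth_on_nth[OF U(1,3)]])
 moreover have "(\<Sigma> j k. christoffel h (\<phi> x) i j k * E x $ j $ b * E x $ k $ c) =
  (\<Sigma> j k. christoffel h (\<phi> x) i j k * E x $ j $ c * E x $ k $ b)" for i
  by (subst sum.swap) (auto simp: christoffel_sym[OF U(4)[OF x], of i] intro!: sum.cong)
 ultimately show ?thesis by (simp add: fconn_def)
qed

end

text \<open>Each of the n directions contributes a covariant derivative with one more index and k n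
  connection terms, each a product costing \<open>4 ^ r\<close>.\<close>

primrec jet_const :: "nat => real => nat => nat => real" where
 "jet_const n G 0 k = 1"
| "jet_const n G (Suc r) k = 1 + real n * (jet_const n G r (Suc k) + real k * real n * 4 ^ r * G * jet_const n G r k)"

text \<open>The second factor bounds the curl of the connection by curvature (a tensor with 4
  indices) and by quadratic terms of the previous order; the first one comes from integrating twice
  radially.\<close>

primrec conn_const :: "nat => real => nat => real" where
 "conn_const n M 0 = 0"
| "conn_const n M (Suc s) = real ((n\<^sup>2 * (s + 2) + n) * (s + 1)) *
  (jet_const n (conn_const n M s) s 4 * M + real n * (2 * (4 ^ s * conn_const n M s * conn_const n M s)))"

lemma (in smooth_at_point) jn_slot:
 fixes F :: "real^'i => 'n::finite list => real"
 assumes A: "!!e l. smooth_on S (A e l)" "!!e l. jn r (A e l) x0 <= G"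
  and F: "!!ls'. length ls' = length ls ==> smooth_on S (\<lambda>x. F x ls')"
   "!!ls'. length ls' = length ls ==> jn r (\<lambda>x. F x ls') x0 <= B"
 shows "jn r (\<lambda>x. slot (\<lambda>e l. A e l x) (F x) ls) x0 <= real (length ls) * real CARD('n) * (4 ^ r * G * B)"
proof -
 have "jn r (\<lambda>x. slot (\<lambda>e l. A e l x) (F x) ls) x0 \<le>
   (\<Sum>i<length ls. jn r (\<lambda>x. \<Sigma> e. A e (ls ! i) x * F x (ls[i := e])) x0)"
  unfolding slot_def by (rule jn_sum) (intro smooth_on_sum smooth_on_mult S(1) A F, simp)
 also have "... <= (\<Sum>i<length ls. \<Sum>e\<in>(UNIV :: 'n set). jn r (\<lambda>x. A e (ls ! i) x * F x (ls[i := e])) x0)"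
  by (intro sum_mono jn_sum smooth_on_mult S(1) A F) simp
 also have "... <= (\<Sum>i<length ls. \<Sum>e\<in>(UNIV :: 'n set). 4 ^ r * G * B)"
  by (intro sum_mono jn_mult_bound A F) simp_all
 finally show ?thesis by (simp add: mult.assoc)
qed

context frame_coords
begin

text \<open>By \<open>pd_fr\<close> a derivative of a component is a component of the covariant
  derivative plus products with the connection. The induction hypothesis is applied to
  \<open>T\<close> and to \<open>covd h T\<close>, so tensor and rank are arbitrary.\<close>

lemma jn_fr:
 assumes "tensor_smooth_on S T" and K: "!!a b c. jn r (\<gamma> a b c) 0 <= K"
  and "!!j us ls. j <= r ==> length us = k ==> length ls = q + j ==> \<bar>fr ((covd h ^^ j) T) 0 us ls\<bar> <= M"
  and "length us = k" "length ls = q"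
 shows "jn r (\<lambda>x. fr T x us ls) 0 <= jet_const CARD('n) K r (k + q) * M"
 using assms
proof (induction r arbitrary: T q us ls)
 case 0
 from 0(3)[of 0 us ls] 0 show ?case by simp
next
 case (Suc r)
 let ?n = "CARD('n)"
 note T = Suc.prems(1) and len = Suc.prems(4,5)
 have K: "jn r (\<gamma> a b c) 0 <= K" for a b c using Suc.prems(2)[of a b c] jn_mono_Suc order_trans by blast
 have cT: "tensor_smooth_on S (covd h T)" by (rule smooth_on_covd[OF T])
 have IH1: "jn r (\<lambda>x. fr T x us ls) 0 <= jet_const ?n K r (k + q) * M" if "length us = k" "length ls = q" for us ls
  by (rule Suc.IH[OF T K _ that]) (auto intro: Suc.prems(3))
 have IH2: "jn r (\<lambda>x. fr (covd h T) x us (c # ls)) 0 <= jet_const ?n K r (k + Suc q) * M" for c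
  by (rule Suc.IH[OF cT K]) (use len Suc.prems(3)[of "Suc _"] in \<open>auto simp: funpow_swap1\<close>)
 let ?s1 = "\<lambda>c x. slot (\<lambda>e l. \<gamma> e c l x) (fr T x us) ls"
 let ?s2 = "\<lambda>c x. slot (\<lambda>e u. - \<gamma> u c e x) (\<lambda>us. fr T x us ls) us"
 let ?B = "4 ^ r * K * (jet_const ?n K r (k + q) * M)"
 have s1: "smooth_on U (?s1 c)" and s2: "smooth_on U (?s2 c)" for c
  unfolding slot_def by (intro smooth_on_sum smooth_on_mult smooth_on_minus U(1) smooth_\<gamma> smooth_fr T)+
 have b1: "jn r (?s1 c) 0 <= real q * real ?n * ?B" for c
  using jn_slot[of "\<lambda>e l. \<gamma> e c l" r K ls "\<lambda>x. fr T x us", OF smooth_\<gamma> K smooth_fr[OF T] IH1[OF len(1)]] len(2) by simp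
 have b2: "jn r (?s2 c) 0 <= real k * real ?n * ?B" for c
 proof -
  have "smooth_on U (\<lambda>x. - \<gamma> u c e x)" "jn r (\<lambda>x. - \<gamma> u c e x) 0 <= K" for u e
   using K by (auto simp: jn_minus[OF smooth_\<gamma>] intro: smooth_on_minus[OF U(1) smooth_\<gamma>])
  then show ?thesis
   using jn_slot[of "\<lambda>e u x. - \<gamma> u c e x" r K us "\<lambda>x us. fr T x us ls", OF _ _ smooth_fr[OF T] IH1[OF _ len(2)]] len(1) by simp
 qed
 have b3: "jn r (pd c (\<lambda>x. fr T x us ls)) 0 <= jn r (\<lambda>x. fr (covd h T) x us (c # ls)) 0 + jn r (?s1 c) 0 + jn r (?s2 c) 0" for c
 proof -
  have "jn r (pd c (\<lambda>x. fr T x us ls)) 0 = jn r (\<lambda>x. fr (covd h T) x us (c # ls) + ?s1 c x + ?s2 c x) 0"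
   by (rule jn_cong_S) (rule pd_fr[OF T])
  also have "... <= jn r (\<lambda>x. fr (covd h T) x us (c # ls) + ?s1 c x) 0 + jn r (?s2 c) 0"
   by (intro jn_add smooth_on_add U(1) smooth_fr cT s1 s2)
  also have "jn r (\<lambda>x. fr (covd h T) x us (c # ls) + ?s1 c x) 0 <= jn r (\<lambda>x. fr (covd h T) x us (c # ls)) 0 + jn r (?s1 c) 0"
   by (intro jn_add smooth_fr cT s1)
  finally show ?thesis by simp
 qed
 have "jn r (pd c (\<lambda>x. fr T x us ls)) 0 <= jet_const ?n K r (k + Suc q) * M + real q * real ?n * ?B + real k * real ?n * ?B" for c
  using b1[of c] b2[of c] b3[of c] IH2[of c] by linarith
 then have "(\<Sigma> c. jn r (pd c (\<lambda>x. fr T x us ls)) 0) <= real ?n * (jet_const ?n K r (k + Suc q) * M + real q * real ?n * ?B + real k * real ?n * ?B)"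
  using sum_bounded_above[of UNIV "\<lambda>c. jn r (pd c (\<lambda>x. fr T x us ls)) 0"] by simp
 moreover have "\<bar>fr T 0 us ls\<bar> <= M" using Suc.prems(3)[of 0 us ls] len by simp
 ultimately show ?case by (simp add: algebra_simps)
qed

text \<open>\<open>pd_fr\<close> solved for the covariant derivative; one partial derivative of the
  components is spent.\<close>

lemma jn_fr_covd:
 assumes T: "tensor_smooth_on S T" and K: "!!a b c. jn r (\<gamma> a b c) 0 <= K"
  and M: "!!us ls. length us = k ==> length ls = q ==> jn (Suc r) (\<lambda>x. fr T x us ls) 0 <= M"
  and len: "length us = k" "length ls = Suc q"
 shows "jn r (\<lambda>x. fr (covd h T) x us ls) 0 <= (1 + real (k + q) * real CARD('n) * (4 ^ r * K)) * M"
proof -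
 obtain c ls' where ls: "ls = c # ls'" "length ls' = q" using len by (cases ls) auto
 let ?s1 = "\<lambda>x. slot (\<lambda>e l. \<gamma> e c l x) (fr T x us) ls'"
 let ?s2 = "\<lambda>x. slot (\<lambda>e u. - \<gamma> u c e x) (\<lambda>us. fr T x us ls') us"
 have Mr: "jn r (\<lambda>x. fr T x us ls) 0 <= M" if "length us = k" "length ls = q" for us ls
  using M[OF that] jn_mono_Suc order_trans by blast
 have s1: "smooth_on U ?s1" and s2: "smooth_on U ?s2"
  unfolding slot_def by (intro smooth_on_sum smooth_on_mult smooth_on_minus U(1) smooth_\<gamma> smooth_fr T)+
 have 1: "jn r ?s1 0 <= real q * real CARD('n) * (4 ^ r * K * M)"
  using jn_slot[of "\<lambda>e l. \<gamma> e c l" r K ls' "\<lambda>x. fr T x us", OF smooth_\<gamma> K smooth_fr[OF T] Mr[OF len(1)]] ls(2) by simp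
 have "smooth_on U (\<lambda>x. - \<gamma> u c e x)" "jn r (\<lambda>x. - \<gamma> u c e x) 0 <= K" for u e
  using K by (auto simp: jn_minus[OF smooth_\<gamma>] intro: smooth_on_minus[OF U(1) smooth_\<gamma>])
 then have 2: "jn r ?s2 0 <= real k * real CARD('n) * (4 ^ r * K * M)"
  using jn_slot[of "\<lambda>e u x. - \<gamma> u c e x" r K us "\<lambda>x us. fr T x us ls'", OF _ _ smooth_fr[OF T] Mr[OF _ ls(2)]] len(1) by simp
 have sp: "smooth_on U (pd c (\<lambda>x. fr T x us ls'))" by (intro smooth_on_pd smooth_fr T)
 have "jn r (\<lambda>x. fr (covd h T) x us ls) 0 = jn r (\<lambda>x. pd c (\<lambda>x. fr T x us ls') x - ?s1 x - ?s2 x) 0"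
  by (rule jn_cong_S) (simp add: pd_fr[OF T] ls(1))
 also have "... <= jn r (\<lambda>x. pd c (\<lambda>x. fr T x us ls') x - ?s1 x) 0 + jn r ?s2 0"
  by (intro jn_diff smooth_on_diff U(1) sp s1 s2)
 also have "jn r (\<lambda>x. pd c (\<lambda>x. fr T x us ls') x - ?s1 x) 0 <= jn r (pd c (\<lambda>x. fr T x us ls')) 0 + jn r ?s1 0"
  by (intro jn_diff sp s1)
 also have "jn r (pd c (\<lambda>x. fr T x us ls')) 0 <= M"
  using jn_pd[of r c "\<lambda>x. fr T x us ls'" 0] M[OF len(1) ls(2)] by linarith
 finally show ?thesis using 1 2 by (simp add: algebra_simps)
qed

lemma jn_fr_covd_iter:
 assumes T: "tensor_smooth_on S T" and K: "!!a b c. jn R (\<gamma> a b c) 0 <= K" and "r + m <= R"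
  and "!!us ls. length us = k ==> length ls = q ==> jn (r + m) (\<lambda>x. fr T x us ls) 0 <= M"
  and "length us = k" "length ls = q + m" "0 <= M"
 shows "jn r (\<lambda>x. fr ((covd h ^^ m) T) x us ls) 0 <= (1 + real (k + q + R) * real CARD('n) * (4 ^ R * K)) ^ m * M"
 using assms(3-7)
proof (induction m arbitrary: r us ls)
 case (Suc m)
 \<comment> \<open>Taken at the largest rank and order that occur, so that one factor serves every
   step.\<close>
 let ?D = "1 + real (k + q + R) * real CARD('n) * (4 ^ R * K)"
 have G0: "0 <= K" using K[of undefined undefined undefined] jn_nonneg order_trans by blast
 then have D: "1 <= ?D" by simp
 have Gr: "jn r (\<gamma> a b c) 0 <= K" for a b c
  using jn_mono[of r R "\<gamma> a b c" 0] K[of a b c] Suc.prems(1) by simp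
 have IH: "jn (Suc r) (\<lambda>x. fr ((covd h ^^ m) T) x us ls) 0 <= ?D ^ m * M" if "length us = k" "length ls = q + m" for us ls
  by (rule Suc.IH[OF _ _ that]) (use Suc.prems in auto)
 have "jn r (\<lambda>x. fr (covd h ((covd h ^^ m) T)) x us ls) 0 <= (1 + real (k + (q + m)) * real CARD('n) * (4 ^ r * K)) * (?D ^ m * M)"
  by (rule jn_fr_covd[OF smooth_on_covd_iter[OF T] Gr IH]) (use Suc.prems in auto)
 also have "... <= ?D * (?D ^ m * M)"
  using Suc.prems(1,5) D G0
  by (intro mult_right_mono add_left_mono mult_mono power_increasing mult_nonneg_nonneg zero_le_power) auto
 finally show ?case by (simp add: mult.assoc)
qed simp

lemma fr_le_tensor_norm:
 assumes "transpose E0 ** h p ** E0 = mat 1" "length us = k" "length ls = q"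
 shows "\<bar>fr T 0 us ls\<bar> <= tensor_norm (h p) k q (T p)"
proof -
 let ?U = "{us :: 'n list. length us = k}" and ?L = "{ls :: 'n list. length ls = q}"
 have "(fr T 0 us ls)\<^sup>2 <= (\<Sum>ls\<in>?L. (fr T 0 us ls)\<^sup>2)"
  by (rule member_le_sum) (use assms finite_lists_length_eq' in auto)
 also have "... <= (\<Sum>us\<in>?U. \<Sum>ls\<in>?L. (fr T 0 us ls)\<^sup>2)"
  by (rule member_le_sum[of us ?U "\<lambda>us. \<Sum>ls\<in>?L. (fr T 0 us ls)\<^sup>2"]) (use assms finite_lists_length_eq' in "auto intro: sum_nonneg")
 finally show ?thesis
  unfolding tensor_norm_fr[OF assms(1)] using real_le_rsqrt[of "\<bar>fr T 0 us ls\<bar>"] by simp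
qed

lemma tensor_norm_le_fr:
 assumes "transpose E0 ** h p ** E0 = mat 1"
  and M: "!!us ls. length us = k ==> length ls = q ==> \<bar>fr T 0 us ls\<bar> <= M"
 shows "tensor_norm (h p) k q (T p) <= sqrt (real (CARD('n) ^ k * CARD('n) ^ q)) * M"
proof -
 let ?U = "{us :: 'n list. length us = k}" and ?L = "{ls :: 'n list. length ls = q}"
 have card: "card ?U = CARD('n) ^ k" "card ?L = CARD('n) ^ q"
  using card_lists_length_eq[of "UNIV :: 'n set"] by auto
 have M0: "0 <= M" using M[of "replicate k undefined" "replicate q undefined"] by (simp add: order_trans[OF abs_ge_zero])
 have "(\<Sum>us\<in>?U. \<Sum>ls\<in>?L. (fr T 0 us ls)\<^sup>2) <= (\<Sum>us\<in>?U. \<Sum>ls\<in>?L. M\<^sup>2)"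
  by (intro sum_mono power2_mono) (use M M0 in auto)
 also have "... = real (CARD('n) ^ k * CARD('n) ^ q) * M\<^sup>2" by (simp add: card)
 finally have "tensor_norm (h p) k q (T p) <= sqrt (real (CARD('n) ^ k * CARD('n) ^ q) * M\<^sup>2)"
  unfolding tensor_norm_fr[OF assms(1)] by (rule real_sqrt_le_mono)
 then show ?thesis using M0 by (simp add: real_sqrt_mult)
qed

text \<open>The part of the curvature that is linear in the connection.\<close>

definition \<rho> :: "'n => 'n => 'n => 'n => real^'n => real" where
 "\<rho> a b c d x = pd c (\<gamma> a d b) x - pd d (\<gamma> a c b) x"

text \<open>The connection contracted once with the position; contracted twice it is
  \<open>radial_conn\<close>.\<close>

definition u :: "'n => 'n => real^'n => real" where
 "u a d x = (\<Sigma> b. x $ b * \<gamma> a d b x)"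

lemma smooth_\<rho>: "smooth_on U (\<rho> a b c d)"
 unfolding \<rho>_def[abs_def] by (intro smooth_on_diff smooth_on_pd U(1) smooth_\<gamma>)

lemma smooth_u: "smooth_on U (u a d)"
 unfolding u_def[abs_def] by (intro smooth_on_sum smooth_on_mult U(1) smooth_on_coord smooth_\<gamma>)

lemma pd_coord_mult: "smooth_on U f ==> x \<in> U ==> pd i (\<lambda>y. y $ c * f y) x = x $ c * pd i f x + (if i = c then f x else 0)"
 using pd_shift_mult[of f x i c] by simp

lemma pd_coord_sum:
 assumes "!!c. smooth_on U (f c)" "x \<in> U"
 shows "pd i (\<lambda>y. \<Sigma> c. y $ c * f c y) x = (\<Sigma> c. x $ c * pd i (f c) x) + f i x"
proof -
 have "pd i (\<lambda>y. \<Sigma> c. y $ c * f c y) x = (\<Sigma> c. x $ c * pd i (f c) x + (if i = c then f c x else 0))"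
  by (subst pd_sum) (auto simp: pd_coord_mult assms intro!: smooth_on_D[OF _ assms(2)] smooth_on_mult U(1) smooth_on_coord assms)
 then show ?thesis by (simp add: sum.distrib)
qed

lemma pd_\<gamma>_sym: "x \<in> U ==> pd d (\<gamma> a b c) x = pd d (\<gamma> a c b) x"
 by (rule pd_cong_open[OF U(1) _ \<gamma>_sym])

text \<open>First radial equation. Differentiating \<open>u\<close> produces the connection itself
  and a derivative in the wrong direction, which \<open>\<rho>\<close> exchanges for the radial
  one.\<close>

lemma euler_\<gamma>:
 assumes x: "x \<in> U"
 shows "euler (\<gamma> a d b) x + \<gamma> a d b x = pd d (u a b) x + (\<Sigma> c. x $ c * \<rho> a b c d x)"
proof -
 have "pd d (u a b) x = (\<Sigma> c. x $ c * pd d (\<gamma> a c b) x) + \<gamma> a d b x"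
  unfolding u_def[abs_def] using pd_coord_sum[of "\<gamma> a b", OF smooth_\<gamma> x] by (simp add: pd_\<gamma>_sym[OF x, of d a b] \<gamma>_sym[OF x, of a b d])
 then show ?thesis by (simp add: euler_def \<rho>_def right_diff_distrib sum_subtractf)
qed

text \<open>Second radial equation, the first one contracted with the position once more. Its source
  is \<open>radial_conn\<close>, which vanishes to high order, and curvature.\<close>

lemma euler_u:
 assumes x: "x \<in> U"
 shows "euler (u a d) x + u a d x = pd d (radial_conn (christoffel h) \<phi> a) x + (\<Sigma> b c. x $ b * (x $ c * \<rho> a b c d x))"
proof -
 have N: "radial_conn (christoffel h) \<phi> a = (\<lambda>y. \<Sigma> b. y $ b * u a b y)"
  by (rule ext) (simp add: radial_conn_def u_def sum_distrib_left)
 have "pd d (radial_conn (christoffel h) \<phi> a) x = (\<Sigma> b. x $ b * pd d (u a b) x) + u a d x"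
  unfolding N by (rule pd_coord_sum[OF smooth_u x])
 also have "... = (\<Sigma> b. x $ b * (euler (\<gamma> a d b) x + \<gamma> a d b x - (\<Sigma> c. x $ c * \<rho> a b c d x))) + u a d x"
  by (simp add: euler_\<gamma>[OF x])
 also have "... = (\<Sigma> b. x $ b * euler (\<gamma> a d b) x) - (\<Sigma> b c. x $ b * (x $ c * \<rho> a b c d x)) + 2 * u a d x"
  by (simp add: right_diff_distrib distrib_left sum_subtractf sum.distrib sum_distrib_left u_def)
 also have "(\<Sigma> b. x $ b * euler (\<gamma> a d b) x) = euler (u a d) x - u a d x"
 proof -
  have "euler (u a d) x = (\<Sigma> c. x $ c * (\<Sigma> b. x $ b * pd c (\<gamma> a d b) x)) + u a d x"
   unfolding euler_def u_def[abs_def] by (simp add: pd_coord_sum[of "\<gamma> a d", OF smooth_\<gamma> x] distrib_left sum.distrib)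
  also have "(\<Sigma> c. x $ c * (\<Sigma> b. x $ b * pd c (\<gamma> a d b) x)) = (\<Sigma> b. x $ b * euler (\<gamma> a d b) x)"
   unfolding euler_def sum_distrib_left by (subst sum.swap) (simp add: mult.left_commute)
  finally show ?thesis by simp
 qed
 finally show ?thesis by simp
qed

lemma jn_coord_mult: "smooth_on U f ==> jn (Suc r) (\<lambda>y. y $ c * f y) 0 <= real (Suc r) * jn r f 0"
 using jn_shift_mult[of f r c] by simp

text \<open>The term with \<open>radial_conn\<close> is invisible at this order, and
  \<open>jn_le_euler\<close> inverts the radial operator; the remaining source carries a coordinate
  factor and so needs one order less of \<open>P\<close>.\<close>

lemma jn_u:
 assumes fl: "flat (r + 2) (radial_conn (christoffel h) \<phi> a)"
  and P: "!!b c. jn r (\<lambda>y. \<Sigma> c. y $ c * \<rho> a b c d y) 0 <= P"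
 shows "jn (Suc r) (u a d) 0 <= real CARD('n) * (real (Suc r) * P)"
proof -
 let ?N = "radial_conn (christoffel h) \<phi> a" and ?s = "\<lambda>b y. \<Sigma> c. y $ c * \<rho> a b c d y"
 have s: "smooth_on U (?s b)" for b by (intro smooth_on_sum smooth_on_mult U(1) smooth_on_coord smooth_\<rho>)
 have sN: "smooth_on U (pd d ?N)"
  by (intro smooth_on_pd coords_at_smooth(6)[where \<Gamma>="christoffel h", OF smooth_on_christoffel coords])
 have "jn (Suc r) (u a d) 0 <= jn (Suc r) (\<lambda>y. euler (u a d) y + real (Suc 0) * u a d y) 0"
  by (rule jn_le_euler[OF smooth_u])
 also have "... = jn (Suc r) (\<lambda>y. pd d ?N y + (\<Sigma> b. y $ b * ?s b y)) 0"
  by (rule jn_cong_S) (simp add: euler_u sum_distrib_left)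
 also have "... <= jn (Suc r) (pd d ?N) 0 + jn (Suc r) (\<lambda>y. \<Sigma> b. y $ b * ?s b y) 0"
  by (intro jn_add sN smooth_on_sum smooth_on_mult U(1) smooth_on_coord smooth_\<rho>)
 also have "jn (Suc r) (pd d ?N) 0 = 0"
  using fl jn_pd[of "Suc r" d ?N 0] jn_nonneg[of "Suc r" "pd d ?N" 0] by (simp only: flat_def add_2_eq_Suc' order_antisym)
 also have "jn (Suc r) (\<lambda>y. \<Sigma> b. y $ b * ?s b y) 0 <= (\<Sigma> b. jn (Suc r) (\<lambda>y. y $ b * ?s b y) 0)"
  by (intro jn_sum smooth_on_mult U(1) smooth_on_coord s)
 also have "... <= (\<Sum>b\<in>(UNIV :: 'n set). real (Suc r) * P)"
  by (intro sum_mono order_trans[OF jn_coord_mult[OF s]] mult_left_mono P) simp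
 finally show ?thesis by simp
qed

lemma jn_\<gamma>_step:
 assumes fl: "flat (r + 2) (radial_conn (christoffel h) \<phi> a)"
  and P: "!!b c. jn r (\<lambda>y. \<Sigma> c. y $ c * \<rho> a b c d y) 0 <= P" "!!d. jn r (\<lambda>y. \<Sigma> c. y $ c * \<rho> a d c b y) 0 <= P"
 shows "jn r (\<gamma> a d b) 0 <= real CARD('n) * (real (Suc r) * P) + P"
proof -
 let ?s = "\<lambda>y. \<Sigma> c. y $ c * \<rho> a b c d y"
 have "jn r (\<gamma> a d b) 0 <= jn r (\<lambda>y. euler (\<gamma> a d b) y + real (Suc 0) * \<gamma> a d b y) 0"
  by (rule jn_le_euler[OF smooth_\<gamma>])
 also have "... = jn r (\<lambda>y. pd d (u a b) y + ?s y) 0" by (rule jn_cong_S) (simp add: euler_\<gamma>)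
 also have "... <= jn r (pd d (u a b)) 0 + jn r ?s 0"
  by (intro jn_add smooth_on_pd smooth_u smooth_on_sum smooth_on_mult U(1) smooth_on_coord smooth_\<rho>)
 also have "jn r (pd d (u a b)) 0 <= jn (Suc r) (u a b) 0" by (rule jn_pd)
 also have "... <= real CARD('n) * (real (Suc r) * P)" by (rule jn_u[OF fl P(2)])
 finally show ?thesis using P(1)[of b] by simp
qed

text \<open>The two radial equations recover the connection from \<open>\<rho>\<close>. Since
  \<open>\<rho>\<close> appears there with a coordinate factor, order s of \<open>\<rho>\<close>,
  hence of curvature and connection, gives order s + 1 of the connection.\<close>

theorem connection_bound:
 assumes fl: "!!a. flat (R + 2) (radial_conn (christoffel h) \<phi> a)"
  and M: "!!j us ls. j <= R ==> length us = 1 ==> length ls = 3 + j ==> \<bar>fr ((covd h ^^ j) riem) 0 us ls\<bar> <= M"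
  and "r <= R"
 shows "jn r (\<gamma> a b c) 0 <= conn_const CARD('n) M r"
 using \<open>r <= R\<close>
proof (induction r arbitrary: a b c)
 case 0
 \<comment> \<open>At the origin the coordinate factors vanish, so the connection itself is zero
   there.\<close>
 have "jn 0 (\<gamma> a b c) 0 <= real CARD('n) * (real (Suc 0) * 0) + 0"
  by (rule jn_\<gamma>_step) (use flat_mono[OF fl[of a], of 2] in "auto simp: numeral_2_eq_2")
 then show ?case by simp
next
 case (Suc s)
 let ?n = "CARD('n)"
 define K where "K = conn_const ?n M s"
 define P where "P = jet_const ?n K s 4 * M + real ?n * (2 * (4 ^ s * K * K))"
 have K: "jn s (\<gamma> a b c) 0 <= K" for a b c unfolding K_def by (rule Suc.IH) (use Suc.prems in simp)
 have \<rho>: "jn s (\<rho> a b c d) 0 <= P" for a b c d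
 proof -
  let ?q = "\<lambda>e x. \<gamma> a c e x * \<gamma> e d b x - \<gamma> a d e x * \<gamma> e c b x"
  have q: "smooth_on U (?q e)" for e by (intro smooth_on_diff smooth_on_mult U(1) smooth_\<gamma>)
  have "jn s (\<rho> a b c d) 0 = jn s (\<lambda>x. fr riem x [a] [b, c, d] - (\<Sigma> e. ?q e x)) 0"
   by (rule jn_cong_S) (subst fr_riem, assumption, simp add: \<rho>_def)
  also have "... <= jn s (\<lambda>x. fr riem x [a] [b, c, d]) 0 + jn s (\<lambda>x. \<Sigma> e. ?q e x) 0"
   by (intro jn_diff smooth_fr smooth_riem smooth_on_sum U(1) q)
  also have "jn s (\<lambda>x. fr riem x [a] [b, c, d]) 0 <= jet_const ?n K s (1 + 3) * M"
   by (rule jn_fr[OF smooth_riem K], rule M) (use Suc.prems in auto)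
  also have "jn s (\<lambda>x. \<Sigma> e. ?q e x) 0 <= (\<Sigma> e. jn s (?q e) 0)" by (rule jn_sum[OF q])
  also have "... <= (\<Sum>e\<in>(UNIV :: 'n set). 4 ^ s * K * K + 4 ^ s * K * K)"
   by (intro sum_mono order_trans[OF jn_diff] add_mono jn_mult_bound smooth_on_mult U(1) smooth_\<gamma> K)
  finally show ?thesis by (simp add: P_def mult_ac)
 qed
 have sum\<rho>: "jn (Suc s) (\<lambda>y. \<Sigma> c. y $ c * \<rho> a b c d y) 0 <= real ?n * (real (Suc s) * P)" for a b d
 proof -
  have "jn (Suc s) (\<lambda>y. \<Sigma> c. y $ c * \<rho> a b c d y) 0 <= (\<Sigma> c. jn (Suc s) (\<lambda>y. y $ c * \<rho> a b c d y) 0)"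
   by (intro jn_sum smooth_on_mult U(1) smooth_on_coord smooth_\<rho>)
  also have "... <= (\<Sum>c\<in>(UNIV :: 'n set). real (Suc s) * P)"
   by (intro sum_mono order_trans[OF jn_coord_mult[OF smooth_\<rho>]] mult_left_mono \<rho>) simp
  finally show ?thesis by simp
 qed
 have "jn (Suc s) (\<gamma> a b c) 0 <= real ?n * (real (Suc (Suc s)) * (real ?n * (real (Suc s) * P))) + real ?n * (real (Suc s) * P)"
  by (rule jn_\<gamma>_step[OF _ sum\<rho> sum\<rho>]) (use flat_mono[OF fl[of a], of "Suc s + 2"] Suc.prems in auto)
 also have "... = conn_const ?n M (Suc s)"
  unfolding conn_const.simps(2) K_def[symmetric] P_def[symmetric] by (simp add: power2_eq_square algebra_simps)
 finally show ?case .
qed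

end

section \<open>Jet polynomials are Lipschitz in the jet\<close>

lemma jn_pdl: "jn r (pdl I f) x <= jn (r + length I) f x"
proof (induction I arbitrary: f)
 case (Cons i I)
 have "jn r (pdl I (pd i f)) x <= jn (r + length I) (pd i f) x" by (rule Cons)
 also have "... <= jn (Suc (r + length I)) f x" by (rule jn_pd)
 finally show ?case by simp
qed simp

text \<open>The argument \<open>n\<close> will dominate both the size of the matrix and the number
  of variables, which spares a second parameter.\<close>

primrec inv_const :: "nat => real => nat => real" where
 "inv_const n M 0 = M"
| "inv_const n M (Suc r) = M + real n * (real n * (real n * (4 ^ r * (4 ^ r * inv_const n M r * M) * inv_const n M r)))"

primrec compose_const :: "nat => real => nat => real" where
 "compose_const n M 0 = 1"
| "compose_const n M (Suc r) = 1 + real n * (4 ^ r * M * compose_const n M r)"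

context smooth_at_point
begin

text \<open>Derivatives of the inverse are products of inverses and derivatives of \<open>g\<close>;
  the value of the inverse at the point is the only further information.\<close>

lemma jn_matrix_inv:
 fixes g :: "real^'i => real^'n::finite^'n"
 assumes g: "!!a b. smooth_on S (\<lambda>x. g x $ a $ b)" "!!x. x \<in> S ==> det (g x) ~= 0"
  and M: "!!a b. jn r (\<lambda>x. g x $ a $ b) x0 <= M" "!!a b. \<bar>matrix_inv (g x0) $ a $ b\<bar> <= M"
 shows "jn r (\<lambda>x. matrix_inv (g x) $ a $ b) x0 <= inv_const (CARD('n) + CARD('i)) M r"
 using M(1)
proof (induction r arbitrary: a b)
 case 0
 show ?case using M(2) by simp
next
 case (Suc r)
 let ?n = "CARD('n) + CARD('i)"
 let ?I = "inv_const ?n M r"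
 let ?k = "\<lambda>a b x. matrix_inv (g x) $ a $ b"
 have "smooth_on S g" using g(1) by (simp add: smooth_on_mat[OF S(1)])
 then have k: "smooth_on S (?k a b)" for a b by (intro smooth_on_entry[OF S(1)] smooth_on_matrix_inv S(1) g(2))
 have I: "jn r (?k a b) x0 <= ?I" for a b by (rule Suc.IH) (use Suc.prems jn_mono_Suc order_trans in blast)
 then have I0: "0 <= ?I" using jn_nonneg order_trans by blast
 have M0: "0 <= M" using Suc.prems jn_nonneg order_trans by blast
 have "jn r (pd i (?k a b)) x0 <= real ?n * (real ?n * (4 ^ r * (4 ^ r * ?I * M) * ?I))" for i
 proof -
  let ?t = "\<lambda>c d x. (?k a c x * pd i (\<lambda>y. g y $ c $ d) x) * ?k d b x"
  have t: "smooth_on S (?t c d)" for c d by (intro smooth_on_mult smooth_on_pd S(1) k g(1))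
  have "jn r (pd i (?k a b)) x0 = jn r (\<lambda>x. - (\<Sigma> c d. ?t c d x)) x0"
   by (rule jn_cong_S) (rule pd_matrix_inv[OF smooth_on_D[OF g(1)] g(2)])
  also have "... = jn r (\<lambda>x. \<Sigma> c d. ?t c d x) x0" by (intro jn_minus smooth_on_sum S(1) t)
  also have "... <= (\<Sigma> c d. jn r (?t c d) x0)" by (intro order_trans[OF jn_sum] sum_mono jn_sum smooth_on_sum S(1) t)
  also have "... <= (\<Sum>c\<in>(UNIV::'n set). \<Sum>d\<in>(UNIV::'n set). 4 ^ r * (4 ^ r * ?I * M) * ?I)"
   by (intro sum_mono jn_mult_bound smooth_on_mult smooth_on_pd S(1) k g(1) I)
    (rule order_trans[OF jn_pd Suc.prems])
  also have "... = real CARD('n) * (real CARD('n) * (4 ^ r * (4 ^ r * ?I * M) * ?I))" by simp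
  also have "... <= real ?n * (real ?n * (4 ^ r * (4 ^ r * ?I * M) * ?I))"
   using I0 M0 by (intro mult_mono mult_nonneg_nonneg) auto
  finally show ?thesis .
 qed
 then have "(\<Sigma> i. jn r (pd i (?k a b)) x0) <= real CARD('i) * (real ?n * (real ?n * (4 ^ r * (4 ^ r * ?I * M) * ?I)))"
  using sum_bounded_above[of UNIV "\<lambda>i. jn r (pd i (?k a b)) x0"] by simp
 also have "... <= real ?n * (real ?n * (real ?n * (4 ^ r * (4 ^ r * ?I * M) * ?I)))"
  using I0 M0 by (intro mult_mono mult_nonneg_nonneg) auto
 finally show ?case using M(2)[of a b] by simp
qed

text \<open>The factor depends on the jet of the inner map alone, so it is uniform over all inner
  maps with a common bound.\<close>

lemma jn_compose:
 fixes \<Psi> :: "real^'i => real^'j::finite" and f :: "real^'j => real"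
 assumes f: "open T" "smooth_on T f" and \<Psi>: "smooth_on S \<Psi>" "\<Psi> ` S \<subseteq> T" "!!c. jn r (\<lambda>x. \<Psi> x $ c) x0 <= M"
 shows "jn r (\<lambda>x. f (\<Psi> x)) x0 <= compose_const (CARD('i) * CARD('j)) M r * jn r f (\<Psi> x0)"
 using f(2) \<Psi>(3)
proof (induction r arbitrary: f)
 case (Suc r)
 let ?n = "CARD('i) * CARD('j)"
 let ?K = "compose_const ?n M r" and ?J = "jn (Suc r) f (\<Psi> x0)"
 have Mr: "jn r (\<lambda>x. \<Psi> x $ c) x0 <= M" for c using Suc.prems(2) jn_mono_Suc order_trans by blast
 have M0: "0 <= M" using Mr jn_nonneg order_trans by blast
 have K0: "0 <= compose_const ?n M r" for r by (induction r) (use M0 in auto)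
 have s\<Psi>: "smooth_on S (\<lambda>x. \<Psi> x $ c)" for c by (rule smooth_on_nth[OF S(1) \<Psi>(1)])
 have sf: "smooth_on S (\<lambda>x. pd c f (\<Psi> x))" for c
  by (rule smooth_on_compose[OF S(1) \<Psi>(1,2) smooth_on_pd[OF Suc.prems(1)]])
 have "jn r (pd i (\<lambda>x. f (\<Psi> x))) x0 <= (\<Sum>c\<in>(UNIV::'j set). 4 ^ r * M * (?K * ?J))" for i
 proof -
  have "jn r (pd i (\<lambda>x. f (\<Psi> x))) x0 = jn r (\<lambda>x. \<Sigma> c. pd i (\<lambda>x. \<Psi> x $ c) x * pd c f (\<Psi> x)) x0"
   by (rule jn_cong_S) (use pd_compose[OF smooth_on_D[OF \<Psi>(1)] smooth_on_D[OF Suc.prems(1)]] \<Psi>(2) in auto)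
  also have "... <= (\<Sigma> c. jn r (\<lambda>x. pd i (\<lambda>x. \<Psi> x $ c) x * pd c f (\<Psi> x)) x0)"
   by (intro jn_sum smooth_on_mult smooth_on_pd S(1) s\<Psi> sf)
  also have "... <= (\<Sum>c\<in>(UNIV::'j set). 4 ^ r * M * (?K * ?J))"
  proof (intro sum_mono jn_mult_bound smooth_on_pd s\<Psi> sf)
   fix c
   show "jn r (pd i (\<lambda>x. \<Psi> x $ c)) x0 <= M" by (rule order_trans[OF jn_pd Suc.prems(2)])
   have "jn r (\<lambda>x. pd c f (\<Psi> x)) x0 <= ?K * jn r (pd c f) (\<Psi> x0)"
    by (rule Suc.IH[OF smooth_on_pd[OF Suc.prems(1)] Mr])
   also have "... <= ?K * ?J" by (intro mult_left_mono jn_pd K0)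
   finally show "jn r (\<lambda>x. pd c f (\<Psi> x)) x0 <= ?K * ?J" .
  qed
  finally show ?thesis .
 qed
 then have "(\<Sigma> i. jn r (pd i (\<lambda>x. f (\<Psi> x))) x0) <= real CARD('i) * (\<Sum>c\<in>(UNIV::'j set). 4 ^ r * M * (?K * ?J))"
  by (intro sum_bounded_above) auto
 then show ?case using abs_le_jn[of f "\<Psi> x0" "Suc r"] by (simp add: algebra_simps)
qed simp

text \<open>The inverse is bounded separately at the point, since a bound on the jet of a metric
  does not keep it away from degeneracy.\<close>

definition near_metrics :: "nat => real => real => 'i metric => 'i metric => bool" where
 "near_metrics R M \<delta> g g' \<longleftrightarrow> regular_on S g \<and> regular_on S g' \<and>
   (\<forall>a b. jn R (\<lambda>x. g x $ a $ b) x0 <= M \<and> jn R (\<lambda>x. g' x $ a $ b) x0 <= M \<and>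
    \<bar>matrix_inv (g x0) $ a $ b\<bar> <= M \<and> \<bar>matrix_inv (g' x0) $ a $ b\<bar> <= M \<and>
    jn R (\<lambda>x. g x $ a $ b - g' x $ a $ b) x0 <= \<delta>)"

lemma near_metrics_mono: "near_metrics R M \<delta> g g' ==> R' <= R ==> near_metrics R' M \<delta> g g'"
 unfolding near_metrics_def by (meson jn_mono order_trans)

lemma near_metrics_sym: "near_metrics R M \<delta> g g' ==> near_metrics R M \<delta> g' g"
proof -
 assume n: "near_metrics R M \<delta> g g'"
 then have "jn R (\<lambda>x. g' x $ a $ b - g x $ a $ b) x0 = jn R (\<lambda>x. g x $ a $ b - g' x $ a $ b) x0" for a b
  using jn_minus[of "\<lambda>x. g x $ a $ b - g' x $ a $ b" R] smooth_on_diff[OF S(1) regular_on_component regular_on_component, of g g' a b a b]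
  by (simp add: near_metrics_def)
 with n show ?thesis by (simp add: near_metrics_def)
qed

lemma near_metrics_nonneg: "near_metrics R M \<delta> g g' ==> 0 <= M \<and> 0 <= \<delta>"
 unfolding near_metrics_def by (meson jn_nonneg order_trans)

lemma jn_matrix_inv_diff:
 assumes n: "near_metrics r M \<delta> g g'" and I: "!!a b. jn r (\<lambda>x. matrix_inv (g x) $ a $ b) x0 <= I"
  "!!a b. jn r (\<lambda>x. matrix_inv (g' x) $ a $ b) x0 <= I"
 shows "jn r (\<lambda>x. matrix_inv (g x) $ a $ b - matrix_inv (g' x) $ a $ b) x0 \<le>
  real CARD('i) * (real CARD('i) * (4 ^ r * (4 ^ r * I * \<delta>) * I))"
proof -
 have r: "regular_on S g" "regular_on S g'" using n by (auto simp: near_metrics_def)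
 have s: "smooth_on S (\<lambda>x. f x $ a $ b)" "smooth_on S (\<lambda>x. matrix_inv (f x) $ a $ b)" if "regular_on S f" for f :: "'i metric" and a b
  using regular_on_component[OF that] jet_poly_smooth[OF jet_poly.upper that] by auto
 let ?t = "\<lambda>c d x. matrix_inv (g x) $ a $ c * (g x $ c $ d - g' x $ c $ d) * matrix_inv (g' x) $ d $ b"
 have t: "smooth_on S (?t c d)" for c d by (intro smooth_on_mult smooth_on_diff S(1) s r)
 have "jn r (\<lambda>x. matrix_inv (g x) $ a $ b - matrix_inv (g' x) $ a $ b) x0 = jn r (\<lambda>x. - (\<Sigma> c d. ?t c d x)) x0"
  by (rule jn_cong_S, rule matrix_inv_diff) (use r in "auto simp: regular_on_def")
 also have "... = jn r (\<lambda>x. \<Sigma> c d. ?t c d x) x0" by (intro jn_minus smooth_on_sum S(1) t)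
 also have "... <= (\<Sigma> c d. jn r (?t c d) x0)" by (intro order_trans[OF jn_sum] sum_mono jn_sum smooth_on_sum S(1) t)
 also have "... <= (\<Sum>c\<in>(UNIV::'i set). \<Sum>d\<in>(UNIV::'i set). 4 ^ r * (4 ^ r * I * \<delta>) * I)"
  by (intro sum_mono jn_mult_bound smooth_on_mult smooth_on_diff S(1) s r I) (use n in "simp add: near_metrics_def")
 finally show ?thesis by simp
qed

end

text \<open>The constant is fixed before domain, point and metrics; this is the source of all
  uniformity in l, chart and point.\<close>

definition jet_lipschitz :: "nat => 'i::finite lagrangian => nat => real => real => bool" where
 "jet_lipschitz r F R M C \<longleftrightarrow> 0 <= C \<and> (\<forall>S x0 g g' \<delta>. smooth_at_point S x0 \<and> smooth_at_point.near_metrics S x0 R M \<delta> g g' -->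
  jn r (F g) x0 <= C \<and> jn r (\<lambda>x. F g x - F g' x) x0 <= C * \<delta>)"

lemma jet_lipschitzD:
 assumes "jet_lipschitz r F R M C" "smooth_at_point S x0" "smooth_at_point.near_metrics S x0 R M \<delta> g g'"
 shows "jn r (F g) x0 <= C" "jn r (\<lambda>x. F g x - F g' x) x0 <= C * \<delta>"
 using assms unfolding jet_lipschitz_def by blast+

lemma jet_lipschitz_mono: "jet_lipschitz r F R M C ==> R <= R' ==> C <= C' ==> jet_lipschitz r F R' M C'"
 unfolding jet_lipschitz_def
 by (meson mult_right_mono order_trans smooth_at_point.near_metrics_mono smooth_at_point.near_metrics_nonneg)

lemma jet_lipschitz_pair:
 assumes "\<exists>R. \<forall>M. \<exists>C. jet_lipschitz r F R M C" "\<exists>R. \<forall>M. \<exists>C. jet_lipschitz r G R M C"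
 shows "\<exists>R. \<forall>M. \<exists>C. jet_lipschitz r F R M C \<and> jet_lipschitz r G R M C"
proof -
 obtain R R' where R: "\<forall>M. \<exists>C. jet_lipschitz r F R M C" "\<forall>M. \<exists>C. jet_lipschitz r G R' M C" using assms by blast
 show ?thesis
 proof (intro exI[of _ "max R R'"] allI)
  fix M
  obtain C C' where C: "jet_lipschitz r F R M C" "jet_lipschitz r G R' M C'" using R by blast
  show "\<exists>C. jet_lipschitz r F (max R R') M C \<and> jet_lipschitz r G (max R R') M C"
   by (intro exI[of _ "max C C'"] conjI jet_lipschitz_mono[OF C(1)] jet_lipschitz_mono[OF C(2)]) simp_all
 qed
qed

text \<open>The order \<open>R\<close> reflects the derivatives in \<open>F\<close> and is chosen
  before the size \<open>M\<close>; \<open>C\<close> then depends on \<open>M\<close> as for any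
  polynomial on a ball.\<close>

theorem jet_poly_lipschitz:
 assumes "jet_poly (F :: 'i::finite lagrangian)"
 shows "\<exists>R. \<forall>M. \<exists>C. jet_lipschitz r F R M C"
 using assms
proof induction
 case (const c)
 show ?case
  by (intro exI[of _ 0] allI exI[of _ "\<bar>c\<bar>"]) (auto simp: jet_lipschitz_def dest: smooth_at_point.near_metrics_nonneg)
next
 case (jet I a b)
 show ?case
 \<comment> \<open>\<open>\<bar>M\<bar> + 1\<close> serves as bound of the value, at most
   \<open>M\<close>, and as Lipschitz constant, which is 1.\<close>
 proof (intro exI[of _ "r + length I"] allI, rule exI[of _ "\<bar>M\<bar> + 1" for M], unfold jet_lipschitz_def, intro conjI allI impI; (elim conjE)?)
  fix M \<delta> :: real and S and x0 :: "real^'i" and g g' :: "'i metric"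
  assume "smooth_at_point S x0" and n: "smooth_at_point.near_metrics S x0 (r + length I) M \<delta> g g'"
  then interpret smooth_at_point S x0 by simp
  note n' = n[unfolded near_metrics_def]
  have "jn r (\<lambda>x. pdl I (\<lambda>y. g y $ a $ b) x) x0 <= jn (r + length I) (\<lambda>y. g y $ a $ b) x0" by (rule jn_pdl)
  also have "... <= M" using n' by blast
  finally show "jn r (\<lambda>x. pdl I (\<lambda>y. g y $ a $ b) x) x0 <= \<bar>M\<bar> + 1" by simp
  have "jn r (\<lambda>x. pdl I (\<lambda>y. g y $ a $ b) x - pdl I (\<lambda>y. g' y $ a $ b) x) x0 = jn r (pdl I (\<lambda>y. g y $ a $ b - g' y $ a $ b)) x0"
   using pdl_add_cmult[OF S(1) _ regular_on_component[of S g a b] regular_on_component[of S g' a b], where I=I and c="-1"] n'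
   by (intro jn_cong_S) simp
  also have "... <= jn (r + length I) (\<lambda>y. g y $ a $ b - g' y $ a $ b) x0" by (rule jn_pdl)
  also have "... <= \<delta>" using n' by blast
  also have "... <= (\<bar>M\<bar> + 1) * \<delta>" using near_metrics_nonneg[OF n] by (simp add: mult_le_cancel_right1)
  finally show "jn r (\<lambda>x. pdl I (\<lambda>y. g y $ a $ b) x - pdl I (\<lambda>y. g' y $ a $ b) x) x0 <= (\<bar>M\<bar> + 1) * \<delta>" .
 qed simp
next
 case (upper a b)
 show ?case
 proof (intro exI[of _ r] allI)
  fix M :: real
  let ?n = "real CARD('i)"
  define I where "I = \<bar>inv_const (CARD('i) + CARD('i)) M r\<bar>"
  \<comment> \<open>The first summand bounds the inverse, the second is its Lipschitz constant from
    the resolvent identity.\<close>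
  define C where "C = I + ?n * (?n * (4 ^ r * (4 ^ r * I) * I))"
  have I0: "0 <= I" "0 <= C" "I <= C" by (auto simp: I_def C_def)
  show "\<exists>C. jet_lipschitz r (\<lambda>g x. matrix_inv (g x) $ a $ b) r M C"
   unfolding jet_lipschitz_def
  proof (intro exI[of _ C] conjI allI impI I0; elim conjE)
   fix \<delta> :: real and S and x0 :: "real^'i" and g g' :: "'i metric"
   assume "smooth_at_point S x0" and n: "smooth_at_point.near_metrics S x0 r M \<delta> g g'"
   then interpret smooth_at_point S x0 by simp
   have inv: "jn r (\<lambda>x. matrix_inv (g x) $ a $ b) x0 <= I" if n: "near_metrics r M \<delta> g g'" for a b g g'
   proof -
    have "jn r (\<lambda>x. matrix_inv (g x) $ a $ b) x0 <= inv_const (CARD('i) + CARD('i)) M r"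
     by (rule jn_matrix_inv) (use n regular_on_component in "auto simp: near_metrics_def regular_on_def")
    then show ?thesis by (simp add: I_def)
   qed
   show "jn r (\<lambda>x. matrix_inv (g x) $ a $ b) x0 <= C" using inv[OF n, of a b] I0(3) by simp
   have "jn r (\<lambda>x. matrix_inv (g x) $ a $ b - matrix_inv (g' x) $ a $ b) x0 <= ?n * (?n * (4 ^ r * (4 ^ r * I * \<delta>) * I))"
    by (rule jn_matrix_inv_diff[OF n inv[OF n] inv[OF near_metrics_sym[OF n]]])
   also have "... <= C * \<delta>" using near_metrics_nonneg[OF n] I0 by (simp add: C_def algebra_simps)
   finally show "jn r (\<lambda>x. matrix_inv (g x) $ a $ b - matrix_inv (g' x) $ a $ b) x0 <= C * \<delta>" .
  qed
 qed
next
 case (add F G)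
 obtain R where R: "\<forall>M. \<exists>C. jet_lipschitz r F R M C \<and> jet_lipschitz r G R M C" using jet_lipschitz_pair[OF add.IH] ..
 show ?case
 proof (intro exI[of _ R] allI)
  fix M
  obtain C where C: "jet_lipschitz r F R M C" "jet_lipschitz r G R M C" using R by blast
  show "\<exists>C. jet_lipschitz r (\<lambda>g x. F g x + G g x) R M C"
   unfolding jet_lipschitz_def
  proof (intro exI[of _ "2 * C"] conjI allI impI; (elim conjE)?)
   fix \<delta> :: real and S and x0 :: "real^'i" and g g' :: "'i metric"
   assume s: "smooth_at_point S x0" and n: "smooth_at_point.near_metrics S x0 R M \<delta> g g'"
   interpret smooth_at_point S x0 by fact
   note CF = jet_lipschitzD[OF C(1) s n] and CG = jet_lipschitzD[OF C(2) s n]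
   have sm: "smooth_on S (F g)" "smooth_on S (G g)" "smooth_on S (F g')" "smooth_on S (G g')"
    using n jet_poly_smooth add.hyps by (auto simp: near_metrics_def)
   show "jn r (\<lambda>x. F g x + G g x) x0 <= 2 * C" using jn_add[OF sm(1,2), of r] CF CG by linarith
   have "jn r (\<lambda>x. F g x + G g x - (F g' x + G g' x)) x0 = jn r (\<lambda>x. (F g x - F g' x) + (G g x - G g' x)) x0"
    by (rule jn_cong_S) simp
   also have "... <= jn r (\<lambda>x. F g x - F g' x) x0 + jn r (\<lambda>x. G g x - G g' x) x0"
    by (intro jn_add smooth_on_diff S(1) sm)
   finally show "jn r (\<lambda>x. F g x + G g x - (F g' x + G g' x)) x0 <= 2 * C * \<delta>" using CF CG by simp
  qed (use C in "simp add: jet_lipschitz_def")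
 qed
next
 case (mult F G)
 obtain R where R: "\<forall>M. \<exists>C. jet_lipschitz r F R M C \<and> jet_lipschitz r G R M C" using jet_lipschitz_pair[OF mult.IH] ..
 show ?case
 proof (intro exI[of _ R] allI)
  fix M
  obtain C where C: "jet_lipschitz r F R M C" "jet_lipschitz r G R M C" using R by blast
  show "\<exists>C. jet_lipschitz r (\<lambda>g x. F g x * G g x) R M C"
   unfolding jet_lipschitz_def
  proof (intro exI[of _ "2 * (4 ^ r * C * C)"] conjI allI impI; (elim conjE)?)
   fix \<delta> :: real and S and x0 :: "real^'i" and g g' :: "'i metric"
   assume s: "smooth_at_point S x0" and n: "smooth_at_point.near_metrics S x0 R M \<delta> g g'"
   interpret smooth_at_point S x0 by fact
   note CF = jet_lipschitzD[OF C(1) s n] and CG = jet_lipschitzD[OF C(2) s n] and CG' = jet_lipschitzD[OF C(2) s near_metrics_sym[OF n]]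
   have sm: "smooth_on S (F g)" "smooth_on S (G g)" "smooth_on S (F g')" "smooth_on S (G g')"
    using n jet_poly_smooth mult.hyps by (auto simp: near_metrics_def)
   have "jn r (\<lambda>x. F g x * G g x) x0 <= 4 ^ r * C * C" by (rule jn_mult_bound[OF sm(1,2) CF(1) CG(1)])
   moreover have C0: "0 <= 4 ^ r * C * C" using C by (simp add: jet_lipschitz_def)
   ultimately show "jn r (\<lambda>x. F g x * G g x) x0 <= 2 * (4 ^ r * C * C)" by linarith
   have "jn r (\<lambda>x. F g x * G g x - F g' x * G g' x) x0 = jn r (\<lambda>x. F g x * (G g x - G g' x) + (F g x - F g' x) * G g' x) x0"
    by (rule jn_cong_S) (simp add: algebra_simps)
   also have "... <= jn r (\<lambda>x. F g x * (G g x - G g' x)) x0 + jn r (\<lambda>x. (F g x - F g' x) * G g' x) x0"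
    by (intro jn_add smooth_on_mult smooth_on_diff S(1) sm)
   also have "... <= 4 ^ r * C * (C * \<delta>) + 4 ^ r * (C * \<delta>) * C"
    by (intro add_mono jn_mult_bound smooth_on_diff S(1) sm CF CG CG'(1))
   finally show "jn r (\<lambda>x. F g x * G g x - F g' x * G g' x) x0 <= 2 * (4 ^ r * C * C) * \<delta>" by (simp add: algebra_simps)
  qed (use C in "simp add: jet_lipschitz_def")
 qed
qed

section \<open>Gaussian null coordinates\<close>

lemma sum_gnc:
 fixes f :: "'n::finite gnc => 'b::comm_monoid_add"
 shows "(\<Sigma> i. f i) = f Tau + (f Rho + (\<Sigma> A. f (Ang A)))"
proof -
 have U: "(UNIV :: 'n gnc set) = insert Tau (insert Rho (range Ang))" by (auto intro: gnc.exhaust)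
 have "inj (Ang :: 'n => 'n gnc)" by (simp add: inj_def)
 then have "(\<Sum>i\<in>range Ang. f i) = (\<Sigma> A. f (Ang A))" by (simp add: sum.reindex)
 moreover have "Tau \<notin> insert Rho (range Ang)" "Rho \<notin> range Ang" by auto
 ultimately have "sum f (insert Tau (insert Rho (range Ang))) = f Tau + (f Rho + (\<Sigma> A. f (Ang A)))"
  by (simp add: image_iff)
 then show ?thesis unfolding U .
qed

lemma gnc_point_nth [simp]:
 "gnc_point \<tau> \<rho> y $ Tau = \<tau>" "gnc_point \<tau> \<rho> y $ Rho = \<rho>" "gnc_point \<tau> \<rho> y $ Ang A = y $ A"
 "ang (gnc_point \<tau> \<rho> y) = y" by (simp_all add: gnc_point_def ang_def vec_eq_iff)

lemma gnc_point_eta: "gnc_point (z $ Tau) (z $ Rho) (ang z) = z"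
 by (auto simp: gnc_point_def ang_def vec_eq_iff split: gnc.splits)

lemma gnc_point_0: "gnc_point 0 0 0 = 0" by (auto simp: gnc_point_def vec_eq_iff split: gnc.splits)

lemma pd_slice: "pd A (\<lambda>y. f (gnc_point \<tau> \<rho> y)) y = pd (Ang A) f (gnc_point \<tau> \<rho> y)"
proof -
 have "gnc_point \<tau> \<rho> (y + t *\<^sub>R axis A 1) = gnc_point \<tau> \<rho> y + t *\<^sub>R axis (Ang A) 1" for t
  by (auto simp: gnc_point_def vec_eq_iff axis_def split: gnc.splits)
 then show ?thesis by (simp add: pd_def)
qed

lemma jn_slice_le: "jn r (\<lambda>y. f (gnc_point \<tau> \<rho> y)) y <= jn r f (gnc_point \<tau> \<rho> y)"
proof (induction r arbitrary: f)
 case (Suc r)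
 have "pd A (\<lambda>y. f (gnc_point \<tau> \<rho> y)) = (\<lambda>y. pd (Ang A) f (gnc_point \<tau> \<rho> y))" for A
  by (rule ext) (rule pd_slice)
 then have "(\<Sigma> A. jn r (pd A (\<lambda>y. f (gnc_point \<tau> \<rho> y))) y) <= (\<Sigma> A. jn r (pd (Ang A) f) (gnc_point \<tau> \<rho> y))"
  by (intro sum_mono) (simp add: Suc)
 then show ?case
  using jn_nonneg[of r "pd Tau f" "gnc_point \<tau> \<rho> y"] jn_nonneg[of r "pd Rho f" "gnc_point \<tau> \<rho> y"] by (simp add: sum_gnc)
qed simp

lemma smooth_on_gnc_point: "smooth_on S (gnc_point \<tau> \<rho> :: real^'n::finite => _)" if "open S"
 unfolding smooth_on_vec[OF that]
proof
 fix i :: "'n gnc"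
 show "smooth_on S (\<lambda>y. gnc_point \<tau> \<rho> y $ i)" by (cases i) (simp_all add: smooth_on_coord)
qed

lemma open_slice: "open V ==> open {y :: real^'n::finite. gnc_point \<tau> \<rho> y \<in> V}"
 using continuous_open_preimage[OF smooth_on_cont[OF smooth_on_gnc_point[OF open_UNIV, of \<tau> \<rho>]] open_UNIV, of V]
 by (simp add: vimage_def)

lemma smooth_on_slice:
 assumes "open V" "smooth_on V (f :: _ => real)"
 shows "smooth_on {y. gnc_point \<tau> \<rho> y \<in> V} (\<lambda>y. f (gnc_point \<tau> \<rho> y))"
 by (rule smooth_on_compose[OF open_slice[OF assms(1)] smooth_on_gnc_point[OF open_slice[OF assms(1)]] _ assms(2)]) auto

text \<open>The regime of validity is phrased with \<open>deriv\<close> in \<rho> of curried fields,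
  calculus here with \<open>pd Rho\<close> on coordinate space.\<close>

lemma pd_Rho_iter:
 assumes V: "open V" and F: "smooth_on V (\<lambda>z :: real^('n::finite gnc). F (z $ Rho) (ang z) :: real)" and z: "z \<in> V"
 shows "smooth_on V ((pd Rho ^^ j) (\<lambda>z. F (z $ Rho) (ang z)))"
  and "(pd Rho ^^ j) (\<lambda>z. F (z $ Rho) (ang z)) z = (deriv ^^ j) (\<lambda>\<rho>. F \<rho> (ang z)) (z $ Rho)"
proof -
 show sm: "smooth_on V ((pd Rho ^^ j) (\<lambda>z. F (z $ Rho) (ang z)))" for j by (induction j) (auto intro: smooth_on_pd F)
 show "(pd Rho ^^ j) (\<lambda>z. F (z $ Rho) (ang z)) z = (deriv ^^ j) (\<lambda>\<rho>. F \<rho> (ang z)) (z $ Rho)"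
  using z
 proof (induction j arbitrary: z)
  case (Suc j)
  let ?D = "\<lambda>z \<rho>. (deriv ^^ j) (\<lambda>\<rho>. F \<rho> (ang z)) \<rho>"
  have ang: "ang (z + t *\<^sub>R axis Rho 1) = ang z" for t by (simp add: ang_def axis_def vec_eq_iff)
  have nth: "(z + t *\<^sub>R axis Rho 1) $ Rho = z $ Rho + t" for t by (simp add: axis_def)
  have "(\<lambda>z. ?D z (z $ Rho)) differentiable (at z)"
   by (rule differentiable_cong_open[OF V Suc.prems _ smooth_on_D[OF sm[of j] Suc.prems]]) (simp add: Suc.IH)
  then have "((\<lambda>t. ?D (z + t *\<^sub>R axis Rho 1) ((z + t *\<^sub>R axis Rho 1) $ Rho)) has_real_derivative pd Rho (\<lambda>z. ?D z (z $ Rho)) z) (at 0)"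
   by (rule DERIV_pd)
  then have "(?D z has_real_derivative pd Rho (\<lambda>z. ?D z (z $ Rho)) z) (at (z $ Rho))"
   using DERIV_shift[of "?D z" _ 0 "z $ Rho"] unfolding ang nth by (simp add: add.commute)
  moreover have "pd Rho ((pd Rho ^^ j) (\<lambda>z. F (z $ Rho) (ang z))) z = pd Rho (\<lambda>z. ?D z (z $ Rho)) z"
   by (rule pd_cong_open[OF V Suc.prems Suc.IH])
  ultimately show ?case by (simp add: DERIV_imp_deriv)
 qed simp
qed

text \<open>Derivatives commute and those along \<tau> vanish, so all jets are tangential jets of
  \<rho>-derivatives. In each order the value, the \<rho>-direction and the angular directions
  account for the factor 2 + n.\<close>

lemma jn_le_slices:
 assumes V: "open V" "gnc_point \<tau> \<rho> y \<in> V" and f: "smooth_on V f" "!!z. z \<in> V ==> pd Tau f z = (0::real)"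
  and M: "!!j. j <= r ==> jn r (\<lambda>y. (pd Rho ^^ j) f (gnc_point \<tau> \<rho> y)) y <= M"
 shows "jn r f (gnc_point \<tau> \<rho> (y :: real^'n::finite)) <= (2 + real CARD('n)) ^ r * M"
 using f M
proof (induction r arbitrary: f)
 case 0
 from 0(3)[of 0] show ?case by simp
next
 case (Suc r)
 let ?z = "gnc_point \<tau> \<rho> y" and ?c = "(2 + real CARD('n)) ^ r"
 have M0: "0 <= M" using Suc.prems(3)[of 0] jn_nonneg order_trans by blast
 have com: "(pd Rho ^^ j) (pd i f) z = pd i ((pd Rho ^^ j) f) z" if "z \<in> V" for i j z
  using that
 proof (induction j arbitrary: z)
  case (Suc j)
  have "smooth_on V ((pd Rho ^^ j) f)" by (induction j) (auto intro: smooth_on_pd \<open>smooth_on V f\<close>)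
  then have "pd i (pd Rho ((pd Rho ^^ j) f)) z = pd Rho (pd i ((pd Rho ^^ j) f)) z" by (rule pd_commute[OF V(1) Suc.prems])
  also have "... = pd Rho ((pd Rho ^^ j) (pd i f)) z" by (rule pd_cong_open[OF V(1) Suc.prems]) (simp add: Suc.IH)
  finally show ?case by simp
 qed simp
 have tau: "pd Tau (pd i f) z = 0" if "z \<in> V" for i z
 proof -
  have "pd Tau (pd i f) z = pd i (pd Tau f) z" by (rule pd_commute[OF V(1) that Suc.prems(1)])
  also have "... = pd i (\<lambda>z. 0) z" by (rule pd_cong_open[OF V(1) that Suc.prems(2)])
  finally show ?thesis by simp
 qed
 have "jn r (pd Tau f) ?z = jn r (\<lambda>z. 0) ?z" by (rule jn_cong[OF V Suc.prems(2)])
 then have T: "jn r (pd Tau f) ?z = 0" by simp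
 have R: "jn r (pd Rho f) ?z <= ?c * M"
 proof (rule Suc.IH[OF smooth_on_pd[OF Suc.prems(1)] tau])
  fix j assume "j <= r"
  then show "jn r (\<lambda>y. (pd Rho ^^ j) (pd Rho f) (gnc_point \<tau> \<rho> y)) y <= M"
   using Suc.prems(3)[of "Suc j"] jn_mono_Suc[of r "\<lambda>y. (pd Rho ^^ Suc j) f (gnc_point \<tau> \<rho> y)" y]
   by (simp only: funpow_Suc_right o_apply) linarith
 qed
 have A: "jn r (pd (Ang A) f) ?z <= ?c * M" for A
 proof (rule Suc.IH[OF smooth_on_pd[OF Suc.prems(1)] tau])
  fix j assume "j <= r"
  have "jn r (\<lambda>y. (pd Rho ^^ j) (pd (Ang A) f) (gnc_point \<tau> \<rho> y)) y = jn r (pd A (\<lambda>y. (pd Rho ^^ j) f (gnc_point \<tau> \<rho> y))) y"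
   by (rule jn_cong[OF open_slice[OF V(1), of \<tau> \<rho>]]) (use V(2) in \<open>auto simp: com pd_slice\<close>)
  also have "... <= jn (Suc r) (\<lambda>y. (pd Rho ^^ j) f (gnc_point \<tau> \<rho> y)) y" by (rule jn_pd)
  also have "... <= M" using Suc.prems(3)[of j] \<open>j <= r\<close> by simp
  finally show "jn r (\<lambda>y. (pd Rho ^^ j) (pd (Ang A) f) (gnc_point \<tau> \<rho> y)) y <= M" .
 qed
 have "jn (Suc r) f ?z <= M + (?c * M + real CARD('n) * (?c * M))"
  using Suc.prems(3)[of 0] abs_le_jn[of "\<lambda>y. f (gnc_point \<tau> \<rho> y)" y "Suc r"] T R
   sum_bounded_above[of UNIV "\<lambda>A. jn r (pd (Ang A) f) ?z", OF A] by (simp add: sum_gnc)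
 also have "... <= ?c * M + (?c * M + real CARD('n) * (?c * M))"
  using mult_left_mono[OF one_le_power[of "2 + real CARD('n)" r] M0] by (simp add: mult.commute)
 finally show ?case by (simp add: algebra_simps)
qed

lemma gnc_metric_nth:
 "gnc_metric X \<omega> h z $ Tau $ Tau = - (z $ Rho * X (z $ Rho) (ang z))"
 "gnc_metric X \<omega> h z $ Tau $ Rho = 1" "gnc_metric X \<omega> h z $ Rho $ Tau = 1" "gnc_metric X \<omega> h z $ Rho $ Rho = 0"
 "gnc_metric X \<omega> h z $ Tau $ Ang A = z $ Rho * \<omega> (z $ Rho) (ang z) $ A"
 "gnc_metric X \<omega> h z $ Ang A $ Tau = z $ Rho * \<omega> (z $ Rho) (ang z) $ A"
 "gnc_metric X \<omega> h z $ Rho $ Ang A = 0" "gnc_metric X \<omega> h z $ Ang A $ Rho = 0"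
 "gnc_metric X \<omega> h z $ Ang A $ Ang B = h (z $ Rho) (ang z) $ A $ B" by (simp_all add: gnc_metric_def Let_def)

lemma gnc_metric_sym:
 assumes "transpose (h (z $ Rho) (ang z)) = h (z $ Rho) (ang z)"
 shows "gnc_metric X \<omega> h z $ a $ b = gnc_metric X \<omega> h z $ b $ a"
 using symmetric_matrix_entry[OF assms] by (cases a; cases b) (simp_all add: gnc_metric_nth)

lemma lorentzian_gnc_metric:
 assumes r: "riemannian (h (z $ Rho) (ang z))"
 shows "lorentzian (gnc_metric X \<omega> h z)"
proof -
 let ?g = "gnc_metric X \<omega> h z" and ?h = "h (z $ Rho) (ang z)"
 define a w where "a = - (z $ Rho * X (z $ Rho) (ang z))" and "w A = z $ Rho * \<omega> (z $ Rho) (ang z) $ A" for A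
 \<comment> \<open>The columns are a unit timelike and a unit spacelike vector in the plane of
   \<partial>\<open>\<^sub>\<tau>\<close> and \<partial>\<open>\<^sub>\<rho>\<close>, and angular
   vectors shifted along \<partial>\<open>\<^sub>\<rho>\<close> to be orthogonal to that
   plane.\<close>
 define P :: "real^('a gnc)^('a gnc)" where "P = (\<chi> i j. case j of
   Tau => (case i of Tau => 1 | Rho => - (1 + a) / 2 | Ang _ => 0)
  | Rho => (case i of Tau => 1 | Rho => (1 - a) / 2 | Ang _ => 0)
  | Ang A => (case i of Tau => 0 | Rho => - w A | Ang B => if B = A then 1 else 0))"
 let ?M = "transpose P ** ?g ** P"
 have M: "?M $ i $ j = (case i of Tau => (case j of Tau => - 1 | _ => 0) | Rho => (case j of Rho => 1 | _ => 0)
   | Ang A => (case j of Ang B => ?h $ A $ B | _ => 0))" for i j by (cases i; cases j)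
   (simp_all add: congruence_entry column_def inner_vec_def matrix_vector_mult_def sum_gnc P_def gnc_metric_nth
    a_def[symmetric] w_def[symmetric] if_distrib[of "\<lambda>c. c * _"] if_distrib[of "\<lambda>c. _ * c"] if_distrib[of "\<lambda>c. c / _"] field_simps cong: if_cong)
 have "lorentzian ?M"
 proof (rule lorentzian_of_riemannian)
  show "?M $ Tau $ Tau < 0" by (simp add: M)
  have h: "?h $ A $ B = ?h $ B $ A" for A B by (rule symmetric_matrix_entry) (use r in "simp add: riemannian_def")
  show "transpose ?M = ?M"
   unfolding vec_eq_iff
  proof (intro allI)
   fix i j
   have "transpose ?M $ i $ j = ?M $ j $ i" by (simp only: transpose_def vec_lambda_beta)
   then show "transpose ?M $ i $ j = ?M $ i $ j" by (auto simp: M h split: gnc.splits)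
  qed
  let ?S = "\<chi> i j. ?M $ i $ j - 2 * ?M $ i $ Tau * ?M $ j $ Tau / ?M $ Tau $ Tau"
  have S: "?S $ i $ j = (case i of Tau => (case j of Tau => 1 | _ => 0) | Rho => (case j of Rho => 1 | _ => 0)
   | Ang A => (case j of Ang B => ?h $ A $ B | _ => 0))" for i j by (auto simp: M split: gnc.splits)
  have pos: "v \<bullet> (?S *v v) > 0" if "v ~= 0" for v
  proof -
   have "v \<bullet> (?S *v v) = (v $ Tau)\<^sup>2 + ((v $ Rho)\<^sup>2 + ang v \<bullet> (?h *v ang v))"
    unfolding inner_vec_def matrix_vector_mult_def
    by (simp add: S sum_gnc ang_def power2_eq_square del: vec_lambda_beta) (simp add: S sum_gnc ang_def)
   moreover have "ang v \<bullet> (?h *v ang v) >= 0" "ang v ~= 0 ==> ang v \<bullet> (?h *v ang v) > 0"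
    using r by (cases "ang v = 0"; simp add: riemannian_def less_imp_le)+
   moreover have "ang v ~= 0 \<or> v $ Tau ~= 0 \<or> v $ Rho ~= 0"
    using that gnc_point_eta[of v] gnc_point_0 by metis
   ultimately show ?thesis by (smt (verit) zero_less_power2 zero_le_power2)
  qed
  show "riemannian ?S"
   unfolding riemannian_def
  proof (intro conjI allI impI pos)
   show "transpose ?S = ?S"
    unfolding vec_eq_iff
   proof (intro allI)
    fix i j
    have "transpose ?S $ i $ j = ?S $ j $ i" by (simp only: transpose_def vec_lambda_beta)
    also have "... = ?S $ i $ j" unfolding S by (auto simp: h split: gnc.splits)
    finally show "transpose ?S $ i $ j = ?S $ i $ j" .
   qed
  qed
 qed
 then show ?thesis
  using lorentzian_det[of ?M] by (simp add: lorentzian_congruence_iff invertible_det_nz det_mul)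
qed

text \<open>At \<rho> = 0 the rows \<open>Tau\<close> and \<open>Rho\<close> of the metric are unit
  vectors, so these entries can be read off from the products of the metric with its
  inverse.\<close>

lemma gnc_metric_inv:
 assumes r: "riemannian (h (z $ Rho) (ang z))" and z: "z $ Rho = 0"
 shows "matrix_inv (gnc_metric X \<omega> h z) $ Tau $ b = (if b = Rho then 1 else 0)"
  and "matrix_inv (gnc_metric X \<omega> h z) $ Rho $ b = (if b = Tau then 1 else 0)"
  and "matrix_inv (gnc_metric X \<omega> h z) $ b $ Tau = (if b = Rho then 1 else 0)"
  and "matrix_inv (gnc_metric X \<omega> h z) $ b $ Rho = (if b = Tau then 1 else 0)"
  and "h (z $ Rho) (ang z) = mat 1 ==> matrix_inv (gnc_metric X \<omega> h z) $ Ang A $ Ang B = (if A = B then 1 else 0)"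
proof -
 let ?g = "gnc_metric X \<omega> h z"
 have nz: "det ?g ~= 0" by (rule lorentzian_det[OF lorentzian_gnc_metric[of h z X \<omega>, OF r]])
 have R: "(\<Sigma> d. ?g $ a $ d * matrix_inv ?g $ d $ b) = (if a = b then 1 else 0)" for a b
  using arg_cong[OF matrix_inv_right[OF nz], of "\<lambda>m. m $ a $ b"] by (simp add: matrix_matrix_mult_def mat_def)
 have L: "(\<Sigma> d. matrix_inv ?g $ a $ d * ?g $ d $ b) = (if a = b then 1 else 0)" for a b
  using arg_cong[OF matrix_inv_left[OF nz], of "\<lambda>m. m $ a $ b"] by (simp add: matrix_matrix_mult_def mat_def)
 show "matrix_inv ?g $ Tau $ b = (if b = Rho then 1 else 0)" "matrix_inv ?g $ Rho $ b = (if b = Tau then 1 else 0)"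
  using R[of Rho b] R[of Tau b] by (simp_all add: sum_gnc gnc_metric_nth z)
 show 1: "matrix_inv ?g $ b $ Tau = (if b = Rho then 1 else 0)" "matrix_inv ?g $ b $ Rho = (if b = Tau then 1 else 0)" for b
  using L[of b Rho] L[of b Tau] by (simp_all add: sum_gnc gnc_metric_nth z)
 assume "h (z $ Rho) (ang z) = mat 1"
 then show "matrix_inv ?g $ Ang A $ Ang B = (if A = B then 1 else 0)"
  using L[of "Ang A" "Ang B"] by (simp add: sum_gnc gnc_metric_nth 1 mat_def if_distrib[of "\<lambda>c. _ * c"] cong: if_cong)
qed

locale gnc_coords =
 fixes X :: "real => real^'n::finite => real" and \<omega> :: "real => real^'n => real^'n"
  and h :: "real => real^'n => real^'n^'n" and V :: "(real^('n gnc)) set"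
 assumes oV: "open V" and smX: "smooth_on V (\<lambda>z. X (z $ Rho) (ang z))"
  and sm\<omega>: "smooth_on V (\<lambda>z. \<omega> (z $ Rho) (ang z))" and smh: "smooth_on V (\<lambda>z. h (z $ Rho) (ang z))"
  and hr: "!!z. z \<in> V ==> riemannian (h (z $ Rho) (ang z))"
begin

abbreviation g :: "'n gnc metric" where "g \<equiv> gnc_metric X \<omega> h"

lemma sm\<omega>_nth: "smooth_on V (\<lambda>z. \<omega> (z $ Rho) (ang z) $ A)" by (rule smooth_on_nth[OF oV sm\<omega>])

lemma smooth_g_nth: "smooth_on V (\<lambda>z. g z $ a $ b)" by (cases a; cases b)
  (auto simp: gnc_metric_nth intro!: smooth_on_minus smooth_on_mult oV smooth_on_coord smX sm\<omega>_nth smooth_on_entry[OF oV smh])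

lemma smooth_g: "smooth_on V g" by (simp add: smooth_on_mat[OF oV] smooth_g_nth)

lemma lorentzian_g: "z \<in> V ==> lorentzian (g z)" by (rule lorentzian_gnc_metric) (rule hr)

lemma regular_g: "regular_on V g" by (rule regular_on_lorentzian[OF oV smooth_g]) (simp add: lorentzian_g)

lemma g_sym: "z \<in> V ==> g z $ a $ b = g z $ b $ a" by (rule gnc_metric_sym) (use hr in "auto simp: riemannian_def")

lemma pd_g_sym: "z \<in> V ==> pd i (\<lambda>z. g z $ a $ b) z = pd i (\<lambda>z. g z $ b $ a) z"
 by (rule pd_cong_open[OF oV _ g_sym])

lemma pd_Tau_g: "pd Tau (\<lambda>z. g z $ a $ b) z = 0"
proof -
 have "g (z + t *\<^sub>R axis Tau 1) = g z" for t
 proof -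
  have "(z + t *\<^sub>R axis Tau 1) $ Rho = z $ Rho" "ang (z + t *\<^sub>R axis Tau 1) = ang z"
   by (simp_all add: axis_def ang_def vec_eq_iff)
  then show ?thesis by (simp only: gnc_metric_def)
 qed
 then show ?thesis by (simp add: pd_def)
qed

text \<open>The exterior derivative of the one-form dual to \<partial>\<open>\<^sub>\<tau>\<close>.
  As nothing depends on \<tau>, the Christoffel symbols with a lower index \<tau> reduce to
  it.\<close>

definition curl :: "'n gnc => 'n gnc => real^('n gnc) => real" where
 "curl b d z = pd b (\<lambda>z. g z $ d $ Tau) z - pd d (\<lambda>z. g z $ b $ Tau) z"

lemma smooth_curl: "smooth_on V (curl b d)"
 unfolding curl_def[abs_def] by (intro smooth_on_diff smooth_on_pd oV smooth_g_nth)

lemma christoffel_Tau: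
 assumes z: "z \<in> V"
 shows "christoffel g z a b Tau = (\<Sigma> d. matrix_inv (g z) $ a $ d * curl b d z) / 2"
 by (simp add: christoffel_def curl_def pd_Tau_g)

lemma pd_Rho_mult:
 assumes "smooth_on V f" "z \<in> V" "z $ Rho = 0"
 shows "pd i (\<lambda>z. z $ Rho * f z) z = (if i = Rho then f z else 0)"
 using pd_mult[OF smooth_on_D[OF smooth_on_coord assms(2)] smooth_on_D[OF assms(1,2)], of i Rho] assms(3) by simp

lemma pd_mult_Rho_ang:
 assumes "smooth_on V f" "z \<in> V"
 shows "pd (Ang A) (\<lambda>z. z $ Rho * f z) z = z $ Rho * pd (Ang A) f z"
 using pd_mult[OF smooth_on_D[OF smooth_on_coord assms(2)] smooth_on_D[OF assms(1,2)], of "Ang A" Rho] by simp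

lemma curl_values:
 assumes z: "z \<in> V"
 shows "curl (Ang A) Tau z = z $ Rho * (- pd (Ang A) (\<lambda>z. X (z $ Rho) (ang z)) z)"
  and "curl (Ang A) (Ang C) z = z $ Rho * (pd (Ang A) (\<lambda>z. \<omega> (z $ Rho) (ang z) $ C) z - pd (Ang C) (\<lambda>z. \<omega> (z $ Rho) (ang z) $ A) z)"
proof -
 have "smooth_on V (\<lambda>z. z $ Rho * X (z $ Rho) (ang z))" by (intro smooth_on_mult oV smooth_on_coord smX)
 then show "curl (Ang A) Tau z = z $ Rho * (- pd (Ang A) (\<lambda>z. X (z $ Rho) (ang z)) z)"
  using pd_Tau_g[of "Ang A" Tau z]
  by (simp add: curl_def gnc_metric_nth pd_minus[OF smooth_on_D[OF _ z]] pd_mult_Rho_ang[OF smX z])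
 show "curl (Ang A) (Ang C) z = z $ Rho * (pd (Ang A) (\<lambda>z. \<omega> (z $ Rho) (ang z) $ C) z - pd (Ang C) (\<lambda>z. \<omega> (z $ Rho) (ang z) $ A) z)"
  by (simp add: curl_def gnc_metric_nth pd_mult_Rho_ang[OF sm\<omega>_nth z] right_diff_distrib)
qed

context
 fixes z :: "real^('n gnc)"
 assumes z: "z \<in> V" "z $ Rho = 0"
begin

lemmas inv0 = gnc_metric_inv(1-4)[of h z X \<omega>, OF hr[OF z(1)] z(2)]

lemma pd_gTT: "pd i (\<lambda>z. g z $ Tau $ Tau) z = (if i = Rho then - X (z $ Rho) (ang z) else 0)"
proof -
 have "smooth_on V (\<lambda>z. z $ Rho * X (z $ Rho) (ang z))" by (intro smooth_on_mult oV smooth_on_coord smX)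
 then show ?thesis by (simp add: gnc_metric_nth pd_minus[OF smooth_on_D[OF _ z(1)]] pd_Rho_mult[OF smX z])
qed

lemma pd_gAT: "pd i (\<lambda>z. g z $ Ang A $ Tau) z = (if i = Rho then \<omega> (z $ Rho) (ang z) $ A else 0)"
 by (simp add: gnc_metric_nth pd_Rho_mult[OF sm\<omega>_nth z])

lemma pd_gR: "pd i (\<lambda>z. g z $ Rho $ a) z = 0" "pd i (\<lambda>z. g z $ a $ Rho) z = 0"
 by (cases a; simp add: gnc_metric_nth)+

lemma pd_gTA: "pd i (\<lambda>z. g z $ Tau $ Ang A) z = (if i = Rho then \<omega> (z $ Rho) (ang z) $ A else 0)"
 using pd_gAT pd_g_sym[OF z(1)] by simp

lemma curl0:
 "curl Tau Rho z = X (z $ Rho) (ang z)" "curl Rho Tau z = - X (z $ Rho) (ang z)"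
 "curl Rho (Ang A) z = \<omega> (z $ Rho) (ang z) $ A" "curl (Ang A) Rho z = - \<omega> (z $ Rho) (ang z) $ A"
 "curl Tau (Ang A) z = 0" "curl (Ang A) Tau z = 0" "curl (Ang A) (Ang B) z = 0" "curl a a z = 0"
 by (simp_all add: curl_def pd_gTT pd_gAT pd_gR)

lemma surface_gravity_gnc: "christoffel g z Tau Tau Tau = X (z $ Rho) (ang z) / 2"
 unfolding christoffel_Tau[OF z(1)] by (simp add: sum_gnc inv0 curl0)

lemma pd_christoffel_sum:
 "(\<Sigma> a. pd a (\<lambda>y. christoffel g y a (Ang A) Tau) z) =
  - (pd (Ang A) (\<lambda>z. X (z $ Rho) (ang z)) z + X (z $ Rho) (ang z) * \<omega> (z $ Rho) (ang z) $ A) / 2"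
proof -
 let ?k = "\<lambda>a d z. matrix_inv (g z) $ a $ d" and ?X = "\<lambda>z. X (z $ Rho) (ang z)"
 have sk: "smooth_on V (?k a d)" for a d using jet_poly_smooth[OF jet_poly.upper regular_g] .
 note sd = smooth_on_D[OF _ z(1)]
 have "pd a (\<lambda>y. christoffel g y a (Ang A) Tau) z =
   (\<Sigma> d. ?k a d z * pd a (curl (Ang A) d) z + pd a (?k a d) z * curl (Ang A) d z) / 2" for a
 proof -
  have s: "smooth_on V (\<lambda>y. \<Sigma> d. ?k a d y * curl (Ang A) d y)"
   by (intro smooth_on_sum smooth_on_mult oV sk smooth_curl)
  have "pd a (\<lambda>y. christoffel g y a (Ang A) Tau) z = pd a (\<lambda>y. 1/2 * (\<Sigma> d. ?k a d y * curl (Ang A) d y)) z"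
   by (rule pd_cong_open[OF oV z(1)]) (simp add: christoffel_Tau)
  also have "... = 1/2 * pd a (\<lambda>y. \<Sigma> d. ?k a d y * curl (Ang A) d y) z" by (rule pd_cmult[OF sd[OF s]])
  also have "pd a (\<lambda>y. \<Sigma> d. ?k a d y * curl (Ang A) d y) z =
   (\<Sigma> d. ?k a d z * pd a (curl (Ang A) d) z + pd a (?k a d) z * curl (Ang A) d z)"
   by (subst pd_sum) (auto intro!: sd smooth_on_mult oV sk smooth_curl sum.cong pd_mult)
  finally show ?thesis by simp
 qed
 then have "(\<Sigma> a. pd a (\<lambda>y. christoffel g y a (Ang A) Tau) z) =
   ((\<Sigma> a d. ?k a d z * pd a (curl (Ang A) d) z) + (\<Sigma> a d. pd a (?k a d) z * curl (Ang A) d z)) / 2"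
  by (simp only: sum.distrib sum_divide_distrib[symmetric])
 \<comment> \<open>With the null entries of the inverse only mixed \<tau>\<rho> and angular pairs
   remain; \<open>curl (Ang A) Tau\<close> and \<open>curl (Ang A) (Ang C)\<close> carry a factor
   \<rho>, so the only surviving derivative is the transversal one of the former.\<close>
 also have "(\<Sigma> a d. ?k a d z * pd a (curl (Ang A) d) z) = - pd (Ang A) ?X z"
 proof -
  have "pd Tau (curl (Ang A) Rho) z = 0"
  proof -
   have "pd Tau (pd i (\<lambda>z. g z $ a $ b)) z = 0" for i a b
   proof -
    have "pd Tau (pd i (\<lambda>z. g z $ a $ b)) z = pd i (pd Tau (\<lambda>z. g z $ a $ b)) z"
     by (rule pd_commute[OF oV z(1) smooth_g_nth])
    also have "pd Tau (\<lambda>z. g z $ a $ b) = (\<lambda>z. 0)" by (rule ext) (rule pd_Tau_g)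
    finally show ?thesis by simp
   qed
   then show ?thesis
    unfolding curl_def[abs_def] by (subst pd_diff) (auto intro!: sd smooth_on_pd smooth_g_nth)
  qed
  moreover have "pd Rho (curl (Ang A) Tau) z = - pd (Ang A) ?X z"
  proof -
   have "pd Rho (curl (Ang A) Tau) z = pd Rho (\<lambda>z. z $ Rho * (- pd (Ang A) ?X z)) z"
    by (rule pd_cong_open[OF oV z(1) curl_values(1)])
   then show ?thesis unfolding pd_Rho_mult[OF smooth_on_minus[OF oV smooth_on_pd[OF smX]] z] by simp
  qed
  moreover have "pd (Ang B) (curl (Ang A) (Ang C)) z = 0" for B C
  proof -
   let ?c = "\<lambda>z. pd (Ang A) (\<lambda>z. \<omega> (z $ Rho) (ang z) $ C) z - pd (Ang C) (\<lambda>z. \<omega> (z $ Rho) (ang z) $ A) z"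
   have "smooth_on V ?c" by (intro smooth_on_diff smooth_on_pd oV sm\<omega>_nth)
   moreover have "pd (Ang B) (curl (Ang A) (Ang C)) z = pd (Ang B) (\<lambda>z. z $ Rho * ?c z) z"
    by (rule pd_cong_open[OF oV z(1) curl_values(2)])
   ultimately show ?thesis using pd_Rho_mult[of ?c, OF _ z, of "Ang B"] by simp
  qed
  ultimately show ?thesis by (simp add: sum_gnc inv0)
 qed
 \<comment> \<open>On the horizon \<open>curl (Ang A) d\<close> is nonzero at most for
   \<open>d = Rho\<close>.\<close>
 also have "(\<Sigma> a d. pd a (?k a d) z * curl (Ang A) d z) = - \<omega> (z $ Rho) (ang z) $ A * (\<Sigma> a. pd a (?k a Rho) z)"
  by (simp add: sum_gnc curl0 distrib_left sum_distrib_left mult.commute)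
 also have "(\<Sigma> a. pd a (?k a Rho) z) = ?X z"
 proof -
  have "pd a (?k a Rho) z = - (\<Sigma> p. ?k a p z * pd a (\<lambda>z. g z $ p $ Tau) z)" for a
   using pd_matrix_inv[of g z a a Rho, OF sd[OF smooth_g_nth] lorentzian_det[OF lorentzian_g[OF z(1)]]]
   by (simp add: inv0 if_distrib[of "\<lambda>c. _ * c"] cong: if_cong)
  then show ?thesis by (simp add: sum_gnc inv0 pd_gTT pd_gAT pd_Tau_g)
 qed
 finally show ?thesis by simp
qed

text \<open>The symmetric inverse metric is contracted with the antisymmetric \<open>curl\<close>;
  geometrically, a Killing field has no divergence.\<close>

lemma christoffel_trace_Tau: "y \<in> V ==> (\<Sigma> a. christoffel g y a a Tau) = 0"
proof -
 assume y: "y \<in> V"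
 have sym: "matrix_inv (g y) $ a $ d = matrix_inv (g y) $ d $ a" for a d
 proof -
  have gs: "transpose (g y) = g y" using g_sym[OF y] by (simp add: vec_eq_iff transpose_def)
  have nz: "det (g y) ~= 0" by (rule lorentzian_det[OF lorentzian_g[OF y]])
  have "transpose (matrix_inv (g y)) = transpose (matrix_inv (g y)) ** (g y ** matrix_inv (g y))"
   by (simp add: matrix_inv_right[OF nz])
  also have "... = transpose (g y ** matrix_inv (g y)) ** matrix_inv (g y)"
   by (simp add: matrix_transpose_mul gs matrix_mul_assoc)
  also have "... = matrix_inv (g y)" by (simp add: matrix_inv_right[OF nz] transpose_mat)
  finally show ?thesis using symmetric_matrix_entry by blast
 qed
 have "(\<Sigma> a d. matrix_inv (g y) $ a $ d * curl a d y) = (\<Sigma> a d. - (matrix_inv (g y) $ a $ d * curl a d y))"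
 proof (subst sum.swap, intro sum.cong refl)
  fix a d
  have "curl d a y = - curl a d y" by (simp add: curl_def)
  then show "matrix_inv (g y) $ d $ a * curl d a y = - (matrix_inv (g y) $ a $ d * curl a d y)" using sym[of d a] by simp
 qed
 then show ?thesis by (simp add: christoffel_Tau[OF y] sum_negf sum_divide_distrib[symmetric])
qed

text \<open>The product of X and \<omega>\<open>\<^sub>A\<close> from the derivative of the
  Christoffel symbols cancels against the one from their products; the two terms with the trace
  vanish.\<close>

lemma ricci_Tau_Ang: "ricci g z Tau (Ang A) = - pd (Ang A) (\<lambda>z. X (z $ Rho) (ang z)) z / 2"
proof -
 let ?X = "X (z $ Rho) (ang z)" and ?w = "\<lambda>A. \<omega> (z $ Rho) (ang z) $ A"
 have sC: "smooth_on V (\<lambda>y. christoffel g y a a Tau)" for a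
 proof -
  have "smooth_on V (\<lambda>z. matrix_inv (g z) $ a $ d)" for d using jet_poly_smooth[OF jet_poly.upper regular_g] .
  then show ?thesis
   unfolding christoffel_def
   by (intro smooth_on_mult smooth_on_const smooth_on_sum smooth_on_diff smooth_on_add smooth_on_pd oV smooth_g_nth)
 qed
 have "(\<Sigma> a. pd (Ang A) (\<lambda>y. christoffel g y a a Tau) z) = pd (Ang A) (\<lambda>y. \<Sigma> a. christoffel g y a a Tau) z"
  by (rule pd_sum[symmetric]) (auto intro: smooth_on_D[OF sC z(1)])
 also have "... = pd (Ang A) (\<lambda>y. 0) z" by (rule pd_cong_open[OF oV z(1) christoffel_trace_Tau])
 finally have 2: "(\<Sigma> a. pd (Ang A) (\<lambda>y. christoffel g y a a Tau) z) = 0" by simp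
 have C: "christoffel g z Tau b Tau = curl b Rho z / 2" "christoffel g z Rho b Tau = curl b Tau z / 2"
  "christoffel g z (Ang B) b Tau = (\<Sigma> C. matrix_inv (g z) $ Ang B $ Ang C * curl b (Ang C) z) / 2" for b B
  by (simp_all add: christoffel_Tau[OF z(1)] sum_gnc inv0)
 have 3: "(\<Sigma> a e. christoffel g z a a e * christoffel g z e (Ang A) Tau) = 0"
 proof -
  have "(\<Sigma> e. christoffel g z a a e * christoffel g z e (Ang A) Tau) = christoffel g z a a Tau * (- ?w A / 2)" for a
   by (simp add: sum_gnc[of "\<lambda>e. christoffel g z _ _ e * _ e"] C curl0)
  then show ?thesis by (simp only: sum_distrib_right[symmetric] christoffel_trace_Tau[OF z(1)] mult_zero_left)
 qed
 have R: "christoffel g z Rho (Ang A) Rho = ?w A / 2" "christoffel g z Rho (Ang A) (Ang B) = 0" for B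
  by (simp_all add: christoffel_def inv0 pd_gR pd_gTA pd_Tau_g if_distrib[of "\<lambda>c. c * _"] cong: if_cong)
 have 4: "(\<Sigma> a e. christoffel g z a (Ang A) e * christoffel g z e a Tau) = - ?X * ?w A / 2"
  by (simp add: sum_gnc C curl0 R)
 have "ricci g z Tau (Ang A) = (\<Sigma> a. pd a (\<lambda>y. christoffel g y a (Ang A) Tau) z)
   - (\<Sigma> a. pd (Ang A) (\<lambda>y. christoffel g y a a Tau) z)
   + ((\<Sigma> a e. christoffel g z a a e * christoffel g z e (Ang A) Tau)
    - (\<Sigma> a e. christoffel g z a (Ang A) e * christoffel g z e a Tau))"
  by (simp add: ricci_def riemann_def sum.distrib sum_subtractf)
 then show ?thesis unfolding pd_christoffel_sum 2 3 4 by (simp add: field_simps)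
qed

end

end

section \<open>Boost weight\<close>

text \<open>Lower indices, as in the equations of motion, and Lorentzian metrics only, because that
  is where the Lagrangians are assumed covariant.\<close>

definition covariant_2tensor :: "('i::finite => 'i => 'i lagrangian) => bool" where
 "covariant_2tensor P \<longleftrightarrow> (\<forall>a b. jet_poly (P a b)) \<and>
   (\<forall>V W \<phi> g x a b. diffeomorphic_map V W \<phi> \<and> smooth_on W g \<and> (\<forall>z\<in>W. lorentzian (g z)) \<and> x \<in> V -->
    P a b (pullback \<phi> g) x = (\<Sigma> c d. jac \<phi> x $ c $ a * jac \<phi> x $ d $ b * P c d g (\<phi> x)))"

definition lowered :: "('i::finite => 'i => 'i lagrangian) => 'i => 'i => 'i lagrangian" where
 "lowered E a b g x = (\<Sigma> p q. g x $ a $ p * g x $ b $ q * E p q g x)"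

lemma matrix_mult_transpose_nth:
 fixes A C :: "real^'k::finite^'l::finite" and B :: "real^'k^'k"
 shows "(A ** B ** transpose C) $ i $ j = (\<Sigma> p q. A $ i $ p * C $ j $ q * B $ p $ q)"
 unfolding matrix_matrix_mult_def transpose_def by (simp add: sum_distrib_right) (subst sum.swap, simp add: mult_ac)

lemma congruence_nth:
 fixes J B :: "real^'k::finite^'k"
 shows "(transpose J ** B ** J) $ i $ j = (\<Sigma> p q. J $ p $ i * J $ q $ j * B $ p $ q)"
 using matrix_mult_transpose_nth[of "transpose J" B "transpose J" i j]
 by (simp only: transpose_transpose) (simp only: transpose_def vec_lambda_beta)

lemma lowered_covariant:
 fixes L :: "'i::finite lagrangian"
 assumes L: "covariant_scalar n L" "jet_poly F" "!!S g x. regular_on S g ==> x \<in> S ==> L g x = F g x"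
  and E: "first_variation F E"
 shows "covariant_2tensor (lowered E)"
 unfolding covariant_2tensor_def
proof (intro conjI allI impI; (elim conjE)?)
 show "jet_poly (lowered E a b)" for a b
  unfolding lowered_def[abs_def] by (intro jet_poly_sum jet_poly.mult jet_poly_lower first_variation_jet_poly[OF E])
 note mm = matrix_mult_transpose_nth
 fix V W \<phi> and g :: "'i metric" and x a b
 assume \<phi>: "diffeomorphic_map V W \<phi>" and g: "smooth_on W g" "\<forall>z\<in>W. lorentzian (g z)" and x: "x \<in> V"
 let ?J = "jac \<phi> x" and ?g = "g (\<phi> x)"
 let ?E = "\<chi> a b. E a b g (\<phi> x)" and ?E' = "\<chi> a b. E a b (pullback \<phi> g) x"
 have df: "\<phi> differentiable (at x)"
  using \<phi> x smooth_on_D by (auto simp: diffeomorphic_map_def)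
 have E': "?E = ?J ** ?E' ** transpose ?J"
  unfolding vec_eq_iff mm by (simp add: first_variation_covariant[OF L E \<phi> g x])
 have "lowered E a b (pullback \<phi> g) x = (pullback \<phi> g x ** ?E' ** transpose (pullback \<phi> g x)) $ a $ b"
  by (simp add: mm lowered_def)
 also have "pullback \<phi> g x ** ?E' ** transpose (pullback \<phi> g x) = transpose ?J ** (?g ** ?E ** transpose ?g) ** ?J"
  by (simp add: pullback_eq[OF df] E' matrix_transpose_mul matrix_mul_assoc)
 also have "... $ a $ b = (\<Sigma> c d. ?J $ c $ a * ?J $ d $ b * (?g ** ?E ** transpose ?g) $ c $ d)" by (rule congruence_nth)
 finally show "lowered E a b (pullback \<phi> g) x = (\<Sigma> c d. ?J $ c $ a * ?J $ d $ b * lowered E c d g (\<phi> x))"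
  unfolding mm by (simp add: lowered_def)
qed

section \<open>The boost and the vanishing of components of nonzero weight\<close>

lemma smooth_on_pdI:
 assumes "!!x. x \<in> S ==> f differentiable (at x)" "!!i. smooth_on S (pd i f)"
 shows "smooth_on S f"
 unfolding smooth_on_def
proof
 fix k show "ck_on k S f"
  using assms by (cases k) (auto simp: smooth_on_def intro: continuous_at_imp_continuous_on differentiable_imp_continuous_within)
qed

text \<open>For \<kappa> = 0 the value is the limit of the other formula; in both cases the
  derivative is 1 / (s + \<kappa> v).\<close>

definition boost_time :: "real => real => real => real" where
 "boost_time \<kappa> s v = (if \<kappa> = 0 then v / s else (ln (s + \<kappa> * v) - ln s) / \<kappa>)"

text \<open>The new time v satisfies s + \<kappa> v = s exp (\<kappa> \<tau>): an affine parameter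
  along the generators that starts at \<tau> = 0 and is scaled by s.\<close>

definition boost :: "real => real => real^('n::finite gnc) => real^('n gnc)" where
 "boost \<kappa> s z = gnc_point (boost_time \<kappa> s (z $ Tau)) (z $ Rho * (s + \<kappa> * z $ Tau)) (ang z)"

lemma boost_time_deriv:
 assumes "0 < s" "0 < s + \<kappa> * v"
 shows "(boost_time \<kappa> s has_real_derivative inverse (s + \<kappa> * v)) (at v)"
 unfolding boost_time_def[abs_def]
 using assms less_imp_neq[OF assms(2)] by (cases "\<kappa> = 0") (auto intro!: derivative_eq_intros simp: divide_simps)

lemma boost_nth [simp]:
 "boost \<kappa> s z $ Tau = boost_time \<kappa> s (z $ Tau)" "boost \<kappa> s z $ Rho = z $ Rho * (s + \<kappa> * z $ Tau)"
 "boost \<kappa> s z $ Ang A = z $ Ang A" "ang (boost \<kappa> s z) = ang z" by (simp_all add: boost_def) (simp add: ang_def)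

lemma open_boost_domain: "open {z :: real^('n::finite gnc). 0 < s + \<kappa> * z $ Tau}"
 by (intro open_Collect_less continuous_intros)

lemma boost_smooth:
 fixes z :: "real^('n::finite gnc)"
 assumes s: "0 < s"
 shows "smooth_on {z :: real^('n::finite gnc). 0 < s + \<kappa> * z $ Tau} (boost \<kappa> s)"
  and "0 < s + \<kappa> * z $ Tau ==> jac (boost \<kappa> s) z $ c $ a = (case c of
   Tau => (if a = Tau then inverse (s + \<kappa> * z $ Tau) else 0)
  | Rho => (if a = Tau then \<kappa> * z $ Rho else if a = Rho then s + \<kappa> * z $ Tau else 0)
  | Ang A => if a = Ang A then 1 else 0)"
proof -
 let ?D = "{z :: real^('n gnc). 0 < s + \<kappa> * z $ Tau}"
 note o = open_boost_domain[of s \<kappa>]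
 have sm\<sigma>: "smooth_on ?D (\<lambda>z. s + \<kappa> * z $ Tau)"
  by (intro smooth_on_add smooth_on_mult o smooth_on_const smooth_on_coord)
 have T: "pd i (\<lambda>z. boost_time \<kappa> s (z $ Tau)) z = inverse (s + \<kappa> * z $ Tau) * (if i = Tau then 1 else 0)"
  "(\<lambda>z. boost_time \<kappa> s (z $ Tau)) differentiable (at z)" if "z \<in> ?D" for z :: "real^('n gnc)" and i
  using pd_compose_real[OF smooth_on_D[OF smooth_on_coord that] boost_time_deriv[OF s]] that by auto
 have "smooth_on ?D (\<lambda>z. boost_time \<kappa> s (z $ Tau))"
 proof (rule smooth_on_pdI[OF T(2)])
  fix i :: "'n gnc"
  have "smooth_on ?D (\<lambda>z. inverse (s + \<kappa> * z $ Tau) * (if i = Tau then 1 else 0))"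
   by (intro smooth_on_mult smooth_on_inverse o sm\<sigma> smooth_on_const) simp
  then show "smooth_on ?D (pd i (\<lambda>z. boost_time \<kappa> s (z $ Tau)))"
   using smooth_on_cong[OF o, of "pd i (\<lambda>z. boost_time \<kappa> s (z $ Tau))"] T(1) by auto
 qed
 moreover have R: "smooth_on ?D (\<lambda>z. z $ Rho * (s + \<kappa> * z $ Tau))" by (intro smooth_on_mult smooth_on_coord o sm\<sigma>)
 ultimately show "smooth_on ?D (boost \<kappa> s)"
  unfolding smooth_on_vec[OF o]
 proof (intro allI)
  fix i :: "'n gnc"
  show "smooth_on ?D (\<lambda>z. boost \<kappa> s z $ i)" if "smooth_on ?D (\<lambda>z. boost_time \<kappa> s (z $ Tau))"
   "smooth_on ?D (\<lambda>z. z $ Rho * (s + \<kappa> * z $ Tau))"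
   using that by (cases i) (simp_all add: smooth_on_coord)
 qed
 assume "0 < s + \<kappa> * z $ Tau"
 then have z: "z \<in> ?D" by simp
 have "pd a (\<lambda>z. s + \<kappa> * z $ Tau) z = \<kappa> * (if a = Tau then 1 else 0)"
  using pd_add[OF smooth_on_D[OF smooth_on_const z], of "\<lambda>z. \<kappa> * z $ Tau"] pd_cmult[OF smooth_on_D[OF smooth_on_coord z]]
   smooth_on_D[OF smooth_on_mult[OF o smooth_on_const smooth_on_coord] z] by simp
 then have "pd a (\<lambda>z. z $ Rho * (s + \<kappa> * z $ Tau)) z = z $ Rho * (\<kappa> * (if a = Tau then 1 else 0)) + (if a = Rho then 1 else 0) * (s + \<kappa> * z $ Tau)"
  using pd_mult[OF smooth_on_D[OF smooth_on_coord z] smooth_on_D[OF sm\<sigma> z], of a Rho] by simp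
 then show "jac (boost \<kappa> s) z $ c $ a = (case c of
   Tau => (if a = Tau then inverse (s + \<kappa> * z $ Tau) else 0)
  | Rho => (if a = Tau then \<kappa> * z $ Rho else if a = Rho then s + \<kappa> * z $ Tau else 0)
  | Ang A => if a = Ang A then 1 else 0)" by (cases c) (simp_all add: jac_def T(1)[OF z])
qed

context gnc_coords
begin

text \<open>In the coordinates of \<^const>\<open>boost\<close> a metric with constant surface gravity is regular as \<open>s\<close>
 tends to 0, while its components with one lower index along the horizon generators have been multiplied by
 \<open>1 / s\<close>.\<close>
theorem boost_weight_zero:
 assumes P: "covariant_2tensor P" and y: "gnc_point 0 0 y \<in> V"
  and XY: "!!z. z \<in> V ==> X (z $ Rho) (ang z) = 2 * \<kappa> + z $ Rho * Y (z $ Rho) (ang z)"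
  and smY: "smooth_on V (\<lambda>z. Y (z $ Rho) (ang z))"
 shows "P Tau (Ang A) g (gnc_point 0 0 y) = 0"
proof -
 let ?z = "gnc_point 0 0 y :: real^('n gnc)" and ?F = "P Tau (Ang A)" and ?t = "\<lambda>s z :: real^('n gnc). s + \<kappa> * z $ Tau"
 let ?D = "\<lambda>s. {z. 0 < ?t s z}"
 let ?r = "\<lambda>s z. z $ Rho * ?t s z"
 have F: "jet_poly ?F" using P by (simp add: covariant_2tensor_def)
 obtain R where R: "\<forall>M. \<exists>C. jet_lipschitz 0 ?F R M C" using jet_poly_lipschitz[OF F] ..
 \<comment> \<open>The fields do not depend on \<tau>, so the boost may be replaced by a map without
   the time component, which is the one that blows up as s tends to 0.\<close>
 define \<Psi> :: "real => real^('n gnc) => real^('n gnc)" where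
  "\<Psi> s z = gnc_point 0 (?r s z) (ang z)" for s z
 \<comment> \<open>The pulled back metric: the constant 2 \<kappa> in X cancels against the term
   that the boost produces from 2 d\<tau> d\<rho>, and s survives only in the argument \<rho> (s +
   \<kappa> \<tau>).\<close>
 define gs :: "real => 'n gnc metric" where "gs s z = gnc_metric (\<lambda>_ _. z $ Rho * Y (?r s z) (ang z))
   (\<lambda>_ _. \<omega> (?r s z) (ang z)) (\<lambda>_ _. h (?r s z) (ang z)) z" for s z
 \<comment> \<open>The boost must be defined and land in \<open>V\<close>, and so must
   \<open>\<Psi>\<close>, through which the fields are expressed.\<close>
 define S where "S s = ?D s \<inter> (?D s \<inter> boost \<kappa> s -` V) \<inter> \<Psi> s -` V" for s
 have \<Psi>_nth: "\<Psi> s z $ i = (case i of Tau => 0 | Rho => ?r s z | Ang A => z $ Ang A)" for s z i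
  by (cases i) (simp_all add: \<Psi>_def, simp add: ang_def)
 have sm\<Psi>: "smooth_on T (\<Psi> s)" if "open T" for T s
  unfolding smooth_on_vec[OF that]
 proof
  fix i :: "'n gnc"
  show "smooth_on T (\<lambda>z. \<Psi> s z $ i)" unfolding \<Psi>_nth
   by (cases i) (auto intro!: smooth_on_mult smooth_on_add that smooth_on_coord)
 qed
 have oS: "open (S s)" if "0 < s" for s
 proof -
  have "open (?D s \<inter> boost \<kappa> s -` V)"
   by (rule continuous_open_preimage[OF smooth_on_cont[OF boost_smooth(1)[OF that]] open_boost_domain oV])
  moreover have "open (UNIV \<inter> \<Psi> s -` V)"
   by (rule continuous_open_preimage[OF smooth_on_cont[OF sm\<Psi>[OF open_UNIV]] open_UNIV oV])
  ultimately show ?thesis unfolding S_def using open_boost_domain[of s \<kappa>] by auto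
 qed
 have z0: "boost \<kappa> s ?z = ?z" "\<Psi> s ?z = ?z" for s by (auto simp: vec_eq_iff boost_def \<Psi>_def boost_time_def)
 have zS: "?z \<in> S s" if "0 < s" for s using that y by (simp add: S_def z0)
 have smc: "smooth_on (S s) (\<lambda>z. f (?r s z) (ang z))" if "smooth_on V (\<lambda>z. f (z $ Rho) (ang z))" "0 < s"
  for f :: "real => real^'n => real" and s
 proof -
  have "smooth_on (S s) (\<lambda>z. (\<lambda>z. f (z $ Rho) (ang z)) (\<Psi> s z))"
   by (rule smooth_on_compose[OF oS[OF that(2)] sm\<Psi>[OF oS[OF that(2)]] _ that(1)]) (auto simp: S_def)
  then show ?thesis by (simp add: \<Psi>_def)
 qed
 note smY' = smc[OF smY] and sm\<omega>' = smc[OF sm\<omega>_nth] and smh' = smc[OF smooth_on_entry[OF oV smh]]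
 have gs_smooth: "smooth_on (S s) (\<lambda>z. gs s z $ a $ b)" if "0 < s" for s a b
  by (cases a; cases b) (auto simp: gs_def gnc_metric_nth
   intro!: smooth_on_minus smooth_on_mult oS smooth_on_coord smY' sm\<omega>' smh' that)
 have gs_reg: "regular_on (S s) (gs s)" if "0 < s" for s
 proof -
  have "lorentzian (gs s z)" if "z \<in> S s" for z
   unfolding gs_def by (rule lorentzian_gnc_metric) (use hr[of "\<Psi> s z"] that in \<open>simp add: S_def \<Psi>_def\<close>)
  then show ?thesis
   using gs_smooth[OF that] oS[OF that] by (auto simp: regular_on_def smooth_on_mat lorentzian_det)
 qed
 have gs_pull: "pullback (boost \<kappa> s) g z = gs s z" if s: "0 < s" and z: "z \<in> S s" for s z
 proof -
  define \<sigma> where "\<sigma> = ?t s z"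
  have \<sigma>: "0 < ?t s z" "0 < \<sigma>" and bV: "boost \<kappa> s z \<in> V" using z by (auto simp: S_def \<sigma>_def)
  have df: "boost \<kappa> s differentiable (at z)" by (rule smooth_on_D[OF boost_smooth(1)[OF s]]) (use \<sigma> in simp)
  note J = boost_smooth(2)[OF s \<sigma>(1), folded \<sigma>_def]
  note X' = XY[OF bV, unfolded boost_nth, folded \<sigma>_def]
  note g = gs_def[of s z, folded \<sigma>_def] boost_nth(2)[of \<kappa> s z, folded \<sigma>_def]
  show ?thesis
   unfolding vec_eq_iff
  proof (intro allI)
   fix a b
   show "pullback (boost \<kappa> s) g z $ a $ b = gs s z $ a $ b"
    unfolding pullback_nth[OF df]
    using \<sigma>(2) by (cases a; cases b)
     (simp_all add: sum_gnc J g gnc_metric_nth X' if_distrib[of "\<lambda>c. c * _"] if_distrib[of "\<lambda>c. _ * c"]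
       del: boost_nth(2) cong: if_cong, simp_all add: field_simps)
  qed
 qed
 \<comment> \<open>The jets of the boosted metric at the point are bounded uniformly in s, by the
   chain rule for \<open>\<Psi>\<close>, whose own jets are bounded for s up to 1.\<close>
 have "\<exists>M. \<forall>s\<in>{0<..1}. jn R (\<lambda>z. gs s z $ a $ b) ?z <= M" for a b
 proof -
  let ?q = "jn R (\<lambda>z. z $ Rho) ?z"
  define m where "m = 4 ^ R * ?q * (1 + \<bar>\<kappa>\<bar> * jn R (\<lambda>z. z $ Tau) ?z) + (\<Sigma> A. jn R (\<lambda>z. z $ Ang A) ?z)"
  have cb: "\<exists>M. \<forall>s\<in>{0<..1}. jn R (\<lambda>z. f (?r s z) (ang z)) ?z <= M"
   if sm: "smooth_on V (\<lambda>z. f (z $ Rho) (ang z))" for f :: "real => real^'n => real"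
  proof (intro exI ballI)
   fix s :: real assume s: "s \<in> {0<..1}"
   interpret sp: smooth_at_point "S s" ?z by unfold_locales (use s oS zS in auto)
   have "jn R (\<lambda>z. \<Psi> s z $ c) ?z <= m" for c
   proof -
    have 1: "jn R (\<lambda>z. ?t s z) ?z <= 1 + \<bar>\<kappa>\<bar> * jn R (\<lambda>z. z $ Tau) ?z"
     using sp.jn_add[OF smooth_on_const smooth_on_mult[OF sp.S(1) smooth_on_const smooth_on_coord], of R s \<kappa> Tau] s
      sp.jn_cmult[OF smooth_on_coord, of R \<kappa> Tau] by simp
    have 2: "jn R (\<lambda>z. ?r s z) ?z <= 4 ^ R * ?q * (1 + \<bar>\<kappa>\<bar> * jn R (\<lambda>z. z $ Tau) ?z)"
     by (intro sp.jn_mult_bound 1 order_refl smooth_on_add smooth_on_mult sp.S(1) smooth_on_coord smooth_on_const)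
    have 3: "0 <= (\<Sigma> A. jn R (\<lambda>z. z $ Ang A) ?z)" by (intro sum_nonneg jn_nonneg)
    have 4: "jn R (\<lambda>z. z $ Ang A) ?z <= (\<Sigma> A. jn R (\<lambda>z. z $ Ang A) ?z)" for A
     by (rule member_le_sum) (auto intro: jn_nonneg)
    have 5: "0 <= 4 ^ R * ?q * (1 + \<bar>\<kappa>\<bar> * jn R (\<lambda>z. z $ Tau) ?z)"
     by (intro mult_nonneg_nonneg add_nonneg_nonneg jn_nonneg) auto
    show ?thesis unfolding \<Psi>_nth m_def using 2 3 4 5 by (cases c) (auto intro: add_increasing)
   qed
   then have "jn R (\<lambda>z. (\<lambda>z. f (z $ Rho) (ang z)) (\<Psi> s z)) ?z \<le>
     compose_const (CARD('n gnc) * CARD('n gnc)) m R * jn R (\<lambda>z. f (z $ Rho) (ang z)) (\<Psi> s ?z)"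
    by (intro sp.jn_compose[OF oV sm sm\<Psi>[OF sp.S(1)]]) (auto simp: S_def)
   then show "jn R (\<lambda>z. f (?r s z) (ang z)) ?z \<le>
     compose_const (CARD('n gnc) * CARD('n gnc)) m R * jn R (\<lambda>z. f (z $ Rho) (ang z)) ?z"
    unfolding z0 by (simp add: \<Psi>_def)
  qed
  have rb: "\<exists>M. \<forall>s\<in>{0<..1}. jn R (\<lambda>z. z $ Rho * f s z) ?z <= M"
   if sm: "!!s. s > 0 ==> smooth_on (S s) (f s)" and ex: "\<exists>M. \<forall>s\<in>{0<..1}. jn R (f s) ?z <= M" for f :: "real => real^('n gnc) => real"
  proof -
   obtain M where M: "\<forall>s\<in>{0<..1}. jn R (f s) ?z <= M" using ex by blast
   show ?thesis
   proof (intro exI ballI)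
    fix s :: real assume s: "s \<in> {0<..1}"
    interpret sp: smooth_at_point "S s" ?z by unfold_locales (use s oS zS in auto)
    show "jn R (\<lambda>z. z $ Rho * f s z) ?z <= 4 ^ R * ?q * M"
     by (rule sp.jn_mult_bound) (use sm M s in "auto intro: smooth_on_coord")
   qed
  qed
  have mb: "jn R (\<lambda>z. - (z $ Rho * (z $ Rho * Y (?r s z) (ang z)))) ?z =
   jn R (\<lambda>z. z $ Rho * (z $ Rho * Y (?r s z) (ang z))) ?z" if "0 < s" for s
  proof -
   interpret sp: smooth_at_point "S s" ?z by unfold_locales (use that oS zS in auto)
   show ?thesis by (intro sp.jn_minus smooth_on_mult sp.S(1) smooth_on_coord smY' that)
  qed
  have "\<exists>M. \<forall>s\<in>{0<..1}. jn R (\<lambda>z. z $ Rho * (z $ Rho * Y (?r s z) (ang z))) ?z <= M"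
   by (intro rb cb smY) (intro smooth_on_mult smooth_on_coord oS smY', assumption+)+
  then have 1: "\<exists>M. \<forall>s\<in>{0<..1}. jn R (\<lambda>z. - (z $ Rho * (z $ Rho * Y (?r s z) (ang z)))) ?z <= M"
   using mb by auto
  have 2: "\<exists>M. \<forall>s\<in>{0<..1}. jn R (\<lambda>z. z $ Rho * \<omega> (?r s z) (ang z) $ A) ?z <= M" for A
   by (intro rb cb sm\<omega>_nth) (rule sm\<omega>')
  have 3: "\<exists>M. \<forall>s\<in>{0<..1}. jn R (\<lambda>z. h (?r s z) (ang z) $ A $ B) ?z <= M" for A B
   by (rule cb[OF smooth_on_entry[OF oV smh]])
  show ?thesis by (cases a; cases b) (auto simp: gs_def gnc_metric_nth 1 2 3)
 qed
 then obtain m where m: "!!a b s. s \<in> {0<..1} ==> jn R (\<lambda>z. gs s z $ a $ b) ?z <= m a b" by metis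
 define M where "M = (\<Sigma> a b. \<bar>m a b\<bar> + \<bar>matrix_inv (g ?z) $ a $ b\<bar>)"
 have M: "\<bar>m a b\<bar> + \<bar>matrix_inv (g ?z) $ a $ b\<bar> <= M" for a b
 proof -
  have "\<bar>m a b\<bar> + \<bar>matrix_inv (g ?z) $ a $ b\<bar> <= (\<Sigma> b. \<bar>m a b\<bar> + \<bar>matrix_inv (g ?z) $ a $ b\<bar>)"
   by (rule member_le_sum) auto
  also have "... <= M" unfolding M_def
   by (rule member_le_sum[of a UNIV "\<lambda>a. \<Sigma> b. \<bar>m a b\<bar> + \<bar>matrix_inv (g ?z) $ a $ b\<bar>"]) (auto intro: sum_nonneg)
  finally show ?thesis .
 qed
 obtain C where C: "jet_lipschitz 0 ?F R M C" using R by blast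
 have bound: "\<bar>?F g ?z\<bar> <= s * C" if s: "s \<in> {0<..1}" for s
 proof -
  have s0: "0 < s" using s by simp
  interpret sp: smooth_at_point "S s" ?z by unfold_locales (use s oS zS in auto)
  \<comment> \<open>At \<rho> = 0 the boosted metric does not depend on s; so its inverse there has
    a bound independent of s.\<close>
  have gz: "gs s ?z = g ?z"
   unfolding vec_eq_iff
  proof (intro allI)
   fix a b show "gs s ?z $ a $ b = g ?z $ a $ b" by (cases a; cases b) (simp_all add: gs_def gnc_metric_nth)
  qed
  \<comment> \<open>The metric is compared with itself because only the bound on the value of
    \<open>?F\<close> is wanted.\<close>
  have "sp.near_metrics R M 0 (gs s) (gs s)"
   unfolding sp.near_metrics_def gz
  proof (intro conjI allI gs_reg s0)
   fix a b
   show "jn R (\<lambda>x. gs s x $ a $ b) ?z <= M" "\<bar>matrix_inv (g ?z) $ a $ b\<bar> <= M"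
    using m[OF s, of a b] M[of a b] by linarith+
   then show "jn R (\<lambda>x. gs s x $ a $ b) ?z <= M" "\<bar>matrix_inv (g ?z) $ a $ b\<bar> <= M" by blast+
  qed simp
  then have b: "\<bar>?F (gs s) ?z\<bar> <= C" using jet_lipschitzD(1)[OF C sp.smooth_at_point_axioms] by simp
  have nz: "det (jac (boost \<kappa> s) ?z) ~= 0"
  proof -
   have "lorentzian (gs s ?z)" unfolding gz by (rule lorentzian_g[OF y])
   then have "det (transpose (jac (boost \<kappa> s) ?z) ** g (boost \<kappa> s ?z) ** jac (boost \<kappa> s) ?z) ~= 0"
    using pullback_eq[OF smooth_on_D[OF boost_smooth(1)[OF s0]], of ?z \<kappa> g] gs_pull[OF s0 zS[OF s0]] s0
    by (simp add: lorentzian_det)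
   then show ?thesis by (auto simp: det_mul)
  qed
  have sub: "S s \<subseteq> ?D s" by (auto simp: S_def)
  obtain V' where V': "open V'" "?z \<in> V'" "V' \<subseteq> S s" "diffeomorphic_map V' (boost \<kappa> s ` V') (boost \<kappa> s)"
   by (rule local_diffeomorphism[OF sp.S(1) smooth_on_subset[OF boost_smooth(1)[OF s0] sub] sp.S(2) nz]) (rule that)
  have im: "boost \<kappa> s ` V' \<subseteq> V" using V'(3) by (auto simp: S_def)
  have "?F (gs s) ?z = ?F (pullback (boost \<kappa> s) g) ?z" by (rule jet_poly_cong_open[OF F sp.S]) (simp add: gs_pull s0)
  also have "... = (\<Sigma> c d. jac (boost \<kappa> s) ?z $ c $ Tau * jac (boost \<kappa> s) ?z $ d $ Ang A * P c d g (boost \<kappa> s ?z))"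
   using P[unfolded covariant_2tensor_def, THEN conjunct2, rule_format, of V' "boost \<kappa> s ` V'" "boost \<kappa> s" g ?z Tau "Ang A"]
    V'(2,4) smooth_on_subset[OF smooth_g im] lorentzian_g im by blast
  \<comment> \<open>On \<rho> = 0 and \<tau> = 0 the column \<open>Tau\<close> of the Jacobian is 1
    / s times a unit vector, and angular columns are unit vectors.\<close>
  also have "... = ?F g ?z / s"
   by (simp add: sum_gnc boost_smooth(2)[OF s0] s0 z0 if_distrib[of "\<lambda>c. c * _"] if_distrib[of "\<lambda>c. _ * c"] divide_inverse cong: if_cong)
  finally have "?F g ?z = s * ?F (gs s) ?z" using s0 by simp
  then show ?thesis using mult_left_mono[OF b, of s] s0 by (simp add: abs_mult)
 qed
 have "\<bar>?F g ?z\<bar> <= 0 + e" if e: "0 < e" for e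
 proof -
  \<comment> \<open>The denominator \<open>C + 1\<close> keeps the choice valid for
    \<open>C = 0\<close>.\<close>
  define s where "s = min 1 (e / (C + 1))"
  have "s \<in> {0<..1}" "s * C <= e" using C e
   by (auto simp: jet_lipschitz_def s_def min_def field_simps intro: order_trans[OF mult_left_mono])
  then show ?thesis using bound[of s] by linarith
 qed
 then have "\<bar>?F g ?z\<bar> <= 0" by (rule field_le_epsilon)
 then show ?thesis by simp
qed

end

section \<open>Taylor expansion across the horizon and the Lipschitz comparison\<close>

lemma pd_Tau_indep: "pd Tau (\<lambda>z :: real^('n::finite gnc). F (z $ Rho) (ang z)) z = (0::real)"
proof -
 have "(z + t *\<^sub>R axis Tau 1) $ Rho = z $ Rho" "ang (z + t *\<^sub>R axis Tau 1) = ang z" for t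
  by (simp_all add: axis_def ang_def vec_eq_iff)
 then show ?thesis by (simp only: pd_def) simp
qed

lemma pd_Rho_ang: "pd Rho (\<lambda>z :: real^('n::finite gnc). c (ang z)) z = (0::real)"
proof -
 have "ang (z + t *\<^sub>R axis Rho 1) = ang z" for t by (simp add: axis_def ang_def vec_eq_iff)
 then show ?thesis by (simp add: pd_def)
qed

lemma smooth_on_iter_pd: "smooth_on V f ==> smooth_on V ((pd i ^^ j) f)" by (induction j) (auto intro: smooth_on_pd)

lemma pd_Rho_iter_linear:
 fixes f :: "'k => real^('n::finite gnc) => real"
 assumes V: "open V" and A: "finite A" "!!k. k \<in> A ==> smooth_on V (\<lambda>z. c k (ang z))" "!!k. k \<in> A ==> smooth_on V (f k)" and z: "z \<in> V"
 shows "(pd Rho ^^ i) (\<lambda>z. \<Sum>k\<in>A. c k (ang z) * f k z) z = (\<Sum>k\<in>A. c k (ang z) * (pd Rho ^^ i) (f k) z)"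
 using z
proof (induction i arbitrary: z)
 case (Suc i)
 have sm: "smooth_on V ((pd Rho ^^ i) (f k))" if "k \<in> A" for k by (rule smooth_on_iter_pd[OF A(3)[OF that]])
 note sd = smooth_on_D[OF _ Suc.prems]
 have "(pd Rho ^^ Suc i) (\<lambda>z. \<Sum>k\<in>A. c k (ang z) * f k z) z = pd Rho (\<lambda>z. \<Sum>k\<in>A. c k (ang z) * (pd Rho ^^ i) (f k) z) z"
  by (simp, rule pd_cong_open[OF V Suc.prems Suc.IH])
 also have "... = (\<Sum>k\<in>A. pd Rho (\<lambda>z. c k (ang z) * (pd Rho ^^ i) (f k) z) z)"
  by (rule pd_sum[OF A(1)]) (intro sd smooth_on_mult V A sm)
 also have "... = (\<Sum>k\<in>A. c k (ang z) * (pd Rho ^^ Suc i) (f k) z)"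
  by (intro sum.cong refl) (simp add: pd_mult[OF sd[OF A(2)] sd[OF sm]] pd_Rho_ang)
 finally show ?case .
qed simp

lemma pd_Rho_iter_power:
 "(pd Rho ^^ i) (\<lambda>z :: real^('n::finite gnc). z $ Rho ^ k / fact k) z = (if i <= k then z $ Rho ^ (k - i) / fact (k - i) else (0::real))"
proof (induction i arbitrary: k)
 case (Suc i)
 have "pd Rho (\<lambda>z :: real^('n gnc). z $ Rho ^ k / fact k) z = (if k = 0 then 0 else z $ Rho ^ (k - 1) / fact (k - 1))" for z
 proof (cases k)
  case (Suc m)
  have "((\<lambda>t. t ^ Suc m / fact (Suc m)) has_real_derivative (1 * of_nat (Suc m) * (z $ Rho) ^ m) / fact (Suc m)) (at (z $ Rho))"
   by (auto intro!: derivative_eq_intros simp del: fact_Suc power_Suc)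
  from pd_compose_real(1)[OF smooth_on_D[OF smooth_on_coord UNIV_I] this, of Rho] show ?thesis
   by (simp add: Suc field_simps del: of_nat_Suc)
 qed simp
 then have "pd Rho (\<lambda>z :: real^('n gnc). z $ Rho ^ k / fact k) = (\<lambda>z. if k = 0 then 0 else z $ Rho ^ (k - 1) / fact (k - 1))" by blast
 then have "(pd Rho ^^ Suc i) (\<lambda>z :: real^('n gnc). z $ Rho ^ k / fact k) z = (pd Rho ^^ i) (\<lambda>z. if k = 0 then 0 else z $ Rho ^ (k - 1) / fact (k - 1)) z"
  by (simp only: funpow_Suc_right o_apply)
 also have "... = (if Suc i <= k then z $ Rho ^ (k - Suc i) / fact (k - Suc i) else 0)"
 proof (cases k)
  case 0
  have "(pd Rho ^^ i) (\<lambda>z :: real^('n gnc). 0 :: real) = (\<lambda>z. 0)" by (induction i) auto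
  then show ?thesis by (simp add: 0)
 qed (use Suc in simp)
 finally show ?case .
qed simp

lemma smooth_on_ang: "open V ==> smooth_on V (ang :: real^('n::finite gnc) => _)"
 by (simp add: smooth_on_vec ang_def smooth_on_coord)

definition slices_bounded ::
 "nat => real => (real => real^'n::finite => real) => (real => real^'n => real^'n) => (real => real^'n => real^'n^'n) => bool" where
 "slices_bounded R M X \<omega> h \<longleftrightarrow> (\<forall>j\<le>R. jn R (\<lambda>x. (deriv ^^ j) (\<lambda>\<rho>. X \<rho> x) 0) 0 <= M \<and>
   (\<forall>A. jn R (\<lambda>x. (deriv ^^ j) (\<lambda>\<rho>. \<omega> \<rho> x $ A) 0) 0 <= M) \<and> (\<forall>A B. jn R (\<lambda>x. (deriv ^^ j) (\<lambda>\<rho>. h \<rho> x $ A $ B) 0) 0 <= M))"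

text \<open>With h = 1 at the origin the inverse of the spacetime metric there has entries 0 and 1,
  whatever X and \<omega> are.\<close>

locale gnc_coords_at_0 = gnc_coords +
 assumes V0: "0 \<in> V" and h0: "h 0 0 = mat 1"
begin

sublocale smooth_at_point V 0 by unfold_locales (rule oV, rule V0)

lemma slice_0: "gnc_point 0 0 0 \<in> V" using V0 by (simp add: gnc_point_0)

lemma jn_field:
 assumes F: "smooth_on V (\<lambda>z. F (z $ Rho) (ang z) :: real)" and M: "!!j. j <= R ==> jn R (\<lambda>x. (deriv ^^ j) (\<lambda>\<rho>. F \<rho> x) 0) 0 <= M"
 shows "jn R (\<lambda>z. F (z $ Rho) (ang z)) 0 <= (2 + real CARD('a)) ^ R * M"
proof -
 have "jn R (\<lambda>z. F (z $ Rho) (ang z)) (gnc_point 0 0 0) <= (2 + real CARD('a)) ^ R * M"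
 proof (rule jn_le_slices[OF oV slice_0 F pd_Tau_indep])
  fix j assume "j <= R"
  have "jn R (\<lambda>y. (pd Rho ^^ j) (\<lambda>z. F (z $ Rho) (ang z)) (gnc_point 0 0 y)) 0 = jn R (\<lambda>x. (deriv ^^ j) (\<lambda>\<rho>. F \<rho> x) 0) 0"
   by (rule jn_cong[OF open_slice[OF oV, of 0 0]]) (use slice_0 in "simp_all add: pd_Rho_iter[OF oV F]")
  then show "jn R (\<lambda>y. (pd Rho ^^ j) (\<lambda>z. F (z $ Rho) (ang z)) (gnc_point 0 0 y)) 0 <= M" using M[OF \<open>j <= R\<close>] by simp
 qed
 then show ?thesis by (simp add: gnc_point_0)
qed

end

text \<open>Compare the metric with one of constant surface gravity, for which the component
  vanishes on the horizon. The constant precedes all fields, so it is uniform; every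
  \<open>R\<close> from \<open>R0\<close> on is allowed because several tensors will have to share
  one order.\<close>

theorem boost_estimate:
 fixes P :: "'n::finite gnc => 'n gnc => 'n gnc lagrangian"
 assumes P: "covariant_2tensor P"
 shows "\<exists>R0. \<forall>R\<ge>R0. \<forall>M. \<exists>C\<ge>0. \<forall>X \<omega> h V. gnc_coords_at_0 X \<omega> h V \<and> slices_bounded R M X \<omega> h -->
  jn r (\<lambda>x. P Tau (Ang A) (gnc_metric X \<omega> h) (gnc_point 0 0 x)) 0 <= C * jn R (\<lambda>x. X 0 x - X 0 0) 0"
proof -
 let ?F = "P Tau (Ang A)" and ?n = "2 + real CARD('n)"
 have F: "jet_poly ?F" using P by (simp add: covariant_2tensor_def)
 obtain R0 where R0: "\<forall>M. \<exists>C. jet_lipschitz r ?F R0 M C" using jet_poly_lipschitz[OF F] ..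
 show ?thesis
 proof (intro exI[of _ R0] allI impI)
  fix R M assume R: "R0 <= R"
  define q where "q = jn R (\<lambda>z :: real^('n gnc). z $ Rho) 0"
  \<comment> \<open>The price of turning slice bounds on a field into a bound on \<rho> times that
    field: \<open>?n ^ R\<close> from \<open>jn_field\<close>, the rest from the product
    rule.\<close>
  define B where "B = 4 ^ R * q * ?n ^ R"
  \<comment> \<open>The jet of the given metric is at most 1 + \<open>?n ^ R * M\<close> +
    \<open>B * M\<close>; the comparison metric differs from it by at most \<open>B * \<mu>\<close>,
    and \<mu> is at most 2 M.\<close>
  define M' where "M' = 1 + ?n ^ R * \<bar>M\<bar> + 3 * (B * \<bar>M\<bar>)"
  have q0: "0 <= q" "0 <= B" unfolding q_def B_def by (auto intro!: mult_nonneg_nonneg jn_nonneg)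
  obtain C where C: "jet_lipschitz r ?F R0 M' C" using R0 by blast
  then have C0: "0 <= C" by (simp add: jet_lipschitz_def)
  show "\<exists>C\<ge>0. \<forall>X \<omega> h V. gnc_coords_at_0 X \<omega> h V \<and> slices_bounded R M X \<omega> h -->
   jn r (\<lambda>x. P Tau (Ang A) (gnc_metric X \<omega> h) (gnc_point 0 0 x)) 0 <= C * jn R (\<lambda>x. X 0 x - X 0 0) 0"
  proof (intro exI[of _ "C * B"] conjI allI impI mult_nonneg_nonneg C0 q0(2); elim conjE)
   fix X \<omega> h and V :: "(real^('n gnc)) set"
   assume gc: "gnc_coords_at_0 X \<omega> h V" and sl: "slices_bounded R M X \<omega> h"
   interpret gnc_coords_at_0 X \<omega> h V by fact
   note sl = sl[unfolded slices_bounded_def, rule_format]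
   \<comment> \<open>The Taylor coefficients of X live on the horizon, so points must project into
     \<open>V\<close> along \<rho>.\<close>
   define V1 where "V1 = V \<inter> {z. gnc_point 0 0 (ang z) \<in> V}"
   have "open (UNIV \<inter> ang -` {y. gnc_point 0 0 y \<in> V})"
    by (rule continuous_open_preimage[OF smooth_on_cont[OF smooth_on_ang[OF open_UNIV]] open_UNIV open_slice[OF oV]])
   then have oV1: "open V1" unfolding V1_def using oV by (auto simp: vimage_def)
   have V1: "V1 \<subseteq> V" "gnc_point 0 0 x \<in> V1 \<longleftrightarrow> gnc_point 0 0 x \<in> V" for x by (auto simp: V1_def)
   let ?Sl = "{x. gnc_point 0 0 x \<in> V}"
   let ?Xj = "\<lambda>j x. (deriv ^^ j) (\<lambda>\<rho>. X \<rho> x) 0" and ?fX = "\<lambda>z. X (z $ Rho) (ang z)"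
   \<comment> \<open>Taylor coefficients of X in \<rho> on the horizon, except that the zeroth is
     frozen at the origin. \<open>Xt\<close> is then 2 \<kappa> + \<rho> \<open>Y\<close> with
     constant \<kappa>.\<close>
   define X' where "X' j x = (if j = 0 then X 0 0 else ?Xj j x)" for j :: nat and x
   define Xt where "Xt \<rho> x = (\<Sum>j\<le>R. X' j x * (\<rho> ^ j / fact j))" for \<rho> x
   define Y where "Y \<rho> x = (\<Sum>j<R. ?Xj (Suc j) x * (\<rho> ^ j / fact (Suc j)))" for \<rho> x
   define D where "D \<rho> x = X \<rho> x - Xt \<rho> x" for \<rho> x
   define \<mu> where "\<mu> = jn R (\<lambda>x. X 0 x - X 0 0) 0"
   have smXj: "smooth_on V1 (\<lambda>z. ?Xj j (ang z))" for j
   proof -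
    have "smooth_on V1 (\<lambda>z. (pd Rho ^^ j) ?fX (gnc_point 0 0 (ang z)))"
     by (rule smooth_on_compose[OF oV1 _ _ smooth_on_iter_pd[OF smX]],
       rule smooth_on_compose_vec[OF oV1 open_UNIV smooth_on_ang[OF oV1] _ smooth_on_gnc_point[OF open_UNIV]]) (auto simp: V1_def)
    then show ?thesis by (rule smooth_on_cong[THEN iffD1, rotated 2, OF _ oV1]) (auto simp: V1_def pd_Rho_iter[OF oV smX])
   qed
   then have smX': "smooth_on V1 (\<lambda>z. X' j (ang z))" for j by (cases "j = 0") (auto simp: X'_def)
   have smp: "smooth_on V1 (\<lambda>z. z $ Rho ^ k / fact j)" for j k
    using smooth_on_mult[OF oV1 smooth_on_const smooth_on_power[OF oV1 smooth_on_coord], of "1 / fact j" Rho k] by simp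
   have smXt: "smooth_on V1 (\<lambda>z. Xt (z $ Rho) (ang z))"
    unfolding Xt_def by (intro smooth_on_sum smooth_on_mult oV1 smX' smp)
   have smD: "smooth_on V1 (\<lambda>z. D (z $ Rho) (ang z))"
    unfolding D_def by (intro smooth_on_diff oV1 smooth_on_subset[OF smX V1(1)] smXt)
   interpret t: gnc_coords_at_0 Xt \<omega> h V1 by unfold_locales
     (use V1(1) slice_0 V0 h0 hr smooth_on_subset[OF sm\<omega> V1(1)] smooth_on_subset[OF smh V1(1)]
      in \<open>auto intro: oV1 smXt simp: V1(2)[of 0, unfolded gnc_point_0]\<close>)
   \<comment> \<open>Up to order \<open>R\<close> only the undifferentiated difference survives on
     the horizon, and it is X(0, x) - X(0, 0).\<close>
   have Dsl: "(deriv ^^ i) (\<lambda>\<rho>. D \<rho> x) 0 = ?Xj i x - X' i x" if i: "i <= R" and x: "x \<in> ?Sl" for i x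
   proof -
    have xV: "gnc_point 0 0 x \<in> V1" using x V1 by simp
    \<comment> \<open>\<open>None\<close> stands for X and \<open>Some j\<close> for a Taylor
      monomial, so that one linear combination covers the whole difference.\<close>
    define f where "f k = (case k of None => ?fX | Some j => \<lambda>z. z $ Rho ^ j / fact j)" for k :: "nat option"
    define c where "c k x = (case k of None => 1 | Some j => - X' j x)" for k and x :: "real^'n"
    let ?A = "insert None (Some ` {..R})"
    have fj: "(pd Rho ^^ i) (f (Some j)) (gnc_point 0 0 x) = (if i = j then 1 else 0)" for j
     by (simp add: f_def pd_Rho_iter_power power_0_left)
    have D: "D (z $ Rho) (ang z) = (\<Sum>k\<in>?A. c k (ang z) * f k z)" for z
     by (simp add: sum.reindex D_def Xt_def f_def c_def sum_negf)
    have "(deriv ^^ i) (\<lambda>\<rho>. D \<rho> x) 0 = (pd Rho ^^ i) (\<lambda>z. D (z $ Rho) (ang z)) (gnc_point 0 0 x)"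
     using pd_Rho_iter(2)[OF oV1 smD xV, of i] by simp
    also have "... = (\<Sum>k\<in>?A. c k (ang (gnc_point 0 0 x)) * (pd Rho ^^ i) (f k) (gnc_point 0 0 x))"
     unfolding D
    proof (rule pd_Rho_iter_linear[OF oV1 _ _ _ xV])
     show "smooth_on V1 (\<lambda>z. c k (ang z))" "smooth_on V1 (f k)" for k
      by (cases k; simp add: c_def f_def smooth_on_minus[OF oV1 smX'] smp smooth_on_subset[OF smX V1(1)])+
    qed simp
    also have "... = ?Xj i x - X' i x"
     using i pd_Rho_iter(2)[OF oV smX, of "gnc_point 0 0 x" i] x
     by (simp add: sum.reindex fj c_def) (simp add: f_def if_distrib[of "\<lambda>c. _ * c"] sum_negf cong: if_cong)
    finally show ?thesis .
   qed
   have \<mu>0: "0 <= \<mu>" unfolding \<mu>_def by (rule jn_nonneg)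
   have jD: "jn R (\<lambda>z. D (z $ Rho) (ang z)) 0 <= ?n ^ R * \<mu>"
   proof (rule t.jn_field[OF smD])
    fix j assume j: "j <= R"
    have "jn R (\<lambda>x. (deriv ^^ j) (\<lambda>\<rho>. D \<rho> x) 0) 0 = jn R (\<lambda>x. ?Xj j x - X' j x) 0"
     by (rule jn_cong[OF open_slice[OF oV, of 0 0]]) (use slice_0 Dsl[OF j] in auto)
    then show "jn R (\<lambda>x. (deriv ^^ j) (\<lambda>\<rho>. D \<rho> x) 0) 0 <= \<mu>"
     using \<mu>0 by (cases "j = 0") (auto simp: X'_def \<mu>_def)
   qed
   have Mx: "0 <= M" using sl[of 0] jn_nonneg order_trans by blast
   have \<mu>M: "\<mu> <= 2 * M"
   proof -
    interpret s: smooth_at_point ?Sl 0 by unfold_locales (use open_slice[OF oV] slice_0 in auto)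
    have "smooth_on ?Sl (X 0)" using smooth_on_slice[OF oV smX, of 0 0] by simp
    then have "\<mu> <= jn R (X 0) 0 + \<bar>X 0 0\<bar>" unfolding \<mu>_def using s.jn_diff[of "X 0" "\<lambda>_. X 0 0" R] by simp
    moreover have "jn R (X 0) 0 <= M" using sl[of 0] by simp
    ultimately show ?thesis using abs_le_jn[of "X 0" 0 R] by simp
   qed
   have jR: "jn R (\<lambda>z. z $ Rho * f z) 0 <= 4 ^ R * q * b" if "smooth_on V1 f" "jn R f 0 <= b" for f b
    using t.jn_mult_bound[OF smooth_on_coord that(1) _ that(2), of Rho q] by (simp add: q_def)
   note sub = smooth_on_subset[OF _ V1(1)]
   have jg: "jn R (\<lambda>z. g z $ a $ b) 0 <= 1 + ?n ^ R * M + B * M" for a b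
   proof -
    have f: "jn R (\<lambda>z. z $ Rho * F (z $ Rho) (ang z)) 0 <= B * M" if "smooth_on V (\<lambda>z. F (z $ Rho) (ang z))"
     "!!j. j <= R ==> jn R (\<lambda>x. (deriv ^^ j) (\<lambda>\<rho>. F \<rho> x) 0) 0 <= M" for F :: "real => real^'n => real"
     using jR[OF sub[OF that(1)] jn_field[OF that]] by (simp add: B_def mult.assoc)
    have 1: "jn R (\<lambda>z. - (z $ Rho * X (z $ Rho) (ang z))) 0 <= B * M"
     using f[OF smX] sl jn_minus[OF smooth_on_mult[OF oV smooth_on_coord smX]] by simp
    have 2: "jn R (\<lambda>z. z $ Rho * \<omega> (z $ Rho) (ang z) $ A) 0 <= B * M" for A
     by (rule f[OF sm\<omega>_nth]) (use sl in blast)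
    have 3: "jn R (\<lambda>z. h (z $ Rho) (ang z) $ A $ A') 0 <= ?n ^ R * M" for A A'
     by (rule jn_field[OF smooth_on_entry[OF oV smh]]) (use sl in blast)
    have "0 <= B * M" "0 <= ?n ^ R * M" using q0 Mx by auto
    then show ?thesis
     by (cases a; cases b) (auto simp: gnc_metric_nth intro: order_trans[OF 1] order_trans[OF 2] order_trans[OF 3])
   qed
   have jd: "jn R (\<lambda>z. g z $ a $ b - t.g z $ a $ b) 0 <= B * \<mu>" for a b
   proof -
    have "jn R (\<lambda>z. - (z $ Rho * D (z $ Rho) (ang z))) 0 <= B * \<mu>"
     using jR[OF smD jD] t.jn_minus[OF smooth_on_mult[OF oV1 smooth_on_coord smD]] by (simp add: B_def mult.assoc)
    moreover have "0 <= B * \<mu>" using q0 \<mu>0 by simp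
    ultimately show ?thesis by (cases a; cases b) (auto simp: gnc_metric_nth D_def right_diff_distrib)
   qed
   have jt: "jn R (\<lambda>z. t.g z $ a $ b) 0 <= M'" for a b
   proof -
    have "jn R (\<lambda>z. t.g z $ a $ b) 0 = jn R (\<lambda>z. g z $ a $ b - (g z $ a $ b - t.g z $ a $ b)) 0" by simp
    also have "... <= jn R (\<lambda>z. g z $ a $ b) 0 + jn R (\<lambda>z. g z $ a $ b - t.g z $ a $ b) 0"
     by (intro t.jn_diff smooth_on_diff oV1 sub[OF smooth_g_nth] t.smooth_g_nth)
    also have "B * \<mu> <= B * (2 * M)" by (rule mult_left_mono[OF \<mu>M q0(2)])
    then have "jn R (\<lambda>z. g z $ a $ b) 0 + jn R (\<lambda>z. g z $ a $ b - t.g z $ a $ b) 0 <= M'"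
     using jg[of a b] jd[of a b] Mx by (simp add: M'_def)
    finally show ?thesis .
   qed
   have inv: "\<bar>matrix_inv (gnc_metric X \<omega> h 0) $ a $ b\<bar> <= M'" if r: "riemannian (h ((0 :: real^('n gnc)) $ Rho) (ang (0 :: real^('n gnc))))"
    for X \<omega> a b
   proof -
    have a0: "ang (0 :: real^('n gnc)) = 0" by (simp add: ang_def vec_eq_iff)
    have "\<bar>matrix_inv (gnc_metric X \<omega> h 0) $ a $ b\<bar> <= 1"
     using gnc_metric_inv[of h 0 X \<omega>, OF r] h0 by (cases a; cases b) (auto simp: a0)
    moreover have "1 <= M'" using q0 by (simp add: M'_def)
    ultimately show ?thesis by linarith
   qed
   have "t.near_metrics R M' (B * \<mu>) g t.g"
    unfolding t.near_metrics_def
   proof (intro conjI allI jd jt inv hr V0 t.regular_g)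
    show "regular_on V1 g"
     using regular_g oV1 V1(1) smooth_on_subset by (auto simp: regular_on_def)
    show "jn R (\<lambda>x. g x $ a $ b) 0 <= M'" for a b
     using jg[of a b] Mx mult_nonneg_nonneg[OF q0(2) Mx] by (simp add: M'_def)
   qed
   then have est: "jn r (\<lambda>z. ?F g z - ?F t.g z) 0 <= C * (B * \<mu>)"
    using jet_lipschitzD(2)[OF C t.smooth_at_point_axioms t.near_metrics_mono[OF _ R]] by blast
   have XY: "Xt \<rho> x = 2 * (X 0 0 / 2) + \<rho> * Y \<rho> x" for \<rho> x
   proof -
    have "Xt \<rho> x = X' 0 x + (\<Sum>j<R. X' (Suc j) x * (\<rho> ^ Suc j / fact (Suc j)))"
     unfolding Xt_def lessThan_Suc_atMost[symmetric] by (subst sum.lessThan_Suc_shift) simp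
    then show ?thesis by (simp add: Y_def X'_def sum_distrib_left mult_ac del: fact_Suc)
   qed
   have smY: "smooth_on V1 (\<lambda>z. Y (z $ Rho) (ang z))"
    unfolding Y_def by (intro smooth_on_sum smooth_on_mult oV1 smXj smp)
   \<comment> \<open>The comparison metric may be subtracted since its component vanishes at every
     horizon point near the origin.\<close>
   have "jn r (\<lambda>x. ?F g (gnc_point 0 0 x)) 0 = jn r (\<lambda>x. (\<lambda>z. ?F g z - ?F t.g z) (gnc_point 0 0 x)) 0"
    by (rule jn_cong[OF open_slice[OF oV, of 0 0]])
     (use slice_0 t.boost_weight_zero[OF P _ XY smY] V1(2) in auto)
   also have "... <= jn r (\<lambda>z. ?F g z - ?F t.g z) (gnc_point 0 0 0)" by (rule jn_slice_le)
   finally show "jn r (\<lambda>x. P Tau (Ang A) g (gnc_point 0 0 x)) 0 <= C * B * jn R (\<lambda>x. X 0 x - X 0 0) 0"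
    using est by (simp add: gnc_point_0 \<mu>_def mult.assoc)
  qed
 qed
qed

section \<open>Order estimates in normal coordinates\<close>

lemma covd_iter_cong:
 assumes "open S" "!!y. y \<in> S ==> T y = T' y" "x \<in> S"
 shows "(covd h ^^ m) T x = (covd h ^^ m) T' x"
 using assms(3)
proof (induction m arbitrary: x)
 case (Suc m)
 have st: "pd c (\<lambda>y. (covd h ^^ m) T y us ls) x = pd c (\<lambda>y. (covd h ^^ m) T' y us ls) x" for c us ls
  by (rule pd_cong_open[OF assms(1) Suc.prems]) (simp only: Suc.IH)
 have "covd h ((covd h ^^ m) T) x us ls = covd h ((covd h ^^ m) T') x us ls" for us ls
  unfolding covd_def[of h "(covd h ^^ m) T"] covd_def[of h "(covd h ^^ m) T'"] Suc.IH[OF Suc.prems] st ..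
 then show ?case by (simp add: fun_eq_iff)
qed (simp add: assms(2))

text \<open>Order \<open>R + 2\<close> of \<open>radial_conn\<close> is what
  \<open>connection_bound\<close> asks for in order to control \<open>R\<close> derivatives of the
  connection.\<close>

definition normal_frame ::
 "nat => 'n::finite metric => (real^'n) set => real^'n => real^'n^'n => (real^'n) set => (real^'n => real^'n) => bool" where
 "normal_frame R h S p E0 U \<phi> \<longleftrightarrow> frame_coords h S p E0 U \<phi> \<and> transpose E0 ** h p ** E0 = mat 1 \<and>
   (\<forall>a. smooth_at_point.flat 0 (R + 2) (radial_conn (christoffel h) \<phi> a))"

lemma normal_frame_exists:
 fixes h :: "'n::finite metric"
 assumes S: "open S" "p \<in> S" and h: "smooth_on S h" "!!x. x \<in> S ==> riemannian (h x)"
 shows "\<exists>E0 U \<phi>. normal_frame R h S p E0 U \<phi>"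
proof -
 obtain E0 :: "real^'n^'n" where E0: "invertible E0" "transpose E0 ** h p ** E0 = mat 1"
  using riemannian_normal_form[OF h(2)[OF S(2)]] by blast
 obtain U \<phi> where "coords_at S p E0 U \<phi>" "\<forall>a. smooth_at_point.flat 0 (Suc (Suc R)) (radial_conn (christoffel h) \<phi> a)"
  using normal_coordinates[OF S, of "christoffel h" E0 "Suc R"] christoffel_smooth_on[OF S(1) h] E0(1) invertible_det_nz by blast
 then show ?thesis
  using S h E0(2) by (auto simp: normal_frame_def frame_coords_def)
qed

lemma killing_gnc_coords:
 assumes "stationary_black_hole B" "K \<in> gncs B"
 shows "gnc_coords (X_of K) (\<omega>_of K) (h_of K) (img (chart_of K))"
proof -
 have "killing_gnc B K" "smooth_atlas (spacetime B) (atlas B)"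
  using assms by (auto simp: stationary_black_hole_def lorentzian_spacetime_def)
 then show ?thesis by unfold_locales (auto simp: killing_gnc_def Let_def smooth_atlas_def)
qed

lemma section_geometry:
 assumes "stationary_black_hole B" "K \<in> gncs B"
 shows "open (section_img K)" "smooth_on (section_img K) (h_of K 0)" "y \<in> section_img K ==> riemannian (h_of K 0 y)"
proof -
 interpret gnc_coords "X_of K" "\<omega>_of K" "h_of K" "img (chart_of K)" by (rule killing_gnc_coords[OF assms])
 show o: "open (section_img K)" unfolding section_img_def by (rule open_slice[OF oV])
 show "smooth_on (section_img K) (h_of K 0)"
  unfolding smooth_on_mat[OF o]
 proof (intro allI)
  fix a b show "smooth_on (section_img K) (\<lambda>x. h_of K 0 x $ a $ b)"
   unfolding section_img_def using smooth_on_slice[OF oV smooth_on_entry[OF oV smh, of a b], of 0 0] by simp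
 qed
 show "y \<in> section_img K ==> riemannian (h_of K 0 y)" using hr[of "gnc_point 0 0 y"] by (simp add: section_img_def)
qed

lemma smooth_section_X:
 assumes "stationary_black_hole B" "K \<in> gncs B"
 shows "smooth_on (section_img K) (X_of K 0)"
proof -
 interpret gnc_coords "X_of K" "\<omega>_of K" "h_of K" "img (chart_of K)" by (rule killing_gnc_coords[OF assms])
 show ?thesis using smooth_on_slice[OF oV smX, of 0 0] by (simp add: section_img_def)
qed

locale horizon_family =
 fixes S :: "real set" and B :: "real => ('p::{t2_space,second_countable_topology}, 'n::finite) black_hole"
 assumes pos: "!!l. l \<in> S ==> 0 < l" and bh: "!!l. l \<in> S ==> stationary_black_hole (B l)"
  and riem: "O_inf S B 1 3 (\<lambda>l K y us ls. riemann (h_of K 0) y (us ! 0) (ls ! 0) (ls ! 1) (ls ! 2)) 0"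
begin

definition frame_at :: "nat => real => ('p, 'n) gnc_chart => real^'n => real^'n^'n => (real^'n) set => (real^'n => real^'n) => bool" where
 "frame_at R l K y E0 U \<phi> \<longleftrightarrow> l \<in> S \<and> K \<in> gncs (B l) \<and> y \<in> section_img K \<and> normal_frame R (h_of K 0) (section_img K) y E0 U \<phi>"

lemma frame_atD:
 assumes "frame_at R l K y E0 U \<phi>"
 shows "l \<in> S" "K \<in> gncs (B l)" "y \<in> section_img K" "frame_coords (h_of K 0) (section_img K) y E0 U \<phi>"
  "transpose E0 ** h_of K 0 y ** E0 = mat 1" "smooth_at_point.flat 0 (R + 2) (radial_conn (christoffel (h_of K 0)) \<phi> a)"
 using assms by (simp_all add: frame_at_def normal_frame_def)

lemma O_inf_frame_bound:
 assumes "O_inf S B p q \<psi> k"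
 shows "\<exists>M. \<forall>l K y E0 U \<phi> j us ls. frame_at R l K y E0 U \<phi> --> j <= R --> length us = p --> length ls = q + j -->
  \<bar>frame_coords.fr \<phi> ((covd (h_of K 0) ^^ j) (\<psi> l K)) 0 us ls\<bar> <= M * l ^ k"
proof -
 obtain C where C: "!!m l K y. l \<in> S ==> K \<in> gncs (B l) ==> y \<in> section_img K ==>
   tensor_norm (h_of K 0 y) p (q + m) ((covd (h_of K 0) ^^ m) (\<psi> l K) y) <= C m * l ^ k"
  using assms unfolding O_inf_def by metis
 show ?thesis
 \<comment> \<open>\<open>O_inf\<close> gives one constant per order; finitely many orders occur, so
   their absolute values are summed.\<close>
 proof (intro exI[of _ "\<Sum>j\<le>R. \<bar>C j\<bar>"] allI impI)
  fix l K y E0 U \<phi> j and us ls :: "'n list"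
  assume F: "frame_at R l K y E0 U \<phi>" and A: "j <= R" "length us = p" "length ls = q + j"
  interpret frame_coords "h_of K 0" "section_img K" y E0 U \<phi> by (rule frame_atD[OF F])
  have "\<bar>fr ((covd (h_of K 0) ^^ j) (\<psi> l K)) 0 us ls\<bar> <= tensor_norm (h_of K 0 y) p (q + j) ((covd (h_of K 0) ^^ j) (\<psi> l K) y)"
   by (rule fr_le_tensor_norm[OF frame_atD(5)[OF F] A(2,3)])
  also have "... <= C j * l ^ k" by (rule C[OF frame_atD(1-3)[OF F]])
  also have "... <= (\<Sum>j\<le>R. \<bar>C j\<bar>) * l ^ k"
  proof (rule mult_right_mono)
   have "\<bar>C j\<bar> <= (\<Sum>j\<le>R. \<bar>C j\<bar>)" by (rule member_le_sum) (use A in auto)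
   then show "C j <= (\<Sum>j\<le>R. \<bar>C j\<bar>)" by simp
  qed (use pos[OF frame_atD(1)[OF F]] in simp)
  finally show "\<bar>fr ((covd (h_of K 0) ^^ j) (\<psi> l K)) 0 us ls\<bar> <= (\<Sum>j\<le>R. \<bar>C j\<bar>) * l ^ k" .
 qed
qed

text \<open>Here the assumed bound on the curvature of the cross-section becomes a bound on the
  connection, uniform over solutions, charts, points and frames.\<close>

lemma frame_connection_bound:
 "\<exists>G\<ge>0. \<forall>l K y E0 U \<phi>. frame_at R l K y E0 U \<phi> --> (\<forall>a b c. jn R (fconn (christoffel (h_of K 0)) \<phi> a b c) 0 <= G)"
proof -
 obtain M where M: "!!l K y E0 U \<phi> j us ls. frame_at R l K y E0 U \<phi> ==> j <= R ==> length us = 1 ==> length ls = 3 + j ==>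
  \<bar>frame_coords.fr \<phi> ((covd (h_of K 0) ^^ j) (\<lambda>y us ls. riemann (h_of K 0) y (us ! 0) (ls ! 0) (ls ! 1) (ls ! 2))) 0 us ls\<bar> <= M"
  using O_inf_frame_bound[OF riem, of R] by (simp only: power_0 mult_1_right) blast
 show ?thesis
 proof (intro exI[of _ "\<bar>conn_const CARD('n) M R\<bar>"] conjI allI impI)
  fix l K y E0 U \<phi> a b c
  assume F: "frame_at R l K y E0 U \<phi>"
  interpret frame_coords "h_of K 0" "section_img K" y E0 U \<phi> by (rule frame_atD[OF F])
  have "jn R (\<gamma> a b c) 0 <= conn_const CARD('n) M R"
   by (rule connection_bound[where R=R], rule frame_atD(6)[OF F], rule M[OF F]) auto
  then show "jn R (\<gamma> a b c) 0 <= \<bar>conn_const CARD('n) M R\<bar>" by simp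
 qed simp
qed

text \<open>The counterpart of \<open>O_inf\<close> with partial derivatives: jets to order
  \<open>m\<close> in coordinates that are normal to order \<open>R\<close>, with one constant for
  the whole family.\<close>

definition jets_bounded :: "nat => nat => (real => ('p, 'n) gnc_chart => 'n tensor_field) => nat => nat => nat => real => bool" where
 "jets_bounded p q \<psi> k R m C \<longleftrightarrow> (\<forall>l K y E0 U \<phi> us ls. frame_at R l K y E0 U \<phi> -->
  length us = p --> length ls = q --> jn m (\<lambda>x. frame_coords.fr \<phi> (\<psi> l K) x us ls) 0 <= C * l ^ k)"

lemma jets_boundedD:
 assumes "jets_bounded p q \<psi> k R m C" "frame_at R l K y E0 U \<phi>" "length us = p" "length ls = q"
 shows "jn m (\<lambda>x. frame_coords.fr \<phi> (\<psi> l K) x us ls) 0 <= C * l ^ k"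
 using assms unfolding jets_bounded_def by blast

lemma O_inf_jets:
 assumes O: "O_inf S B p q \<psi> k" and sm: "!!l K. l \<in> S ==> K \<in> gncs (B l) ==> tensor_smooth_on (section_img K) (\<psi> l K)"
 shows "\<exists>C. jets_bounded p q \<psi> k R R C"
proof -
 obtain M where M: "!!l K y E0 U \<phi> j us ls. frame_at R l K y E0 U \<phi> ==> j <= R ==> length us = p ==> length ls = q + j ==>
  \<bar>frame_coords.fr \<phi> ((covd (h_of K 0) ^^ j) (\<psi> l K)) 0 us ls\<bar> <= M * l ^ k"
  using O_inf_frame_bound[OF O, of R] by blast
 obtain G where G: "!!l K y E0 U \<phi> a b c. frame_at R l K y E0 U \<phi> ==> jn R (fconn (christoffel (h_of K 0)) \<phi> a b c) 0 <= G"
  using frame_connection_bound[of R] by blast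
 show ?thesis
  unfolding jets_bounded_def
 proof (intro exI[of _ "jet_const CARD('n) G R (p + q) * M"] allI impI)
  fix l K y E0 U \<phi> and us ls :: "'n list"
  assume F: "frame_at R l K y E0 U \<phi>" and len: "length us = p" "length ls = q"
  interpret frame_coords "h_of K 0" "section_img K" y E0 U \<phi> by (rule frame_atD[OF F])
  show "jn R (\<lambda>x. fr (\<psi> l K) x us ls) 0 <= jet_const CARD('n) G R (p + q) * M * l ^ k"
   unfolding mult.assoc by (rule jn_fr[OF sm[OF frame_atD(1,2)[OF F]] _ _ len]) (rule G[OF F], rule M[OF F])
 qed
qed

text \<open>The order \<open>R\<close> of the coordinates may exceed \<open>m\<close> freely, so
  estimates that lose derivatives can still be fed in.\<close>

lemma O_inf_jetsI:
 assumes sm: "!!l K. l \<in> S ==> K \<in> gncs (B l) ==> tensor_smooth_on (section_img K) (\<psi> l K)"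
  and jets: "!!m. \<exists>R\<ge>m. \<exists>C. jets_bounded p q \<psi> k R m C"
 shows "O_inf S B p q \<psi> k"
 unfolding O_inf_def
proof
 fix m
 obtain R C where R: "m <= R" and jb: "jets_bounded p q \<psi> k R m C" using jets[of m] by blast
 note C = jets_boundedD[OF jb]
 obtain G where G: "!!l K y E0 U \<phi> a b c. frame_at R l K y E0 U \<phi> ==> jn R (fconn (christoffel (h_of K 0)) \<phi> a b c) 0 <= G"
  using frame_connection_bound[of R] by blast
 define D where "D = (1 + real (p + q + R) * real CARD('n) * (4 ^ R * G)) ^ m"
 show "\<exists>C. \<forall>l\<in>S. \<forall>K\<in>gncs (B l). \<forall>y\<in>section_img K. tensor_norm (h_of K 0 y) p (q + m) ((covd (h_of K 0) ^^ m) (\<psi> l K) y) <= C * l ^ k"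
 proof (intro exI[of _ "sqrt (real (CARD('n) ^ p * CARD('n) ^ (q + m))) * (D * C)"] ballI)
  fix l K y assume A: "l \<in> S" "K \<in> gncs (B l)" "y \<in> section_img K"
  obtain E0 U \<phi> where F: "frame_at R l K y E0 U \<phi>"
   using normal_frame_exists[OF section_geometry(1)[OF bh[OF A(1)] A(2)] A(3) section_geometry(2,3)[OF bh[OF A(1)] A(2)]] A
   unfolding frame_at_def by blast
  interpret frame_coords "h_of K 0" "section_img K" y E0 U \<phi> by (rule frame_atD[OF F])
  have C0: "0 <= C * l ^ k" by (rule order_trans[OF jn_nonneg C[OF F, of "replicate p undefined" "replicate q undefined"]]) auto
  have "\<bar>fr ((covd (h_of K 0) ^^ m) (\<psi> l K)) 0 us ls\<bar> <= D * (C * l ^ k)" if len: "length us = p" "length ls = q + m" for us ls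
  proof -
   have "jn 0 (\<lambda>x. fr ((covd (h_of K 0) ^^ m) (\<psi> l K)) x us ls) 0 <= D * (C * l ^ k)"
    unfolding D_def by (rule jn_fr_covd_iter[OF sm[OF A(1,2)] _ _ _ len C0], rule G[OF F]) (use R C[OF F] in auto)
   then show ?thesis by simp
  qed
  from tensor_norm_le_fr[OF frame_atD(5)[OF F] this]
  show "tensor_norm (h_of K 0 y) p (q + m) ((covd (h_of K 0) ^^ m) (\<psi> l K) y) \<le>
    sqrt (real (CARD('n) ^ p * CARD('n) ^ (q + m))) * (D * C) * l ^ k" by (simp add: mult.assoc)
 qed
qed

end

section \<open>Spacetime coordinates adapted to a point of the cross-section\<close>

locale adapted_frame = g: gnc_coords X \<omega> h V + f: frame_coords "h 0" "{y. gnc_point 0 0 y \<in> V}" p E0 U \<phi>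
 for X :: "real => real^'n::finite => real" and \<omega> :: "real => real^'n => real^'n" and h :: "real => real^'n => real^'n^'n"
  and V :: "(real^('n gnc)) set" and p :: "real^'n" and E0 :: "real^'n^'n" and U :: "(real^'n) set" and \<phi> :: "real^'n => real^'n" +
 assumes ortho: "transpose E0 ** h 0 p ** E0 = mat 1"
begin

text \<open>New coordinates on the cross-section, extended trivially in \<tau> and \<rho>; the
  pulled back metric keeps its Gaussian null form, with the fields \<open>X'\<close>,
  \<open>\<omega>'\<close>, \<open>h'\<close>.\<close>

definition \<Phi> :: "real^('n gnc) => real^('n gnc)" where "\<Phi> z = gnc_point (z $ Tau) (z $ Rho) (\<phi> (ang z))"
definition X' :: "real => real^'n => real" where "X' \<rho> x = X \<rho> (\<phi> x)"
definition \<omega>' :: "real => real^'n => real^'n" where "\<omega>' \<rho> x = (\<chi> a. \<Sigma> i. jac \<phi> x $ i $ a * \<omega> \<rho> (\<phi> x) $ i)"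
definition h' :: "real => real^'n => real^'n^'n" where "h' \<rho> x = transpose (jac \<phi> x) ** h \<rho> (\<phi> x) ** jac \<phi> x"
definition W :: "(real^('n gnc)) set" where "W = {z. ang z \<in> U} \<inter> \<Phi> -` V"

lemma open_ang: "open {z :: real^('n gnc). ang z \<in> U}"
 using continuous_open_preimage[OF smooth_on_cont[OF smooth_on_ang[OF open_UNIV]] open_UNIV f.U(1)] by (simp add: vimage_def)

lemma smooth_compose_ang:
 fixes f :: "real^'n => real"
 assumes "smooth_on U f"
 shows "smooth_on {z. ang z \<in> U} (\<lambda>z. f (ang z))"
 by (rule smooth_on_compose[OF open_ang smooth_on_ang[OF open_ang] _ assms]) auto

lemma \<Phi>_nth: "\<Phi> z $ i = (case i of Tau => z $ Tau | Rho => z $ Rho | Ang A => \<phi> (ang z) $ A)" "ang (\<Phi> z) = \<phi> (ang z)"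
 by (cases i) (simp_all add: \<Phi>_def)

lemma smooth_\<Phi>: "smooth_on {z. ang z \<in> U} \<Phi>"
 unfolding smooth_on_vec[OF open_ang]
proof
 fix i
 show "smooth_on {z. ang z \<in> U} (\<lambda>z. \<Phi> z $ i)" unfolding \<Phi>_nth
  by (cases i) (auto intro: smooth_on_coord smooth_compose_ang smooth_on_nth[OF f.U(1,3)])
qed

lemma oW: "open W"
 unfolding W_def by (rule continuous_open_preimage[OF smooth_on_cont[OF smooth_\<Phi>] open_ang g.oV])

lemma W_sub: "W \<subseteq> {z. ang z \<in> U}" and \<Phi>_W: "\<Phi> ` W \<subseteq> V" by (auto simp: W_def)

lemma slice_W: "x \<in> U ==> gnc_point 0 0 x \<in> W" "\<Phi> (gnc_point 0 0 x) = gnc_point 0 0 (\<phi> x)"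
 using f.U(4) by (auto simp: W_def \<Phi>_def)

lemma jac_\<Phi>:
 assumes "z \<in> W"
 shows "jac \<Phi> z $ c $ a = (case c of Ang i => (case a of Ang b => jac \<phi> (ang z) $ i $ b | _ => 0) | _ => if a = c then 1 else 0)"
proof -
 have "pd (Ang b) (\<lambda>z. \<phi> (ang z) $ i) (gnc_point (z $ Tau) (z $ Rho) (ang z)) = jac \<phi> (ang z) $ i $ b" for i b
  unfolding pd_slice[symmetric] by (simp add: jac_def)
 then show ?thesis
  using pd_Tau_indep[of "\<lambda>_ x. \<phi> x $ _" z] pd_Rho_ang[of "\<lambda>x. \<phi> x $ _" z]
  by (cases c; cases a) (auto simp: jac_def \<Phi>_nth gnc_point_eta)
qed

lemma smooth_pulled:
 assumes "smooth_on V (\<lambda>z. F (z $ Rho) (ang z) :: real)"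
 shows "smooth_on W (\<lambda>z. F (z $ Rho) (\<phi> (ang z)))"
 using smooth_on_compose[OF oW smooth_on_subset[OF smooth_\<Phi> W_sub] \<Phi>_W assms] by (simp add: \<Phi>_nth)

lemma smooth_J: "smooth_on W (\<lambda>z. jac \<phi> (ang z) $ i $ a)"
 by (rule smooth_on_subset[OF smooth_compose_ang[OF f.smooth_E] W_sub])

lemmas smooth_pulled\<omega> = smooth_pulled[of "\<lambda>\<rho> x. \<omega> \<rho> x $ _", OF g.sm\<omega>_nth]
lemmas smooth_pulledh = smooth_pulled[of "\<lambda>\<rho> x. h \<rho> x $ _ $ _", OF smooth_on_entry[OF g.oV g.smh]]

lemma coords_W: "gnc_coords_at_0 X' \<omega>' h' W"
proof unfold_locales
 show "open W" by (rule oW)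
 show "smooth_on W (\<lambda>z. X' (z $ Rho) (ang z))" unfolding X'_def by (rule smooth_pulled[OF g.smX])
 show "smooth_on W (\<lambda>z. \<omega>' (z $ Rho) (ang z))"
  unfolding smooth_on_vec[OF oW] \<omega>'_def vec_lambda_beta
  by (intro allI smooth_on_sum smooth_on_mult oW smooth_J smooth_pulled\<omega>)
 show "smooth_on W (\<lambda>z. h' (z $ Rho) (ang z))"
  unfolding smooth_on_mat[OF oW] h'_def congruence_nth by (intro allI smooth_on_sum smooth_on_mult oW smooth_J smooth_pulledh)
 show "riemannian (h' (z $ Rho) (ang z))" if "z \<in> W" for z
  unfolding h'_def
  by (rule riemannian_congruence) (use that g.hr[of "\<Phi> z"] f.U(5) in \<open>auto simp: W_def \<Phi>_nth invertible_det_nz\<close>)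
 show "0 \<in> W" using slice_W(1)[OF f.U(2)] by (simp add: gnc_point_0)
 show "h' 0 0 = mat 1" by (simp add: h'_def f.U(6,7) ortho)
qed

lemma pullback_\<Phi>: "z \<in> W ==> pullback \<Phi> g.g z = gnc_metric X' \<omega>' h' z"
proof -
 assume z: "z \<in> W"
 have df: "\<Phi> differentiable (at z)" by (rule smooth_on_D[OF smooth_\<Phi>]) (use z W_sub in auto)
 show ?thesis
  unfolding vec_eq_iff
 proof (intro allI)
  fix a b
  show "pullback \<Phi> g.g z $ a $ b = gnc_metric X' \<omega>' h' z $ a $ b"
   unfolding pullback_nth[OF df]
   by (cases a; cases b) (simp_all add: sum_gnc jac_\<Phi>[OF z] gnc_metric_nth \<Phi>_nth X'_def \<omega>'_def h'_def congruence_nth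
    sum_distrib_left mult_ac)
 qed
qed

text \<open>As \<tau> and \<rho> are left alone, components with one index \<open>Tau\<close>
  transform like a one-form on the cross-section.\<close>

lemma pull_tensor:
 assumes P: "covariant_2tensor P" and x: "x \<in> U"
 shows "P Tau (Ang b) (gnc_metric X' \<omega>' h') (gnc_point 0 0 x) = (\<Sigma> i. jac \<phi> x $ i $ b * P Tau (Ang i) g.g (gnc_point 0 0 (\<phi> x)))"
proof -
 let ?z = "gnc_point 0 0 x :: real^('n gnc)"
 interpret w: gnc_coords_at_0 X' \<omega>' h' W by (rule coords_W)
 note z = slice_W(1)[OF x]
 have sm: "smooth_on W \<Phi>" by (rule smooth_on_subset[OF smooth_\<Phi> W_sub])
 have "det (transpose (jac \<Phi> ?z) ** g.g (\<Phi> ?z) ** jac \<Phi> ?z) ~= 0"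
  using lorentzian_det[OF w.lorentzian_g[OF z]] pullback_\<Phi>[OF z] pullback_eq[OF smooth_on_D[OF sm z], of g.g] by simp
 then have nz: "det (jac \<Phi> ?z) ~= 0" by (auto simp: det_mul)
 obtain V' where V': "open V'" "?z \<in> V'" "V' \<subseteq> W" "diffeomorphic_map V' (\<Phi> ` V') \<Phi>"
  by (rule local_diffeomorphism[OF oW sm z nz]) (rule that)
 have im: "\<Phi> ` V' \<subseteq> V" using V'(3) \<Phi>_W by auto
 have jp: "jet_poly (P Tau (Ang b))" using P by (simp add: covariant_2tensor_def)
 have "P Tau (Ang b) (gnc_metric X' \<omega>' h') ?z = P Tau (Ang b) (pullback \<Phi> g.g) ?z"
  by (rule jet_poly_cong_open[OF jp oW z]) (simp add: pullback_\<Phi>)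
 also have "... = (\<Sigma> c d. jac \<Phi> ?z $ c $ Tau * jac \<Phi> ?z $ d $ Ang b * P c d g.g (\<Phi> ?z))"
  using P[unfolded covariant_2tensor_def, THEN conjunct2, rule_format, of V' "\<Phi> ` V'" \<Phi> g.g ?z Tau "Ang b"]
   V'(2,4) smooth_on_subset[OF g.smooth_g im] g.lorentzian_g im by blast
 finally show ?thesis by (simp add: sum_gnc jac_\<Phi>[OF z] slice_W(2))
qed

text \<open>\<open>deriv\<close> is linear on differentiable functions only; differentiability along
  \<rho> is drawn from smoothness of the fields on \<open>W\<close>.\<close>

lemma deriv_linear:
 assumes A: "finite A" "!!k. k \<in> A ==> smooth_on W (\<lambda>z. c k (ang z))" "!!k. k \<in> A ==> smooth_on W (\<lambda>z. F k (z $ Rho) (ang z))" and x: "x \<in> U"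
 shows "(deriv ^^ j) (\<lambda>\<rho>. \<Sum>k\<in>A. c k x * F k \<rho> x) 0 = (\<Sum>k\<in>A. c k x * (deriv ^^ j) (\<lambda>\<rho>. F k \<rho> x) 0)"
proof -
 note z = slice_W(1)[OF x]
 have sm: "smooth_on W (\<lambda>z. (\<lambda>\<rho> x. \<Sum>k\<in>A. c k x * F k \<rho> x) (z $ Rho) (ang z))"
  by (intro smooth_on_sum smooth_on_mult oW A)
 have "(deriv ^^ j) (\<lambda>\<rho>. \<Sum>k\<in>A. c k x * F k \<rho> x) 0 = (pd Rho ^^ j) (\<lambda>z. \<Sum>k\<in>A. c k (ang z) * F k (z $ Rho) (ang z)) (gnc_point 0 0 x)"
  using pd_Rho_iter(2)[OF oW sm z, of j] by simp
 also have "... = (\<Sum>k\<in>A. c k x * (pd Rho ^^ j) (\<lambda>z. F k (z $ Rho) (ang z)) (gnc_point 0 0 x))"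
  using pd_Rho_iter_linear[where f="\<lambda>k z. F k (z $ Rho) (ang z)" and c=c and i=j, OF oW A z] by simp
 also have "... = (\<Sum>k\<in>A. c k x * (deriv ^^ j) (\<lambda>\<rho>. F k \<rho> x) 0)"
  by (rule sum.cong[OF refl]) (simp add: pd_Rho_iter(2)[OF oW A(3) z])
 finally show ?thesis .
qed

text \<open>The Jacobian of \<open>\<phi>\<close> does not depend on \<rho>, so \<rho>-derivatives
  of the pulled back fields are the frame components of those of the original ones.\<close>

lemma slices_boundedI:
 assumes "!!j us ls. j <= R ==> length us = 0 ==> length ls = 0 ==> jn R (\<lambda>x. f.fr (\<lambda>y us ls. (deriv ^^ j) (\<lambda>\<rho>. X \<rho> y) 0) x us ls) 0 <= M"
  and "!!j us ls. j <= R ==> length us = 0 ==> length ls = 1 ==> jn R (\<lambda>x. f.fr (\<lambda>y us ls. (deriv ^^ j) (\<lambda>\<rho>. \<omega> \<rho> y $ (ls ! 0)) 0) x us ls) 0 <= M"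
  and "!!j us ls. j <= R ==> length us = 0 ==> length ls = 2 ==> jn R (\<lambda>x. f.fr (\<lambda>y us ls. (deriv ^^ j) (\<lambda>\<rho>. h \<rho> y $ (ls ! 0) $ (ls ! 1)) 0) x us ls) 0 <= M"
 shows "slices_bounded R M X' \<omega>' h'"
 unfolding slices_bounded_def
proof (intro allI impI conjI)
 fix j a b assume j: "j <= R"
 show "jn R (\<lambda>x. (deriv ^^ j) (\<lambda>\<rho>. X' \<rho> x) 0) 0 <= M"
  using assms(1)[OF j, of "[]" "[]"] by (simp add: f.fr_def X'_def)
 have "jn R (\<lambda>x. (deriv ^^ j) (\<lambda>\<rho>. \<omega>' \<rho> x $ a) 0) 0 = jn R (\<lambda>x. f.fr (\<lambda>y us ls. (deriv ^^ j) (\<lambda>\<rho>. \<omega> \<rho> y $ (ls ! 0)) 0) x [] [a]) 0"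
 proof (rule f.jn_cong_S)
  fix x assume x: "x \<in> U"
  show "(deriv ^^ j) (\<lambda>\<rho>. \<omega>' \<rho> x $ a) 0 = f.fr (\<lambda>y us ls. (deriv ^^ j) (\<lambda>\<rho>. \<omega> \<rho> y $ (ls ! 0)) 0) x [] [a]"
   using deriv_linear[of UNIV "\<lambda>i x. jac \<phi> x $ i $ a" "\<lambda>i \<rho> x. \<omega> \<rho> (\<phi> x) $ i", OF _ smooth_J smooth_pulled\<omega> x]
   by (simp add: \<omega>'_def f.fr_def)
 qed
 then show "jn R (\<lambda>x. (deriv ^^ j) (\<lambda>\<rho>. \<omega>' \<rho> x $ a) 0) 0 <= M" using assms(2)[OF j, of "[]" "[a]"] by simp
 have "jn R (\<lambda>x. (deriv ^^ j) (\<lambda>\<rho>. h' \<rho> x $ a $ b) 0) 0 = jn R (\<lambda>x. f.fr (\<lambda>y us ls. (deriv ^^ j) (\<lambda>\<rho>. h \<rho> y $ (ls ! 0) $ (ls ! 1)) 0) x [] [a, b]) 0"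
 proof (rule f.jn_cong_S)
  fix x assume x: "x \<in> U"
  have pr: "(\<Sigma> i k. f i k) = (\<Sigma> k. f (fst k) (snd k))" for f :: "'n => 'n => real"
   by (simp add: sum.cartesian_product case_prod_unfold)
  have "(deriv ^^ j) (\<lambda>\<rho>. \<Sigma> k. jac \<phi> x $ fst k $ a * jac \<phi> x $ snd k $ b * h \<rho> (\<phi> x) $ fst k $ snd k) 0 =
   (\<Sigma> k. jac \<phi> x $ fst k $ a * jac \<phi> x $ snd k $ b * (deriv ^^ j) (\<lambda>\<rho>. h \<rho> (\<phi> x) $ fst k $ snd k) 0)"
   by (rule deriv_linear[of _ "\<lambda>k x. jac \<phi> x $ fst k $ a * jac \<phi> x $ snd k $ b" "\<lambda>k \<rho> x. h \<rho> (\<phi> x) $ fst k $ snd k", OF _ _ _ x])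
    (auto intro: smooth_on_mult oW smooth_J smooth_pulledh)
  then show "(deriv ^^ j) (\<lambda>\<rho>. h' \<rho> x $ a $ b) 0 = f.fr (\<lambda>y us ls. (deriv ^^ j) (\<lambda>\<rho>. h \<rho> y $ (ls ! 0) $ (ls ! 1)) 0) x [] [a, b]"
   by (simp add: h'_def congruence_nth f.fr_def sum_distrib_left mult.assoc pr)
 qed
 then show "jn R (\<lambda>x. (deriv ^^ j) (\<lambda>\<rho>. h' \<rho> x $ a $ b) 0) 0 <= M" using assms(3)[OF j, of "[]" "[a, b]"] by simp
qed

end

section \<open>The zeroth law\<close>

lemma christoffel_cong_open:
 assumes "open V" "z \<in> V" "!!z. z \<in> V ==> g z = g' z"
 shows "christoffel g z = christoffel g' z"
proof -
 have "pd i (\<lambda>y. g y $ a $ b) z = pd i (\<lambda>y. g' y $ a $ b) z" for i a b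
  by (rule pd_cong_open[OF assms(1,2)]) (simp add: assms(3))
 then show ?thesis by (simp add: christoffel_def fun_eq_iff assms)
qed

lemma ricci_cong_open:
 assumes V: "open V" "z \<in> V" "!!z. z \<in> V ==> g z = g' z"
 shows "ricci g z = ricci g' z"
proof -
 have "pd i (\<lambda>y. christoffel g y a b c) z = pd i (\<lambda>y. christoffel g' y a b c) z" for i a b c
  by (rule pd_cong_open[OF V(1,2)]) (simp add: christoffel_cong_open[OF V(1) _ V(3)])
 then show ?thesis by (simp add: ricci_def riemann_def fun_eq_iff christoffel_cong_open[OF V])
qed

lemma smooth_slice_deriv:
 assumes "open V" "smooth_on V (\<lambda>z :: real^('n::finite gnc). F (z $ Rho) (ang z) :: real)"
 shows "smooth_on {y. gnc_point 0 0 y \<in> V} (\<lambda>y. (deriv ^^ j) (\<lambda>\<rho>. F \<rho> y) 0)"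
 by (rule smooth_on_cong[THEN iffD1, OF open_slice[OF assms(1)] _
   smooth_on_slice[where \<tau>=0 and \<rho>=0, OF assms(1) smooth_on_iter_pd[where i=Rho and j=j, OF assms(2)]]])
  (simp add: pd_Rho_iter[OF assms])

lemma power_le_mult_power:
 fixes l l0 :: real
 assumes "0 < l" "l <= l0" "j <= i"
 shows "l ^ i <= l0 ^ (i - j) * l ^ j"
proof -
 have "l ^ i = l ^ (i - j) * l ^ j" using assms(3) by (simp flip: power_add)
 also have "... <= l0 ^ (i - j) * l ^ j" using assms by (intro mult_right_mono power_mono) auto
 finally show ?thesis .
qed

text \<open>The component \<open>Tau\<close> of the defining equation: the Killing field is constant
  in these coordinates, which leaves a single Christoffel symbol.\<close>

lemma surface_gravity_section:
 assumes bh: "stationary_black_hole B" and sg: "surface_gravity B \<kappa>" and K: "K \<in> gncs B" and y: "y \<in> section_img K"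
 shows "\<kappa> (param (chart_of K) (gnc_point 0 0 y)) = X_of K 0 y / 2"
proof -
 let ?c = "chart_of K" and ?z = "gnc_point 0 0 y"
 interpret gnc_coords "X_of K" "\<omega>_of K" "h_of K" "img ?c" by (rule killing_gnc_coords[OF bh K])
 have z: "?z \<in> img ?c" using y by (simp add: section_img_def)
 have k: "killing_gnc B K" using bh K by (simp add: stationary_black_hole_def)
 note k = k[unfolded killing_gnc_def Let_def]
 have p: "param ?c ?z \<in> dom_of ?c" "coord ?c (param ?c ?z) = ?z"
  using z inv_into_into[of ?z "coord ?c" "dom_of ?c"] f_inv_into_f[of ?z "coord ?c" "dom_of ?c"]
  by (simp_all add: img_def param_def)
 have hz: "param ?c ?z \<in> horizon B" "?c \<in> atlas B" using k z by simp_all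
 have \<xi>: "killing B ?c z $ i = (if i = Tau then 1 else 0)" if "z \<in> img ?c" for z i
  using k that by (simp add: axis_def)
 have "pd b (\<lambda>y. killing B ?c y $ a) ?z = 0" for a b
  using pd_cong_open[OF oV z, of "\<lambda>y. killing B ?c y $ a" "\<lambda>y. if a = Tau then 1 else 0"] \<xi> by simp
 moreover have "christoffel (metric B ?c) ?z = christoffel g ?z" by (rule christoffel_cong_open[OF oV z]) (use k in blast)
 ultimately show ?thesis
  using sg[unfolded surface_gravity_def Let_def, rule_format, of ?c "param ?c ?z" Tau] p hz \<xi>[OF z]
   surface_gravity_gnc[OF z] by (simp add: sum_gnc)
qed

section \<open>One-forms on the cross-section and uniform bounds on the geometry\<close>

context horizon_family
begin

text \<open>Covariant derivatives at a point see only an open neighbourhood, so agreement on the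
  open set \<open>section_img K\<close> is enough.\<close>

lemma O_inf_cong:
 assumes "O_inf S B p q \<psi> k" "!!l K y. l \<in> S ==> K \<in> gncs (B l) ==> y \<in> section_img K ==> \<psi> l K y = \<psi>' l K y"
 shows "O_inf S B p q \<psi>' k"
proof -
 have "(covd (h_of K 0) ^^ m) (\<psi> l K) y = (covd (h_of K 0) ^^ m) (\<psi>' l K) y"
  if "l \<in> S" "K \<in> gncs (B l)" "y \<in> section_img K" for l K y m
  by (rule covd_iter_cong[OF section_geometry(1)[OF bh[OF that(1)] that(2)] _ that(3)]) (rule assms(2)[OF that(1,2)])
 with assms(1) show ?thesis unfolding O_inf_def by (metis (no_types, lifting))
qed

abbreviation d\<kappa> :: "real => ('p, 'n) gnc_chart => 'n tensor_field" where
 "d\<kappa> l K y us ls \<equiv> pd (ls ! 0) (X_of K 0) y / 2"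

abbreviation on_section :: "('n gnc => 'n gnc => 'n gnc lagrangian) => ('p, 'n) gnc_chart => 'n tensor_field" where
 "on_section P K y us ls \<equiv> P Tau (Ang (ls ! 0)) (gnc_metric (X_of K) (\<omega>_of K) (h_of K)) (gnc_point 0 0 y)"

abbreviation X_jet :: "nat => real => ('p, 'n) gnc_chart => 'n tensor_field" where
 "X_jet j l K y us ls \<equiv> (deriv ^^ j) (\<lambda>\<rho>. X_of K \<rho> y) 0"

abbreviation \<omega>_jet :: "nat => real => ('p, 'n) gnc_chart => 'n tensor_field" where
 "\<omega>_jet j l K y us ls \<equiv> (deriv ^^ j) (\<lambda>\<rho>. \<omega>_of K \<rho> y $ (ls ! 0)) 0"

abbreviation h_jet :: "nat => real => ('p, 'n) gnc_chart => 'n tensor_field" where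
 "h_jet j l K y us ls \<equiv> (deriv ^^ j) (\<lambda>\<rho>. h_of K \<rho> y $ (ls ! 0) $ (ls ! 1)) 0"

lemma frame_d\<kappa>:
 assumes F: "frame_at R l K y E0 U \<phi>" and x: "x \<in> U"
 shows "frame_coords.fr \<phi> (d\<kappa> l K) x [] [b] = pd b (\<lambda>x. X_of K 0 (\<phi> x)) x / 2"
proof -
 interpret f: frame_coords "h_of K 0" "section_img K" y E0 U \<phi> by (rule frame_atD[OF F])
 from f.pd_phi[OF x smooth_section_X[OF bh[OF frame_atD(1)[OF F]] frame_atD(2)[OF F]], of b] show ?thesis by (simp add: f.fr_def sum_divide_distrib)
qed

lemma adapted:
 assumes F: "frame_at R l K y E0 U \<phi>"
 shows "adapted_frame (X_of K) (\<omega>_of K) (h_of K) (img (chart_of K)) y E0 U \<phi>"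
 unfolding adapted_frame_def adapted_frame_axioms_def
 using frame_atD(4,5)[OF F] killing_gnc_coords[OF bh] F by (auto simp: frame_at_def section_img_def)

lemma smooth_d\<kappa>:
 assumes A: "l \<in> S" "K \<in> gncs (B l)"
 shows "tensor_smooth_on (section_img K) (d\<kappa> l K)"
 unfolding tensor_smooth_on_def divide_inverse
 by (intro allI smooth_on_mult section_geometry(1)[OF bh A(2)] smooth_on_pd smooth_section_X[OF bh A(2)] smooth_on_const A(1))

lemma smooth_on_section:
 assumes "covariant_2tensor P" and A: "l \<in> S" "K \<in> gncs (B l)"
 shows "tensor_smooth_on (section_img K) (on_section P K)"
proof -
 interpret g: gnc_coords "X_of K" "\<omega>_of K" "h_of K" "img (chart_of K)" by (rule killing_gnc_coords[OF bh A(2)]) fact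
 have "jet_poly (P a b)" for a b using assms(1) by (simp add: covariant_2tensor_def)
 then show ?thesis
  unfolding tensor_smooth_on_def section_img_def by (intro allI smooth_on_slice[OF g.oV] jet_poly_smooth g.regular_g)
qed

context
 assumes OX: "!!j. O_inf S B 0 0 (X_jet j) 0"
  and O\<omega>: "!!j. O_inf S B 0 1 (\<omega>_jet j) 0"
  and Oh: "!!j. O_inf S B 0 2 (h_jet j) 0"
begin

lemma smooth_coefficients:
 assumes A: "l \<in> S" "K \<in> gncs (B l)"
 shows "tensor_smooth_on (section_img K) (X_jet j l K)"
  "tensor_smooth_on (section_img K) (\<omega>_jet j l K)"
  "tensor_smooth_on (section_img K) (h_jet j l K)"
proof -
 interpret g: gnc_coords "X_of K" "\<omega>_of K" "h_of K" "img (chart_of K)" by (rule killing_gnc_coords[OF bh A(2)]) fact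
 show "tensor_smooth_on (section_img K) (X_jet j l K)"
  "tensor_smooth_on (section_img K) (\<omega>_jet j l K)"
  "tensor_smooth_on (section_img K) (h_jet j l K)"
  unfolding tensor_smooth_on_def section_img_def
  by (intro allI smooth_slice_deriv[OF g.oV] g.smX g.sm\<omega>_nth smooth_on_entry[OF g.oV g.smh])+
qed

text \<open>The start of the induction, from the bound on X alone; one derivative is lost, hence
  frames of order \<open>Suc m\<close>.\<close>

lemma d\<kappa>_bounded: "O_inf S B 0 1 d\<kappa> 0"
proof (rule O_inf_jetsI[OF smooth_d\<kappa>])
 fix m
 have "\<exists>C. jets_bounded 0 0 (X_jet 0) 0 (Suc m) (Suc m) C" by (rule O_inf_jets[OF OX[of 0]]) (rule smooth_coefficients)
 then obtain C where jb: "jets_bounded 0 0 (X_jet 0) 0 (Suc m) (Suc m) C" ..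
 note C = jets_boundedD[OF jb]
 show "\<exists>R\<ge>m. \<exists>C. jets_bounded 0 1 d\<kappa> 0 R m C"
  unfolding jets_bounded_def
 proof (intro exI[of _ "Suc m"] conjI exI[of _ C] allI impI)
  fix l K y E0 U \<phi> and us ls :: "'n list"
  assume F: "frame_at (Suc m) l K y E0 U \<phi>" and len: "length us = 0" "length ls = 1"
  interpret a: adapted_frame "X_of K" "\<omega>_of K" "h_of K" "img (chart_of K)" y E0 U \<phi> by (rule adapted[OF F])
  obtain b where b: "ls = [b]" using len by (cases ls) auto
  have sm: "smooth_on U (pd b (\<lambda>x. X_of K 0 (\<phi> x)))"
   using smooth_on_pd[OF a.f.smooth_fr[OF smooth_coefficients(1)[OF frame_atD(1,2)[OF F], of 0, unfolded section_img_def], of "[]" "[]"]]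
   by (simp add: a.f.fr_def)
  have "jn m (\<lambda>x. a.f.fr (d\<kappa> l K) x us ls) 0 = jn m (\<lambda>x. 1 / 2 * pd b (\<lambda>x. X_of K 0 (\<phi> x)) x) 0"
   by (rule a.f.jn_cong_S) (use len in \<open>simp add: b frame_d\<kappa>[OF F]\<close>)
  also have "... = 1 / 2 * jn m (pd b (\<lambda>x. X_of K 0 (\<phi> x))) 0" using a.f.jn_cmult[OF sm, of m "1 / 2"] by simp
  also have "... <= jn m (pd b (\<lambda>x. X_of K 0 (\<phi> x))) 0" using jn_nonneg[of m "pd b (\<lambda>x. X_of K 0 (\<phi> x))" 0] by simp
  also have "... <= jn (Suc m) (\<lambda>x. X_of K 0 (\<phi> x)) 0" by (rule jn_pd)
  also have "... <= C * l ^ 0" using C[OF F, of "[]" "[]"] by (simp add: a.f.fr_def)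
  finally show "jn m (\<lambda>x. a.f.fr (d\<kappa> l K) x us ls) 0 <= C * l ^ 0" .
 qed simp
qed

text \<open>Finitely many \<rho>-derivatives of three fields enter, so a single \<open>M\<close> is
  the sum of their constants.\<close>

lemma slices_uniform:
 "\<exists>M. \<forall>l K y E0 U \<phi>. frame_at R l K y E0 U \<phi> -->
  slices_bounded R M (adapted_frame.X' (X_of K) \<phi>) (adapted_frame.\<omega>' (\<omega>_of K) \<phi>) (adapted_frame.h' (h_of K) \<phi>)"
proof -
 have ex: "\<forall>j. \<exists>C. jets_bounded 0 0 (X_jet j) 0 R R C"
  "\<forall>j. \<exists>C. jets_bounded 0 1 (\<omega>_jet j) 0 R R C"
  "\<forall>j. \<exists>C. jets_bounded 0 2 (h_jet j) 0 R R C"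
  by - (rule allI, (rule O_inf_jets[OF OX] O_inf_jets[OF O\<omega>] O_inf_jets[OF Oh]; (rule smooth_coefficients; assumption)))+
 from choice[OF ex(1)] choice[OF ex(2)] choice[OF ex(3)] obtain c1 c2 c3
  where "\<forall>j. jets_bounded 0 0 (X_jet j) 0 R R (c1 j)"
  "\<forall>j. jets_bounded 0 1 (\<omega>_jet j) 0 R R (c2 j)"
  "\<forall>j. jets_bounded 0 2 (h_jet j) 0 R R (c3 j)" by (elim exE) (rule that)
 note c = this[THEN spec, THEN jets_boundedD]
 define M where "M = (\<Sum>j\<le>R. \<bar>c1 j\<bar> + \<bar>c2 j\<bar> + \<bar>c3 j\<bar>)"
 have M: "\<bar>c1 j\<bar> + \<bar>c2 j\<bar> + \<bar>c3 j\<bar> <= M" if "j <= R" for j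
  unfolding M_def by (rule member_le_sum) (use that in auto)
 then have cM: "c1 j <= M" "c2 j <= M" "c3 j <= M" if "j <= R" for j using M[OF that] by linarith+
 show ?thesis
 proof (intro exI[of _ M] allI impI)
  fix l K y E0 U \<phi>
  assume F: "frame_at R l K y E0 U \<phi>"
  interpret a: adapted_frame "X_of K" "\<omega>_of K" "h_of K" "img (chart_of K)" y E0 U \<phi> by (rule adapted[OF F])
  show "slices_bounded R M a.X' a.\<omega>' a.h'"
   by (rule a.slices_boundedI; rule order_trans[OF c(1)[OF F, unfolded power_0 mult_1_right] cM(1)]
    order_trans[OF c(2)[OF F, unfolded power_0 mult_1_right] cM(2)]
    order_trans[OF c(3)[OF F, unfolded power_0 mult_1_right] cM(3)]; assumption)
 qed
qed

end

end

context horizon_family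
begin

text \<open>By the equations of motion \<open>\<partial>\<^sub>A \<kappa>\<close> is, up to \<open>E\<close>, a sum of components with one lower index along the
 horizon generators; these vanish for constant \<open>\<kappa>\<close>, so every order of \<open>d\<kappa>\<close> yields one more.\<close>
lemma d\<kappa>_improve:
 assumes A: "finite A" "!!n. n \<in> A ==> covariant_2tensor (P n)" "!!n. n \<in> A ==> 1 <= n"
  and slices: "!!R. \<exists>M. \<forall>l K y E0 U \<phi>. frame_at R l K y E0 U \<phi> -->
   slices_bounded R M (adapted_frame.X' (X_of K) \<phi>) (adapted_frame.\<omega>' (\<omega>_of K) \<phi>) (adapted_frame.h' (h_of K) \<phi>)"
  and E: "O_inf S B 0 1 (\<lambda>l K y us ls. - d\<kappa> l K y us ls - (\<Sum>n\<in>A. l ^ n * on_section (P n) K y us ls)) N"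
  and l0: "!!l. l \<in> S ==> l <= l0" and k: "k < N" and IH: "O_inf S B 0 1 d\<kappa> k"
 shows "O_inf S B 0 1 d\<kappa> (Suc k)"
proof (rule O_inf_jetsI[OF smooth_d\<kappa>])
 fix m
 let ?E = "\<lambda>l K y us ls. - d\<kappa> l K y us ls - (\<Sum>n\<in>A. l ^ n * on_section (P n) K y us ls)"
 define D where "D n b R M C \<longleftrightarrow> C >= 0 \<and> (\<forall>X \<omega> h V. gnc_coords_at_0 X \<omega> h V \<and> slices_bounded R M X \<omega> h -->
  jn m (\<lambda>x. P n Tau (Ang b) (gnc_metric X \<omega> h) (gnc_point 0 0 x)) 0 <= C * jn R (\<lambda>x. X 0 x - X 0 0) 0)" for n b R M C
 have "\<forall>n\<in>A. \<forall>b. \<exists>R0. \<forall>R\<ge>R0. \<forall>M. \<exists>C. D n b R M C"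
  unfolding D_def using boost_estimate[OF A(2), where r=m] by blast
 then obtain R0 where R0: "!!n b R M. n \<in> A ==> R0 n b <= R ==> \<exists>C. D n b R M C" by metis
 define R1 where "R1 = (\<Sum>n\<in>A. \<Sigma> b. R0 n b)"
 \<comment> \<open>At least \<open>m\<close>, at least every order that
   \<open>boost_estimate\<close> demands, and a successor: the jet of X - X(0) of this order is read
   from a jet of d\<kappa> of one order less.\<close>
 let ?R = "Suc (m + R1)"
 have R: "R0 n b <= ?R" if "n \<in> A" for n b
 proof -
  have "R0 n b <= (\<Sigma> b. R0 n b)" by (rule member_le_sum) auto
  also have "... <= R1" unfolding R1_def by (rule member_le_sum[of n A "\<lambda>n. \<Sigma> b. R0 n b"]) (use that A(1) in auto)
  finally show ?thesis by simp
 qed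
 obtain M where M: "!!l K y E0 U \<phi>. frame_at ?R l K y E0 U \<phi> ==>
   slices_bounded ?R M (adapted_frame.X' (X_of K) \<phi>) (adapted_frame.\<omega>' (\<omega>_of K) \<phi>) (adapted_frame.h' (h_of K) \<phi>)"
  using slices[of ?R] by blast
 have "\<forall>n\<in>A. \<forall>b. \<exists>C. D n b ?R M C" using R0 R by blast
 then obtain C where C: "!!n b. n \<in> A ==> D n b ?R M (C n b)" by metis
 have "\<exists>c. jets_bounded 0 1 d\<kappa> k ?R ?R c" by (rule O_inf_jets[OF IH]) (rule smooth_d\<kappa>)
 then obtain c where "jets_bounded 0 1 d\<kappa> k ?R ?R c" ..
 note c = jets_boundedD[OF this]
 have smE: "tensor_smooth_on (section_img K) (?E l K)" if lK: "l \<in> S" "K \<in> gncs (B l)" for l K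
  using smooth_d\<kappa>[OF lK] smooth_on_section[OF A(2) lK] section_geometry(1)[OF bh[OF lK(1)] lK(2)] unfolding tensor_smooth_on_def
  by (auto intro!: smooth_on_diff smooth_on_minus smooth_on_sum smooth_on_mult)
 have "\<exists>e. jets_bounded 0 1 ?E N ?R ?R e" by (rule O_inf_jets[OF E]) (rule smE)
 then obtain e where "jets_bounded 0 1 ?E N ?R ?R e" ..
 note e = jets_boundedD[OF this]
 \<comment> \<open>X - X(0) vanishes at the point, so its jet norm is the sum over the directions of
   jets of dX = 2 d\<kappa>.\<close>
 define c' where "c' = real CARD('n) * (2 * \<bar>c\<bar>)"
 \<comment> \<open>Because n is at least 1, \<open>l ^ n\<close> supplies the one extra power of l
   that is gained; the other powers are absorbed by \<open>l0\<close>.\<close>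
 define q where "q n = l0 ^ (n - 1) * ((\<Sigma> b. C n b) * c')" for n
 define Q where "Q = \<bar>e\<bar> * l0 ^ (N - Suc k) + (\<Sum>n\<in>A. q n)"
 show "\<exists>R\<ge>m. \<exists>C. jets_bounded 0 1 d\<kappa> (Suc k) R m C"
  unfolding jets_bounded_def
 proof (intro exI[of _ ?R] conjI exI[of _ Q] allI impI)
  fix l K y E0 U \<phi> and us ls :: "'n list"
  assume F: "frame_at ?R l K y E0 U \<phi>" and len: "length us = 0" "length ls = 1"
  note lK = frame_atD(1,2)[OF F]
  interpret a: adapted_frame "X_of K" "\<omega>_of K" "h_of K" "img (chart_of K)" y E0 U \<phi> by (rule adapted[OF F])
  obtain b where b: "ls = [b]" "us = []" using len by (cases ls) auto
  note sm = a.f.smooth_fr[OF smE[OF lK, unfolded section_img_def]] a.f.smooth_fr[OF smooth_on_section[OF A(2) lK, unfolded section_img_def]]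
   a.f.smooth_fr[OF smooth_d\<kappa>[OF lK, unfolded section_img_def]]
  let ?p = "\<lambda>n x. a.f.fr (on_section (P n) K) x us ls"
  let ?\<mu> = "jn ?R (\<lambda>x. a.X' 0 x - a.X' 0 0) 0"
  have l: "0 < l" "l <= l0" using pos l0 lK by auto
  have fr: "a.f.fr (d\<kappa> l K) x us ls = - a.f.fr (?E l K) x us ls - (\<Sum>n\<in>A. l ^ n * ?p n x)" for x
  proof -
   let ?J = "\<lambda>i. jac \<phi> x $ i $ b"
   have "(\<Sigma> i. ?J i * (\<Sum>n\<in>A. l ^ n * on_section (P n) K (\<phi> x) [] [i])) = (\<Sum>n\<in>A. l ^ n * ?p n x)"
    unfolding sum_distrib_left by (subst sum.swap) (simp add: b a.f.fr_def sum_distrib_left mult.left_commute)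
   then show ?thesis by (simp add: b a.f.fr_def right_diff_distrib sum_subtractf sum_negf)
  qed
  have \<mu>: "?\<mu> <= c' * l ^ k"
  proof -
   have smX: "smooth_on U (a.X' 0)"
    using smooth_on_slice[OF a.oW a.smooth_pulled[OF a.g.smX], of 0 0] a.slice_W(1)
    by (auto simp: a.X'_def[abs_def] intro: smooth_on_subset)
   have "jn (m + R1) (pd i (\<lambda>x. a.X' 0 x - a.X' 0 0)) 0 <= 2 * \<bar>c\<bar> * l ^ k" for i
   proof -
    have "jn (m + R1) (pd i (\<lambda>x. a.X' 0 x - a.X' 0 0)) 0 = jn (m + R1) (\<lambda>x. 2 * a.f.fr (d\<kappa> l K) x [] [i]) 0"
    proof (rule a.f.jn_cong_S)
     fix x assume x: "x \<in> U"
     have "pd i (\<lambda>x. a.X' 0 x - a.X' 0 0) x = pd i (a.X' 0) x"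
      using pd_diff[OF smooth_on_D[OF smX x], of "\<lambda>_. a.X' 0 0" i] by simp
     then show "pd i (\<lambda>x. a.X' 0 x - a.X' 0 0) x = 2 * a.f.fr (d\<kappa> l K) x [] [i]"
      by (simp add: frame_d\<kappa>[OF F x] a.X'_def[abs_def])
    qed
    also have "... = 2 * jn (m + R1) (\<lambda>x. a.f.fr (d\<kappa> l K) x [] [i]) 0" using a.f.jn_cmult[OF sm(3), of _ 2] by simp
    also have "... <= 2 * jn ?R (\<lambda>x. a.f.fr (d\<kappa> l K) x [] [i]) 0" by (intro mult_left_mono jn_mono) auto
    also have "... <= 2 * (c * l ^ k)" using c[OF F, of "[]" "[i]"] by simp
    also have "... <= 2 * \<bar>c\<bar> * l ^ k" using l by (simp add: mult_right_mono)
    finally show ?thesis .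
   qed
   then have "(\<Sigma> i. jn (m + R1) (pd i (\<lambda>x. a.X' 0 x - a.X' 0 0)) 0) <= of_nat (card (UNIV :: 'n set)) * (2 * \<bar>c\<bar> * l ^ k)"
    by (intro sum_bounded_above) auto
   then show ?thesis by (simp add: c'_def mult.assoc)
  qed
  have p: "jn m (\<lambda>x. l ^ n * ?p n x) 0 <= q n * l ^ Suc k" if n: "n \<in> A" for n
  proof -
   have C0: "0 <= C n b" for b using C[OF n] by (simp add: D_def)
   have "jn m (?p n) 0 = jn m (\<lambda>x. P n Tau (Ang b) (gnc_metric a.X' a.\<omega>' a.h') (gnc_point 0 0 x)) 0"
    by (rule a.f.jn_cong_S) (simp add: a.pull_tensor[OF A(2)[OF n]] b a.f.fr_def)
   also have "... <= C n b * ?\<mu>"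
    using C[OF n, of b] a.coords_W M[OF F] unfolding D_def by blast
   also have "... <= (\<Sigma> b. C n b) * (c' * l ^ k)"
    by (intro mult_mono \<mu> member_le_sum sum_nonneg jn_nonneg) (auto intro: C0)
   finally have "l ^ n * jn m (?p n) 0 <= (l0 ^ (n - 1) * l ^ 1) * ((\<Sigma> b. C n b) * (c' * l ^ k))"
    using power_le_mult_power[OF l A(3)[OF n]] l by (intro mult_mono jn_nonneg mult_nonneg_nonneg) auto
   then show ?thesis using a.f.jn_cmult[OF sm(2)[OF n], of m "l ^ n"] l by (simp add: q_def mult_ac)
  qed
  have "jn m (\<lambda>x. a.f.fr (?E l K) x us ls) 0 <= jn ?R (\<lambda>x. a.f.fr (?E l K) x us ls) 0" by (rule jn_mono) simp
  also have "... <= e * l ^ N" by (rule e[OF F len])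
  also have "... <= \<bar>e\<bar> * (l0 ^ (N - Suc k) * l ^ Suc k)"
   using power_le_mult_power[OF l, of "Suc k" N] k l by (intro mult_mono) auto
  finally have 1: "jn m (\<lambda>x. - a.f.fr (?E l K) x us ls) 0 <= \<bar>e\<bar> * (l0 ^ (N - Suc k) * l ^ Suc k)"
   by (subst a.f.jn_minus[OF sm(1)])
  have 2: "jn m (\<lambda>x. a.f.fr (d\<kappa> l K) x us ls) 0 <= jn m (\<lambda>x. - a.f.fr (?E l K) x us ls) 0 + jn m (\<lambda>x. \<Sum>n\<in>A. l ^ n * ?p n x) 0"
   unfolding fr by (intro a.f.jn_diff smooth_on_minus smooth_on_sum smooth_on_mult smooth_on_const a.f.U(1) sm)
  have "jn m (\<lambda>x. \<Sum>n\<in>A. l ^ n * ?p n x) 0 <= (\<Sum>n\<in>A. jn m (\<lambda>x. l ^ n * ?p n x) 0)"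
   by (intro a.f.jn_sum smooth_on_mult smooth_on_const a.f.U(1) sm)
  also have "... <= (\<Sum>n\<in>A. q n * l ^ Suc k)" by (rule sum_mono[OF p])
  finally have 3: "jn m (\<lambda>x. \<Sum>n\<in>A. l ^ n * ?p n x) 0 <= (\<Sum>n\<in>A. q n * l ^ Suc k)" .
  have "Q * l ^ Suc k = \<bar>e\<bar> * (l0 ^ (N - Suc k) * l ^ Suc k) + (\<Sum>n\<in>A. q n * l ^ Suc k)"
   unfolding Q_def distrib_right by (simp only: sum_distrib_right mult.assoc)
  then show "jn m (\<lambda>x. a.f.fr (d\<kappa> l K) x us ls) 0 <= Q * l ^ Suc k" using 1 2 3 by linarith
 qed simp
qed

end

theorem mainTheorem3:
  fixes N :: nat
    and L :: "nat \<Rightarrow> 'n::finite gnc lagrangian"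
    and l0 :: real
    and B :: "real \<Rightarrow> ('p::{t2_space,second_countable_topology}, 'n) black_hole"
    and \<Lambda> :: "real \<Rightarrow> real"
    and lH :: "real \<Rightarrow> ('p, 'n gnc) chart \<Rightarrow> real^('n gnc) \<Rightarrow> real^('n gnc)^('n gnc)"
    and \<kappa> :: "real \<Rightarrow> 'p \<Rightarrow> real"
  assumes "N \<ge> 1"
    and "\<And>n. n \<in> {1..<N} \<Longrightarrow> covariant_scalar (n + 2) (L n)"
    and "l0 > 0"
    and "\<And>l. l \<in> {0<..l0} \<Longrightarrow> stationary_black_hole (B l)"
    and "\<And>l. l \<in> {0<..l0} \<Longrightarrow> surface_gravity (B l) (\<kappa> l)"
    and "\<And>l. l \<in> {0<..l0} \<Longrightarrow> eft_correction N L l (B l) (lH l)"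
    and "regime_of_validity N {0<..l0} B \<Lambda> lH"
  shows "O_inf {0<..l0} B 0 1
           (\<lambda>l K y us ls. pd (ls ! 0) (\<lambda>y. \<kappa> l (param (chart_of K) (gnc_point 0 0 y))) y) N"
proof -
 let ?S = "{0<..l0}" and ?A = "{1..<N}"
 note reg = assms(7)[unfolded regime_of_validity_def Let_def]
 interpret horizon_family ?S B by unfold_locales (use assms(4) reg in auto)
 \<comment> \<open>Replace the Lagrangians by their normal forms, for which Euler-Lagrange
   expressions have been constructed.\<close>
 have "\<forall>n\<in>?A. \<exists>F. jet_poly F \<and> jet_eq (L n) F"
  using metric_expr_jet_poly assms(2) unfolding covariant_scalar_def by blast
 then obtain F where F: "!!n. n \<in> ?A ==> jet_poly (F n)" "!!n S g x. n \<in> ?A ==> regular_on S g ==> x \<in> S ==> L n g x = F n g x"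
  by metis
 obtain E where E: "!!n. n \<in> ?A ==> first_variation (F n) (E n)" using euler_lagrange[OF F(1)] by metis
 let ?P = "\<lambda>n. lowered (E n)"
 have P: "covariant_2tensor (?P n)" if "n \<in> ?A" for n
  by (rule lowered_covariant[OF assms(2)[OF that] F(1)[OF that] F(2)[OF that] E[OF that]])
 have \<kappa>: "pd (ls ! 0) (\<lambda>y. \<kappa> l (param (chart_of K) (gnc_point 0 0 y))) y = d\<kappa> l K y us ls"
  if lK: "l \<in> ?S" "K \<in> gncs (B l)" "y \<in> section_img K" for l K y and us ls :: "'n list"
 proof -
  note o = section_geometry(1)[OF bh[OF lK(1)] lK(2)]
  have "pd (ls ! 0) (\<lambda>y. \<kappa> l (param (chart_of K) (gnc_point 0 0 y))) y = pd (ls ! 0) (\<lambda>y. 1 / 2 * X_of K 0 y) y"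
   by (rule pd_cong_open[OF o lK(3)]) (simp add: surface_gravity_section[OF bh[OF lK(1)] assms(5)[OF lK(1)] lK(2)])
  also have "pd (ls ! 0) (\<lambda>y. 1 / 2 * X_of K 0 y) y = 1 / 2 * pd (ls ! 0) (X_of K 0) y"
   by (rule pd_cmult[OF smooth_on_D[OF smooth_section_X[OF bh[OF lK(1)] lK(2)] lK(3)]])
  finally show ?thesis by simp
 qed
 \<comment> \<open>On the horizon the metric component with indices \<tau> and A is zero, which
   removes the scalar curvature and \<Lambda> from this component; the Ricci component is -
   d\<kappa>.\<close>
 have eq: "eom (\<Lambda> l) (metric (B l) (chart_of K)) (lH l (chart_of K)) (gnc_point 0 0 y) Tau (Ang (ls ! 0)) =
   - d\<kappa> l K y us ls - (\<Sum>n\<in>?A. l ^ n * on_section (?P n) K y us ls)"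
  if lK: "l \<in> ?S" "K \<in> gncs (B l)" "y \<in> section_img K" for l K y and us ls :: "'n list"
 proof -
  let ?c = "chart_of K" and ?z = "gnc_point 0 0 y :: real^('n gnc)"
  interpret g: gnc_coords "X_of K" "\<omega>_of K" "h_of K" "img ?c" by (rule killing_gnc_coords[OF bh lK(2)]) (rule lK(1))
  have z: "?z \<in> img ?c" using lK(3) by (simp add: section_img_def)
  have "killing_gnc (B l) K" using bh[OF lK(1)] lK(2) by (simp add: stationary_black_hole_def)
  then have k: "?c \<in> atlas (B l)" "!!z. z \<in> img ?c ==> metric (B l) ?c z = g.g z"
   by (simp_all add: killing_gnc_def Let_def)
  have mv: "metric_variation (img ?c) (metric (B l) ?c) (\<lambda>g z. \<Sum>n\<in>?A. l ^ n * L n g z) (lH l ?c)"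
   using assms(6)[OF lK(1)] k(1) by (simp add: eft_correction_def)
  have gs: "smooth_on (img ?c) (metric (B l) ?c)" "\<forall>z\<in>img ?c. lorentzian (metric (B l) ?c z)"
   using smooth_on_cong[OF g.oV k(2)] g.smooth_g g.lorentzian_g k(2) by auto
  have "lH l ?c ?z $ Tau $ Ang (ls ! 0) = - (\<Sum>n\<in>?A. l ^ n * ?P n Tau (Ang (ls ! 0)) (metric (B l) ?c) ?z)"
  proof -
   have sw: "(\<Sigma> p q. m p q * (\<Sum>n\<in>?A. l ^ n * f n p q)) = (\<Sum>n\<in>?A. l ^ n * (\<Sigma> p q. m p q * f n p q))"
    for m :: "'n gnc => 'n gnc => real" and f
   proof -
    have "(\<Sigma> p q. m p q * (\<Sum>n\<in>?A. l ^ n * f n p q)) = (\<Sigma> p. \<Sum>n\<in>?A. \<Sigma> q. l ^ n * (m p q * f n p q))"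
     unfolding sum_distrib_left by (rule sum.cong[OF refl], subst sum.swap) (simp add: mult.left_commute)
    also have "... = (\<Sum>n\<in>?A. \<Sigma> p q. l ^ n * (m p q * f n p q))" by (rule sum.swap)
    finally show ?thesis by (simp add: sum_distrib_left)
   qed
   show ?thesis
    unfolding lowered_def sw[symmetric] by (rule metric_variation_eq[OF mv g.oV gs _ _ _ z]) (rule F E; assumption)+
  qed
  moreover have "?P n Tau (Ang (ls ! 0)) (metric (B l) ?c) ?z = on_section (?P n) K y us ls" if "n \<in> ?A" for n
   by (rule jet_poly_cong_open[OF _ g.oV z k(2)]) (use P[OF that] in "simp add: covariant_2tensor_def")
  moreover have "ricci (metric (B l) ?c) ?z = ricci g.g ?z" by (rule ricci_cong_open[OF g.oV z k(2)])
  moreover have "pd (Ang (ls ! 0)) (\<lambda>z. X_of K (z $ Rho) (ang z)) ?z = pd (ls ! 0) (X_of K 0) y"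
   using pd_slice[of "ls ! 0" "\<lambda>z. X_of K (z $ Rho) (ang z)" 0 0 y] by simp
  ultimately show ?thesis
   using g.ricci_Tau_Ang[OF z, of "ls ! 0"] k(2)[OF z] by (simp add: eom_def gnc_metric_nth)
 qed
 have OE: "O_inf ?S B 0 1 (\<lambda>l K y us ls. - d\<kappa> l K y us ls - (\<Sum>n\<in>?A. l ^ n * on_section (?P n) K y us ls)) N"
  by (rule O_inf_cong[of 0 1 "\<lambda>l K y us ls. eom (\<Lambda> l) (metric (B l) (chart_of K)) (lH l (chart_of K)) (gnc_point 0 0 y) Tau (Ang (ls ! 0))"])
   (use reg eq in "auto simp: fun_eq_iff")
 have O: "!!j. O_inf ?S B 0 0 (X_jet j) 0"
  "!!j. O_inf ?S B 0 1 (\<omega>_jet j) 0"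
  "!!j. O_inf ?S B 0 2 (h_jet j) 0"
  using reg by blast+
 have "O_inf ?S B 0 1 d\<kappa> k" if "k <= N" for k
  using that
 proof (induction k)
  case 0
  show ?case by (rule d\<kappa>_bounded[OF O])
 next
  case (Suc k)
  show ?case by (rule d\<kappa>_improve[OF _ P _ slices_uniform[OF O] OE, where ?l0.0=l0]) (use Suc in auto)
 qed
 then show ?thesis by (rule O_inf_cong[of 0 1 d\<kappa> N]) (auto simp: fun_eq_iff \<kappa>)
qed

end
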